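(* Let $(\mathcal{B},\mathcal{L},\theta,\mathcal{I}_\alpha;\mathcal{J})$ be a relative generalized Boolean dynamical system. Then $C^*(\mathcal{B},\mathcal{L},\theta,\mathcal{I}_\alpha;\mathcal{J})$ is (isomorphic to) a full hereditary $C^*$-subalgebra of $C^*(\mathcal{B},\mathcal{L},\theta,\mathcal{B};\mathcal{J})$.
   Context: A Boolean algebra $\mathcal{B}$ (not necessarily unital) is a distributive lattice $(\mathcal{B},\cap,\cup)$ with least element $\emptyset$ and relative complements $A\setminus B$, satisfying $(A\cap B)\cup(A\setminus B)=A$ and $(A\cap B)\cap(A\setminus B)=\emptyset$. Write $A\subseteq B$ iff $A\cap B=A$. An ideal of $\mathcal{B}$ is a non-empty subset closed under finite unions and under intersection with arbitrary elements of $\mathcal{B}$. A Boolean dynamical system $(\mathcal{B},\mathcal{L},\theta)$ is a Boolean algebra $\mathcal{B}$, a set $\mathcal{L}$, and maps $\theta_\alpha:\mathcal{B}\to\mathcal{B}$ ($\alpha\in\mathcal{L}$) preserving $\cap,\cup,\setminus$ and $\emptyset$. For $A\in\mathcal{B}$ let $\Delta_A=\{\alpha\in\mathcal{L}:\theta_\alpha(A)\ne\emptyset\}$ and $\lambda_A=|\Delta_A|$. $A$ is regular if $0<\lambda_B<\infty$ for every $\emptyset\neq B\subseteq A$; $\mathcal{B}_{reg}$ is the ideal of regular elements (so $\emptyset\in\mathcal{B}_{reg}$). Let $\mathcal{R}_\alpha=\{A\in\mathcal{B}:A\subseteq\theta_\alpha(B)\text{ for some }B\in\mathcal{B}\}$.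 A relative generalized Boolean dynamical system $(\mathcal{B},\mathcal{L},\theta,\mathcal{I}_\alpha;\mathcal{J})$ consists of a Boolean dynamical system, ideals $\mathcal{I}_\alpha$ of $\mathcal{B}$ with $\mathcal{R}_\alpha\subseteq\mathcal{I}_\alpha$ ($\alpha\in\mathcal{L}$), and an ideal $\mathcal{J}$ of $\mathcal{B}_{reg}$. A $(\mathcal{B},\mathcal{L},\theta,\mathcal{I}_\alpha;\mathcal{J})$-representation in a $C^*$-algebra is a family of projections $\{P_A:A\in\mathcal{B}\}$ and partial isometries $\{S_{\alpha,B}:\alpha\in\mathcal{L},B\in\mathcal{I}_\alpha\}$ such that (i) $P_\emptyset=0$, $P_{A\cap A'}=P_AP_{A'}$, $P_{A\cup A'}=P_A+P_{A'}-P_{A\cap A'}$; (ii) $P_AS_{\alpha,B}=S_{\alpha,B}P_{\theta_\alpha(A)}$; (iii) $S_{\alpha,B}^*S_{\alpha',B'}=\delta_{\alpha,\alpha'}P_{B\cap B'}$; (iv) $P_A=\sum_{\alpha\in\Delta_A}S_{\alpha,\theta_\alpha(A)}S_{\alpha,\theta_\alpha(A)}^*$ for all $A\in\mathcal{J}$. $C^*(\mathcal{B},\mathcal{L},\theta,\mathcal{I}_\alpha;\mathcal{J})$ is the $C^*$-algebra generated by a universal such representation. $C^*(\mathcal{B},\mathcal{L},\theta,\mathcal{B};\mathcal{J})$ denotes this algebra for the choice $\mathcal{I}_\alpha=\mathcal{B}$ for every $\alpha\in\mathcal{L}$. A $C^*$-subalgebra is full if it is not contained in any proper closed two-sided ideal.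 *)

theory Defs
  imports "HOL-Analysis.Analysis" "HOL-Algebra.Module"
begin

section \<open>Boolean dynamical systems\<close>

text \<open>Boolean algebras need not have a top element; the library class
  \<^class>\<open>boolean_algebra\<close> is the unital case.\<close>

class generalized_boolean_algebra = distrib_lattice + bounded_lattice_bot + minus +
  assumes inf_sup_diff: "sup (inf a b) (a - b) = a"
    and inf_inf_diff: "inf (inf a b) (a - b) = bot"

text \<open>\<open>boolean_ideal C X\<close>: the set \<open>X\<close> is an ideal of the Boolean algebra \<open>C\<close> (a subalgebra of
  the ambient one).\<close>

definition boolean_ideal :: "'b::generalized_boolean_algebra set \<Rightarrow> 'b set \<Rightarrow> bool" where
  "boolean_ideal C X \<longleftrightarrow> X \<subseteq> C \<and> X \<noteq> {} \<and>
     (\<forall>A\<in>X. \<forall>B\<in>X. sup A B \<in> X) \<and> (\<forall>A\<in>X. \<forall>B\<in>C. inf A B \<in> X)"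

locale boolean_dynamical_system =
  fixes L :: "'l set" and \<theta> :: "'l \<Rightarrow> 'b::generalized_boolean_algebra \<Rightarrow> 'b"
  assumes \<theta>_inf: "\<alpha> \<in> L \<Longrightarrow> \<theta> \<alpha> (inf A B) = inf (\<theta> \<alpha> A) (\<theta> \<alpha> B)"
    and \<theta>_sup: "\<alpha> \<in> L \<Longrightarrow> \<theta> \<alpha> (sup A B) = sup (\<theta> \<alpha> A) (\<theta> \<alpha> B)"
    and \<theta>_diff: "\<alpha> \<in> L \<Longrightarrow> \<theta> \<alpha> (A - B) = \<theta> \<alpha> A - \<theta> \<alpha> B"
    and \<theta>_bot: "\<alpha> \<in> L \<Longrightarrow> \<theta> \<alpha> bot = bot"

definition bds_Delta :: "'l set \<Rightarrow> ('l \<Rightarrow> 'b \<Rightarrow> 'b) \<Rightarrow> 'b::generalized_boolean_algebra \<Rightarrow> 'l set" where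
  "bds_Delta L \<theta> A = {\<alpha>\<in>L. \<theta> \<alpha> A \<noteq> bot}"

definition bds_reg :: "'l set \<Rightarrow> ('l \<Rightarrow> 'b \<Rightarrow> 'b) \<Rightarrow> 'b::generalized_boolean_algebra set" where
  "bds_reg L \<theta> = {A. \<forall>B. B \<noteq> bot \<and> B \<le> A \<longrightarrow>
      finite (bds_Delta L \<theta> B) \<and> 0 < card (bds_Delta L \<theta> B)}"

definition bds_range :: "('l \<Rightarrow> 'b \<Rightarrow> 'b) \<Rightarrow> 'l \<Rightarrow> 'b::generalized_boolean_algebra set" where
  "bds_range \<theta> \<alpha> = {A. \<exists>B. A \<le> \<theta> \<alpha> B}"

locale relative_generalized_bds = boolean_dynamical_system L \<theta>
  for L :: "'l set" and \<theta> :: "'l \<Rightarrow> 'b::generalized_boolean_algebra \<Rightarrow> 'b" +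
  fixes \<I> :: "'l \<Rightarrow> 'b set" and J :: "'b set"
  assumes ideal_\<I>: "\<alpha> \<in> L \<Longrightarrow> boolean_ideal UNIV (\<I> \<alpha>)"
    and range_subset_\<I>: "\<alpha> \<in> L \<Longrightarrow> bds_range \<theta> \<alpha> \<subseteq> \<I> \<alpha>"
    and ideal_J: "boolean_ideal (bds_reg L \<theta>) J"


section \<open>C*-algebras\<close>

text \<open>The record field \<^const>\<open>one\<close> inherited from \<open>module\<close> is not constrained by any axiom below and
  plays no role: C*-algebras are not assumed to be unital.\<close>

record 'a cstar = "(complex, 'a) module" +
  adj :: "'a \<Rightarrow> 'a"
  cnorm :: "'a \<Rightarrow> real"

definition complex_ring :: "complex ring" where
  "complex_ring = \<lparr>carrier = UNIV, monoid.mult = (*), one = 1, ring.zero = 0, add = (+)\<rparr>"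

text \<open>The distance is truncated to \<open>0\<close> outside the carrier, because the locale
  \<^locale>\<open>Metric_space\<close> demands nonnegativity and symmetry on the whole type.\<close>

definition cdist :: "('a, 'z) cstar_scheme \<Rightarrow> 'a \<Rightarrow> 'a \<Rightarrow> real" where
  "cdist A x y = (if x \<in> carrier A \<and> y \<in> carrier A then cnorm A (x \<ominus>\<^bsub>A\<^esub> y) else 0)"

locale cstar_algebra = module complex_ring A for A (structure) +
  assumes mult_closed: "\<lbrakk>x \<in> carrier A; y \<in> carrier A\<rbrakk> \<Longrightarrow> x \<otimes> y \<in> carrier A"
    and mult_assoc: "\<lbrakk>x \<in> carrier A; y \<in> carrier A; z \<in> carrier A\<rbrakk> \<Longrightarrow> (x \<otimes> y) \<otimes> z = x \<otimes> (y \<otimes> z)"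
    and mult_distr_left: "\<lbrakk>x \<in> carrier A; y \<in> carrier A; z \<in> carrier A\<rbrakk> \<Longrightarrow>
          (x \<oplus> y) \<otimes> z = (x \<otimes> z) \<oplus> (y \<otimes> z)"
    and mult_distr_right: "\<lbrakk>x \<in> carrier A; y \<in> carrier A; z \<in> carrier A\<rbrakk> \<Longrightarrow>
          z \<otimes> (x \<oplus> y) = (z \<otimes> x) \<oplus> (z \<otimes> y)"
    and smult_mult_left: "\<lbrakk>x \<in> carrier A; y \<in> carrier A\<rbrakk> \<Longrightarrow> (c \<odot> x) \<otimes> y = c \<odot> (x \<otimes> y)"
    and smult_mult_right: "\<lbrakk>x \<in> carrier A; y \<in> carrier A\<rbrakk> \<Longrightarrow> x \<otimes> (c \<odot> y) = c \<odot> (x \<otimes> y)"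
    and adj_closed: "x \<in> carrier A \<Longrightarrow> adj A x \<in> carrier A"
    and adj_add: "\<lbrakk>x \<in> carrier A; y \<in> carrier A\<rbrakk> \<Longrightarrow> adj A (x \<oplus> y) = adj A x \<oplus> adj A y"
    and adj_smult: "x \<in> carrier A \<Longrightarrow> adj A (c \<odot> x) = cnj c \<odot> adj A x"
    and adj_mult: "\<lbrakk>x \<in> carrier A; y \<in> carrier A\<rbrakk> \<Longrightarrow> adj A (x \<otimes> y) = adj A y \<otimes> adj A x"
    and adj_adj: "x \<in> carrier A \<Longrightarrow> adj A (adj A x) = x"
    and cnorm_nonneg: "x \<in> carrier A \<Longrightarrow> 0 \<le> cnorm A x"
    and cnorm_eq_0: "x \<in> carrier A \<Longrightarrow> cnorm A x = 0 \<longleftrightarrow> x = \<zero>"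
    and cnorm_add: "\<lbrakk>x \<in> carrier A; y \<in> carrier A\<rbrakk> \<Longrightarrow> cnorm A (x \<oplus> y) \<le> cnorm A x + cnorm A y"
    and cnorm_smult: "x \<in> carrier A \<Longrightarrow> cnorm A (c \<odot> x) = cmod c * cnorm A x"
    and cnorm_mult: "\<lbrakk>x \<in> carrier A; y \<in> carrier A\<rbrakk> \<Longrightarrow> cnorm A (x \<otimes> y) \<le> cnorm A x * cnorm A y"
    and cnorm_adj_mult: "x \<in> carrier A \<Longrightarrow> cnorm A (adj A x \<otimes> x) = (cnorm A x)\<^sup>2"
    and complete: "Metric_space.mcomplete (carrier A) (cdist A)"

definition cstar_closed :: "('a, 'z) cstar_scheme \<Rightarrow> 'a set \<Rightarrow> bool" where
  "cstar_closed A H \<longleftrightarrow> closedin (Metric_space.mtopology (carrier A) (cdist A)) H"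

definition cstar_subalgebra :: "'a set \<Rightarrow> ('a, 'z) cstar_scheme \<Rightarrow> bool" where
  "cstar_subalgebra H A \<longleftrightarrow> submodule H complex_ring A \<and>
     (\<forall>x\<in>H. \<forall>y\<in>H. x \<otimes>\<^bsub>A\<^esub> y \<in> H) \<and> (\<forall>x\<in>H. adj A x \<in> H) \<and> cstar_closed A H"

definition closed_two_sided_ideal :: "'a set \<Rightarrow> ('a, 'z) cstar_scheme \<Rightarrow> bool" where
  "closed_two_sided_ideal K A \<longleftrightarrow> submodule K complex_ring A \<and>
     (\<forall>x\<in>K. \<forall>a\<in>carrier A. a \<otimes>\<^bsub>A\<^esub> x \<in> K \<and> x \<otimes>\<^bsub>A\<^esub> a \<in> K) \<and> cstar_closed A K"

definition cstar_positive :: "('a, 'z) cstar_scheme \<Rightarrow> 'a \<Rightarrow> bool" where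
  "cstar_positive A x \<longleftrightarrow> (\<exists>y\<in>carrier A. x = adj A y \<otimes>\<^bsub>A\<^esub> y)"

text \<open>The order is the usual one: \<open>b \<le> a\<close> iff \<open>a - b\<close> is positive.\<close>

definition hereditary_cstar_subalgebra :: "'a set \<Rightarrow> ('a, 'z) cstar_scheme \<Rightarrow> bool" where
  "hereditary_cstar_subalgebra H A \<longleftrightarrow> cstar_subalgebra H A \<and>
     (\<forall>a\<in>H. \<forall>b\<in>carrier A. cstar_positive A b \<and> cstar_positive A (a \<ominus>\<^bsub>A\<^esub> b) \<longrightarrow> b \<in> H)"

definition full_cstar_subalgebra :: "'a set \<Rightarrow> ('a, 'z) cstar_scheme \<Rightarrow> bool" where
  "full_cstar_subalgebra H A \<longleftrightarrow> cstar_subalgebra H A \<and>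
     (\<forall>K. closed_two_sided_ideal K A \<and> H \<subseteq> K \<longrightarrow> K = carrier A)"

definition star_hom :: "('a, 'z) cstar_scheme \<Rightarrow> ('c, 'w) cstar_scheme \<Rightarrow> ('a \<Rightarrow> 'c) set" where
  "star_hom A C = {\<phi>. \<phi> \<in> carrier A \<rightarrow> carrier C \<and>
     (\<forall>x\<in>carrier A. \<forall>y\<in>carrier A. \<phi> (x \<oplus>\<^bsub>A\<^esub> y) = \<phi> x \<oplus>\<^bsub>C\<^esub> \<phi> y) \<and>
     (\<forall>c. \<forall>x\<in>carrier A. \<phi> (c \<odot>\<^bsub>A\<^esub> x) = c \<odot>\<^bsub>C\<^esub> \<phi> x) \<and>
     (\<forall>x\<in>carrier A. \<forall>y\<in>carrier A. \<phi> (x \<otimes>\<^bsub>A\<^esub> y) = \<phi> x \<otimes>\<^bsub>C\<^esub> \<phi> y) \<and>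
     (\<forall>x\<in>carrier A. \<phi> (adj A x) = adj C (\<phi> x))}"

definition star_isomorphic :: "('a, 'z) cstar_scheme \<Rightarrow> ('c, 'w) cstar_scheme \<Rightarrow> bool" where
  "star_isomorphic A C \<longleftrightarrow> (\<exists>\<phi>\<in>star_hom A C. bij_betw \<phi> (carrier A) (carrier C))"

definition cstar_generates :: "('a, 'z) cstar_scheme \<Rightarrow> 'a set \<Rightarrow> bool" where
  "cstar_generates A X \<longleftrightarrow> (\<forall>H. cstar_subalgebra H A \<and> X \<subseteq> H \<longrightarrow> H = carrier A)"

definition cstar_projection :: "('a, 'z) cstar_scheme \<Rightarrow> 'a \<Rightarrow> bool" where
  "cstar_projection A p \<longleftrightarrow> p \<in> carrier A \<and> adj A p = p \<and> p \<otimes>\<^bsub>A\<^esub> p = p"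

definition cstar_partial_isometry :: "('a, 'z) cstar_scheme \<Rightarrow> 'a \<Rightarrow> bool" where
  "cstar_partial_isometry A s \<longleftrightarrow> s \<in> carrier A \<and> (s \<otimes>\<^bsub>A\<^esub> adj A s) \<otimes>\<^bsub>A\<^esub> s = s"


section \<open>Representations and the universal C*-algebra\<close>

locale bds_representation = cstar_algebra A
  for L :: "'l set" and \<theta> :: "'l \<Rightarrow> 'b::generalized_boolean_algebra \<Rightarrow> 'b"
    and \<I> :: "'l \<Rightarrow> 'b set" and J :: "'b set"
    and A :: "('a, 'z) cstar_scheme" (structure)
    and P :: "'b \<Rightarrow> 'a" and S :: "'l \<Rightarrow> 'b \<Rightarrow> 'a" +
  assumes projection_P: "cstar_projection A (P X)"
    and partial_isometry_S: "\<lbrakk>\<alpha> \<in> L; B \<in> \<I> \<alpha>\<rbrakk> \<Longrightarrow> cstar_partial_isometry A (S \<alpha> B)"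
    and P_bot: "P bot = \<zero>"
    and P_inf: "P (inf X Y) = P X \<otimes> P Y"
    and P_sup: "P (sup X Y) = (P X \<oplus> P Y) \<ominus> P (inf X Y)"
    and P_S: "\<lbrakk>\<alpha> \<in> L; B \<in> \<I> \<alpha>\<rbrakk> \<Longrightarrow> P X \<otimes> S \<alpha> B = S \<alpha> B \<otimes> P (\<theta> \<alpha> X)"
    and adj_S_S: "\<lbrakk>\<alpha> \<in> L; B \<in> \<I> \<alpha>; \<beta> \<in> L; C \<in> \<I> \<beta>\<rbrakk> \<Longrightarrow>
          adj A (S \<alpha> B) \<otimes> S \<beta> C = (if \<alpha> = \<beta> then P (inf B C) else \<zero>)"
    and P_sum: "X \<in> J \<Longrightarrow>
          P X = (\<Oplus>\<alpha>\<in>bds_Delta L \<theta> X. S \<alpha> (\<theta> \<alpha> X) \<otimes> adj A (S \<alpha> (\<theta> \<alpha> X)))"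

text \<open>HOL cannot quantify over all types inside a formula, so the universal property is stated for
  all C*-algebras whose carrier is a set of elements of one sufficiently large type: sequences of
  formal *-polynomials in the generators. Every C*-algebra generated by a representation is a
  set of limits of such sequences, hence is isomorphic to a C*-algebra on that type. The lemma
  \<open>universal_bds_representation_property\<close> below recovers the universal property for C*-algebras on
  an arbitrary type, and \<open>universal_bds_representation_exists\<close> shows that universal
  representations exist.\<close>

datatype ('b, 'l) star_poly =
    GenP 'b
  | GenS 'l 'b
  | Plus "('b, 'l) star_poly" "('b, 'l) star_poly"
  | Times "('b, 'l) star_poly" "('b, 'l) star_poly"
  | Scale complex "('b, 'l) star_poly"
  | Adj "('b, 'l) star_poly"

type_synonym ('b, 'l) cstar_universe = "nat \<Rightarrow> ('b, 'l) star_poly"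

definition universal_bds_representation ::
  "'l set \<Rightarrow> ('l \<Rightarrow> 'b::generalized_boolean_algebra \<Rightarrow> 'b) \<Rightarrow> ('l \<Rightarrow> 'b set) \<Rightarrow> 'b set \<Rightarrow>
   'a cstar \<Rightarrow> ('b \<Rightarrow> 'a) \<Rightarrow> ('l \<Rightarrow> 'b \<Rightarrow> 'a) \<Rightarrow> bool" where
  "universal_bds_representation L \<theta> \<I> J A P S \<longleftrightarrow>
     bds_representation L \<theta> \<I> J A P S \<and>
     cstar_generates A (range P \<union> {S \<alpha> B |\<alpha> B. \<alpha> \<in> L \<and> B \<in> \<I> \<alpha>}) \<and>
     (\<forall>(C :: ('b, 'l) cstar_universe cstar) Q T. bds_representation L \<theta> \<I> J C Q T \<longrightarrow>
        (\<exists>\<phi>\<in>star_hom A C. (\<forall>X. \<phi> (P X) = Q X) \<and>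
           (\<forall>\<alpha>\<in>L. \<forall>B\<in>\<I> \<alpha>. \<phi> (S \<alpha> B) = T \<alpha> B)))"


section \<open>Basic facts on C*-algebras\<close>

lemma complex_ring_simps [simp]:
  "carrier complex_ring = UNIV" "\<zero>\<^bsub>complex_ring\<^esub> = 0" "\<one>\<^bsub>complex_ring\<^esub> = 1"
  "x \<oplus>\<^bsub>complex_ring\<^esub> y = x + y" "x \<otimes>\<^bsub>complex_ring\<^esub> y = x * y"
  by (simp_all add: complex_ring_def)

lemma cring_complex_ring: "cring complex_ring"
proof -
  have "\<exists>y. x + y = 0" for x :: complex
    by (rule exI[of _ "- x"]) simp
  thus ?thesis
    unfolding complex_ring_def
    by unfold_locales (auto simp: algebra_simps Units_def)
qed

context cstar_algebra
begin

lemma smult_in [simp, intro]: "x \<in> carrier A \<Longrightarrow> c \<odot> x \<in> carrier A"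
  by simp

declare mult_closed [simp, intro] adj_closed [simp, intro]

lemma minus_eq_smult: "x \<in> carrier A \<Longrightarrow> \<ominus> x = (-1) \<odot> x"
proof -
  assume x: "x \<in> carrier A"
  have "(-1) \<odot> x \<oplus> x = (-1) \<odot> x \<oplus> 1 \<odot> x"
    using x smult_one[of x] by simp
  also have "\<dots> = (- 1 + 1) \<odot> x"
    using smult_l_distr[of "-1" 1 x] x by simp
  also have "\<dots> = \<zero>" using smult_l_null[of x] x by simp
  finally show ?thesis using x by (intro minus_equality) auto
qed

lemma minus_eq: "\<lbrakk>x \<in> carrier A; y \<in> carrier A\<rbrakk> \<Longrightarrow> x \<ominus> y = x \<oplus> (-1) \<odot> y"
  by (simp add: a_minus_def minus_eq_smult)

lemma cnorm_zero: "cnorm A \<zero> = 0"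
  by (simp add: cnorm_eq_0)

lemma cnorm_uminus: "x \<in> carrier A \<Longrightarrow> cnorm A (\<ominus> x) = cnorm A x"
  by (simp add: minus_eq_smult cnorm_smult)

lemma diff_eq_0: "\<lbrakk>x \<in> carrier A; y \<in> carrier A\<rbrakk> \<Longrightarrow> x \<ominus> y = \<zero> \<longleftrightarrow> x = y"
  by (simp add: a_minus_def) (metis M.a_inv_closed minus_equality minus_minus r_neg)

lemma diff_commute: "\<lbrakk>x \<in> carrier A; y \<in> carrier A\<rbrakk> \<Longrightarrow> \<ominus> (x \<ominus> y) = y \<ominus> x"
  by (simp add: a_minus_def minus_add a_comm)

lemma cnorm_commute: "\<lbrakk>x \<in> carrier A; y \<in> carrier A\<rbrakk> \<Longrightarrow> cnorm A (x \<ominus> y) = cnorm A (y \<ominus> x)"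
  by (metis cnorm_uminus diff_commute M.minus_closed)

lemma diff_split: "\<lbrakk>x \<in> carrier A; y \<in> carrier A; z \<in> carrier A\<rbrakk> \<Longrightarrow> x \<ominus> z = (x \<ominus> y) \<oplus> (y \<ominus> z)"
proof -
  assume a: "x \<in> carrier A" "y \<in> carrier A" "z \<in> carrier A"
  have "(x \<ominus> y) \<oplus> (y \<ominus> z) = x \<oplus> ((\<ominus> y \<oplus> y) \<oplus> \<ominus> z)"
    using a by (simp add: a_minus_def a_assoc del: l_neg)
  thus ?thesis using a by (simp add: a_minus_def l_neg)
qed

lemma cnorm_triangle: "\<lbrakk>x \<in> carrier A; y \<in> carrier A; z \<in> carrier A\<rbrakk> \<Longrightarrow>
    cnorm A (x \<ominus> z) \<le> cnorm A (x \<ominus> y) + cnorm A (y \<ominus> z)"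
  using diff_split[of x y z] cnorm_add[of "x \<ominus> y" "y \<ominus> z"] by simp

lemma Metric_space_cdist: "Metric_space (carrier A) (cdist A)"
proof
  fix x y z
  show "0 \<le> cdist A x y" by (simp add: cdist_def cnorm_nonneg)
  show "cdist A x y = cdist A y x" by (simp add: cdist_def cnorm_commute)
  show "cdist A x y = 0 \<longleftrightarrow> x = y" if "x \<in> carrier A" "y \<in> carrier A"
    using that by (simp add: cdist_def cnorm_eq_0 diff_eq_0)
  show "cdist A x z \<le> cdist A x y + cdist A y z"
    if "x \<in> carrier A" "y \<in> carrier A" "z \<in> carrier A"
    using that by (simp add: cdist_def cnorm_triangle)
qed

sublocale metr: Metric_space "carrier A" "cdist A"
  by (rule Metric_space_cdist)

lemma cnorm_adj: "x \<in> carrier A \<Longrightarrow> cnorm A (adj A x) = cnorm A x"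
proof -
  have le: "cnorm A y \<le> cnorm A (adj A y)" if y: "y \<in> carrier A" for y
  proof (cases "cnorm A y = 0")
    case True
    then show ?thesis using y by (simp add: cnorm_nonneg)
  next
    case False
    have "cnorm A y * cnorm A y \<le> cnorm A (adj A y) * cnorm A y"
      using cnorm_adj_mult[OF y] cnorm_mult[of "adj A y" y] y by (simp add: power2_eq_square)
    then show ?thesis using False cnorm_nonneg[OF y] by simp
  qed
  assume x: "x \<in> carrier A"
  show ?thesis using le[OF x] le[of "adj A x"] x by (simp add: adj_adj)
qed

lemma adj_zero: "adj A \<zero> = \<zero>"
  using cnorm_adj[of \<zero>] by (simp add: cnorm_zero cnorm_eq_0)

definition cconv :: "(nat \<Rightarrow> 'a) \<Rightarrow> 'a \<Rightarrow> bool" where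
  "cconv \<sigma> x \<longleftrightarrow> range \<sigma> \<subseteq> carrier A \<and> x \<in> carrier A \<and> (\<lambda>n. cnorm A (\<sigma> n \<ominus> x)) \<longlonglongrightarrow> 0"

lemma limitin_cconv: "range \<sigma> \<subseteq> carrier A \<Longrightarrow>
    limitin metr.mtopology \<sigma> x sequentially \<longleftrightarrow> cconv \<sigma> x"
  unfolding cconv_def metr.limit_metric_sequentially LIMSEQ_iff
  by (auto simp: cdist_def cnorm_nonneg image_subset_iff)

lemma cstar_closed_iff: "cstar_closed A H \<longleftrightarrow>
    H \<subseteq> carrier A \<and> (\<forall>\<sigma> x. range \<sigma> \<subseteq> H \<and> cconv \<sigma> x \<longrightarrow> x \<in> H)"
  unfolding cstar_closed_def metr.metric_closedin_iff_sequentially_closed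
  by (metis limitin_cconv order_trans)

lemma complete_cconv:
  assumes "range \<sigma> \<subseteq> carrier A"
    and "\<And>e. e > 0 \<Longrightarrow> \<exists>N. \<forall>m\<ge>N. \<forall>n\<ge>N. cnorm A (\<sigma> m \<ominus> \<sigma> n) < e"
  shows "\<exists>x. cconv \<sigma> x"
proof -
  have "\<sigma> n \<in> carrier A" for n using assms(1) by auto
  hence "metr.MCauchy \<sigma>" unfolding metr.MCauchy_def cdist_def using assms
    by auto
  thus ?thesis using complete limitin_cconv[OF assms(1)] unfolding metr.mcomplete_def by blast
qed

lemma cconv_unique: "cconv \<sigma> x \<Longrightarrow> cconv \<sigma> y \<Longrightarrow> x = y"
  using metr.limitin_metric_unique[of \<sigma> x sequentially y] limitin_cconv
  by (metis cconv_def trivial_limit_sequentially)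

lemma cconv_dominated:
  assumes "range \<sigma> \<subseteq> carrier A" "x \<in> carrier A" "\<And>n. cnorm A (\<sigma> n \<ominus> x) \<le> f n" "f \<longlonglongrightarrow> 0"
  shows "cconv \<sigma> x"
  unfolding cconv_def
  using assms by (auto intro!: tendsto_sandwich[OF _ _ tendsto_const assms(4)] simp: cnorm_nonneg image_subset_iff)

lemma cconv_add:
  assumes "cconv \<sigma> x" "cconv \<tau> y" shows "cconv (\<lambda>n. \<sigma> n \<oplus> \<tau> n) (x \<oplus> y)"
proof (rule cconv_dominated)
  have c: "x \<in> carrier A" "y \<in> carrier A" "\<sigma> n \<in> carrier A" "\<tau> n \<in> carrier A" for n
    using assms by (auto simp: cconv_def)
  show "range (\<lambda>n. \<sigma> n \<oplus> \<tau> n) \<subseteq> carrier A" "x \<oplus> y \<in> carrier A" using c by auto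
  show "(\<lambda>n. cnorm A (\<sigma> n \<ominus> x) + cnorm A (\<tau> n \<ominus> y)) \<longlonglongrightarrow> 0"
    using assms by (intro tendsto_add_zero) (auto simp: cconv_def)
  fix n
  have "(\<sigma> n \<oplus> \<tau> n) \<ominus> (x \<oplus> y) = (\<sigma> n \<ominus> x) \<oplus> (\<tau> n \<ominus> y)"
    using c by (simp add: a_minus_def minus_add a_ac)
  thus "cnorm A ((\<sigma> n \<oplus> \<tau> n) \<ominus> (x \<oplus> y)) \<le> cnorm A (\<sigma> n \<ominus> x) + cnorm A (\<tau> n \<ominus> y)"
    using c by (simp add: cnorm_add)
qed

lemma smult_diff: "\<lbrakk>x \<in> carrier A; y \<in> carrier A\<rbrakk> \<Longrightarrow> c \<odot> (x \<ominus> y) = c \<odot> x \<ominus> c \<odot> y"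
  by (simp add: a_minus_def smult_r_distr smult_r_minus)

lemma cconv_smult:
  assumes "cconv \<sigma> x" shows "cconv (\<lambda>n. c \<odot> \<sigma> n) (c \<odot> x)"
proof (rule cconv_dominated)
  have c: "x \<in> carrier A" "\<sigma> n \<in> carrier A" for n
    using assms by (auto simp: cconv_def)
  show "range (\<lambda>n. c \<odot> \<sigma> n) \<subseteq> carrier A" "c \<odot> x \<in> carrier A" using c by auto
  show "(\<lambda>n. cmod c * cnorm A (\<sigma> n \<ominus> x)) \<longlonglongrightarrow> 0"
    using assms by (intro tendsto_mult_right_zero) (auto simp: cconv_def)
  show "cnorm A (c \<odot> \<sigma> n \<ominus> c \<odot> x) \<le> cmod c * cnorm A (\<sigma> n \<ominus> x)" for n
    using c by (simp add: smult_diff[symmetric] cnorm_smult)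
qed

lemma adj_diff: "\<lbrakk>x \<in> carrier A; y \<in> carrier A\<rbrakk> \<Longrightarrow> adj A (x \<ominus> y) = adj A x \<ominus> adj A y"
  by (simp add: minus_eq adj_add adj_smult)

lemma cconv_adj:
  assumes "cconv \<sigma> x" shows "cconv (\<lambda>n. adj A (\<sigma> n)) (adj A x)"
proof (rule cconv_dominated)
  have c: "x \<in> carrier A" "\<sigma> n \<in> carrier A" for n
    using assms by (auto simp: cconv_def)
  show "range (\<lambda>n. adj A (\<sigma> n)) \<subseteq> carrier A" "adj A x \<in> carrier A" using c by auto
  show "(\<lambda>n. cnorm A (\<sigma> n \<ominus> x)) \<longlonglongrightarrow> 0"
    using assms by (simp add: cconv_def)
  show "cnorm A (adj A (\<sigma> n) \<ominus> adj A x) \<le> cnorm A (\<sigma> n \<ominus> x)" for n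
    using c by (simp add: adj_diff[symmetric] cnorm_adj)
qed

lemma mult_diff_right: "\<lbrakk>x \<in> carrier A; y \<in> carrier A; z \<in> carrier A\<rbrakk> \<Longrightarrow>
    z \<otimes> (x \<ominus> y) = z \<otimes> x \<ominus> z \<otimes> y"
  by (simp add: minus_eq mult_distr_right smult_mult_right)

lemma mult_diff_left: "\<lbrakk>x \<in> carrier A; y \<in> carrier A; z \<in> carrier A\<rbrakk> \<Longrightarrow>
    (x \<ominus> y) \<otimes> z = x \<otimes> z \<ominus> y \<otimes> z"
  by (simp add: minus_eq mult_distr_left smult_mult_left)

lemma diff_add_cancel: "\<lbrakk>x \<in> carrier A; y \<in> carrier A\<rbrakk> \<Longrightarrow> (x \<ominus> y) \<oplus> y = x"
  by (simp add: a_minus_def a_assoc l_neg)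

lemma cconv_mult:
  assumes "cconv \<sigma> x" "cconv \<tau> y" shows "cconv (\<lambda>n. \<sigma> n \<otimes> \<tau> n) (x \<otimes> y)"
proof (rule cconv_dominated)
  have c: "x \<in> carrier A" "y \<in> carrier A" "\<sigma> n \<in> carrier A" "\<tau> n \<in> carrier A" for n
    using assms by (auto simp: cconv_def)
  show "range (\<lambda>n. \<sigma> n \<otimes> \<tau> n) \<subseteq> carrier A" "x \<otimes> y \<in> carrier A" using c by auto
  let ?f = "\<lambda>n. (cnorm A (\<sigma> n \<ominus> x) + cnorm A x) * cnorm A (\<tau> n \<ominus> y)
               + cnorm A (\<sigma> n \<ominus> x) * cnorm A y"
  have "?f \<longlonglongrightarrow> (0 + cnorm A x) * 0 + 0 * cnorm A y"
    using assms by (intro tendsto_intros) (auto simp: cconv_def)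
  thus "?f \<longlonglongrightarrow> 0" by simp
  fix n
  have "cnorm A (\<sigma> n \<otimes> \<tau> n \<ominus> x \<otimes> y) \<le>
      cnorm A (\<sigma> n \<otimes> \<tau> n \<ominus> \<sigma> n \<otimes> y) + cnorm A (\<sigma> n \<otimes> y \<ominus> x \<otimes> y)"
    using c by (intro cnorm_triangle) auto
  also have "\<sigma> n \<otimes> \<tau> n \<ominus> \<sigma> n \<otimes> y = \<sigma> n \<otimes> (\<tau> n \<ominus> y)"
    using c by (simp add: mult_diff_right)
  also have "\<sigma> n \<otimes> y \<ominus> x \<otimes> y = (\<sigma> n \<ominus> x) \<otimes> y"
    using c by (simp add: mult_diff_left)
  also have "cnorm A ((\<sigma> n \<ominus> x) \<otimes> y) \<le> cnorm A (\<sigma> n \<ominus> x) * cnorm A y"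
    using c by (simp add: cnorm_mult)
  also have "cnorm A (\<sigma> n \<otimes> (\<tau> n \<ominus> y)) \<le> cnorm A (\<sigma> n) * cnorm A (\<tau> n \<ominus> y)"
    using c by (simp add: cnorm_mult)
  also have "\<dots> \<le> (cnorm A (\<sigma> n \<ominus> x) + cnorm A x) * cnorm A (\<tau> n \<ominus> y)"
    using c cnorm_add[of "\<sigma> n \<ominus> x" x]
    by (intro mult_right_mono) (simp_all add: cnorm_nonneg diff_add_cancel)
  finally show "cnorm A (\<sigma> n \<otimes> \<tau> n \<ominus> x \<otimes> y) \<le> ?f n" by simp
qed

lemma cconv_const: "x \<in> carrier A \<Longrightarrow> cconv (\<lambda>_. x) x"
  using diff_eq_0[of x x] by (simp add: cconv_def cnorm_zero)

lemma submoduleI':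
  assumes "H \<subseteq> carrier A" "H \<noteq> {}" "\<And>x y. x \<in> H \<Longrightarrow> y \<in> H \<Longrightarrow> x \<oplus> y \<in> H"
    "\<And>c x. x \<in> H \<Longrightarrow> c \<odot> x \<in> H"
  shows "submodule H complex_ring A"
proof (rule submoduleI)
  from assms(2) obtain x where x: "x \<in> H" by blast
  have "0 \<odot> x = \<zero>" using smult_l_null[of x] x assms(1) by auto
  thus "\<zero> \<in> H" using assms(4)[OF x, of 0] by simp
  fix a assume "a \<in> H"
  thus "\<ominus> a \<in> H" using assms(4)[of a "-1"] assms(1) by (simp add: minus_eq_smult subset_iff)
qed (use assms in auto)

end

lemma star_homD:
  assumes "\<phi> \<in> star_hom A C"
  shows "x \<in> carrier A \<Longrightarrow> \<phi> x \<in> carrier C"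
    and "\<lbrakk>x \<in> carrier A; y \<in> carrier A\<rbrakk> \<Longrightarrow> \<phi> (x \<oplus>\<^bsub>A\<^esub> y) = \<phi> x \<oplus>\<^bsub>C\<^esub> \<phi> y"
    and "x \<in> carrier A \<Longrightarrow> \<phi> (c \<odot>\<^bsub>A\<^esub> x) = c \<odot>\<^bsub>C\<^esub> \<phi> x"
    and "\<lbrakk>x \<in> carrier A; y \<in> carrier A\<rbrakk> \<Longrightarrow> \<phi> (x \<otimes>\<^bsub>A\<^esub> y) = \<phi> x \<otimes>\<^bsub>C\<^esub> \<phi> y"
    and "x \<in> carrier A \<Longrightarrow> \<phi> (adj A x) = adj C (\<phi> x)"
  using assms by (auto simp: star_hom_def)

lemma star_hom_zero:
  assumes "cstar_algebra A" "cstar_algebra C" "\<phi> \<in> star_hom A C"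
  shows "\<phi> \<zero>\<^bsub>A\<^esub> = \<zero>\<^bsub>C\<^esub>"
proof -
  interpret A: cstar_algebra A by fact
  interpret C: cstar_algebra C by fact
  have "\<phi> \<zero>\<^bsub>A\<^esub> = \<phi> (0 \<odot>\<^bsub>A\<^esub> \<zero>\<^bsub>A\<^esub>)" using A.smult_l_null[of "\<zero>\<^bsub>A\<^esub>"] by simp
  also have "\<dots> = 0 \<odot>\<^bsub>C\<^esub> \<phi> \<zero>\<^bsub>A\<^esub>" using star_homD(3)[OF assms(3), of "\<zero>\<^bsub>A\<^esub>" 0] by simp
  also have "\<dots> = \<zero>\<^bsub>C\<^esub>" using C.smult_l_null star_homD(1)[OF assms(3), of "\<zero>\<^bsub>A\<^esub>"] by simp
  finally show ?thesis .
qed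

lemma star_hom_diff:
  assumes "cstar_algebra A" "cstar_algebra C" "\<phi> \<in> star_hom A C" "x \<in> carrier A" "y \<in> carrier A"
  shows "\<phi> (x \<ominus>\<^bsub>A\<^esub> y) = \<phi> x \<ominus>\<^bsub>C\<^esub> \<phi> y"
proof -
  interpret A: cstar_algebra A by fact
  interpret C: cstar_algebra C by fact
  show ?thesis using assms(4,5)
    by (simp add: A.minus_eq C.minus_eq star_homD[OF assms(3)])
qed

lemma star_hom_finsum:
  assumes "cstar_algebra A" "cstar_algebra C" "\<phi> \<in> star_hom A C" "f \<in> F \<rightarrow> carrier A"
  shows "\<phi> (finsum A f F) = finsum C (\<lambda>i. \<phi> (f i)) F"
proof -
  interpret A: cstar_algebra A by fact
  interpret C: cstar_algebra C by fact
  show ?thesis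
    using assms(4)
  proof (induction F rule: infinite_finite_induct)
    case (infinite F)
    then show ?case using star_hom_zero[OF assms(1-3)] by (simp add: finsum_def finprod_def)
  next
    case empty
    then show ?case using star_hom_zero[OF assms(1-3)] by simp
  next
    case (insert a F)
    have f: "f \<in> F \<rightarrow> carrier A" "f a \<in> carrier A" using insert.prems by auto
    have "(\<lambda>i. \<phi> (f i)) \<in> F \<rightarrow> carrier C" "\<phi> (f a) \<in> carrier C"
      using f star_homD(1)[OF assms(3)] by auto
    then show ?case using insert f
      by (simp add: star_homD[OF assms(3)])
  qed
qed

text \<open>A structure with a jointly isometric family of *-homomorphisms to C*-algebras.\<close>

lemma cstar_algebra_embed:
  fixes A :: "('a, 'w) cstar_scheme" and C :: "'i \<Rightarrow> ('c, 'z) cstar_scheme"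
  assumes ne: "I \<noteq> {}" and C: "\<And>i. i \<in> I \<Longrightarrow> cstar_algebra (C i)"
    and zero: "\<zero>\<^bsub>A\<^esub> \<in> carrier A"
    and add: "\<And>x y. \<lbrakk>x \<in> carrier A; y \<in> carrier A\<rbrakk> \<Longrightarrow> x \<oplus>\<^bsub>A\<^esub> y \<in> carrier A"
    and smult: "\<And>c x. x \<in> carrier A \<Longrightarrow> c \<odot>\<^bsub>A\<^esub> x \<in> carrier A"
    and mult: "\<And>x y. \<lbrakk>x \<in> carrier A; y \<in> carrier A\<rbrakk> \<Longrightarrow> x \<otimes>\<^bsub>A\<^esub> y \<in> carrier A"
    and adj: "\<And>x. x \<in> carrier A \<Longrightarrow> adj A x \<in> carrier A"
    and hom: "\<And>i. i \<in> I \<Longrightarrow> \<iota> i \<in> star_hom A (C i)"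
    and hom0: "\<And>i. i \<in> I \<Longrightarrow> \<iota> i \<zero>\<^bsub>A\<^esub> = \<zero>\<^bsub>C i\<^esub>"
    and inj: "\<And>x y. \<lbrakk>x \<in> carrier A; y \<in> carrier A; \<And>i. i \<in> I \<Longrightarrow> \<iota> i x = \<iota> i y\<rbrakk> \<Longrightarrow> x = y"
    and bdd: "\<And>x. x \<in> carrier A \<Longrightarrow> bdd_above ((\<lambda>i. cnorm (C i) (\<iota> i x)) ` I)"
    and norm: "\<And>x. x \<in> carrier A \<Longrightarrow> cnorm A x = (SUP i\<in>I. cnorm (C i) (\<iota> i x))"
    and compl: "\<And>\<sigma> :: nat \<Rightarrow> 'a. \<lbrakk>range \<sigma> \<subseteq> carrier A;
        \<And>e. e > 0 \<Longrightarrow> \<exists>N. \<forall>m\<ge>N. \<forall>n\<ge>N. \<forall>i\<in>I. cnorm (C i) (\<iota> i (\<sigma> m) \<ominus>\<^bsub>C i\<^esub> \<iota> i (\<sigma> n)) < e\<rbrakk> \<Longrightarrow>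
        \<exists>x\<in>carrier A. \<forall>e>0. \<exists>N. \<forall>n\<ge>N. \<forall>i\<in>I. cnorm (C i) (\<iota> i (\<sigma> n) \<ominus>\<^bsub>C i\<^esub> \<iota> i x) \<le> e"
  shows "cstar_algebra A"
proof -
  note hD = star_homD[OF hom]
  note cl = zero add smult mult adj
  have le: "cnorm (C i) (\<iota> i x) \<le> cnorm A x" if "x \<in> carrier A" "i \<in> I" for i x
    using norm[OF that(1)] bdd[OF that(1)] that(2) by (auto intro: cSUP_upper)
  have ge: "cnorm A x \<le> c" if "x \<in> carrier A" "\<And>i. i \<in> I \<Longrightarrow> cnorm (C i) (\<iota> i x) \<le> c" for x c
    using norm[OF that(1)] ne that(2) by (auto intro: cSUP_least)
  have grp: "abelian_group A"
  proof (rule abelian_groupI)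
    fix x assume x: "x \<in> carrier A"
    have "(-1) \<odot>\<^bsub>A\<^esub> x \<oplus>\<^bsub>A\<^esub> x = \<zero>\<^bsub>A\<^esub>"
    proof (rule inj)
      fix i assume i: "i \<in> I"
      interpret C: cstar_algebra "C i" using C[OF i] .
      have ix: "\<iota> i x \<in> carrier (C i)" using hD(1)[OF i x] .
      show "\<iota> i ((-1) \<odot>\<^bsub>A\<^esub> x \<oplus>\<^bsub>A\<^esub> x) = \<iota> i \<zero>\<^bsub>A\<^esub>"
        using i x ix cl by (simp add: hD hom0 C.minus_eq_smult[symmetric] C.l_neg)
    qed (use x cl in auto)
    thus "\<exists>y\<in>carrier A. y \<oplus>\<^bsub>A\<^esub> x = \<zero>\<^bsub>A\<^esub>" using x cl by blast
  next
    fix x y assume xy: "x \<in> carrier A" "y \<in> carrier A"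
    show "x \<oplus>\<^bsub>A\<^esub> y = y \<oplus>\<^bsub>A\<^esub> x"
    proof (rule inj)
      fix i assume i: "i \<in> I"
      interpret C: cstar_algebra "C i" using C[OF i] .
      show "\<iota> i (x \<oplus>\<^bsub>A\<^esub> y) = \<iota> i (y \<oplus>\<^bsub>A\<^esub> x)"
        using i xy cl by (simp add: hD C.a_comm)
    qed (use xy cl in auto)
  next
    fix x y z assume xy: "x \<in> carrier A" "y \<in> carrier A" "z \<in> carrier A"
    show "x \<oplus>\<^bsub>A\<^esub> y \<oplus>\<^bsub>A\<^esub> z = x \<oplus>\<^bsub>A\<^esub> (y \<oplus>\<^bsub>A\<^esub> z)"
    proof (rule inj)
      fix i assume i: "i \<in> I"
      interpret C: cstar_algebra "C i" using C[OF i] .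
      show "\<iota> i (x \<oplus>\<^bsub>A\<^esub> y \<oplus>\<^bsub>A\<^esub> z) = \<iota> i (x \<oplus>\<^bsub>A\<^esub> (y \<oplus>\<^bsub>A\<^esub> z))"
        using i xy cl by (simp add: hD C.a_assoc)
    qed (use xy cl in auto)
  next
    fix x assume x: "x \<in> carrier A"
    show "\<zero>\<^bsub>A\<^esub> \<oplus>\<^bsub>A\<^esub> x = x"
    proof (rule inj)
      fix i assume i: "i \<in> I"
      interpret C: cstar_algebra "C i" using C[OF i] .
      show "\<iota> i (\<zero>\<^bsub>A\<^esub> \<oplus>\<^bsub>A\<^esub> x) = \<iota> i x"
        using i x cl by (simp add: hD hom0)
    qed (use x cl in auto)
  qed (use cl in auto)
  have mod: "module complex_ring A"
  proof (rule moduleI)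
    fix a b x assume x: "x \<in> carrier A"
    show "(a \<oplus>\<^bsub>complex_ring\<^esub> b) \<odot>\<^bsub>A\<^esub> x = a \<odot>\<^bsub>A\<^esub> x \<oplus>\<^bsub>A\<^esub> b \<odot>\<^bsub>A\<^esub> x"
    proof (rule inj)
      fix i assume i: "i \<in> I"
      interpret C: cstar_algebra "C i" using C[OF i] .
      show "\<iota> i ((a \<oplus>\<^bsub>complex_ring\<^esub> b) \<odot>\<^bsub>A\<^esub> x) = \<iota> i (a \<odot>\<^bsub>A\<^esub> x \<oplus>\<^bsub>A\<^esub> b \<odot>\<^bsub>A\<^esub> x)"
        using i x cl C.smult_l_distr[of a b "\<iota> i x"] by (simp add: hD)
    qed (use x cl in auto)
    show "(a \<otimes>\<^bsub>complex_ring\<^esub> b) \<odot>\<^bsub>A\<^esub> x = a \<odot>\<^bsub>A\<^esub> (b \<odot>\<^bsub>A\<^esub> x)"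
    proof (rule inj)
      fix i assume i: "i \<in> I"
      interpret C: cstar_algebra "C i" using C[OF i] .
      show "\<iota> i ((a \<otimes>\<^bsub>complex_ring\<^esub> b) \<odot>\<^bsub>A\<^esub> x) = \<iota> i (a \<odot>\<^bsub>A\<^esub> (b \<odot>\<^bsub>A\<^esub> x))"
        using i x cl C.smult_assoc1[of a b "\<iota> i x"] by (simp add: hD)
    qed (use x cl in auto)
    show "\<one>\<^bsub>complex_ring\<^esub> \<odot>\<^bsub>A\<^esub> x = x"
    proof (rule inj)
      fix i assume i: "i \<in> I"
      interpret C: cstar_algebra "C i" using C[OF i] .
      show "\<iota> i (\<one>\<^bsub>complex_ring\<^esub> \<odot>\<^bsub>A\<^esub> x) = \<iota> i x"
        using i x cl C.smult_one[of "\<iota> i x"] by (simp add: hD)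
    qed (use x cl in auto)
  next
    fix a x y assume x: "x \<in> carrier A" "y \<in> carrier A"
    show "a \<odot>\<^bsub>A\<^esub> (x \<oplus>\<^bsub>A\<^esub> y) = a \<odot>\<^bsub>A\<^esub> x \<oplus>\<^bsub>A\<^esub> a \<odot>\<^bsub>A\<^esub> y"
    proof (rule inj)
      fix i assume i: "i \<in> I"
      interpret C: cstar_algebra "C i" using C[OF i] .
      show "\<iota> i (a \<odot>\<^bsub>A\<^esub> (x \<oplus>\<^bsub>A\<^esub> y)) = \<iota> i (a \<odot>\<^bsub>A\<^esub> x \<oplus>\<^bsub>A\<^esub> a \<odot>\<^bsub>A\<^esub> y)"
        using i x cl C.smult_r_distr[of a "\<iota> i x" "\<iota> i y"] by (simp add: hD)
    qed (use x cl in auto)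
  qed (use cl grp cring_complex_ring in auto)
  interpret M: module complex_ring A by (rule mod)
  have minus: "x \<ominus>\<^bsub>A\<^esub> y = x \<oplus>\<^bsub>A\<^esub> (-1) \<odot>\<^bsub>A\<^esub> y" if xy: "x \<in> carrier A" "y \<in> carrier A" for x y
  proof -
    have "(-1) \<odot>\<^bsub>A\<^esub> y \<oplus>\<^bsub>A\<^esub> y = \<zero>\<^bsub>A\<^esub>"
      using M.smult_l_distr[of "-1" 1 y] M.smult_one[of y] M.smult_l_null[of y] xy by simp
    hence "\<ominus>\<^bsub>A\<^esub> y = (-1) \<odot>\<^bsub>A\<^esub> y" using xy cl by (intro M.minus_equality) auto
    thus ?thesis by (simp add: a_minus_def)
  qed
  have mincl: "x \<ominus>\<^bsub>A\<^esub> y \<in> carrier A" if "x \<in> carrier A" "y \<in> carrier A" for x y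
    using that cl by (simp add: minus)
  have hdiff: "\<iota> i (x \<ominus>\<^bsub>A\<^esub> y) = \<iota> i x \<ominus>\<^bsub>C i\<^esub> \<iota> i y"
    if "x \<in> carrier A" "y \<in> carrier A" "i \<in> I" for i x y
  proof -
    interpret C: cstar_algebra "C i" using C[OF that(3)] .
    show ?thesis using that cl by (simp add: minus C.minus_eq hD)
  qed
  have nn: "0 \<le> cnorm A x" if x: "x \<in> carrier A" for x
  proof -
    obtain i where i: "i \<in> I" using ne by blast
    interpret C: cstar_algebra "C i" using C[OF i] .
    show ?thesis using le[OF x i] C.cnorm_nonneg[OF hD(1)[OF i x]] by simp
  qed
  have n0: "cnorm A x = 0 \<longleftrightarrow> x = \<zero>\<^bsub>A\<^esub>" if x: "x \<in> carrier A" for x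
  proof
    assume 0: "cnorm A x = 0"
    show "x = \<zero>\<^bsub>A\<^esub>"
    proof (rule inj[OF x zero])
      fix i assume i: "i \<in> I"
      interpret C: cstar_algebra "C i" using C[OF i] .
      show "\<iota> i x = \<iota> i \<zero>\<^bsub>A\<^esub>"
        using le[OF x i] 0 C.cnorm_nonneg[OF hD(1)[OF i x]] C.cnorm_eq_0[OF hD(1)[OF i x]] hom0[OF i]
        by simp
    qed
  next
    assume "x = \<zero>\<^bsub>A\<^esub>"
    moreover have "cnorm A \<zero>\<^bsub>A\<^esub> \<le> 0"
      using zero by (rule ge) (simp add: hom0 cstar_algebra.cnorm_zero[OF C])
    ultimately show "cnorm A x = 0" using nn[OF x] by simp
  qed
  have nadd: "cnorm A (x \<oplus>\<^bsub>A\<^esub> y) \<le> cnorm A x + cnorm A y" if x: "x \<in> carrier A" "y \<in> carrier A" for x y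
  proof (rule ge)
    fix i assume i: "i \<in> I"
    interpret C: cstar_algebra "C i" using C[OF i] .
    show "cnorm (C i) (\<iota> i (x \<oplus>\<^bsub>A\<^esub> y)) \<le> cnorm A x + cnorm A y"
      using C.cnorm_add[of "\<iota> i x" "\<iota> i y"] le[OF x(1) i] le[OF x(2) i] x i by (simp add: hD)
  qed (use x cl in auto)
  have nmult: "cnorm A (x \<otimes>\<^bsub>A\<^esub> y) \<le> cnorm A x * cnorm A y" if x: "x \<in> carrier A" "y \<in> carrier A" for x y
  proof (rule ge)
    fix i assume i: "i \<in> I"
    interpret C: cstar_algebra "C i" using C[OF i] .
    have "cnorm (C i) (\<iota> i x \<otimes>\<^bsub>C i\<^esub> \<iota> i y) \<le> cnorm (C i) (\<iota> i x) * cnorm (C i) (\<iota> i y)"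
      using x i by (simp add: hD C.cnorm_mult)
    also have "\<dots> \<le> cnorm A x * cnorm A y"
      using x i le nn by (intro mult_mono) (simp_all add: hD C.cnorm_nonneg)
    finally show "cnorm (C i) (\<iota> i (x \<otimes>\<^bsub>A\<^esub> y)) \<le> cnorm A x * cnorm A y"
      using x i by (simp add: hD)
  qed (use x cl in auto)
  have nsm_le: "cnorm A (c \<odot>\<^bsub>A\<^esub> x) \<le> cmod c * cnorm A x" if x: "x \<in> carrier A" for x c
  proof (rule ge)
    fix i assume i: "i \<in> I"
    interpret C: cstar_algebra "C i" using C[OF i] .
    show "cnorm (C i) (\<iota> i (c \<odot>\<^bsub>A\<^esub> x)) \<le> cmod c * cnorm A x"
      using x i le[OF x i] by (simp add: hD C.cnorm_smult mult_left_mono)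
  qed (use x cl in auto)
  have nsm: "cnorm A (c \<odot>\<^bsub>A\<^esub> x) = cmod c * cnorm A x" if x: "x \<in> carrier A" for x c
  proof (cases "c = 0")
    case True
    then show ?thesis using M.smult_l_null[OF x] n0[OF zero] zero by simp
  next
    case False
    have "inverse c \<odot>\<^bsub>A\<^esub> (c \<odot>\<^bsub>A\<^esub> x) = x"
      using M.smult_assoc1[of "inverse c" c x] M.smult_one[of x] x False by simp
    hence "cnorm A x \<le> cmod (inverse c) * cnorm A (c \<odot>\<^bsub>A\<^esub> x)"
      using nsm_le[of "c \<odot>\<^bsub>A\<^esub> x" "inverse c"] x cl by simp
    hence "cmod c * cnorm A x \<le> cnorm A (c \<odot>\<^bsub>A\<^esub> x)"
      using False by (simp add: norm_divide norm_inverse field_simps)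
    thus ?thesis using nsm_le[OF x, of c] by simp
  qed
  have nstar_le: "cnorm A (adj A x) \<le> cnorm A x" if x: "x \<in> carrier A" for x
  proof (rule ge)
    fix i assume i: "i \<in> I"
    interpret C: cstar_algebra "C i" using C[OF i] .
    show "cnorm (C i) (\<iota> i (adj A x)) \<le> cnorm A x"
      using x i le[OF x i] by (simp add: hD C.cnorm_adj)
  qed (use x cl in auto)
  have nstar: "cnorm A (adj A x \<otimes>\<^bsub>A\<^esub> x) = (cnorm A x)\<^sup>2" if x: "x \<in> carrier A" for x
  proof (rule antisym)
    have "cnorm A (adj A x \<otimes>\<^bsub>A\<^esub> x) \<le> cnorm A (adj A x) * cnorm A x"
      using nmult x cl by simp
    also have "\<dots> \<le> cnorm A x * cnorm A x"
      using nstar_le[OF x] nn[OF x] by (rule mult_right_mono)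
    finally show "cnorm A (adj A x \<otimes>\<^bsub>A\<^esub> x) \<le> (cnorm A x)\<^sup>2" by (simp add: power2_eq_square)
    have "cnorm A x \<le> sqrt (cnorm A (adj A x \<otimes>\<^bsub>A\<^esub> x))"
    proof (rule ge[OF x])
      fix i assume i: "i \<in> I"
      interpret C: cstar_algebra "C i" using C[OF i] .
      have "(cnorm (C i) (\<iota> i x))\<^sup>2 = cnorm (C i) (\<iota> i (adj A x \<otimes>\<^bsub>A\<^esub> x))"
        using C.cnorm_adj_mult[of "\<iota> i x"] x i cl by (simp add: hD)
      also have "\<dots> \<le> cnorm A (adj A x \<otimes>\<^bsub>A\<^esub> x)"
        using le x i cl by simp
      finally show "cnorm (C i) (\<iota> i x) \<le> sqrt (cnorm A (adj A x \<otimes>\<^bsub>A\<^esub> x))"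
        by (rule real_le_rsqrt)
    qed
    hence "(cnorm A x)\<^sup>2 \<le> (sqrt (cnorm A (adj A x \<otimes>\<^bsub>A\<^esub> x)))\<^sup>2"
      using nn[OF x] by (intro power_mono) auto
    thus "(cnorm A x)\<^sup>2 \<le> cnorm A (adj A x \<otimes>\<^bsub>A\<^esub> x)"
      using nn[of "adj A x \<otimes>\<^bsub>A\<^esub> x"] x cl by simp
  qed
  have ncomm: "cnorm A (x \<ominus>\<^bsub>A\<^esub> y) = cnorm A (y \<ominus>\<^bsub>A\<^esub> x)"
    if xy: "x \<in> carrier A" "y \<in> carrier A" for x y
  proof -
    have "(SUP i\<in>I. cnorm (C i) (\<iota> i (x \<ominus>\<^bsub>A\<^esub> y))) = (SUP i\<in>I. cnorm (C i) (\<iota> i (y \<ominus>\<^bsub>A\<^esub> x)))"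
    proof (rule SUP_cong)
      fix i assume i: "i \<in> I"
      interpret C: cstar_algebra "C i" using C[OF i] .
      show "cnorm (C i) (\<iota> i (x \<ominus>\<^bsub>A\<^esub> y)) = cnorm (C i) (\<iota> i (y \<ominus>\<^bsub>A\<^esub> x))"
        using xy i hD(1)[OF i] by (simp add: hdiff C.cnorm_commute)
    qed simp
    thus ?thesis using xy mincl by (simp add: norm)
  qed
  have ms: "Metric_space (carrier A) (cdist A)"
  proof
    fix x y z
    show "0 \<le> cdist A x y" using nn mincl by (simp add: cdist_def)
    show "cdist A x y = cdist A y x" by (simp add: cdist_def ncomm)
    show "cdist A x y = 0 \<longleftrightarrow> x = y" if xy: "x \<in> carrier A" "y \<in> carrier A"
    proof -
      have "x \<ominus>\<^bsub>A\<^esub> y = \<zero>\<^bsub>A\<^esub> \<longleftrightarrow> x = y"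
        using xy by (simp add: a_minus_def) (metis M.a_inv_closed M.minus_equality M.minus_minus M.r_neg)
      thus ?thesis using xy n0[OF mincl] by (simp add: cdist_def)
    qed
    show "cdist A x z \<le> cdist A x y + cdist A y z"
      if xy: "x \<in> carrier A" "y \<in> carrier A" "z \<in> carrier A"
    proof -
      have "(x \<ominus>\<^bsub>A\<^esub> y) \<oplus>\<^bsub>A\<^esub> (y \<ominus>\<^bsub>A\<^esub> z) = x \<oplus>\<^bsub>A\<^esub> ((\<ominus>\<^bsub>A\<^esub> y \<oplus>\<^bsub>A\<^esub> y) \<oplus>\<^bsub>A\<^esub> \<ominus>\<^bsub>A\<^esub> z)"
        using xy by (simp add: a_minus_def M.a_assoc del: M.l_neg)
      also have "\<dots> = x \<ominus>\<^bsub>A\<^esub> z" using xy by (simp add: a_minus_def M.l_neg)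
      finally show ?thesis using nadd[OF mincl mincl, of x y y z] xy by (simp add: cdist_def)
    qed
  qed
  interpret ms: Metric_space "carrier A" "cdist A" by (rule ms)
  have compl': "ms.mcomplete"
    unfolding ms.mcomplete_def
  proof (intro allI impI)
    fix \<sigma> assume \<sigma>: "ms.MCauchy \<sigma>"
    hence r: "range \<sigma> \<subseteq> carrier A" by (simp add: ms.MCauchy_def)
    hence r': "\<sigma> n \<in> carrier A" for n by auto
    have "\<exists>x\<in>carrier A. \<forall>e>0. \<exists>N. \<forall>n\<ge>N. \<forall>i\<in>I. cnorm (C i) (\<iota> i (\<sigma> n) \<ominus>\<^bsub>C i\<^esub> \<iota> i x) \<le> e"
    proof (rule compl[OF r])
      fix e :: real assume "e > 0"
      then obtain N where N: "\<And>m n. m \<ge> N \<Longrightarrow> n \<ge> N \<Longrightarrow> cdist A (\<sigma> m) (\<sigma> n) < e"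
        using \<sigma> unfolding ms.MCauchy_def by blast
      have "cnorm (C i) (\<iota> i (\<sigma> m) \<ominus>\<^bsub>C i\<^esub> \<iota> i (\<sigma> n)) < e" if "m \<ge> N" "n \<ge> N" "i \<in> I" for m n i
        using N[OF that(1,2)] le[OF mincl[OF r'[of m] r'[of n]] that(3)] r' that(3)
        by (simp add: cdist_def hdiff)
      thus "\<exists>N. \<forall>m\<ge>N. \<forall>n\<ge>N. \<forall>i\<in>I. cnorm (C i) (\<iota> i (\<sigma> m) \<ominus>\<^bsub>C i\<^esub> \<iota> i (\<sigma> n)) < e" by blast
    qed
    then obtain x where x: "x \<in> carrier A"
      "\<And>e. e > 0 \<Longrightarrow> \<exists>N. \<forall>n\<ge>N. \<forall>i\<in>I. cnorm (C i) (\<iota> i (\<sigma> n) \<ominus>\<^bsub>C i\<^esub> \<iota> i x) \<le> e" by blast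
    have "limitin ms.mtopology \<sigma> x sequentially"
      unfolding ms.limit_metric_sequentially
    proof (intro conjI allI impI x(1))
      fix e :: real assume e: "e > 0"
      obtain N where N: "\<And>n i. n \<ge> N \<Longrightarrow> i \<in> I \<Longrightarrow> cnorm (C i) (\<iota> i (\<sigma> n) \<ominus>\<^bsub>C i\<^esub> \<iota> i x) \<le> e / 2"
        using x(2)[of "e/2"] e by (metis half_gt_zero)
      have "cnorm A (\<sigma> n \<ominus>\<^bsub>A\<^esub> x) \<le> e / 2" if "n \<ge> N" for n
        using mincl[OF r'[of n] x(1)] N[OF that] r' x(1) by (intro ge) (auto simp: hdiff)
      hence "cdist A (\<sigma> n) x < e" if "n \<ge> N" for n
        using that r' x(1) e by (fastforce simp: cdist_def)
      thus "\<exists>N. \<forall>n\<ge>N. \<sigma> n \<in> carrier A \<and> cdist A (\<sigma> n) x < e" using r' by blast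
    qed
    thus "\<exists>x. limitin ms.mtopology \<sigma> x sequentially" ..
  qed
  show ?thesis
  proof (rule cstar_algebra.intro[OF mod], unfold_locales)
    fix x y z assume xyz: "x \<in> carrier A" "y \<in> carrier A" "z \<in> carrier A"
    show "x \<otimes>\<^bsub>A\<^esub> y \<otimes>\<^bsub>A\<^esub> z = x \<otimes>\<^bsub>A\<^esub> (y \<otimes>\<^bsub>A\<^esub> z)"
      by (rule inj) (use xyz cl in \<open>auto simp: hD cstar_algebra.mult_assoc[OF C]\<close>)
    show "(x \<oplus>\<^bsub>A\<^esub> y) \<otimes>\<^bsub>A\<^esub> z = x \<otimes>\<^bsub>A\<^esub> z \<oplus>\<^bsub>A\<^esub> y \<otimes>\<^bsub>A\<^esub> z"
      by (rule inj) (use xyz cl in \<open>auto simp: hD cstar_algebra.mult_distr_left[OF C]\<close>)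
    show "z \<otimes>\<^bsub>A\<^esub> (x \<oplus>\<^bsub>A\<^esub> y) = z \<otimes>\<^bsub>A\<^esub> x \<oplus>\<^bsub>A\<^esub> z \<otimes>\<^bsub>A\<^esub> y"
      by (rule inj) (use xyz cl in \<open>auto simp: hD cstar_algebra.mult_distr_right[OF C]\<close>)
  next
    fix x y c assume xyz: "x \<in> carrier A" "y \<in> carrier A"
    show "c \<odot>\<^bsub>A\<^esub> x \<otimes>\<^bsub>A\<^esub> y = c \<odot>\<^bsub>A\<^esub> (x \<otimes>\<^bsub>A\<^esub> y)"
      by (rule inj) (use xyz cl in \<open>auto simp: hD cstar_algebra.smult_mult_left[OF C]\<close>)
    show "x \<otimes>\<^bsub>A\<^esub> (c \<odot>\<^bsub>A\<^esub> y) = c \<odot>\<^bsub>A\<^esub> (x \<otimes>\<^bsub>A\<^esub> y)"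
      by (rule inj) (use xyz cl in \<open>auto simp: hD cstar_algebra.smult_mult_right[OF C]\<close>)
    show "adj A (x \<oplus>\<^bsub>A\<^esub> y) = adj A x \<oplus>\<^bsub>A\<^esub> adj A y"
      by (rule inj) (use xyz cl in \<open>auto simp: hD cstar_algebra.adj_add[OF C]\<close>)
    show "adj A (x \<otimes>\<^bsub>A\<^esub> y) = adj A y \<otimes>\<^bsub>A\<^esub> adj A x"
      by (rule inj) (use xyz cl in \<open>auto simp: hD cstar_algebra.adj_mult[OF C]\<close>)
  next
    fix x c assume xyz: "x \<in> carrier A"
    show "adj A (c \<odot>\<^bsub>A\<^esub> x) = cnj c \<odot>\<^bsub>A\<^esub> adj A x"
      by (rule inj) (use xyz cl in \<open>auto simp: hD cstar_algebra.adj_smult[OF C]\<close>)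
    show "adj A (adj A x) = x"
      by (rule inj) (use xyz cl in \<open>auto simp: hD cstar_algebra.adj_adj[OF C]\<close>)
  qed (use cl nn n0 nadd nmult nsm nstar compl' in auto)
qed

lemma bds_representation_reflect:
  fixes A :: "('a, 'w) cstar_scheme" and C :: "'i \<Rightarrow> ('c, 'z) cstar_scheme"
  assumes A: "cstar_algebra A"
    and hom: "\<And>i. i \<in> I \<Longrightarrow> \<iota> i \<in> star_hom A (C i)"
    and inj: "\<And>x y. \<lbrakk>x \<in> carrier A; y \<in> carrier A; \<And>i. i \<in> I \<Longrightarrow> \<iota> i x = \<iota> i y\<rbrakk> \<Longrightarrow> x = y"
    and P: "\<And>Y. P Y \<in> carrier A"
    and S: "\<And>\<alpha> B. \<lbrakk>\<alpha> \<in> L; B \<in> \<I> \<alpha>\<rbrakk> \<Longrightarrow> S \<alpha> B \<in> carrier A"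
    and rep: "\<And>i. i \<in> I \<Longrightarrow> bds_representation L \<theta> \<I> J (C i) (P' i) (S' i)"
    and P': "\<And>i Y. i \<in> I \<Longrightarrow> \<iota> i (P Y) = P' i Y"
    and S': "\<And>i \<alpha> B. \<lbrakk>i \<in> I; \<alpha> \<in> L; B \<in> \<I> \<alpha>\<rbrakk> \<Longrightarrow> \<iota> i (S \<alpha> B) = S' i \<alpha> B"
    and J: "\<And>Y \<alpha>. \<lbrakk>Y \<in> J; \<alpha> \<in> bds_Delta L \<theta> Y\<rbrakk> \<Longrightarrow> \<alpha> \<in> L \<and> \<theta> \<alpha> Y \<in> \<I> \<alpha>"
  shows "bds_representation L \<theta> \<I> J A P S"
proof -
  interpret A: cstar_algebra A by fact
  note hD = star_homD[OF hom]
  note r = bds_representation.axioms(1)[OF rep] bds_representation.projection_P[OF rep]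
    bds_representation.partial_isometry_S[OF rep] bds_representation.P_bot[OF rep]
    bds_representation.P_inf[OF rep] bds_representation.P_sup[OF rep]
    bds_representation.P_S[OF rep] bds_representation.adj_S_S[OF rep] bds_representation.P_sum[OF rep]
  have C: "cstar_algebra (C i)" if "i \<in> I" for i using r(1) that by blast
  note hz = star_hom_zero[OF A C hom] and hm = star_hom_diff[OF A C hom]
  note simps = P' S' hD hz hm P S r(4,5,6,7,8)
  show ?thesis
  proof (rule bds_representation.intro[OF A], unfold_locales)
    show "cstar_projection A (P X)" for X
      unfolding cstar_projection_def
      using r(2) P by (auto simp: simps cstar_projection_def intro!: inj)
    show "cstar_partial_isometry A (S \<alpha> B)" if "\<alpha> \<in> L" "B \<in> \<I> \<alpha>" for \<alpha> B
      unfolding cstar_partial_isometry_def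
      using r(3)[OF _ that] S[OF that] that by (auto simp: simps cstar_partial_isometry_def intro!: inj)
    show "P bot = \<zero>\<^bsub>A\<^esub>" by (rule inj) (auto simp: simps)
    show "P (inf X Y) = P X \<otimes>\<^bsub>A\<^esub> P Y" for X Y by (rule inj) (auto simp: simps)
    show "P (sup X Y) = P X \<oplus>\<^bsub>A\<^esub> P Y \<ominus>\<^bsub>A\<^esub> P (inf X Y)" for X Y
    proof (rule inj)
      fix i assume i: "i \<in> I"
      have "\<iota> i (P (sup X Y)) = P' i X \<oplus>\<^bsub>C i\<^esub> P' i Y \<ominus>\<^bsub>C i\<^esub> P' i (inf X Y)"
        using i by (simp add: P' r(6))
      also have "\<dots> = \<iota> i (P X \<oplus>\<^bsub>A\<^esub> P Y \<ominus>\<^bsub>A\<^esub> P (inf X Y))"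
        using i P by (simp add: hm hD(2) P')
      finally show "\<iota> i (P (sup X Y)) = \<iota> i (P X \<oplus>\<^bsub>A\<^esub> P Y \<ominus>\<^bsub>A\<^esub> P (inf X Y))" .
    qed (use P in auto)
    show "P X \<otimes>\<^bsub>A\<^esub> S \<alpha> B = S \<alpha> B \<otimes>\<^bsub>A\<^esub> P (\<theta> \<alpha> X)" if "\<alpha> \<in> L" "B \<in> \<I> \<alpha>" for X \<alpha> B
      by (rule inj) (use that in \<open>auto simp: simps\<close>)
    show "adj A (S \<alpha> B) \<otimes>\<^bsub>A\<^esub> S \<beta> D = (if \<alpha> = \<beta> then P (inf B D) else \<zero>\<^bsub>A\<^esub>)"
      if "\<alpha> \<in> L" "B \<in> \<I> \<alpha>" "\<beta> \<in> L" "D \<in> \<I> \<beta>" for \<alpha> B \<beta> D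
    proof (rule inj)
      fix i assume i: "i \<in> I"
      have "\<iota> i (adj A (S \<alpha> B) \<otimes>\<^bsub>A\<^esub> S \<beta> D) = adj (C i) (S' i \<alpha> B) \<otimes>\<^bsub>C i\<^esub> S' i \<beta> D"
        using i that S by (simp add: hD S')
      also have "\<dots> = (if \<alpha> = \<beta> then P' i (inf B D) else \<zero>\<^bsub>C i\<^esub>)"
        using r(8) i that by blast
      finally show "\<iota> i (adj A (S \<alpha> B) \<otimes>\<^bsub>A\<^esub> S \<beta> D) =
          \<iota> i (if \<alpha> = \<beta> then P (inf B D) else \<zero>\<^bsub>A\<^esub>)"
        using i by (simp add: P' hz)
    qed (use that S P in auto)
    show "P X = (\<Oplus>\<^bsub>A\<^esub>\<alpha>\<in>bds_Delta L \<theta> X. S \<alpha> (\<theta> \<alpha> X) \<otimes>\<^bsub>A\<^esub> adj A (S \<alpha> (\<theta> \<alpha> X)))"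
      if X: "X \<in> J" for X
    proof (rule inj)
      let ?f = "\<lambda>\<alpha>. S \<alpha> (\<theta> \<alpha> X) \<otimes>\<^bsub>A\<^esub> adj A (S \<alpha> (\<theta> \<alpha> X))"
      have f: "?f \<in> bds_Delta L \<theta> X \<rightarrow> carrier A" using J[OF X] S by auto
      show "(\<Oplus>\<^bsub>A\<^esub>\<alpha>\<in>bds_Delta L \<theta> X. ?f \<alpha>) \<in> carrier A" using f by (rule A.finsum_closed)
      fix i assume i: "i \<in> I"
      interpret C: cstar_algebra "C i" by (rule C[OF i])
      have eq: "\<iota> i (?f \<alpha>) = S' i \<alpha> (\<theta> \<alpha> X) \<otimes>\<^bsub>C i\<^esub> adj (C i) (S' i \<alpha> (\<theta> \<alpha> X))"
        if "\<alpha> \<in> bds_Delta L \<theta> X" for \<alpha>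
        using J[OF X that] S i by (simp add: hD S')
      have cl: "\<iota> i (?f \<alpha>) \<in> carrier (C i)" if "\<alpha> \<in> bds_Delta L \<theta> X" for \<alpha>
        using f that hD(1)[OF i] by auto
      have "\<iota> i (P X) = P' i X" by (rule P'[OF i])
      also have "\<dots> = (\<Oplus>\<^bsub>C i\<^esub>\<alpha>\<in>bds_Delta L \<theta> X. S' i \<alpha> (\<theta> \<alpha> X) \<otimes>\<^bsub>C i\<^esub> adj (C i) (S' i \<alpha> (\<theta> \<alpha> X)))"
        using r(9) i X by blast
      also have "\<dots> = (\<Oplus>\<^bsub>C i\<^esub>\<alpha>\<in>bds_Delta L \<theta> X. \<iota> i (?f \<alpha>))"
        using eq cl by (intro C.finsum_cong') auto
      also have "\<dots> = \<iota> i (\<Oplus>\<^bsub>A\<^esub>\<alpha>\<in>bds_Delta L \<theta> X. ?f \<alpha>)"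
        using star_hom_finsum[OF A C[OF i] hom[OF i] f] by simp
      finally show "\<iota> i (P X) = \<iota> i (\<Oplus>\<^bsub>A\<^esub>\<alpha>\<in>bds_Delta L \<theta> X. ?f \<alpha>)" .
    qed (rule P)
  qed
qed


section \<open>The universal property over arbitrary types\<close>

lemma star_homI:
  assumes "\<And>x. x \<in> carrier A \<Longrightarrow> \<phi> x \<in> carrier C"
    and "\<And>x y. \<lbrakk>x \<in> carrier A; y \<in> carrier A\<rbrakk> \<Longrightarrow> \<phi> (x \<oplus>\<^bsub>A\<^esub> y) = \<phi> x \<oplus>\<^bsub>C\<^esub> \<phi> y"
    and "\<And>c x. x \<in> carrier A \<Longrightarrow> \<phi> (c \<odot>\<^bsub>A\<^esub> x) = c \<odot>\<^bsub>C\<^esub> \<phi> x"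
    and "\<And>x y. \<lbrakk>x \<in> carrier A; y \<in> carrier A\<rbrakk> \<Longrightarrow> \<phi> (x \<otimes>\<^bsub>A\<^esub> y) = \<phi> x \<otimes>\<^bsub>C\<^esub> \<phi> y"
    and "\<And>x. x \<in> carrier A \<Longrightarrow> \<phi> (adj A x) = adj C (\<phi> x)"
  shows "\<phi> \<in> star_hom A C"
  using assms by (auto simp: star_hom_def)

context cstar_algebra
begin

lemma cstar_subalgebraD:
  assumes "cstar_subalgebra H A"
  shows "H \<subseteq> carrier A" "\<zero> \<in> H" "\<And>x y. x \<in> H \<Longrightarrow> y \<in> H \<Longrightarrow> x \<oplus> y \<in> H"
    "\<And>c x. x \<in> H \<Longrightarrow> c \<odot> x \<in> H" "\<And>x y. x \<in> H \<Longrightarrow> y \<in> H \<Longrightarrow> x \<otimes> y \<in> H"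
    "\<And>x. x \<in> H \<Longrightarrow> adj A x \<in> H"
    "\<And>\<sigma> x. range \<sigma> \<subseteq> H \<Longrightarrow> cconv \<sigma> x \<Longrightarrow> x \<in> H"
proof -
  have sm: "submodule H complex_ring A" and cl: "cstar_closed A H"
    using assms by (auto simp: cstar_subalgebra_def)
  note E = submoduleE[OF sm]
  show H: "H \<subseteq> carrier A" using E(1) .
  show sc: "c \<odot> x \<in> H" if "x \<in> H" for c x using E(4)[OF _ that] by simp
  obtain x where "x \<in> H" using E(2) by blast
  thus "\<zero> \<in> H" using sc[of x 0] smult_l_null[of x] H by auto
  show "x \<oplus> y \<in> H" if "x \<in> H" "y \<in> H" for x y using E(5) that by blast
  show "x \<in> H" if "range \<sigma> \<subseteq> H" "cconv \<sigma> x" for \<sigma> x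
    using cl that unfolding cstar_closed_iff by blast
qed (use assms in \<open>auto simp: cstar_subalgebra_def\<close>)

lemma cstar_subalgebraI:
  assumes "H \<subseteq> carrier A" "\<zero> \<in> H" "\<And>x y. x \<in> H \<Longrightarrow> y \<in> H \<Longrightarrow> x \<oplus> y \<in> H"
    "\<And>c x. x \<in> H \<Longrightarrow> c \<odot> x \<in> H" "\<And>x y. x \<in> H \<Longrightarrow> y \<in> H \<Longrightarrow> x \<otimes> y \<in> H"
    "\<And>x. x \<in> H \<Longrightarrow> adj A x \<in> H"
    "\<And>\<sigma> x. range \<sigma> \<subseteq> H \<Longrightarrow> cconv \<sigma> x \<Longrightarrow> x \<in> H"
  shows "cstar_subalgebra H A"
  unfolding cstar_subalgebra_def cstar_closed_iff
  using assms submoduleI'[of H] by auto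

lemma cconv_le:
  assumes "cconv \<sigma> x" "y \<in> carrier A" "\<And>m. m \<ge> N \<Longrightarrow> cnorm A (y \<ominus> \<sigma> m) \<le> e"
  shows "cnorm A (y \<ominus> x) \<le> e"
proof (rule LIMSEQ_le_const)
  have c: "x \<in> carrier A" "\<sigma> n \<in> carrier A" for n
    using assms by (auto simp: cconv_def)
  have "(\<lambda>n. e + cnorm A (\<sigma> n \<ominus> x)) \<longlonglongrightarrow> e + 0"
    using assms(1) by (intro tendsto_intros) (simp add: cconv_def)
  thus "(\<lambda>n. e + cnorm A (\<sigma> n \<ominus> x)) \<longlonglongrightarrow> e" by simp
  show "\<exists>M. \<forall>n\<ge>M. cnorm A (y \<ominus> x) \<le> e + cnorm A (\<sigma> n \<ominus> x)"
    using cnorm_triangle[OF assms(2) c(2) c(1)] assms(3) by (meson add_right_mono order_trans)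
qed

lemma cconvD: "cconv \<sigma> x \<Longrightarrow> e > 0 \<Longrightarrow> \<exists>N. \<forall>n\<ge>N. cnorm A (\<sigma> n \<ominus> x) \<le> e"
  using order_tendstoD(2)[of "\<lambda>n. cnorm A (\<sigma> n \<ominus> x)" 0 sequentially e]
  by (auto simp: cconv_def eventually_sequentially) (meson less_imp_le)

lemma cnorm_projection: "cstar_projection A p \<Longrightarrow> cnorm A p \<le> 1"
  using cnorm_adj_mult[of p] cnorm_nonneg[of p]
  by (auto simp: cstar_projection_def power2_eq_square)

lemma subalgebra_diff:
  assumes "cstar_subalgebra H A" "x \<in> H" "y \<in> H" shows "x \<ominus> y \<in> H"
  using cstar_subalgebraD[OF assms(1)] assms(2,3) by (simp add: minus_eq subset_iff)

lemma subalgebra_cstar: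
  assumes H: "cstar_subalgebra H A"
  shows "cstar_algebra (A\<lparr>carrier := H\<rparr>)"
proof (rule cstar_algebra_embed[where I = "{()}" and C = "\<lambda>_. A" and \<iota> = "\<lambda>_ x. x"])
  note D = cstar_subalgebraD[OF H]
  show "cstar_algebra A" by unfold_locales
  show "(\<lambda>x. x) \<in> star_hom (A\<lparr>carrier := H\<rparr>) A"
    using D by (intro star_homI) auto
  fix \<sigma> :: "nat \<Rightarrow> 'a"
  assume \<sigma>: "range \<sigma> \<subseteq> carrier (A\<lparr>carrier := H\<rparr>)"
    and C: "\<And>e. e > 0 \<Longrightarrow> \<exists>N. \<forall>m\<ge>N. \<forall>n\<ge>N. \<forall>i\<in>{()}. cnorm A (\<sigma> m \<ominus> \<sigma> n) < e"
  have r: "range \<sigma> \<subseteq> carrier A" using \<sigma> D by auto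
  obtain x where x: "cconv \<sigma> x" using complete_cconv[OF r] C by auto
  have "x \<in> H" using D(7) \<sigma> x by auto
  moreover have "\<exists>N. \<forall>n\<ge>N. cnorm A (\<sigma> n \<ominus> x) \<le> e" if "e > 0" for e
    using cconvD[OF x that] .
  ultimately show "\<exists>x\<in>carrier (A\<lparr>carrier := H\<rparr>). \<forall>e>0. \<exists>N. \<forall>n\<ge>N. \<forall>i\<in>{()}.
      cnorm A (\<sigma> n \<ominus> x) \<le> e"
    by auto
qed (use cstar_subalgebraD[OF H] in auto)

lemma subalgebra_trans:
  assumes H: "cstar_subalgebra H A" and K: "cstar_subalgebra K (A\<lparr>carrier := H\<rparr>)"
  shows "cstar_subalgebra K A"
proof -
  interpret B: cstar_algebra "A\<lparr>carrier := H\<rparr>" by (rule subalgebra_cstar[OF H])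
  note D = cstar_subalgebraD[OF H]
  note E = B.cstar_subalgebraD[OF K, simplified]
  have min: "a_minus (A\<lparr>carrier := H\<rparr>) x y = x \<ominus> y" if "x \<in> H" "y \<in> H" for x y
    using that D(1) B.minus_eq[of x y] minus_eq[of x y] by (simp add: subset_iff)
  show ?thesis
  proof (rule cstar_subalgebraI)
    fix \<sigma> x assume \<sigma>: "range \<sigma> \<subseteq> K" and c: "cconv \<sigma> x"
    have x: "x \<in> H" using D(7)[OF _ c] \<sigma> E(1) by auto
    have "B.cconv \<sigma> x"
      using c \<sigma> E(1) x by (auto simp: cconv_def B.cconv_def min image_subset_iff subset_iff)
    thus "x \<in> K" using E(7) \<sigma> by blast
  qed (use D(1) E in auto)
qed

lemma subalgebra_Inter:
  assumes "\<And>H. H \<in> \<H> \<Longrightarrow> cstar_subalgebra H A" "\<H> \<noteq> {}"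
  shows "cstar_subalgebra (\<Inter>\<H>) A"
proof -
  note D = cstar_subalgebraD[OF assms(1)]
  show ?thesis
  proof (rule cstar_subalgebraI)
    fix \<sigma> x assume "range \<sigma> \<subseteq> \<Inter>\<H>" "cconv \<sigma> x"
    thus "x \<in> \<Inter>\<H>" using D(7) by blast
  next
    obtain H where H: "H \<in> \<H>" using assms(2) by blast
    show "\<Inter>\<H> \<subseteq> carrier A" using D(1)[OF H] H by blast
  qed (auto intro: D)
qed

lemma subalgebra_carrier: "cstar_subalgebra (carrier A) A"
  by (rule cstar_subalgebraI) (auto simp: cconv_def)

end

context relative_generalized_bds
begin

lemma Delta_\<I>: "\<alpha> \<in> bds_Delta L \<theta> Y \<Longrightarrow> \<alpha> \<in> L \<and> \<theta> \<alpha> Y \<in> \<I> \<alpha>"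
  using range_subset_\<I> by (fastforce simp: bds_Delta_def bds_range_def)

lemma representation_subalgebra:
  assumes rep: "bds_representation L \<theta> \<I> J A P S" and H: "cstar_subalgebra H A"
    and P: "range P \<subseteq> H" and S: "\<And>\<alpha> B. \<alpha> \<in> L \<Longrightarrow> B \<in> \<I> \<alpha> \<Longrightarrow> S \<alpha> B \<in> H"
  shows "bds_representation L \<theta> \<I> J (A\<lparr>carrier := H\<rparr>) P S"
proof -
  interpret A: cstar_algebra A by (rule bds_representation.axioms(1)[OF rep])
  show ?thesis
  proof (rule bds_representation_reflect[where I = "{()}" and C = "\<lambda>_. A" and \<iota> = "\<lambda>_ x. x"
        and P' = "\<lambda>_. P" and S' = "\<lambda>_. S"])
    show "cstar_algebra (A\<lparr>carrier := H\<rparr>)" by (rule A.subalgebra_cstar[OF H])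
    show "(\<lambda>x. x) \<in> star_hom (A\<lparr>carrier := H\<rparr>) A"
      using A.cstar_subalgebraD[OF H] by (intro star_homI) auto
  qed (use P S rep Delta_\<I> in auto)
qed

end

primrec star_poly_eval :: "'l set \<Rightarrow> ('l \<Rightarrow> 'b set) \<Rightarrow> ('a, 'z) cstar_scheme \<Rightarrow>
    ('b \<Rightarrow> 'a) \<Rightarrow> ('l \<Rightarrow> 'b \<Rightarrow> 'a) \<Rightarrow> ('b, 'l) star_poly \<Rightarrow> 'a" where
  "star_poly_eval L \<I> A P S (GenP X) = P X"
| "star_poly_eval L \<I> A P S (GenS \<alpha> B) = (if \<alpha> \<in> L \<and> B \<in> \<I> \<alpha> then S \<alpha> B else \<zero>\<^bsub>A\<^esub>)"
| "star_poly_eval L \<I> A P S (Plus s t) = star_poly_eval L \<I> A P S s \<oplus>\<^bsub>A\<^esub> star_poly_eval L \<I> A P S t"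
| "star_poly_eval L \<I> A P S (Times s t) = star_poly_eval L \<I> A P S s \<otimes>\<^bsub>A\<^esub> star_poly_eval L \<I> A P S t"
| "star_poly_eval L \<I> A P S (Scale c t) = c \<odot>\<^bsub>A\<^esub> star_poly_eval L \<I> A P S t"
| "star_poly_eval L \<I> A P S (Adj t) = adj A (star_poly_eval L \<I> A P S t)"

lemma universal_bds_representation_property:
  fixes L :: "'l set" and \<theta> :: "'l \<Rightarrow> 'b::generalized_boolean_algebra \<Rightarrow> 'b"
    and A :: "'a cstar" and C :: "'c cstar"
  assumes sys: "relative_generalized_bds L \<theta> \<I> J"
    and univ: "universal_bds_representation L \<theta> \<I> J A P S"
    and rep: "bds_representation L \<theta> \<I> J C Q T"
  shows "\<exists>\<phi>\<in>star_hom A C. (\<forall>X. \<phi> (P X) = Q X) \<and> (\<forall>\<alpha>\<in>L. \<forall>B\<in>\<I> \<alpha>. \<phi> (S \<alpha> B) = T \<alpha> B)"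
proof -
  interpret relative_generalized_bds L \<theta> \<I> J by fact
  interpret C: cstar_algebra C by (rule bds_representation.axioms(1)[OF rep])
  let ?ev = "star_poly_eval L \<I> C Q T"
  have Q: "Q X \<in> carrier C" for X
    using bds_representation.projection_P[OF rep, of X] by (simp add: cstar_projection_def)
  have T: "T \<alpha> B \<in> carrier C" if "\<alpha> \<in> L" "B \<in> \<I> \<alpha>" for \<alpha> B
    using bds_representation.partial_isometry_S[OF rep that] by (simp add: cstar_partial_isometry_def)
  have ev: "?ev t \<in> carrier C" for t by (induction t) (use Q T in auto)
  define H where "H = {x. \<exists>t. C.cconv (\<lambda>n. ?ev (t n)) x}"
  have evH: "?ev t \<in> H" for t
    unfolding H_def using C.cconv_const[OF ev[of t]] by (auto intro!: exI[of _ "\<lambda>_. t"])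
  have H: "cstar_subalgebra H C"
  proof (rule C.cstar_subalgebraI)
    show "H \<subseteq> carrier C" by (auto simp: H_def C.cconv_def)
    show "\<zero>\<^bsub>C\<^esub> \<in> H" using evH[of "Scale 0 (GenP bot)"] C.smult_l_null[OF Q] by simp
    fix x assume "x \<in> H"
    then obtain s where s: "C.cconv (\<lambda>n. ?ev (s n)) x" by (auto simp: H_def)
    show "c \<odot>\<^bsub>C\<^esub> x \<in> H" for c
      unfolding H_def using C.cconv_smult[OF s, of c] by (auto intro!: exI[of _ "\<lambda>n. Scale c (s n)"])
    show "adj C x \<in> H"
      unfolding H_def using C.cconv_adj[OF s] by (auto intro!: exI[of _ "\<lambda>n. Adj (s n)"])
    fix y assume "y \<in> H"
    then obtain t where t: "C.cconv (\<lambda>n. ?ev (t n)) y" by (auto simp: H_def)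
    show "x \<oplus>\<^bsub>C\<^esub> y \<in> H"
      unfolding H_def using C.cconv_add[OF s t] by (auto intro!: exI[of _ "\<lambda>n. Plus (s n) (t n)"])
    show "x \<otimes>\<^bsub>C\<^esub> y \<in> H"
      unfolding H_def using C.cconv_mult[OF s t] by (auto intro!: exI[of _ "\<lambda>n. Times (s n) (t n)"])
  next
    fix \<sigma> x assume \<sigma>: "range \<sigma> \<subseteq> H" and x: "C.cconv \<sigma> x"
    have c: "\<sigma> n \<in> carrier C" "x \<in> carrier C" for n using x by (auto simp: C.cconv_def)
    have "\<exists>t. cnorm C (?ev t \<ominus>\<^bsub>C\<^esub> \<sigma> n) \<le> inverse (real (Suc n))" for n
    proof -
      obtain s where "C.cconv (\<lambda>n. ?ev (s n)) (\<sigma> n)" using \<sigma> by (auto simp: H_def)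
      hence "eventually (\<lambda>k. cnorm C (?ev (s k) \<ominus>\<^bsub>C\<^esub> \<sigma> n) < inverse (real (Suc n))) sequentially"
        by (intro order_tendstoD(2)[of _ 0]) (auto simp: C.cconv_def)
      thus ?thesis by (meson eventually_sequentially less_imp_le order_refl)
    qed
    then obtain t where t: "\<And>n. cnorm C (?ev (t n) \<ominus>\<^bsub>C\<^esub> \<sigma> n) \<le> inverse (real (Suc n))" by metis
    have "C.cconv (\<lambda>n. ?ev (t n)) x"
    proof (rule C.cconv_dominated)
      show "(\<lambda>n. inverse (real (Suc n)) + cnorm C (\<sigma> n \<ominus>\<^bsub>C\<^esub> x)) \<longlonglongrightarrow> 0"
        using x by (intro tendsto_add_zero LIMSEQ_inverse_real_of_nat) (simp add: C.cconv_def)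
      show "cnorm C (?ev (t n) \<ominus>\<^bsub>C\<^esub> x) \<le> inverse (real (Suc n)) + cnorm C (\<sigma> n \<ominus>\<^bsub>C\<^esub> x)" for n
        using C.cnorm_triangle[OF ev c, of "t n" n] t[of n] by simp
    qed (use ev c in auto)
    thus "x \<in> H" by (auto simp: H_def)
  qed
  note D = C.cstar_subalgebraD[OF H]
  define code where "code x = (SOME t. C.cconv (\<lambda>n. ?ev (t n)) x)" for x
  have code: "C.cconv (\<lambda>n. ?ev (code x n)) x" if "x \<in> H" for x
    using that someI_ex[of "\<lambda>t. C.cconv (\<lambda>n. ?ev (t n)) x"] by (simp add: code_def H_def)
  have inj: "inj_on code H"
    by (rule inj_onI) (metis code C.cconv_unique)
  define \<iota> where "\<iota> = inv_into H code"
  have \<iota>: "\<iota> (code x) = x" if "x \<in> H" for x using inj that by (simp add: \<iota>_def)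
  have \<iota>H: "\<iota> u \<in> H" "code (\<iota> u) = u" if "u \<in> code ` H" for u using that \<iota> by auto
  define U :: "('b, 'l) cstar_universe cstar" where
    "U = \<lparr>carrier = code ` H, monoid.mult = (\<lambda>x y. code (\<iota> x \<otimes>\<^bsub>C\<^esub> \<iota> y)), one = undefined,
          ring.zero = code \<zero>\<^bsub>C\<^esub>, add = (\<lambda>x y. code (\<iota> x \<oplus>\<^bsub>C\<^esub> \<iota> y)),
          smult = (\<lambda>c x. code (c \<odot>\<^bsub>C\<^esub> \<iota> x)), adj = (\<lambda>x. code (adj C (\<iota> x))),
          cnorm = (\<lambda>x. cnorm C (\<iota> x))\<rparr>"
  have hom: "\<iota> \<in> star_hom U C"
    using D(1-6) \<iota> \<iota>H(1) by (intro star_homI) (auto simp: U_def)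
  have Uc: "carrier U = code ` H" "\<zero>\<^bsub>U\<^esub> = code \<zero>\<^bsub>C\<^esub>"
    and Uo: "x \<oplus>\<^bsub>U\<^esub> y = code (\<iota> x \<oplus>\<^bsub>C\<^esub> \<iota> y)" "x \<otimes>\<^bsub>U\<^esub> y = code (\<iota> x \<otimes>\<^bsub>C\<^esub> \<iota> y)"
      "c \<odot>\<^bsub>U\<^esub> x = code (c \<odot>\<^bsub>C\<^esub> \<iota> x)" "adj U x = code (adj C (\<iota> x))"
      "cnorm U x = cnorm C (\<iota> x)" for x y c
    by (simp_all add: U_def)
  have Uinj: "x = y" if "x \<in> carrier U" "y \<in> carrier U" "\<iota> x = \<iota> y" for x y
  proof -
    have "x = code (\<iota> x)" using that(1) by (simp only: Uc \<iota>H(2))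
    also have "\<dots> = y" using that(2,3) by (simp only: Uc \<iota>H(2))
    finally show ?thesis .
  qed
  have Ucl: "\<zero>\<^bsub>U\<^esub> \<in> carrier U"
    "\<And>x y. x \<in> carrier U \<Longrightarrow> y \<in> carrier U \<Longrightarrow> x \<oplus>\<^bsub>U\<^esub> y \<in> carrier U"
    "\<And>x y. x \<in> carrier U \<Longrightarrow> y \<in> carrier U \<Longrightarrow> x \<otimes>\<^bsub>U\<^esub> y \<in> carrier U"
    "\<And>c x. x \<in> carrier U \<Longrightarrow> c \<odot>\<^bsub>U\<^esub> x \<in> carrier U"
    "\<And>x. x \<in> carrier U \<Longrightarrow> adj U x \<in> carrier U"
    unfolding Uc Uo by (intro imageI D \<iota>H(1); assumption)+
  have U0: "\<iota> \<zero>\<^bsub>U\<^esub> = \<zero>\<^bsub>C\<^esub>" unfolding Uc by (rule \<iota>[OF D(2)])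
  have U: "cstar_algebra U"
  proof (rule cstar_algebra_embed[where I = "{()}" and C = "\<lambda>_. C" and \<iota> = "\<lambda>_. \<iota>"])
    show "cstar_algebra C" by unfold_locales
    fix \<sigma> :: "nat \<Rightarrow> ('b, 'l) cstar_universe"
    assume \<sigma>: "range \<sigma> \<subseteq> carrier U"
      and Cau: "\<And>e. e > 0 \<Longrightarrow> \<exists>N. \<forall>m\<ge>N. \<forall>n\<ge>N. \<forall>i\<in>{()}. cnorm C (\<iota> (\<sigma> m) \<ominus>\<^bsub>C\<^esub> \<iota> (\<sigma> n)) < e"
    have \<sigma>H: "range (\<iota> \<circ> \<sigma>) \<subseteq> H" using \<sigma> \<iota>H(1) unfolding Uc by auto
    obtain x where x: "C.cconv (\<iota> \<circ> \<sigma>) x"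
      using C.complete_cconv[of "\<iota> \<circ> \<sigma>"] \<sigma>H D(1) Cau by auto
    have xH: "x \<in> H" using D(7) \<sigma>H x by blast
    have "\<exists>N. \<forall>n\<ge>N. cnorm C (\<iota> (\<sigma> n) \<ominus>\<^bsub>C\<^esub> \<iota> (code x)) \<le> e" if "e > 0" for e
      using C.cconvD[OF x that] \<iota>[OF xH] by simp
    moreover have "code x \<in> carrier U" using xH by (simp add: Uc)
    ultimately show "\<exists>x\<in>carrier U. \<forall>e>0. \<exists>N. \<forall>n\<ge>N. \<forall>i\<in>{()}.
      cnorm C (\<iota> (\<sigma> n) \<ominus>\<^bsub>C\<^esub> \<iota> x) \<le> e" by auto
  next
    fix x y assume "x \<in> carrier U" "y \<in> carrier U" "\<And>i. i \<in> {()} \<Longrightarrow> \<iota> x = \<iota> y"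
    thus "x = y" using Uinj by blast
  qed (simp_all add: hom Ucl U0 Uo(5))
  have QH: "Q X \<in> H" for X using evH[of "GenP X"] by simp
  have TH: "T \<alpha> B \<in> H" if "\<alpha> \<in> L" "B \<in> \<I> \<alpha>" for \<alpha> B using evH[of "GenS \<alpha> B"] that by simp
  have "bds_representation L \<theta> \<I> J U (\<lambda>X. code (Q X)) (\<lambda>\<alpha> B. code (T \<alpha> B))"
  proof (rule bds_representation_reflect[where I = "{()}" and C = "\<lambda>_. C" and \<iota> = "\<lambda>_. \<iota>"
        and P' = "\<lambda>_. Q" and S' = "\<lambda>_. T"])
    fix x y assume "x \<in> carrier U" "y \<in> carrier U" "\<And>i. i \<in> {()} \<Longrightarrow> \<iota> x = \<iota> y"
    thus "x = y" using Uinj by blast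
  qed (simp_all add: U hom rep Uc(1) QH TH \<iota> Delta_\<I>)
  note univ[unfolded universal_bds_representation_def, THEN conjunct2, THEN conjunct2, rule_format, OF this]
  then obtain \<phi> where \<phi>: "\<phi> \<in> star_hom A U" "\<And>X. \<phi> (P X) = code (Q X)"
    "\<And>\<alpha> B. \<alpha> \<in> L \<Longrightarrow> B \<in> \<I> \<alpha> \<Longrightarrow> \<phi> (S \<alpha> B) = code (T \<alpha> B)"
    by blast
  have "(\<lambda>x. \<iota> (\<phi> x)) \<in> star_hom A C"
    by (intro star_homI) (simp_all add: star_homD[OF \<phi>(1)] star_homD[OF hom])
  thus ?thesis by (rule bexI[rotated]) (simp add: \<phi>(2,3) QH TH \<iota>)
qed


section \<open>Existence of universal representations\<close>

text \<open>The universal representation, inside the product of all representations on C*-algebras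
  over the universe.\<close>

definition zero_cstar :: "'a cstar" where
  "zero_cstar = \<lparr>carrier = {undefined}, monoid.mult = (\<lambda>_ _. undefined), one = undefined,
     ring.zero = undefined, add = (\<lambda>_ _. undefined), smult = (\<lambda>_ _. undefined),
     adj = (\<lambda>_. undefined), cnorm = (\<lambda>_. 0)\<rparr>"

lemma zero_cstar_simps [simp]:
  "carrier zero_cstar = {undefined}" "x \<otimes>\<^bsub>zero_cstar\<^esub> y = undefined" "\<zero>\<^bsub>zero_cstar\<^esub> = undefined"
  "x \<oplus>\<^bsub>zero_cstar\<^esub> y = undefined" "c \<odot>\<^bsub>zero_cstar\<^esub> x = undefined" "adj zero_cstar x = undefined"
  "cnorm zero_cstar x = 0"
  by (simp_all add: zero_cstar_def)

lemma zero_cstar: "cstar_algebra (zero_cstar :: 'a cstar)"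
proof -
  let ?Z = "zero_cstar :: 'a cstar"
  have grp: "abelian_group ?Z" by (rule abelian_groupI) auto
  have mod: "module complex_ring ?Z"
    by (rule moduleI) (use grp cring_complex_ring in auto)
  have ms: "Metric_space (carrier ?Z) (cdist ?Z)"
    by unfold_locales (auto simp: cdist_def)
  interpret ms: Metric_space "carrier ?Z" "cdist ?Z" by (rule ms)
  have compl: "ms.mcomplete"
    unfolding ms.mcomplete_def ms.limit_metric_sequentially ms.MCauchy_def
    by (auto simp: cdist_def image_subset_iff)
  show ?thesis
    by (rule cstar_algebra.intro[OF mod], unfold_locales) (use compl in auto)
qed

context relative_generalized_bds
begin

lemma zero_representation: "bds_representation L \<theta> \<I> J (zero_cstar :: 'z cstar) (\<lambda>_. undefined) (\<lambda>_ _. undefined)"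
proof -
  interpret Z: cstar_algebra "zero_cstar :: 'z cstar" by (rule zero_cstar)
  have "(\<Oplus>\<^bsub>(zero_cstar :: 'z cstar)\<^esub>\<alpha>\<in>F. undefined) = undefined" for F :: "'l set"
    using Z.finsum_closed[of "\<lambda>_. undefined" F] by simp
  thus ?thesis
    by (intro bds_representation.intro[OF zero_cstar], unfold_locales)
      (auto simp: cstar_projection_def cstar_partial_isometry_def Z.minus_eq)
qed

lemma representation_carrier:
  assumes "bds_representation L \<theta> \<I> J A P S"
  shows "P X \<in> carrier A" "cnorm A (P X) \<le> 1"
    and "\<alpha> \<in> L \<Longrightarrow> B \<in> \<I> \<alpha> \<Longrightarrow> S \<alpha> B \<in> carrier A"
    and "\<alpha> \<in> L \<Longrightarrow> B \<in> \<I> \<alpha> \<Longrightarrow> cnorm A (S \<alpha> B) \<le> 1"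
proof -
  interpret bds_representation L \<theta> \<I> J A P S by fact
  show P: "P X \<in> carrier A" "cnorm A (P X) \<le> 1" for X
    using projection_P[of X] cnorm_projection by (auto simp: cstar_projection_def)
  assume S: "\<alpha> \<in> L" "B \<in> \<I> \<alpha>"
  show S': "S \<alpha> B \<in> carrier A"
    using partial_isometry_S[OF S] by (auto simp: cstar_partial_isometry_def)
  have "(cnorm A (S \<alpha> B))\<^sup>2 = cnorm A (P (inf B B))"
    using cnorm_adj_mult[OF S'] adj_S_S[OF S S] by simp
  hence "(cnorm A (S \<alpha> B))\<^sup>2 \<le> 1" using P(2) by simp
  thus "cnorm A (S \<alpha> B) \<le> 1" using power2_le_imp_le[of "cnorm A (S \<alpha> B)" 1] by simp
qed

end

lemma universal_bds_representation_exists: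
  fixes L :: "'l set" and \<theta> :: "'l \<Rightarrow> 'b::generalized_boolean_algebra \<Rightarrow> 'b"
  assumes sys: "relative_generalized_bds L \<theta> \<I> J"
  shows "\<exists>(A :: (('b, 'l) cstar_universe cstar \<times> ('b \<Rightarrow> ('b, 'l) cstar_universe) \<times>
      ('l \<Rightarrow> 'b \<Rightarrow> ('b, 'l) cstar_universe) \<Rightarrow> ('b, 'l) cstar_universe) cstar) P S.
    universal_bds_representation L \<theta> \<I> J A P S"
proof -
  interpret relative_generalized_bds L \<theta> \<I> J by fact
  define R :: "(('b, 'l) cstar_universe cstar \<times> ('b \<Rightarrow> ('b, 'l) cstar_universe) \<times>
      ('l \<Rightarrow> 'b \<Rightarrow> ('b, 'l) cstar_universe)) set"
    where "R = {(C, Q, T). bds_representation L \<theta> \<I> J C Q T}"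
  have rep: "bds_representation L \<theta> \<I> J (fst r) (fst (snd r)) (snd (snd r))" if "r \<in> R" for r
    using that by (auto simp: R_def)
  have C: "cstar_algebra (fst r)" if "r \<in> R" for r
    using bds_representation.axioms(1)[OF rep[OF that]] .
  have ne: "R \<noteq> {}" using zero_representation by (auto simp: R_def)
  define F where "F = {f. (\<forall>r\<in>R. f r \<in> carrier (fst r)) \<and> (\<forall>r. r \<notin> R \<longrightarrow> f r = undefined) \<and>
      bdd_above ((\<lambda>r. cnorm (fst r) (f r)) ` R)}"
  define A where "A = \<lparr>carrier = F,
      monoid.mult = (\<lambda>f g r. if r \<in> R then f r \<otimes>\<^bsub>fst r\<^esub> g r else undefined), one = undefined,
      ring.zero = (\<lambda>r. if r \<in> R then \<zero>\<^bsub>fst r\<^esub> else undefined),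
      add = (\<lambda>f g r. if r \<in> R then f r \<oplus>\<^bsub>fst r\<^esub> g r else undefined),
      smult = (\<lambda>c f r. if r \<in> R then c \<odot>\<^bsub>fst r\<^esub> f r else undefined),
      adj = (\<lambda>f r. if r \<in> R then adj (fst r) (f r) else undefined),
      cnorm = (\<lambda>f. SUP r\<in>R. cnorm (fst r) (f r))\<rparr>"
  have Ac: "carrier A = F" by (simp add: A_def)
  have Ao: "(f \<otimes>\<^bsub>A\<^esub> g) r = (if r \<in> R then f r \<otimes>\<^bsub>fst r\<^esub> g r else undefined)"
    "(f \<oplus>\<^bsub>A\<^esub> g) r = (if r \<in> R then f r \<oplus>\<^bsub>fst r\<^esub> g r else undefined)"
    "(c \<odot>\<^bsub>A\<^esub> f) r = (if r \<in> R then c \<odot>\<^bsub>fst r\<^esub> f r else undefined)"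
    "(adj A f) r = (if r \<in> R then adj (fst r) (f r) else undefined)"
    "\<zero>\<^bsub>A\<^esub> r = (if r \<in> R then \<zero>\<^bsub>fst r\<^esub> else undefined)"
    "cnorm A f = (SUP r\<in>R. cnorm (fst r) (f r))" for f g c r
    by (simp_all add: A_def)
  have FI: "f \<in> F" if "\<And>r. r \<in> R \<Longrightarrow> f r \<in> carrier (fst r)" "\<And>r. r \<notin> R \<Longrightarrow> f r = undefined"
    "\<And>r. r \<in> R \<Longrightarrow> cnorm (fst r) (f r) \<le> K" for f K
    using that unfolding F_def by (auto intro!: bdd_aboveI[of _ K])
  have FD: "f r \<in> carrier (fst r)" if "f \<in> F" "r \<in> R" for f r using that by (simp add: F_def)
  have FU: "f r = undefined" if "f \<in> F" "r \<notin> R" for f r using that unfolding F_def by blast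
  have FB: "\<exists>K\<ge>0. \<forall>r\<in>R. cnorm (fst r) (f r) \<le> K" if "f \<in> F" for f
  proof -
    have "\<exists>K. \<forall>r\<in>R. cnorm (fst r) (f r) \<le> K"
      using that unfolding F_def bdd_above_def by blast
    then obtain K where "\<And>r. r \<in> R \<Longrightarrow> cnorm (fst r) (f r) \<le> K" by blast
    thus ?thesis by (intro exI[of _ "max 0 K"]) (simp add: le_max_iff_disj)
  qed
  have cl0: "\<zero>\<^bsub>A\<^esub> \<in> F"
  proof (rule FI)
    fix r assume r: "r \<in> R"
    interpret C: cstar_algebra "fst r" by (rule C[OF r])
    show "\<zero>\<^bsub>A\<^esub> r \<in> carrier (fst r)" "cnorm (fst r) (\<zero>\<^bsub>A\<^esub> r) \<le> 0"
      using r by (simp_all add: Ao C.cnorm_zero)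
  qed (simp add: Ao)
  have cl_add: "f \<oplus>\<^bsub>A\<^esub> g \<in> F" and cl_mult: "f \<otimes>\<^bsub>A\<^esub> g \<in> F" if f: "f \<in> F" "g \<in> F" for f g
  proof -
    obtain K M where K: "\<And>r. r \<in> R \<Longrightarrow> cnorm (fst r) (f r) \<le> K" "K \<ge> 0"
      and M: "\<And>r. r \<in> R \<Longrightarrow> cnorm (fst r) (g r) \<le> M" "M \<ge> 0" using FB f by meson
    show "f \<oplus>\<^bsub>A\<^esub> g \<in> F"
    proof (rule FI)
      fix r assume r: "r \<in> R"
      interpret C: cstar_algebra "fst r" by (rule C[OF r])
      note fr = FD[OF f(1) r] FD[OF f(2) r]
      show "(f \<oplus>\<^bsub>A\<^esub> g) r \<in> carrier (fst r)" using r fr by (simp add: Ao)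
      show "cnorm (fst r) ((f \<oplus>\<^bsub>A\<^esub> g) r) \<le> K + M"
        using C.cnorm_add[OF fr] K(1)[OF r] M(1)[OF r] r by (simp add: Ao)
    qed (simp add: Ao)
    show "f \<otimes>\<^bsub>A\<^esub> g \<in> F"
    proof (rule FI)
      fix r assume r: "r \<in> R"
      interpret C: cstar_algebra "fst r" by (rule C[OF r])
      note fr = FD[OF f(1) r] FD[OF f(2) r]
      show "(f \<otimes>\<^bsub>A\<^esub> g) r \<in> carrier (fst r)" using r fr by (simp add: Ao)
      have "cnorm (fst r) (f r) * cnorm (fst r) (g r) \<le> K * M"
        using K M r fr by (intro mult_mono) (simp_all add: C.cnorm_nonneg)
      thus "cnorm (fst r) ((f \<otimes>\<^bsub>A\<^esub> g) r) \<le> K * M"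
        using C.cnorm_mult[OF fr] r by (simp add: Ao)
    qed (simp add: Ao)
  qed
  have cl_smult: "c \<odot>\<^bsub>A\<^esub> f \<in> F" and cl_adj: "adj A f \<in> F" if f: "f \<in> F" for f c
  proof -
    obtain K where K: "\<And>r. r \<in> R \<Longrightarrow> cnorm (fst r) (f r) \<le> K" "K \<ge> 0" using FB f by meson
    show "c \<odot>\<^bsub>A\<^esub> f \<in> F"
    proof (rule FI)
      fix r assume r: "r \<in> R"
      interpret C: cstar_algebra "fst r" by (rule C[OF r])
      note fr = FD[OF f r]
      show "(c \<odot>\<^bsub>A\<^esub> f) r \<in> carrier (fst r)" using r fr by (simp add: Ao)
      show "cnorm (fst r) ((c \<odot>\<^bsub>A\<^esub> f) r) \<le> cmod c * K"
        using K(1)[OF r] fr r by (simp add: Ao C.cnorm_smult mult_left_mono)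
    qed (simp add: Ao)
    show "adj A f \<in> F"
    proof (rule FI)
      fix r assume r: "r \<in> R"
      interpret C: cstar_algebra "fst r" by (rule C[OF r])
      note fr = FD[OF f r]
      show "(adj A f) r \<in> carrier (fst r)" using r fr by (simp add: Ao)
      show "cnorm (fst r) ((adj A f) r) \<le> K"
        using K(1)[OF r] fr r by (simp add: Ao C.cnorm_adj)
    qed (simp add: Ao)
  qed
  have hom: "(\<lambda>f. f r) \<in> star_hom A (fst r)" if "r \<in> R" for r
    using that by (intro star_homI) (simp_all add: Ac FD Ao)
  have inj: "f = g" if "f \<in> carrier A" "g \<in> carrier A" "\<And>r. r \<in> R \<Longrightarrow> f r = g r" for f g
  proof
    fix r show "f r = g r" using that FU[of f r] FU[of g r] by (cases "r \<in> R") (simp_all add: Ac)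
  qed
  have A: "cstar_algebra A"
  proof (rule cstar_algebra_embed[where I = R and C = fst and \<iota> = "\<lambda>r f. f r"])
    fix \<sigma> :: "nat \<Rightarrow> _"
    assume \<sigma>: "range \<sigma> \<subseteq> carrier A"
      and Cau: "\<And>e. e > 0 \<Longrightarrow>
        \<exists>N. \<forall>m\<ge>N. \<forall>n\<ge>N. \<forall>r\<in>R. cnorm (fst r) (\<sigma> m r \<ominus>\<^bsub>fst r\<^esub> \<sigma> n r) < e"
    have \<sigma>F: "\<sigma> n \<in> F" for n using \<sigma> by (auto simp: Ac)
    have "\<exists>x. cstar_algebra.cconv (fst r) (\<lambda>n. \<sigma> n r) x" if r: "r \<in> R" for r
    proof -
      interpret C: cstar_algebra "fst r" by (rule C[OF r])
      show ?thesis
      proof (rule C.complete_cconv)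
        show "range (\<lambda>n. \<sigma> n r) \<subseteq> carrier (fst r)" using FD[OF \<sigma>F r] by auto
        fix e :: real assume "e > 0"
        thus "\<exists>N. \<forall>m\<ge>N. \<forall>n\<ge>N. cnorm (fst r) (\<sigma> m r \<ominus>\<^bsub>fst r\<^esub> \<sigma> n r) < e"
          using Cau r by meson
      qed
    qed
    then obtain y where y: "\<And>r. r \<in> R \<Longrightarrow> cstar_algebra.cconv (fst r) (\<lambda>n. \<sigma> n r) (y r)" by metis
    define x where "x = (\<lambda>r. if r \<in> R then y r else undefined)"
    have conv: "cstar_algebra.cconv (fst r) (\<lambda>n. \<sigma> n r) (x r)" and xc: "x r \<in> carrier (fst r)"
      if "r \<in> R" for r
      using y[OF that] that cstar_algebra.cconv_def[OF C[OF that]] by (auto simp: x_def)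
    have lim: "\<exists>N. \<forall>n\<ge>N. \<forall>r\<in>R. cnorm (fst r) (\<sigma> n r \<ominus>\<^bsub>fst r\<^esub> x r) \<le> e" if e: "e > 0" for e
    proof -
      obtain N where N: "\<And>m n r. m \<ge> N \<Longrightarrow> n \<ge> N \<Longrightarrow> r \<in> R \<Longrightarrow>
          cnorm (fst r) (\<sigma> m r \<ominus>\<^bsub>fst r\<^esub> \<sigma> n r) < e" using Cau[OF e] by blast
      have "cnorm (fst r) (\<sigma> n r \<ominus>\<^bsub>fst r\<^esub> x r) \<le> e" if n: "n \<ge> N" and r: "r \<in> R" for n r
        by (rule cstar_algebra.cconv_le[OF C[OF r] conv[OF r] FD[OF \<sigma>F r]])
          (rule less_imp_le[OF N[OF n _ r]])
      thus ?thesis by blast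
    qed
    obtain N where N: "\<And>r. r \<in> R \<Longrightarrow> cnorm (fst r) (\<sigma> N r \<ominus>\<^bsub>fst r\<^esub> x r) \<le> 1"
      using lim[of 1] by auto
    obtain K where K: "\<And>r. r \<in> R \<Longrightarrow> cnorm (fst r) (\<sigma> N r) \<le> K" using FB[OF \<sigma>F] by meson
    have "x \<in> F"
    proof (rule FI)
      fix r assume r: "r \<in> R"
      interpret C: cstar_algebra "fst r" by (rule C[OF r])
      show "x r \<in> carrier (fst r)" using xc[OF r] .
      note c = xc[OF r] FD[OF \<sigma>F r, of N]
      have "x r = (x r \<ominus>\<^bsub>fst r\<^esub> \<sigma> N r) \<oplus>\<^bsub>fst r\<^esub> \<sigma> N r" using c by (simp add: C.diff_add_cancel)
      hence "cnorm (fst r) (x r) \<le> cnorm (fst r) (x r \<ominus>\<^bsub>fst r\<^esub> \<sigma> N r) + cnorm (fst r) (\<sigma> N r)"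
        using C.cnorm_add[of "x r \<ominus>\<^bsub>fst r\<^esub> \<sigma> N r" "\<sigma> N r"] c by simp
      thus "cnorm (fst r) (x r) \<le> 1 + K"
        using N[OF r] K[OF r] C.cnorm_commute[OF c] by simp
    qed (simp add: x_def)
    thus "\<exists>x\<in>carrier A. \<forall>e>0. \<exists>N. \<forall>n\<ge>N. \<forall>r\<in>R. cnorm (fst r) (\<sigma> n r \<ominus>\<^bsub>fst r\<^esub> x r) \<le> e"
      using lim unfolding Ac by blast
  next
    fix x assume "x \<in> carrier A"
    thus "bdd_above ((\<lambda>r. cnorm (fst r) (x r)) ` R)" by (simp add: Ac F_def)
  next
    fix f g assume "f \<in> carrier A" "g \<in> carrier A" "\<And>r. r \<in> R \<Longrightarrow> f r = g r"
    thus "f = g" by (rule inj)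
  qed (simp_all add: ne C hom Ac cl0 cl_add cl_mult cl_smult cl_adj Ao(5,6))
  interpret A: cstar_algebra A by (rule A)
  define P where "P X = (\<lambda>r. if r \<in> R then fst (snd r) X else undefined)" for X
  define S where "S \<alpha> B = (\<lambda>r. if r \<in> R then snd (snd r) \<alpha> B else undefined)" for \<alpha> B
  have PSr: "P X r = fst (snd r) X" "S \<alpha> B r = snd (snd r) \<alpha> B" if "r \<in> R" for X \<alpha> B r
    using that by (simp_all add: P_def S_def)
  have PF: "P X \<in> F" for X
    by (rule FI[where K = 1]) (simp_all add: P_def representation_carrier[OF rep])
  have SF: "S \<alpha> B \<in> F" if "\<alpha> \<in> L" "B \<in> \<I> \<alpha>" for \<alpha> B
    by (rule FI[where K = 1]) (simp_all add: S_def representation_carrier[OF rep] that)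
  have repA: "bds_representation L \<theta> \<I> J A P S"
  proof (rule bds_representation_reflect[where I = R and C = fst and \<iota> = "\<lambda>r f. f r"
        and P' = "\<lambda>r. fst (snd r)" and S' = "\<lambda>r. snd (snd r)"])
    fix f g assume "f \<in> carrier A" "g \<in> carrier A" "\<And>r. r \<in> R \<Longrightarrow> f r = g r"
    thus "f = g" by (rule inj)
  qed (simp_all add: A hom Ac PF SF rep PSr Delta_\<I>)
  define G where "G = range P \<union> {S \<alpha> B |\<alpha> B. \<alpha> \<in> L \<and> B \<in> \<I> \<alpha>}"
  define H where "H = \<Inter>{H. cstar_subalgebra H A \<and> G \<subseteq> H}"
  have GA: "G \<subseteq> carrier A" unfolding G_def Ac using PF SF by auto
  have GH: "G \<subseteq> H" unfolding H_def by blast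
  have H: "cstar_subalgebra H A"
    unfolding H_def by (rule A.subalgebra_Inter) (use A.subalgebra_carrier GA in auto)
  have repH: "bds_representation L \<theta> \<I> J (A\<lparr>carrier := H\<rparr>) P S"
    by (rule representation_subalgebra[OF repA H]) (use GH in \<open>auto simp: G_def\<close>)
  have gen: "cstar_generates (A\<lparr>carrier := H\<rparr>) G"
    unfolding cstar_generates_def
  proof (intro allI impI)
    fix K assume K: "cstar_subalgebra K (A\<lparr>carrier := H\<rparr>) \<and> G \<subseteq> K"
    interpret B: cstar_algebra "A\<lparr>carrier := H\<rparr>" by (rule A.subalgebra_cstar[OF H])
    have "H \<subseteq> K" using A.subalgebra_trans[OF H] K unfolding H_def by blast
    moreover have "K \<subseteq> H" using B.cstar_subalgebraD(1) K by fastforce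
    ultimately show "K = carrier (A\<lparr>carrier := H\<rparr>)" by simp
  qed
  have "\<exists>\<phi>\<in>star_hom (A\<lparr>carrier := H\<rparr>) C. (\<forall>X. \<phi> (P X) = Q X) \<and>
      (\<forall>\<alpha>\<in>L. \<forall>B\<in>\<I> \<alpha>. \<phi> (S \<alpha> B) = T \<alpha> B)"
    if "bds_representation L \<theta> \<I> J C Q T"
    for C :: "('b, 'l) cstar_universe cstar" and Q T
  proof (rule bexI[of _ "\<lambda>f. f (C, Q, T)"])
    have r: "(C, Q, T) \<in> R" using that by (simp add: R_def)
    have "H \<subseteq> carrier A" using A.cstar_subalgebraD(1)[OF H] .
    thus "(\<lambda>f. f (C, Q, T)) \<in> star_hom (A\<lparr>carrier := H\<rparr>) C"
      using star_homD[OF hom[OF r]] by (intro star_homI) (auto simp: subset_iff)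
    show "(\<forall>X. P X (C, Q, T) = Q X) \<and> (\<forall>\<alpha>\<in>L. \<forall>B\<in>\<I> \<alpha>. S \<alpha> B (C, Q, T) = T \<alpha> B)"
      using r by (simp add: P_def S_def)
  qed
  hence "universal_bds_representation L \<theta> \<I> J (A\<lparr>carrier := H\<rparr>) P S"
    unfolding universal_bds_representation_def using repH gen unfolding G_def by blast
  thus ?thesis by blast
qed

end

theory Submission
  imports Defs
begin

text \<open>
  Let \<open>\<phi>\<close> be the canonical homomorphism from the algebra \<open>A\<close> of the system with ideals \<open>\<I> \<alpha>\<close> to the
  algebra \<open>D\<close> of the system with the full ideals. It is isometric because the representation in \<open>A\<close>
  dilates: where \<open>A\<close> has an isometry defined only on the limit \<open>p\<^sub>\<alpha>\<close> of the projections \<open>P B\<close>, \<open>B \<in> \<I> \<alpha>\<close>,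
  one sends the complement of \<open>p\<^sub>\<alpha>\<close> identically to a fresh coordinate. The limit \<open>p\<^sub>\<alpha>\<close> need not
  exist in \<open>A\<close>; it does exist in a reduced product of matrix algebras over \<open>A\<close>, and so \<open>\<phi>\<close> followed
  by a homomorphism on \<open>D\<close> is an isometric embedding of \<open>A\<close>.

  The image \<open>H\<close> of \<open>\<phi>\<close> satisfies \<open>H D H \<subseteq> H\<close>, because the generators of \<open>D\<close> leave invariant the
  space of all \<open>x\<close> with \<open>Q X x \<in> H\<close> and \<open>(T \<alpha> B)\<^sup>* x \<in> H\<close>. Hence \<open>H\<close> is hereditary, and it is full
  because \<open>T \<alpha> B = T \<alpha> B Q B\<close>.

  Positivity rests on an elementary route to square roots and to the theorem that \<open>y\<^sup>* y\<close> is a square: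
  norm estimates for power series and for unitaries replace the spectral theory.
\<close>

section \<open>Noncommutative polynomial identities\<close>

text \<open>Injectivity of \<open>\<phi>\<close> cannot be read off the universal property of
  \<open>A\<close>, which yields only maps out of \<open>A\<close>; a representation of the larger
  system has to be built from the smaller one. For \<open>B\<close> outside
  \<open>\<I> \<alpha>\<close> the missing isometry must have initial projection \<open>P B\<close>,
  of which \<open>S\<close> supplies only the part below the ideal. The rest must be annihilated
  from the left by every \<open>P X\<close>: it is disjoint from all
  \<open>\<theta> \<alpha> X\<close>, as these belong to \<open>\<I> \<alpha>\<close>, and
  \<open>P X\<close> has to pass the isometry as \<open>P (\<theta> \<alpha> X)\<close>. Hence a
  coordinate on which every \<open>P X\<close> is zero, one for each label so that distinct labels
  keep orthogonal ranges. The relations over \<open>J\<close> survive because they involve only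
  \<open>\<theta> \<alpha> X\<close>, where nothing changes. Weak limits of the \<open>P B\<close>
  would call for Hilbert spaces or biduals. In a reduced product each relation needs only finitely
  many ideal elements and holds exactly from some finite set on. Square roots or positivity enter
  three times: in the Cauchy-Schwarz inequality for columns over \<open>A\<close>, in the
  contractivity of homomorphisms, and in approximate units in \<open>H\<close>.\<close>

datatype nc_expr =
    NC_Var nat
  | NC_Zero
  | NC_One
  | NC_Add nc_expr nc_expr
  | NC_Mult nc_expr nc_expr
  | NC_Smult complex nc_expr
  | NC_Uminus nc_expr
  | NC_Minus nc_expr nc_expr

primrec nc_nf :: "nc_expr \<Rightarrow> (complex \<times> nat list) list" where
  "nc_nf (NC_Var i) = [(1, [i])]"
| "nc_nf NC_Zero = []"
| "nc_nf NC_One = [(1, [])]"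
| "nc_nf (NC_Add s t) = nc_nf s @ nc_nf t"
| "nc_nf (NC_Mult s t) =
     concat (map (\<lambda>(c, v). map (\<lambda>(d, w). (c * d, v @ w)) (nc_nf t)) (nc_nf s))"
| "nc_nf (NC_Smult c t) = map (\<lambda>(d, w). (c * d, w)) (nc_nf t)"
| "nc_nf (NC_Uminus t) = map (\<lambda>(d, w). (- 1 * d, w)) (nc_nf t)"
| "nc_nf (NC_Minus s t) = nc_nf s @ map (\<lambda>(d, w). (- 1 * d, w)) (nc_nf t)"

text \<open>Words are compared up to a normalisation \<open>\<kappa>\<close>: the identity for arbitrary atoms, sorting for
  atoms that commute.\<close>

primrec nc_coeff :: "(nat list \<Rightarrow> nat list) \<Rightarrow> (complex \<times> nat list) list \<Rightarrow> nat list \<Rightarrow> complex" where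
  "nc_coeff \<kappa> [] w = 0"
| "nc_coeff \<kappa> (p # ps) w = (if \<kappa> (snd p) = w then fst p + nc_coeff \<kappa> ps w else nc_coeff \<kappa> ps w)"

context cstar_algebra
begin

lemma mult_zero [simp]: "x \<in> carrier A \<Longrightarrow> x \<otimes> \<zero> = \<zero>"
  using smult_mult_right[of x \<zero> 0] smult_l_null[of \<zero>] smult_l_null[of "x \<otimes> \<zero>"] by simp

lemma zero_mult [simp]: "x \<in> carrier A \<Longrightarrow> \<zero> \<otimes> x = \<zero>"
  using smult_mult_left[of \<zero> x 0] smult_l_null[of \<zero>] smult_l_null[of "\<zero> \<otimes> x"] by simp

end

locale unital_cstar_algebra = cstar_algebra +
  assumes one_in [simp, intro]: "\<one> \<in> carrier A"
    and one_mult [simp]: "x \<in> carrier A \<Longrightarrow> \<one> \<otimes> x = x"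
    and mult_one [simp]: "x \<in> carrier A \<Longrightarrow> x \<otimes> \<one> = x"
begin

text \<open>An index beyond the list denotes zero, so every expression has a value in the carrier,
  whatever variables it mentions.\<close>

primrec nc_eval :: "'a list \<Rightarrow> nc_expr \<Rightarrow> 'a" where
  "nc_eval xs (NC_Var i) = (if i < length xs then xs ! i else \<zero>)"
| "nc_eval xs NC_Zero = \<zero>"
| "nc_eval xs NC_One = \<one>"
| "nc_eval xs (NC_Add s t) = nc_eval xs s \<oplus> nc_eval xs t"
| "nc_eval xs (NC_Mult s t) = nc_eval xs s \<otimes> nc_eval xs t"
| "nc_eval xs (NC_Smult c t) = c \<odot> nc_eval xs t"
| "nc_eval xs (NC_Uminus t) = \<ominus> nc_eval xs t"
| "nc_eval xs (NC_Minus s t) = nc_eval xs s \<ominus> nc_eval xs t"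

primrec nc_word :: "'a list \<Rightarrow> nat list \<Rightarrow> 'a" where
  "nc_word xs [] = \<one>"
| "nc_word xs (i # w) = (if i < length xs then xs ! i else \<zero>) \<otimes> nc_word xs w"

primrec nc_poly :: "'a list \<Rightarrow> (complex \<times> nat list) list \<Rightarrow> 'a" where
  "nc_poly xs [] = \<zero>"
| "nc_poly xs (p # ps) = fst p \<odot> nc_word xs (snd p) \<oplus> nc_poly xs ps"

context
  fixes xs assumes xs: "set xs \<subseteq> carrier A"
begin

lemma nc_atom: "(if i < length xs then xs ! i else \<zero>) \<in> carrier A"
  using xs by auto

lemma nc_word_in [simp]: "nc_word xs w \<in> carrier A"
  by (induction w) (auto simp: nc_atom intro: mult_closed)

lemma nc_poly_in [simp]: "nc_poly xs p \<in> carrier A"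
  by (induction p) auto

lemma nc_word_append: "nc_word xs (v @ w) = nc_word xs v \<otimes> nc_word xs w"
proof (induction v)
  case (Cons i v)
  show ?case
    using Cons mult_assoc[OF nc_atom nc_word_in nc_word_in, of i v w] by simp
qed simp

lemma nc_poly_append: "nc_poly xs (p @ q) = nc_poly xs p \<oplus> nc_poly xs q"
  by (induction p) (auto simp: a_assoc)

lemma nc_poly_smult: "nc_poly xs (map (\<lambda>(d, w). (c * d, w)) p) = c \<odot> nc_poly xs p"
proof (induction p)
  case (Cons a p)
  show ?case using Cons smult_assoc1[of c "fst a" "nc_word xs (snd a)"]
    by (cases a) (simp add: smult_r_distr)
qed (simp add: smult_r_null)

lemma nc_poly_word_mult:
  "nc_poly xs (map (\<lambda>(d, w). (c * d, v @ w)) p) = (c \<odot> nc_word xs v) \<otimes> nc_poly xs p"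
proof (induction p)
  case (Cons a p)
  show ?case using Cons smult_assoc1[of c "fst a" "nc_word xs (v @ snd a)"]
      smult_assoc1[of "fst a" c "nc_word xs (v @ snd a)"]
    by (cases a) (simp add: mult_distr_right smult_mult_left smult_mult_right nc_word_append
        smult_r_distr mult.commute[of c])
qed (simp add: smult_r_null)

lemma nc_poly_mult:
  "nc_poly xs (concat (map (\<lambda>(c, v). map (\<lambda>(d, w). (c * d, v @ w)) q) p)) =
     nc_poly xs p \<otimes> nc_poly xs q"
proof (induction p)
  case (Cons a p)
  show ?case using Cons
    by (cases a) (simp add: nc_poly_append nc_poly_word_mult mult_distr_left)
qed simp

lemma nc_eval_nf: "nc_eval xs t = nc_poly xs (nc_nf t)"
proof (induction t)
  case (NC_Var i)
  show ?case using nc_atom[of i] smult_one[OF nc_atom[of i]] by (simp split del: if_split)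
next
  case NC_One
  show ?case using smult_one[of \<one>] by simp
next
  case (NC_Uminus t)
  show ?case unfolding nc_nf.simps nc_eval.simps nc_poly_smult NC_Uminus by (simp add: minus_eq_smult)
next
  case (NC_Minus s t)
  show ?case unfolding nc_nf.simps nc_eval.simps nc_poly_append nc_poly_smult NC_Minus by (simp add: minus_eq)
qed (simp_all add: nc_poly_append nc_poly_smult nc_poly_mult)

text \<open>Terms are collected by normalised word. \<open>W\<close> is only required to contain
  these words, so that two polynomials can be compared over one common index set.\<close>

lemma nc_poly_coeff:
  assumes \<kappa>: "\<And>w. nc_word xs (\<kappa> w) = nc_word xs w"
    and W: "finite W" "\<kappa> ` snd ` set p \<subseteq> W"
  shows "nc_poly xs p = (\<Oplus>w\<in>W. nc_coeff \<kappa> p w \<odot> nc_word xs w)"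
  using W(2)
proof (induction p)
  case Nil
  have "(\<Oplus>w\<in>W. nc_coeff \<kappa> [] w \<odot> nc_word xs w) = (\<Oplus>w\<in>W. \<zero>)"
    using smult_l_null[OF nc_word_in] by (intro finsum_cong') auto
  thus ?case by simp
next
  case (Cons a p)
  let ?u = "\<kappa> (snd a)"
  have uW: "?u \<in> W" using Cons.prems by simp
  have "(\<Oplus>w\<in>W. nc_coeff \<kappa> (a # p) w \<odot> nc_word xs w) =
      (\<Oplus>w\<in>W. (if ?u = w then fst a \<odot> nc_word xs w else \<zero>) \<oplus> nc_coeff \<kappa> p w \<odot> nc_word xs w)"
    using smult_l_distr[of "fst a" _ "nc_word xs _"] by (intro finsum_cong') auto
  also have "\<dots> = (\<Oplus>w\<in>W. (if ?u = w then fst a \<odot> nc_word xs w else \<zero>)) \<oplus>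
      (\<Oplus>w\<in>W. nc_coeff \<kappa> p w \<odot> nc_word xs w)"
    by (rule finsum_addf) auto
  also have "(\<Oplus>w\<in>W. (if ?u = w then fst a \<odot> nc_word xs w else \<zero>)) = fst a \<odot> nc_word xs ?u"
    using finsum_singleton[OF uW W(1), of "\<lambda>w. fst a \<odot> nc_word xs w"] by simp
  finally show ?case using Cons by (simp add: \<kappa>)
qed

lemma nc_poly_eqI:
  assumes \<kappa>: "\<And>w. nc_word xs (\<kappa> w) = nc_word xs w"
    and eq: "\<forall>w\<in>\<kappa> ` snd ` set (p @ q). nc_coeff \<kappa> p w = nc_coeff \<kappa> q w"
  shows "nc_poly xs p = nc_poly xs q"
proof -
  let ?W = "\<kappa> ` snd ` set (p @ q)"
  have "nc_poly xs p = (\<Oplus>w\<in>?W. nc_coeff \<kappa> p w \<odot> nc_word xs w)"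
    by (rule nc_poly_coeff[OF \<kappa>]) auto
  also have "\<dots> = (\<Oplus>w\<in>?W. nc_coeff \<kappa> q w \<odot> nc_word xs w)"
    using eq by (intro finsum_cong' refl) (blast intro: smult_in nc_word_in, metis)
  also have "\<dots> = nc_poly xs q"
    by (rule nc_poly_coeff[OF \<kappa>, symmetric]) auto
  finally show ?thesis .
qed

lemma nc_word_insort:
  assumes comm: "\<And>x y. x \<in> set xs \<Longrightarrow> y \<in> set xs \<Longrightarrow> x \<otimes> y = y \<otimes> x"
  shows "nc_word xs (insort i w) = nc_word xs (i # w)"
proof (induction w)
  case (Cons j w)
  let ?a = "\<lambda>i. if i < length xs then xs ! i else \<zero>"
  have ac: "?a i \<in> carrier A" for i using nc_atom .
  have "?a i \<otimes> ?a j = ?a j \<otimes> ?a i" 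
  proof (cases "i < length xs \<and> j < length xs")
    case True
    thus ?thesis using comm[of "xs ! i" "xs ! j"] by simp
  next
    case False
    thus ?thesis using ac[of i] ac[of j] by (auto split: if_splits)
  qed
  hence "?a i \<otimes> (?a j \<otimes> nc_word xs w) = ?a j \<otimes> (?a i \<otimes> nc_word xs w)"
    using mult_assoc[OF ac ac nc_word_in, of i j w] mult_assoc[OF ac ac nc_word_in, of j i w] by simp
  thus ?case using Cons by (cases "i \<le> j") (simp_all split del: if_split)
qed simp

lemma nc_word_sort:
  assumes "\<And>x y. x \<in> set xs \<Longrightarrow> y \<in> set xs \<Longrightarrow> x \<otimes> y = y \<otimes> x"
  shows "nc_word xs (sort w) = nc_word xs w"
  by (induction w) (simp_all add: nc_word_insort[OF assms])

end

text \<open>Equality by reflection: the rules \<open>nc_reify\<close> compute \<open>s\<close> and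
  \<open>t\<close> from the two sides, and the comparison of finitely many coefficients is left to
  evaluation. Anything listed in \<open>xs\<close> counts as an atom, so an element and its adjoint
  are independent variables.\<close>

lemma nc_eqI:
  assumes "x = nc_eval xs s" "y = nc_eval xs t" "set xs \<subseteq> carrier A"
    and "\<forall>w\<in>snd ` set (nc_nf s @ nc_nf t). nc_coeff id (nc_nf s) w = nc_coeff id (nc_nf t) w"
  shows "x = y"
  using nc_poly_eqI[OF assms(3), of id "nc_nf s" "nc_nf t"] assms nc_eval_nf[OF assms(3)] by simp

text \<open>Words in commuting atoms are sorted before their coefficients are compared; commutation
  has to be supplied for all pairs from \<open>xs\<close>.\<close>

lemma nc_comm_eqI:
  assumes "x = nc_eval xs s" "y = nc_eval xs t" "set xs \<subseteq> carrier A"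
    and "\<forall>x\<in>set xs. \<forall>y\<in>set xs. x \<otimes> y = y \<otimes> x"
    and "\<forall>w\<in>sort ` snd ` set (nc_nf s @ nc_nf t). nc_coeff sort (nc_nf s) w = nc_coeff sort (nc_nf t) w"
  shows "x = y"
  using nc_poly_eqI[OF assms(3), of sort "nc_nf s" "nc_nf t"] nc_word_sort[OF assms(3)]
    assms nc_eval_nf[OF assms(3)] by simp

lemma nc_reify_ops:
  "x = nc_eval xs s \<Longrightarrow> y = nc_eval xs t \<Longrightarrow> x \<oplus> y = nc_eval xs (NC_Add s t)"
  "x = nc_eval xs s \<Longrightarrow> y = nc_eval xs t \<Longrightarrow> x \<otimes> y = nc_eval xs (NC_Mult s t)"
  "x = nc_eval xs s \<Longrightarrow> c \<odot> x = nc_eval xs (NC_Smult c s)"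
  "x = nc_eval xs s \<Longrightarrow> \<ominus> x = nc_eval xs (NC_Uminus s)"
  "x = nc_eval xs s \<Longrightarrow> y = nc_eval xs t \<Longrightarrow> x \<ominus> y = nc_eval xs (NC_Minus s t)"
  "\<zero> = nc_eval xs NC_Zero" "\<one> = nc_eval xs NC_One"
  by simp_all

lemma nc_reify_atoms:
  "x0 = nc_eval (x0 # xs) (NC_Var 0)"
  "x1 = nc_eval (x0 # x1 # xs) (NC_Var 1)"
  "x2 = nc_eval (x0 # x1 # x2 # xs) (NC_Var 2)"
  "x3 = nc_eval (x0 # x1 # x2 # x3 # xs) (NC_Var 3)"
  "x4 = nc_eval (x0 # x1 # x2 # x3 # x4 # xs) (NC_Var 4)"
  by (simp_all add: numeral_eq_Suc)

lemmas nc_reify = nc_reify_ops nc_reify_atoms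

end

section \<open>Square roots and positivity\<close>

text \<open>The square root iteration for the scalar \<open>1\<close>. Its fixed point
  \<open>1\<close> is a double root, so convergence is not geometric and is obtained from
  monotonicity and boundedness.\<close>

primrec sqrt_majorant :: "nat \<Rightarrow> real" where
  "sqrt_majorant 0 = 0"
| "sqrt_majorant (Suc n) = (1 + (sqrt_majorant n)\<^sup>2) / 2"

lemma sqrt_majorant_bounds: "0 \<le> sqrt_majorant n" "sqrt_majorant n \<le> 1"
proof -
  have "0 \<le> sqrt_majorant n \<and> sqrt_majorant n \<le> 1"
    by (induction n) (auto simp: power_le_one)
  thus "0 \<le> sqrt_majorant n" "sqrt_majorant n \<le> 1" by auto
qed

lemma sqrt_majorant_mono: "sqrt_majorant n \<le> sqrt_majorant (Suc n)"
  using zero_le_power2[of "sqrt_majorant n - 1"] by (simp add: power2_eq_square algebra_simps)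

lemma sqrt_majorant_Cauchy: "Cauchy sqrt_majorant"
proof -
  have "incseq sqrt_majorant" by (rule incseq_SucI) (rule sqrt_majorant_mono)
  moreover have "Bseq sqrt_majorant"
    using sqrt_majorant_bounds by (intro BseqI'[of _ 1]) auto
  ultimately show ?thesis
    using Bseq_monoseq_convergent[of sqrt_majorant] convergent_Cauchy by (auto simp: monoseq_iff)
qed

section \<open>The square root iteration in an algebra that may lack a unit\<close>

context cstar_algebra
begin

lemma cconv_in: "cconv \<sigma> x \<Longrightarrow> \<sigma> n \<in> carrier A" "cconv \<sigma> x \<Longrightarrow> x \<in> carrier A"
  by (auto simp: cconv_def)

lemma cconv_Suc: "cconv \<sigma> x \<Longrightarrow> cconv (\<lambda>n. \<sigma> (Suc n)) x"
  unfolding cconv_def by (auto intro: LIMSEQ_Suc)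

lemma diff_self: "x \<in> carrier A \<Longrightarrow> x \<ominus> x = \<zero>"
  by (simp add: diff_eq_0)

text \<open>With a formal unit, \<open>1 - d\<close> is the square root of \<open>1 - e\<close>. The iteration
  \<open>d \<mapsto> (e + d\<^sup>2) / 2\<close> is majorised by the same iteration for the real number \<open>1\<close>, which makes it
  converge even when the norm of \<open>e\<close> is \<open>1\<close>.\<close>

lemma sqrt_iteration:
  assumes e: "e \<in> carrier A" "adj A e = e" "cnorm A e \<le> 1"
  obtains d where "d \<in> carrier A" "adj A d = d" "cnorm A d \<le> 1"
    "complex_of_real 2 \<odot> d = e \<oplus> d \<otimes> d"
    "\<And>z. z \<in> carrier A \<Longrightarrow> z \<otimes> e = e \<otimes> z \<Longrightarrow> z \<otimes> d = d \<otimes> z"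
proof -
  define D where "D = rec_nat \<zero> (\<lambda>_ d. complex_of_real (1/2) \<odot> (e \<oplus> d \<otimes> d))"
  have D0: "D 0 = \<zero>" and DS: "D (Suc n) = complex_of_real (1/2) \<odot> (e \<oplus> D n \<otimes> D n)" for n
    by (simp_all add: D_def)
  have Dc [simp]: "D n \<in> carrier A" for n
    by (induction n) (simp_all add: D0 DS e)
  have Dn: "cnorm A (D n) \<le> sqrt_majorant n" for n
  proof (induction n)
    case (Suc n)
    have "cnorm A (e \<oplus> D n \<otimes> D n) \<le> cnorm A e + cnorm A (D n) * cnorm A (D n)"
      using cnorm_add[of e "D n \<otimes> D n"] cnorm_mult[of "D n" "D n"] e by simp
    also have "\<dots> \<le> 1 + (sqrt_majorant n)\<^sup>2"
      unfolding power2_eq_square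
      using e Suc by (intro add_mono mult_mono) (auto simp: cnorm_nonneg sqrt_majorant_bounds)
    finally show ?case using e by (simp add: DS cnorm_smult norm_divide)
  qed (simp add: D0 cnorm_zero)
  \<comment> \<open>\<open>a\<^sup>2 - b\<^sup>2 = a (a - b) + (a - b) b\<close> holds without
    commutativity, and the increments of the majorant satisfy the matching recursion with
    equality.\<close>
  have step: "cnorm A (D (Suc n) \<ominus> D n) \<le> sqrt_majorant (Suc n) - sqrt_majorant n" for n
  proof (induction n)
    case 0
    have "cnorm A (D (Suc 0) \<ominus> D 0) = cnorm A (complex_of_real (1/2) \<odot> e)"
      using e by (simp add: D0 DS minus_eq smult_r_null)
    thus ?case using e by (simp add: cnorm_smult norm_divide)
  next
    case (Suc n)
    let ?a = "D (Suc n)" and ?b = "D n"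
    have "?a \<otimes> (?a \<ominus> ?b) \<oplus> (?a \<ominus> ?b) \<otimes> ?b =
        (?a \<otimes> ?a \<ominus> ?a \<otimes> ?b) \<oplus> (?a \<otimes> ?b \<ominus> ?b \<otimes> ?b)"
      by (simp add: mult_diff_left mult_diff_right)
    also have "\<dots> = ?a \<otimes> ?a \<ominus> ?b \<otimes> ?b"
      by (rule diff_split[symmetric]) simp_all
    finally have eq: "?a \<otimes> ?a \<ominus> ?b \<otimes> ?b = ?a \<otimes> (?a \<ominus> ?b) \<oplus> (?a \<ominus> ?b) \<otimes> ?b" ..
    have "(e \<oplus> ?a \<otimes> ?a) \<ominus> (e \<oplus> ?b \<otimes> ?b) = (e \<ominus> e) \<oplus> (?a \<otimes> ?a \<ominus> ?b \<otimes> ?b)"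
      using e by (simp add: a_minus_def minus_add a_ac)
    also have "\<dots> = ?a \<otimes> ?a \<ominus> ?b \<otimes> ?b" using e by (simp add: diff_self)
    finally have "D (Suc (Suc n)) \<ominus> D (Suc n) = complex_of_real (1/2) \<odot> (?a \<otimes> ?a \<ominus> ?b \<otimes> ?b)"
      using e by (simp add: DS[of "Suc n"] DS[of n] smult_diff[symmetric] del: of_real_divide)
    hence "2 * cnorm A (D (Suc (Suc n)) \<ominus> D (Suc n)) = cnorm A (?a \<otimes> ?a \<ominus> ?b \<otimes> ?b)"
      by (simp add: cnorm_smult norm_divide)
    also have "\<dots> \<le> cnorm A (?a \<otimes> (?a \<ominus> ?b)) + cnorm A ((?a \<ominus> ?b) \<otimes> ?b)"
      unfolding eq by (rule cnorm_add) simp_all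
    also have "\<dots> \<le> cnorm A ?a * cnorm A (?a \<ominus> ?b) + cnorm A (?a \<ominus> ?b) * cnorm A ?b"
      by (intro add_mono cnorm_mult) simp_all
    also have "\<dots> \<le> sqrt_majorant (Suc n) * (sqrt_majorant (Suc n) - sqrt_majorant n) +
        (sqrt_majorant (Suc n) - sqrt_majorant n) * sqrt_majorant n"
      using Suc Dn sqrt_majorant_mono[of n]
      by (intro add_mono mult_mono) (auto simp: cnorm_nonneg sqrt_majorant_bounds simp del: sqrt_majorant.simps)
    also have "\<dots> = 2 * (sqrt_majorant (Suc (Suc n)) - sqrt_majorant (Suc n))"
      by (simp add: power2_eq_square field_simps)
    finally show ?case by (rule mult_left_le_imp_le) simp
  qed
  have dist: "cnorm A (D (n + k) \<ominus> D n) \<le> sqrt_majorant (n + k) - sqrt_majorant n" for n k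
  proof (induction k)
    case 0
    show ?case by (simp add: diff_self cnorm_zero)
  next
    case (Suc k)
    show ?case using cnorm_triangle[of "D (n + Suc k)" "D (n + k)" "D n"] Suc step[of "n + k"]
      by (simp del: sqrt_majorant.simps)
  qed
  have "\<exists>d. cconv D d"
  proof (rule complete_cconv)
    fix \<epsilon> :: real assume "\<epsilon> > 0"
    then obtain N where N: "\<And>m n. m \<ge> N \<Longrightarrow> n \<ge> N \<Longrightarrow> \<bar>sqrt_majorant m - sqrt_majorant n\<bar> < \<epsilon>"
      using sqrt_majorant_Cauchy unfolding Cauchy_def dist_real_def by blast
    have "cnorm A (D m \<ominus> D n) < \<epsilon>" if "m \<ge> N" "n \<ge> N" for m n
    proof (cases "m \<ge> n")
      case True
      then show ?thesis using dist[of n "m - n"] N[OF that] by simp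
    next
      case False
      then show ?thesis using dist[of m "n - m"] N[OF that(2,1)] cnorm_commute[of "D m" "D n"] by simp
    qed
    thus "\<exists>N. \<forall>m\<ge>N. \<forall>n\<ge>N. cnorm A (D m \<ominus> D n) < \<epsilon>" by blast
  qed auto
  then obtain d where d: "cconv D d" ..
  note dc = cconv_in(2)[OF d]
  have adjD: "adj A (D n) = D n" for n
  proof (induction n)
    case (Suc n)
    have "adj A (complex_of_real (1/2) \<odot> (e \<oplus> D n \<otimes> D n)) =
        cnj (complex_of_real (1/2)) \<odot> (adj A e \<oplus> adj A (D n) \<otimes> adj A (D n))"
      using e(1) by (simp only: adj_smult adj_add adj_mult add.m_closed Dc mult_closed)
    thus ?case unfolding DS Suc e(2) complex_cnj_complex_of_real .
  qed (simp add: D0 adj_zero)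
  show ?thesis
  proof (rule that[OF dc])
    show "adj A d = d"
      by (rule cconv_unique[OF _ d]) (use cconv_adj[OF d] in \<open>simp only: adjD\<close>)
    have "cnorm A (\<zero> \<ominus> d) \<le> 1"
    proof (rule cconv_le[OF d zero_closed])
      fix m show "cnorm A (\<zero> \<ominus> D m) \<le> 1"
        using Dn[of m] sqrt_majorant_bounds(2)[of m] by (simp add: a_minus_def cnorm_uminus)
    qed
    thus "cnorm A d \<le> 1" using dc by (simp add: a_minus_def cnorm_uminus)
    have "cconv (\<lambda>n. D (Suc n)) (complex_of_real (1/2) \<odot> (e \<oplus> d \<otimes> d))"
      unfolding DS using e by (intro cconv_smult cconv_add cconv_const cconv_mult d)
    hence "d = complex_of_real (1/2) \<odot> (e \<oplus> d \<otimes> d)"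
      using cconv_Suc[OF d] cconv_unique by blast
    hence "complex_of_real 2 \<odot> d = complex_of_real 2 \<odot> (complex_of_real (1/2) \<odot> (e \<oplus> d \<otimes> d))"
      by simp
    also have "\<dots> = (complex_of_real 2 * complex_of_real (1/2)) \<odot> (e \<oplus> d \<otimes> d)"
      using smult_assoc1[of "complex_of_real 2" "complex_of_real (1/2)" "e \<oplus> d \<otimes> d"] e dc by simp
    finally show "complex_of_real 2 \<odot> d = e \<oplus> d \<otimes> d"
      using smult_one[of "e \<oplus> d \<otimes> d"] e dc by simp
    fix z assume z: "z \<in> carrier A" "z \<otimes> e = e \<otimes> z"
    \<comment> \<open>Each iterate is a polynomial in \<open>e\<close>, so it commutes with whatever
      commutes with \<open>e\<close>; this passes to the limit.\<close>
    have comm: "z \<otimes> D n = D n \<otimes> z" for n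
    proof (induction n)
      case (Suc n)
      have "z \<otimes> (D n \<otimes> D n) = (D n \<otimes> D n) \<otimes> z"
        using z Suc mult_assoc[of z "D n" "D n"] mult_assoc[of "D n" z "D n"] mult_assoc[of "D n" "D n" z]
        by simp
      thus ?case using z e
        by (simp add: DS smult_mult_left smult_mult_right mult_distr_left mult_distr_right)
    qed (use z in \<open>simp add: D0\<close>)
    show "z \<otimes> d = d \<otimes> z"
      using cconv_mult[OF cconv_const[OF z(1)] d] cconv_mult[OF d cconv_const[OF z(1)]]
      unfolding comm by (rule cconv_unique)
  qed
qed

end

text \<open>Exponential growth beats linear growth. Bernoulli's inequality alone gives a linear
  lower bound, so it is squared: \<open>r ^ (2 ^ Suc n)\<close> is the square of
  \<open>r ^ (2 ^ n)\<close> and therefore grows at least quadratically in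
  \<open>2 ^ n\<close>.\<close>

lemma power_exp_bound:
  fixes r C :: real
  assumes "\<And>n. r ^ (2 ^ n) \<le> 1 + C * 2 ^ n"
  shows "r \<le> 1"
proof (rule ccontr)
  assume "\<not> r \<le> 1"
  hence r: "r > 1" by simp
  have bound: "(r - 1)\<^sup>2 * 2 ^ n \<le> 1 + 2 * \<bar>C\<bar>" for n :: nat
  proof -
    let ?M = "2 ^ n :: nat"
    have b: "0 \<le> real ?M * (r - 1)" using r by simp
    have "1 + real ?M * (r - 1) \<le> r ^ ?M" using Bernoulli_inequality[of "r - 1" ?M] r by simp
    hence "real ?M * (r - 1) \<le> r ^ ?M" by simp
    hence "(real ?M * (r - 1))\<^sup>2 \<le> (r ^ ?M)\<^sup>2" using b by (rule power_mono)
    also have "(r ^ ?M)\<^sup>2 = r ^ (2 ^ Suc n)" by (simp add: power_mult[symmetric] mult.commute)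
    also have "\<dots> \<le> 1 + C * 2 ^ Suc n" by (rule assms)
    also have "\<dots> \<le> 1 + 2 * \<bar>C\<bar> * 2 ^ n" by (simp add: mult_right_mono)
    also have "\<dots> \<le> (1 + 2 * \<bar>C\<bar>) * 2 ^ n" by (simp add: algebra_simps)
    finally have "((r - 1)\<^sup>2 * 2 ^ n) * 2 ^ n \<le> (1 + 2 * \<bar>C\<bar>) * 2 ^ n"
      by (simp add: power2_eq_square algebra_simps)
    thus ?thesis by (rule mult_right_le_imp_le) simp
  qed
  obtain n :: nat where "(1 + 2 * \<bar>C\<bar>) / (r - 1)\<^sup>2 < 2 ^ n"
    using real_arch_pow[of 2] by auto
  hence "1 + 2 * \<bar>C\<bar> < (r - 1)\<^sup>2 * 2 ^ n" using r by (subst (asm) pos_divide_less_eq) (simp_all add: mult.commute)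
  with bound[of n] show False by linarith
qed

context cstar_algebra
begin

lemma self_adjoint_square_zero:
  "x \<in> carrier A \<Longrightarrow> adj A x = x \<Longrightarrow> x \<otimes> x = \<zero> \<Longrightarrow> x = \<zero>"
  using cnorm_adj_mult[of x] by (simp add: cnorm_zero cnorm_eq_0)

lemma adj_mult_zero: "x \<in> carrier A \<Longrightarrow> adj A x \<otimes> x = \<zero> \<Longrightarrow> x = \<zero>"
  using cnorm_adj_mult[of x] by (simp add: cnorm_zero cnorm_eq_0)

lemma cnorm_self_adjoint_square: "x \<in> carrier A \<Longrightarrow> adj A x = x \<Longrightarrow> cnorm A (x \<otimes> x) = (cnorm A x)\<^sup>2"
  using cnorm_adj_mult[of x] by simp

lemma adj_uminus: "x \<in> carrier A \<Longrightarrow> adj A (\<ominus> x) = \<ominus> adj A x"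
  by (simp add: minus_eq_smult adj_smult)

lemmas adj_simps = adj_add adj_smult adj_mult adj_adj adj_diff adj_uminus adj_zero

lemma diff_zero [simp]: "x \<in> carrier A \<Longrightarrow> x \<ominus> \<zero> = x"
  by (simp add: minus_eq smult_r_null)

lemma smult_one' [simp]: "x \<in> carrier A \<Longrightarrow> 1 \<odot> x = x"
  using smult_one[of x] by simp

lemma smult_smult: "x \<in> carrier A \<Longrightarrow> c \<odot> (d \<odot> x) = (c * d) \<odot> x"
  using smult_assoc1[of c d x] by simp

end

section \<open>Norm bounds from unitaries, and the cone of positive elements\<close>

context unital_cstar_algebra
begin

lemma adj_one [simp]: "adj A \<one> = \<one>"
  using adj_mult[of "adj A \<one>" \<one>] adj_adj[of \<one>] by simp

lemma cnorm_one: "cnorm A \<one> \<le> 1"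
  by (rule cnorm_projection) (simp add: cstar_projection_def)

lemma cnorm_smult_one: "cnorm A (c \<odot> \<one>) \<le> cmod c"
  using mult_left_mono[OF cnorm_one, of "cmod c"] by (simp add: cnorm_smult)

text \<open>The element \<open>h + \<i> c\<close> is a multiple of a unitary.\<close>

lemma unitary_bound:
  assumes h: "h \<in> carrier A" "adj A h = h" and c: "c \<in> carrier A" "adj A c = c"
    and comm: "c \<otimes> h = h \<otimes> c"
    and eq: "h \<otimes> h \<oplus> c \<otimes> c = complex_of_real \<delta> \<odot> \<one>" and \<delta>: "\<delta> \<ge> 0"
  shows "(cnorm A h)\<^sup>2 \<le> \<delta>"
proof -
  let ?u = "h \<oplus> \<i> \<odot> c"
  have u: "?u \<in> carrier A" using h c by simp
  have adju: "adj A ?u = h \<oplus> (-\<i>) \<odot> c" using h c by (simp add: adj_simps)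
  have "adj A ?u \<otimes> ?u = h \<otimes> h \<oplus> c \<otimes> c"
    unfolding adju
    by (rule nc_comm_eqI[where xs = "[h, c]"], (rule nc_reify)+) (use h c comm in simp_all)
  hence "(cnorm A ?u)\<^sup>2 = cnorm A (complex_of_real \<delta> \<odot> \<one>)"
    using cnorm_adj_mult[OF u] eq by simp
  also have "\<dots> \<le> \<delta>" using cnorm_smult_one[of "complex_of_real \<delta>"] \<delta> by simp
  finally have un: "(cnorm A ?u)\<^sup>2 \<le> \<delta>" .
  have "h = complex_of_real (1/2) \<odot> (?u \<oplus> adj A ?u)"
    unfolding adju
    by (rule nc_eqI[where xs = "[h, c]"], (rule nc_reify)+) (use h c in simp_all)
  hence "cnorm A h = cnorm A (complex_of_real (1/2) \<odot> (?u \<oplus> adj A ?u))" by simp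
  also have "\<dots> = 1/2 * cnorm A (?u \<oplus> adj A ?u)"
    by (subst cnorm_smult) (use u adj_closed[OF u] in \<open>auto simp: norm_divide\<close>)
  also have "\<dots> \<le> 1/2 * (cnorm A ?u + cnorm A (adj A ?u))"
    using cnorm_add[OF u adj_closed[OF u]] by simp
  also have "\<dots> = cnorm A ?u" using cnorm_adj[OF u] by simp
  finally have "(cnorm A h)\<^sup>2 \<le> (cnorm A ?u)\<^sup>2" using h by (intro power_mono) (auto simp: cnorm_nonneg)
  thus ?thesis using un by simp
qed

text \<open>The root is \<open>\<one> \<ominus> d\<close> with \<open>d\<close> from
  \<open>sqrt_iteration\<close>, because \<open>2 d = e + d\<^sup>2\<close>. The bound on
  \<open>\<one> \<ominus> c\<close> later makes the root positive in the sense of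
  \<open>pos\<close>.\<close>

lemma sqrt_one_minus:
  assumes e: "e \<in> carrier A" "adj A e = e" "cnorm A e \<le> 1"
  obtains c where "c \<in> carrier A" "adj A c = c" "cnorm A (\<one> \<ominus> c) \<le> 1" "c \<otimes> c = \<one> \<ominus> e"
    "\<And>z. z \<in> carrier A \<Longrightarrow> z \<otimes> e = e \<otimes> z \<Longrightarrow> z \<otimes> c = c \<otimes> z"
proof -
  obtain d where d: "d \<in> carrier A" "adj A d = d" "cnorm A d \<le> 1"
    "complex_of_real 2 \<odot> d = e \<oplus> d \<otimes> d"
    "\<And>z. z \<in> carrier A \<Longrightarrow> z \<otimes> e = e \<otimes> z \<Longrightarrow> z \<otimes> d = d \<otimes> z"
    by (rule sqrt_iteration[OF e], rule that)
  show ?thesis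
  proof (rule that[of "\<one> \<ominus> d"])
    have "\<one> \<ominus> (\<one> \<ominus> d) = d"
      by (rule nc_eqI[where xs = "[d]"], (rule nc_reify)+) (use d(1) in simp_all)
    thus "cnorm A (\<one> \<ominus> (\<one> \<ominus> d)) \<le> 1" using d(3) by simp
    have "(\<one> \<ominus> d) \<otimes> (\<one> \<ominus> d) = (\<one> \<ominus> e) \<oplus> ((e \<oplus> d \<otimes> d) \<ominus> complex_of_real 2 \<odot> d)"
      by (rule nc_eqI[where xs = "[d, e]"], (rule nc_reify)+) (use d(1) e in simp_all)
    also have "(e \<oplus> d \<otimes> d) \<ominus> complex_of_real 2 \<odot> d = \<zero>"
      unfolding d(4) using d(1) e by (intro diff_self) simp
    finally show "(\<one> \<ominus> d) \<otimes> (\<one> \<ominus> d) = \<one> \<ominus> e" using e by simp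
    show "z \<otimes> (\<one> \<ominus> d) = (\<one> \<ominus> d) \<otimes> z" if "z \<in> carrier A" "z \<otimes> e = e \<otimes> z" for z
      using d(1) d(5)[OF that] that(1) by (simp add: mult_diff_left mult_diff_right)
  qed (use d(1,2) in \<open>auto simp: adj_simps\<close>)
qed

text \<open>With \<open>c\<close> a square root of \<open>1 - h\<^sup>2\<close> commuting with
  \<open>h\<close>, the sum \<open>c\<^sup>2 + h\<^sup>2\<close> is \<open>1\<close>;
  \<open>unitary_bound\<close>, with \<open>c\<close> in the place of \<open>h\<close>, bounds
  \<open>c\<close> and hence its square.\<close>

lemma norm_one_minus_square:
  assumes h: "h \<in> carrier A" "adj A h = h" "cnorm A h \<le> 1"
  shows "cnorm A (\<one> \<ominus> h \<otimes> h) \<le> 1"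
proof -
  have hh: "h \<otimes> h \<in> carrier A" "adj A (h \<otimes> h) = h \<otimes> h" "cnorm A (h \<otimes> h) \<le> 1"
    using h by (simp_all add: cnorm_self_adjoint_square power_le_one cnorm_nonneg adj_mult)
  obtain c where c: "c \<in> carrier A" "adj A c = c" "c \<otimes> c = \<one> \<ominus> h \<otimes> h"
    "\<And>z. z \<in> carrier A \<Longrightarrow> z \<otimes> (h \<otimes> h) = (h \<otimes> h) \<otimes> z \<Longrightarrow> z \<otimes> c = c \<otimes> z"
    by (rule sqrt_one_minus[OF hh], rule that)
  have "(cnorm A c)\<^sup>2 \<le> 1"
  proof (rule unitary_bound[OF c(1,2) h(1,2)])
    show "h \<otimes> c = c \<otimes> h" by (rule c(4)) (use h in \<open>auto simp: mult_assoc\<close>)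
    have "(\<one> \<ominus> h \<otimes> h) \<oplus> h \<otimes> h = complex_of_real 1 \<odot> \<one>" using h by (simp add: diff_add_cancel)
    thus "c \<otimes> c \<oplus> h \<otimes> h = complex_of_real 1 \<odot> \<one>" by (simp only: c(3))
  qed simp
  thus ?thesis using cnorm_self_adjoint_square[OF c(1,2)] by (simp only: c(3))
qed

text \<open>Positivity without spectra: for self-adjoint \<open>a\<close> the inequality says that
  the spectrum lies in \<open>[0, 2 t]\<close>. Sums are then handled by the triangle inequality,
  and \<open>1 - a / t\<close> is a legitimate input of \<open>sqrt_one_minus\<close>.\<close>

definition pos :: "'a \<Rightarrow> bool" where
  "pos a \<longleftrightarrow> a \<in> carrier A \<and> adj A a = a \<and> (\<exists>t>0. cnorm A (complex_of_real t \<odot> \<one> \<ominus> a) \<le> t)"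

lemma posD: "pos a \<Longrightarrow> a \<in> carrier A" "pos a \<Longrightarrow> adj A a = a"
  by (auto simp: pos_def)

text \<open>By definition \<open>a = t (1 - e)\<close> with \<open>e\<close> of norm at most one;
  the root is \<open>sqrt t\<close> times the root of \<open>1 - e\<close>. The commutation clause
  is what allows two such roots to be paired in \<open>unitary_bound\<close>.\<close>

lemma pos_sqrt:
  assumes "pos a"
  obtains q where "q \<in> carrier A" "adj A q = q" "pos q" "q \<otimes> q = a"
    "\<And>z. z \<in> carrier A \<Longrightarrow> z \<otimes> a = a \<otimes> z \<Longrightarrow> z \<otimes> q = q \<otimes> z"
proof -
  obtain t where t: "t > 0" "cnorm A (complex_of_real t \<odot> \<one> \<ominus> a) \<le> t"
    and a: "a \<in> carrier A" "adj A a = a" using assms by (auto simp: pos_def)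
  define e where "e = complex_of_real (1/t) \<odot> (complex_of_real t \<odot> \<one> \<ominus> a)"
  have e: "e \<in> carrier A" "adj A e = e" using a by (auto simp: e_def adj_simps)
  have en: "cnorm A e \<le> 1" using t a by (simp add: e_def cnorm_smult norm_divide)
  obtain c where c: "c \<in> carrier A" "adj A c = c" "cnorm A (\<one> \<ominus> c) \<le> 1" "c \<otimes> c = \<one> \<ominus> e"
    "\<And>z. z \<in> carrier A \<Longrightarrow> z \<otimes> e = e \<otimes> z \<Longrightarrow> z \<otimes> c = c \<otimes> z"
    by (rule sqrt_one_minus[OF e en], rule that)
  let ?s = "complex_of_real (sqrt t)"
  have ss: "?s * ?s = complex_of_real t" using t by (simp flip: of_real_mult)
  have q: "?s \<odot> c \<in> carrier A" "adj A (?s \<odot> c) = ?s \<odot> c" using c(1,2) by (auto simp: adj_simps)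
  have "?s \<odot> \<one> \<ominus> ?s \<odot> c = ?s \<odot> (\<one> \<ominus> c)" using c(1) by (simp add: smult_diff)
  hence "cnorm A (?s \<odot> \<one> \<ominus> ?s \<odot> c) \<le> sqrt t"
    using c(1,3) t mult_left_mono[of "cnorm A (\<one> \<ominus> c)" 1 "sqrt t"] by (simp add: cnorm_smult)
  moreover have "sqrt t > 0" using t by simp
  ultimately have "pos (?s \<odot> c)" unfolding pos_def using q by blast
  moreover have "(?s \<odot> c) \<otimes> (?s \<odot> c) = a"
  proof -
    have "(?s \<odot> c) \<otimes> (?s \<odot> c) = complex_of_real t \<odot> (c \<otimes> c)"
      using c(1) by (simp add: smult_mult_left smult_mult_right smult_smult ss del: of_real_eq_iff)
    also have "\<dots> = complex_of_real t \<odot> (\<one> \<ominus> e)" by (simp only: c(4))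
    also have "\<dots> = a" unfolding e_def
      by (rule nc_eqI[where xs = "[a]"], (rule nc_reify)+) (use a t in simp_all)
    finally show ?thesis .
  qed
  moreover have "z \<otimes> (?s \<odot> c) = (?s \<odot> c) \<otimes> z" if z: "z \<in> carrier A" "z \<otimes> a = a \<otimes> z" for z
  proof -
    have "z \<otimes> e = e \<otimes> z"
      using z a by (simp add: e_def smult_mult_left smult_mult_right mult_diff_left mult_diff_right)
    thus ?thesis using c(1) c(5)[OF z(1)] z by (simp add: smult_mult_left smult_mult_right)
  qed
  ultimately show ?thesis using that[OF q] by blast
qed

lemma pos_zero: "pos \<zero>"
proof -
  have "cnorm A (complex_of_real 1 \<odot> \<one> \<ominus> \<zero>) \<le> 1"
    using cnorm_one by simp
  thus ?thesis unfolding pos_def by (auto simp: adj_zero intro!: exI[of _ 1])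
qed

lemma pos_smult:
  assumes "pos a" "c \<ge> 0" shows "pos (complex_of_real c \<odot> a)"
proof (cases "c = 0")
  case True
  thus ?thesis using pos_zero posD[OF assms(1)] smult_l_null[of a] by simp
next
  case False
  obtain t where t: "t > 0" "cnorm A (complex_of_real t \<odot> \<one> \<ominus> a) \<le> t"
    and a: "a \<in> carrier A" "adj A a = a" using assms by (auto simp: pos_def)
  have "complex_of_real (c * t) \<odot> \<one> \<ominus> complex_of_real c \<odot> a = complex_of_real c \<odot> (complex_of_real t \<odot> \<one> \<ominus> a)"
    using a by (simp add: smult_diff smult_smult)
  hence "cnorm A (complex_of_real (c * t) \<odot> \<one> \<ominus> complex_of_real c \<odot> a) \<le> c * t"
    using t a assms(2) by (simp add: cnorm_smult mult_left_mono)
  moreover have "c * t > 0" using t False assms(2) by simp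
  ultimately show ?thesis unfolding pos_def using a by (auto simp: adj_simps)
qed

lemma pos_add:
  assumes "pos a" "pos b" shows "pos (a \<oplus> b)"
proof -
  obtain t where t: "t > 0" "cnorm A (complex_of_real t \<odot> \<one> \<ominus> a) \<le> t"
    and a: "a \<in> carrier A" "adj A a = a" using assms by (auto simp: pos_def)
  obtain s where s: "s > 0" "cnorm A (complex_of_real s \<odot> \<one> \<ominus> b) \<le> s"
    and b: "b \<in> carrier A" "adj A b = b" using assms by (auto simp: pos_def)
  have "complex_of_real (t + s) \<odot> \<one> \<ominus> (a \<oplus> b) =
      (complex_of_real t \<odot> \<one> \<ominus> a) \<oplus> (complex_of_real s \<odot> \<one> \<ominus> b)"
    by (rule nc_eqI[where xs = "[a, b]"], (rule nc_reify)+) (use a b in simp_all)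
  hence "cnorm A (complex_of_real (t + s) \<odot> \<one> \<ominus> (a \<oplus> b)) \<le> t + s"
    using cnorm_add[of "complex_of_real t \<odot> \<one> \<ominus> a" "complex_of_real s \<odot> \<one> \<ominus> b"] t s a b by simp
  moreover have "t + s > 0" using t s by simp
  ultimately show ?thesis unfolding pos_def using a b by (auto simp: adj_simps)
qed

lemma pos_square:
  assumes q: "q \<in> carrier A" "adj A q = q" shows "pos (q \<otimes> q)"
proof -
  \<comment> \<open>The added \<open>1\<close> keeps \<open>t\<close> positive when \<open>q\<close>
    is zero.\<close>
  define t where "t = cnorm A q + 1"
  have t: "t > 0" "cnorm A q \<le> t" using cnorm_nonneg[OF q(1)] by (auto simp: t_def)
  let ?h = "complex_of_real (1/t) \<odot> q"
  have h: "?h \<in> carrier A" "adj A ?h = ?h" using q by (auto simp: adj_simps)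
  have "cnorm A ?h \<le> 1" using q t by (simp add: cnorm_smult norm_divide)
  hence n: "cnorm A (\<one> \<ominus> ?h \<otimes> ?h) \<le> 1" by (rule norm_one_minus_square[OF h])
  have "complex_of_real (t\<^sup>2) \<odot> \<one> \<ominus> q \<otimes> q = complex_of_real (t\<^sup>2) \<odot> (\<one> \<ominus> ?h \<otimes> ?h)"
    by (rule nc_eqI[where xs = "[q]"], (rule nc_reify)+)
      (use q t in \<open>simp_all add: power2_eq_square\<close>)
  hence "cnorm A (complex_of_real (t\<^sup>2) \<odot> \<one> \<ominus> q \<otimes> q) \<le> t\<^sup>2"
    using n h q t mult_left_mono[OF n, of "t\<^sup>2"] by (simp add: cnorm_smult norm_power)
  moreover have "t\<^sup>2 > 0" using t by simp
  ultimately have "\<exists>t>0. cnorm A (complex_of_real t \<odot> \<one> \<ominus> q \<otimes> q) \<le> t" by blast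
  thus ?thesis unfolding pos_def using q by (simp add: adj_mult)
qed

text \<open>Roots \<open>q\<close> of \<open>a\<close> and \<open>r\<close> of \<open>-a\<close>
  commute and satisfy \<open>q\<^sup>2 + r\<^sup>2 = 0\<close>, so \<open>unitary_bound\<close> with
  bound \<open>0\<close> kills \<open>q\<close>.\<close>

lemma pos_uminus_zero:
  assumes "pos a" "pos (\<ominus> a)" shows "a = \<zero>"
proof -
  note a = posD[OF assms(1)]
  obtain q where q: "q \<in> carrier A" "adj A q = q" "q \<otimes> q = a"
    "\<And>z. z \<in> carrier A \<Longrightarrow> z \<otimes> a = a \<otimes> z \<Longrightarrow> z \<otimes> q = q \<otimes> z"
    by (rule pos_sqrt[OF assms(1)], rule that)
  obtain r where r: "r \<in> carrier A" "adj A r = r" "r \<otimes> r = \<ominus> a"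
    "\<And>z. z \<in> carrier A \<Longrightarrow> z \<otimes> (\<ominus> a) = (\<ominus> a) \<otimes> z \<Longrightarrow> z \<otimes> r = r \<otimes> z"
    by (rule pos_sqrt[OF assms(2)], rule that)
  have ra: "r \<otimes> a = a \<otimes> r"
  proof -
    have "a = \<ominus> (r \<otimes> r)" using r(3) a by simp
    thus ?thesis using r(1)
      by (simp add: minus_eq_smult smult_mult_left smult_mult_right mult_assoc)
  qed
  have "(cnorm A q)\<^sup>2 \<le> 0"
  proof (rule unitary_bound[OF q(1,2) r(1,2)])
    show "r \<otimes> q = q \<otimes> r" using q(4)[OF r(1) ra] .
    show "q \<otimes> q \<oplus> r \<otimes> r = complex_of_real 0 \<odot> \<one>"
      using q(3) r(3) a smult_l_null[of \<one>] by (simp add: r_neg)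
  qed simp
  hence "cnorm A q = 0" by simp
  hence "q = \<zero>" using cnorm_eq_0[OF q(1)] by simp
  thus ?thesis using q(3) by simp
qed

text \<open>The spectra of \<open>t\<^sup>* t\<close> and \<open>t t\<^sup>*\<close> agree up to zero; this is seen here through the growth of
  \<open>(1 + t t\<^sup>*)\<^bsup>N\<^esup> = 1 + t (\<Sum>k<N. (1 + t\<^sup>* t)\<^bsup>k\<^esup>) t\<^sup>*\<close> for \<open>N\<close> a power of two.\<close>

lemma norm_one_plus_flip:
  assumes t: "t \<in> carrier A" and n: "cnorm A (\<one> \<oplus> adj A t \<otimes> t) \<le> 1"
  shows "cnorm A (\<one> \<oplus> t \<otimes> adj A t) \<le> 1"
proof -
  let ?s = "adj A t"
  define g where "g = rec_nat \<one> (\<lambda>_ g. g \<oplus> g \<otimes> (\<one> \<oplus> (?s \<otimes> t) \<otimes> g))"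
  have g0: "g 0 = \<one>" and gS: "g (Suc n) = g n \<oplus> g n \<otimes> (\<one> \<oplus> (?s \<otimes> t) \<otimes> g n)" for n
    by (simp_all add: g_def)
  have gc [simp]: "g n \<in> carrier A" for n by (induction n) (use t in \<open>simp_all add: g0 gS\<close>)
  define v where "v n = \<one> \<oplus> (?s \<otimes> t) \<otimes> g n" for n
  define w where "w n = \<one> \<oplus> t \<otimes> (g n \<otimes> ?s)" for n
  have vc [simp]: "v n \<in> carrier A" and wc [simp]: "w n \<in> carrier A" for n
    using t by (simp_all add: v_def w_def)
  have vS: "v (Suc n) = v n \<otimes> v n" for n
    unfolding v_def gS
    by (rule nc_eqI[where xs = "[t, ?s, g n]"], (rule nc_reify)+) (use t in simp_all)
  have wS: "w (Suc n) = w n \<otimes> w n" for n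
    unfolding w_def gS
    by (rule nc_eqI[where xs = "[t, ?s, g n]"], (rule nc_reify)+) (use t in simp_all)
  have vn: "cnorm A (v n) \<le> 1" for n
  proof (induction n)
    case 0
    then show ?case using n t by (simp add: v_def g0)
  next
    case (Suc n)
    have "cnorm A (v (Suc n)) \<le> cnorm A (v n) * cnorm A (v n)" unfolding vS by (rule cnorm_mult) simp_all
    also have "\<dots> \<le> 1" using Suc by (simp add: mult_le_one cnorm_nonneg)
    finally show ?case .
  qed
  have gn: "cnorm A (g n) \<le> 2 ^ n" for n
  proof (induction n)
    case 0
    then show ?case using cnorm_one by (simp add: g0)
  next
    case (Suc n)
    have "cnorm A (g (Suc n)) \<le> cnorm A (g n) + cnorm A (g n) * cnorm A (v n)"
      unfolding gS v_def[symmetric]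
      using cnorm_add[of "g n" "g n \<otimes> v n"] cnorm_mult[of "g n" "v n"] by simp
    also have "\<dots> \<le> cnorm A (g n) + cnorm A (g n) * 1"
      by (intro add_left_mono mult_left_mono vn cnorm_nonneg gc)
    finally show ?case using Suc by simp
  qed
  have wadj: "adj A (w n) = w n" for n
  proof (induction n)
    case 0
    then show ?case using t by (simp add: w_def g0 adj_simps)
  next
    case (Suc n)
    then show ?case by (simp add: wS adj_mult)
  qed
  have wn: "cnorm A (w n) = cnorm A (w 0) ^ (2 ^ n)" for n
  proof (induction n)
    case (Suc n)
    have "cnorm A (w (Suc n)) = (cnorm A (w n))\<^sup>2"
      unfolding wS by (rule cnorm_self_adjoint_square) (simp_all add: wadj)
    thus ?case using Suc by (simp add: power_mult[symmetric] mult.commute)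
  qed simp
  have "cnorm A (w 0) ^ (2 ^ n) \<le> 1 + (cnorm A t)\<^sup>2 * 2 ^ n" for n
  proof -
    have "cnorm A (t \<otimes> (g n \<otimes> ?s)) \<le> cnorm A t * (cnorm A (g n) * cnorm A ?s)"
      using cnorm_mult[of t "g n \<otimes> ?s"] cnorm_mult[of "g n" ?s] t
      by (meson cnorm_nonneg gc adj_closed mult_closed mult_left_mono order_trans)
    also have "\<dots> = (cnorm A t)\<^sup>2 * cnorm A (g n)" using t by (simp add: cnorm_adj power2_eq_square)
    also have "\<dots> \<le> (cnorm A t)\<^sup>2 * 2 ^ n" by (rule mult_left_mono[OF gn]) simp
    finally have "cnorm A (w n) \<le> 1 + (cnorm A t)\<^sup>2 * 2 ^ n"
      unfolding w_def using cnorm_add[of \<one> "t \<otimes> (g n \<otimes> ?s)"] cnorm_one t by simp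
    thus ?thesis using wn[of n] by simp
  qed
  hence "cnorm A (w 0) \<le> 1" by (rule power_exp_bound)
  thus ?thesis using t by (simp add: w_def g0)
qed

text \<open>Dividing \<open>t\<close> by \<open>sqrt s\<close> turns the witness of positivity into
  the hypothesis of \<open>norm_one_plus_flip\<close>; the conclusion is scaled back.\<close>

lemma pos_uminus_flip:
  assumes t: "t \<in> carrier A" and p: "pos (\<ominus> (adj A t \<otimes> t))"
  shows "pos (\<ominus> (t \<otimes> adj A t))"
proof -
  obtain s where s: "s > 0" "cnorm A (complex_of_real s \<odot> \<one> \<ominus> \<ominus> (adj A t \<otimes> t)) \<le> s"
    using p by (auto simp: pos_def)
  define c where "c = complex_of_real (1 / sqrt s)"
  have cc: "cnj c = c" "c * c = complex_of_real (1/s)" "cmod c = 1 / sqrt s"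
    using s by (simp_all add: c_def norm_divide flip: of_real_mult)
  let ?u = "c \<odot> t"
  have u: "?u \<in> carrier A" "adj A ?u = c \<odot> adj A t" using t by (simp_all add: adj_simps cc)
  have eq: "\<one> \<oplus> (c \<odot> x) \<otimes> (c \<odot> y) = complex_of_real (1/s) \<odot> (complex_of_real s \<odot> \<one> \<ominus> \<ominus> (x \<otimes> y))"
    if "x \<in> carrier A" "y \<in> carrier A" for x y
  proof -
    have "(c \<odot> x) \<otimes> (c \<odot> y) = complex_of_real (1/s) \<odot> (x \<otimes> y)"
      using that cc(2) by (simp add: smult_mult_left smult_mult_right smult_smult)
    thus ?thesis
      using that s by (simp add: minus_eq smult_r_distr smult_smult minus_eq_smult)
  qed
  have "cnorm A (\<one> \<oplus> adj A ?u \<otimes> ?u) \<le> 1"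
    unfolding u(2) eq[OF adj_closed[OF t] t]
    using s t by (subst cnorm_smult) (simp_all add: norm_divide)
  hence "cnorm A (\<one> \<oplus> ?u \<otimes> adj A ?u) \<le> 1" by (rule norm_one_plus_flip[OF u(1)])
  hence "cnorm A (complex_of_real (1/s) \<odot> (complex_of_real s \<odot> \<one> \<ominus> \<ominus> (t \<otimes> adj A t))) \<le> 1"
    by (simp only: u(2) eq[OF t adj_closed[OF t]])
  hence "cnorm A (complex_of_real s \<odot> \<one> \<ominus> \<ominus> (t \<otimes> adj A t)) \<le> s"
    using s t by (subst (asm) cnorm_smult) (simp_all add: norm_divide field_simps)
  thus ?thesis unfolding pos_def using s t by (auto simp: adj_simps)
qed

text \<open>For \<open>t = h + \<i> k\<close> with self-adjoint \<open>h\<close> and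
  \<open>k\<close>, the sum of \<open>t\<^sup>* t\<close> and \<open>t t\<^sup>*\<close> is
  \<open>2 h\<^sup>2 + 2 k\<^sup>2\<close>. Both products are negative by the flip, so
  \<open>-h\<^sup>2\<close> is a sum of positive elements, which forces \<open>h = 0\<close>; the
  same argument applies to \<open>k\<close>.\<close>

lemma adj_mult_neg_square_zero:
  assumes t: "t \<in> carrier A" and p: "pos (\<ominus> (adj A t \<otimes> t))"
  shows "t = \<zero>"
proof -
  let ?s = "adj A t"
  define h where "h = complex_of_real (1/2) \<odot> (t \<oplus> ?s)"
  define k where "k = (- \<i> / 2) \<odot> (t \<ominus> ?s)"
  have h: "h \<in> carrier A" "adj A h = h" using t by (auto simp: h_def adj_simps a_comm)
  have k: "k \<in> carrier A" using t by (auto simp: k_def)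
  have "adj A k = (\<i> / 2) \<odot> (?s \<ominus> t)" using t by (simp add: k_def adj_simps)
  also have "\<dots> = k" unfolding k_def
    by (rule nc_eqI[where xs = "[t, ?s]"], (rule nc_reify)+) (use t in simp_all)
  finally have k': "adj A k = k" .
  have p2: "pos (\<ominus> (?s \<otimes> t) \<oplus> \<ominus> (t \<otimes> ?s))" by (rule pos_add[OF p pos_uminus_flip[OF t p]])
  have zero: "x = \<zero>" if x: "x \<in> carrier A" "adj A x = x" and y: "y \<in> carrier A" "adj A y = y"
    and eq: "\<ominus> (x \<otimes> x) = y \<otimes> y \<oplus> complex_of_real (1/2) \<odot> (\<ominus> (?s \<otimes> t) \<oplus> \<ominus> (t \<otimes> ?s))" for x y
  proof -
    have "pos (\<ominus> (x \<otimes> x))" unfolding eq by (intro pos_add pos_square y pos_smult p2) simp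
    hence "x \<otimes> x = \<zero>" using pos_uminus_zero pos_square[OF x] by blast
    thus ?thesis by (rule self_adjoint_square_zero[OF x])
  qed
  have "h = \<zero>"
  proof (rule zero[OF h k k'])
    show "\<ominus> (h \<otimes> h) = k \<otimes> k \<oplus> complex_of_real (1/2) \<odot> (\<ominus> (?s \<otimes> t) \<oplus> \<ominus> (t \<otimes> ?s))"
      unfolding h_def k_def
      by (rule nc_eqI[where xs = "[t, ?s]"], (rule nc_reify)+) (use t in simp_all)
  qed
  moreover have "k = \<zero>"
  proof (rule zero[OF k k' h])
    show "\<ominus> (k \<otimes> k) = h \<otimes> h \<oplus> complex_of_real (1/2) \<odot> (\<ominus> (?s \<otimes> t) \<oplus> \<ominus> (t \<otimes> ?s))"
      unfolding h_def k_def
      by (rule nc_eqI[where xs = "[t, ?s]"], (rule nc_reify)+) (use t in simp_all)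
  qed
  moreover have "t = h \<oplus> \<i> \<odot> k"
    unfolding h_def k_def
    by (rule nc_eqI[where xs = "[t, ?s]"], (rule nc_reify)+) (use t in simp_all)
  ultimately show ?thesis by (simp add: smult_r_null)
qed

text \<open>With \<open>c\<close> the absolute value of \<open>a = y\<^sup>* y\<close> and \<open>m = c - a\<close> twice its negative part, the element
  \<open>(y m)\<^sup>* (y m) = - c m\<^sup>2\<close> is negative, hence zero.\<close>

theorem pos_adj_mult:
  assumes y: "y \<in> carrier A" shows "pos (adj A y \<otimes> y)"
proof -
  define a where "a = adj A y \<otimes> y"
  have a: "a \<in> carrier A" "adj A a = a" using y by (auto simp: a_def adj_simps)
  obtain c where c: "c \<in> carrier A" "adj A c = c" "pos c" "c \<otimes> c = a \<otimes> a"
    "\<And>z. z \<in> carrier A \<Longrightarrow> z \<otimes> (a \<otimes> a) = (a \<otimes> a) \<otimes> z \<Longrightarrow> z \<otimes> c = c \<otimes> z"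
    by (rule pos_sqrt[OF pos_square[OF a]], rule that)
  have ac: "a \<otimes> c = c \<otimes> a" by (rule c(5)) (use a in \<open>auto simp: mult_assoc\<close>)
  obtain q where q: "q \<in> carrier A" "adj A q = q" "q \<otimes> q = c"
    "\<And>z. z \<in> carrier A \<Longrightarrow> z \<otimes> c = c \<otimes> z \<Longrightarrow> z \<otimes> q = q \<otimes> z"
    by (rule pos_sqrt[OF c(3)], rule that)
  have aq: "a \<otimes> q = q \<otimes> a" using q(4)[OF a(1) ac] .
  have cq: "c \<otimes> q = q \<otimes> c" by (rule q(4)[OF c(1) refl])
  define m where "m = c \<ominus> a"
  have m: "m \<in> carrier A" "adj A m = m" using a c(1,2) by (auto simp: m_def adj_simps)
  have qm: "m \<otimes> q = q \<otimes> m" using a(1) c(1) q(1) aq cq by (simp add: m_def mult_diff_left mult_diff_right)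
  let ?t = "y \<otimes> m" and ?g = "q \<otimes> m"
  have z: "c \<otimes> c \<ominus> a \<otimes> a = \<zero>" using c(1,4) a diff_self by simp
  have g: "?g \<in> carrier A" "adj A ?g = ?g" using q(1,2) m qm by (auto simp: adj_simps)
  have "adj A ?t \<otimes> ?t = m \<otimes> (a \<otimes> m)" using y m by (simp add: adj_simps a_def mult_assoc)
  \<comment> \<open>All elements commute, and
    \<open>a m\<^sup>2 = (c\<^sup>2 - a\<^sup>2) m - c m\<^sup>2\<close>; writing \<open>c\<close>
    as \<open>q\<^sup>2\<close> exhibits the last term as the square of the self-adjoint
    \<open>q m\<close>.\<close>
  also have "\<dots> = (c \<otimes> c \<ominus> a \<otimes> a) \<otimes> (c \<ominus> a) \<ominus> ?g \<otimes> ?g"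
    unfolding m_def q(3)[symmetric]
    by (rule nc_comm_eqI[where xs = "[a, q]"], (rule nc_reify)+) (use a(1) q(1) aq in simp_all)
  also have "\<dots> = \<ominus> (?g \<otimes> ?g)" unfolding z using a(1) c(1) g(1) by (simp add: a_minus_def)
  finally have "\<ominus> (adj A ?t \<otimes> ?t) = ?g \<otimes> ?g" using g by simp
  hence t0: "?t = \<zero>" using adj_mult_neg_square_zero[of ?t] pos_square[OF g] y m by simp
  have am: "a \<otimes> m = \<zero>"
    using t0 y m by (simp add: a_def mult_assoc)
  \<comment> \<open>\<open>(c - a)\<^sup>2 = (c\<^sup>2 - a\<^sup>2) - 2 a (c - a)\<close>, and both
    terms vanish.\<close>
  have "m \<otimes> m = (c \<otimes> c \<ominus> a \<otimes> a) \<oplus> (-2) \<odot> (a \<otimes> m)"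
    unfolding m_def by (rule nc_comm_eqI[where xs = "[a, c]"], (rule nc_reify)+) (use a(1) c(1) ac in simp_all)
  hence "m \<otimes> m = \<zero>" by (simp add: z am smult_r_null)
  hence "m = \<zero>" by (rule self_adjoint_square_zero[OF m])
  hence "c = a" using diff_eq_0 a(1) c(1) by (simp add: m_def)
  thus ?thesis using c(3) by (simp add: a_def)
qed

lemma pos_norm_minus:
  assumes a: "a \<in> carrier A" "adj A a = a" and s: "cnorm A a \<le> s"
  shows "pos (complex_of_real s \<odot> \<one> \<ominus> a)"
proof -
  have s0: "s \<ge> 0" using cnorm_nonneg[OF a(1)] s by simp
  \<comment> \<open>The witness is \<open>s + 1\<close> rather than \<open>s\<close>: it is positive
    even for \<open>s = 0\<close>, and the difference that remains is
    \<open>\<one> \<oplus> a\<close>, of norm at most \<open>1 + s\<close>.\<close>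
  have eq: "complex_of_real (s + 1) \<odot> \<one> \<ominus> (complex_of_real s \<odot> \<one> \<ominus> a) = \<one> \<oplus> a"
    by (rule nc_eqI[where xs = "[a]"], (rule nc_reify)+) (use a in simp_all)
  have "cnorm A (complex_of_real (s + 1) \<odot> \<one> \<ominus> (complex_of_real s \<odot> \<one> \<ominus> a)) \<le> s + 1"
    unfolding eq using cnorm_add[OF one_in a(1)] cnorm_one s by simp
  thus ?thesis unfolding pos_def using a s0
    by (intro conjI exI[of _ "s + 1"]) (auto simp: adj_simps)
qed

text \<open>The roots \<open>q\<close> of \<open>a\<close> and \<open>r\<close> of
  \<open>s - a\<close> commute and \<open>q\<^sup>2 + r\<^sup>2 = s\<close>, so
  \<open>unitary_bound\<close> applies to \<open>q\<close>.\<close>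

lemma pos_bound:
  assumes "pos a" "pos (complex_of_real s \<odot> \<one> \<ominus> a)" "s \<ge> 0"
  shows "cnorm A a \<le> s"
proof -
  note a = posD[OF assms(1)]
  obtain q where q: "q \<in> carrier A" "adj A q = q" "q \<otimes> q = a"
    by (rule pos_sqrt[OF assms(1)], rule that)
  let ?b = "complex_of_real s \<odot> \<one> \<ominus> a"
  obtain r where r: "r \<in> carrier A" "adj A r = r" "r \<otimes> r = ?b"
    "\<And>z. z \<in> carrier A \<Longrightarrow> z \<otimes> ?b = ?b \<otimes> z \<Longrightarrow> z \<otimes> r = r \<otimes> z"
    by (rule pos_sqrt[OF assms(2)], rule that)
  have "(cnorm A q)\<^sup>2 \<le> s"
  proof (rule unitary_bound[OF q(1,2) r(1,2) _ _ assms(3)])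
    have "q \<otimes> ?b = ?b \<otimes> q"
      unfolding q(3)[symmetric]
      by (rule nc_eqI[where xs = "[q]"], (rule nc_reify)+) (use q in simp_all)
    thus "r \<otimes> q = q \<otimes> r" using r(4)[OF q(1)] by simp
    show "q \<otimes> q \<oplus> r \<otimes> r = complex_of_real s \<odot> \<one>"
      unfolding q(3) r(3) by (rule nc_eqI[where xs = "[a]"], (rule nc_reify)+) (use a in simp_all)
  qed
  thus ?thesis using cnorm_self_adjoint_square[OF q(1,2)] q(3) by simp
qed

text \<open>With \<open>s\<close> the norm of \<open>a + b\<close>, the element \<open>s - a\<close>
  is the sum of the positive elements \<open>s - (a + b)\<close> and \<open>b\<close>.\<close>

lemma pos_cnorm_mono:
  assumes "pos a" "pos b" shows "cnorm A a \<le> cnorm A (a \<oplus> b)"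
proof (rule pos_bound[OF assms(1)])
  note a = posD[OF assms(1)] and b = posD[OF assms(2)]
  let ?s = "complex_of_real (cnorm A (a \<oplus> b))"
  have "pos ((?s \<odot> \<one> \<ominus> (a \<oplus> b)) \<oplus> b)"
    by (rule pos_add[OF pos_norm_minus assms(2)]) (use a b in \<open>auto simp: adj_simps\<close>)
  also have "(?s \<odot> \<one> \<ominus> (a \<oplus> b)) \<oplus> b = ?s \<odot> \<one> \<ominus> a"
    by (rule nc_eqI[where xs = "[a, b]"], (rule nc_reify)+) (use a b in simp_all)
  finally show "pos (?s \<odot> \<one> \<ominus> a)" .
  show "0 \<le> cnorm A (a \<oplus> b)" using a b by (simp add: cnorm_nonneg)
qed

lemma pos_norm_one_minus:
  assumes "pos a" "cnorm A a \<le> 1" shows "cnorm A (\<one> \<ominus> a) \<le> 1"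
proof -
  obtain q where q: "q \<in> carrier A" "adj A q = q" "q \<otimes> q = a"
    by (rule pos_sqrt[OF assms(1)], rule that)
  have "(cnorm A q)\<^sup>2 \<le> 1" using cnorm_self_adjoint_square[OF q(1,2)] q(3) assms(2) by simp
  hence "cnorm A q \<le> 1" using power2_le_imp_le[of "cnorm A q" 1] by simp
  thus ?thesis using norm_one_minus_square[OF q(1,2)] q(3) by simp
qed

end

section \<open>Adjointable operators on Hilbert modules\<close>

text \<open>Only inequalities are asked of the norm. Homogeneity follows by scaling back with the
  inverse scalar; the C*-identity follows since \<open>\<parallel>x\<parallel>\<^sup>2 \<le>
  \<parallel>x\<^sup>* x\<parallel> \<le> \<parallel>x\<^sup>*\<parallel>
  \<parallel>x\<parallel>\<close> makes the adjoint isometric. Differences are written with the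
  scalar \<open>-1\<close>, because subtraction presupposes the group structure that is still to be
  established.\<close>

lemma cstar_algebraI:
  fixes A :: "('a, 'w) cstar_scheme" (structure)
  assumes cl: "\<zero> \<in> carrier A"
      "\<And>x y. \<lbrakk>x \<in> carrier A; y \<in> carrier A\<rbrakk> \<Longrightarrow> x \<oplus> y \<in> carrier A"
      "\<And>c x. x \<in> carrier A \<Longrightarrow> c \<odot> x \<in> carrier A"
      "\<And>x y. \<lbrakk>x \<in> carrier A; y \<in> carrier A\<rbrakk> \<Longrightarrow> x \<otimes> y \<in> carrier A"
      "\<And>x. x \<in> carrier A \<Longrightarrow> adj A x \<in> carrier A"
    and add: "\<And>x y z. \<lbrakk>x \<in> carrier A; y \<in> carrier A; z \<in> carrier A\<rbrakk> \<Longrightarrow> (x \<oplus> y) \<oplus> z = x \<oplus> (y \<oplus> z)"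
      "\<And>x y. \<lbrakk>x \<in> carrier A; y \<in> carrier A\<rbrakk> \<Longrightarrow> x \<oplus> y = y \<oplus> x"
      "\<And>x. x \<in> carrier A \<Longrightarrow> \<zero> \<oplus> x = x"
      "\<And>x. x \<in> carrier A \<Longrightarrow> (-1) \<odot> x \<oplus> x = \<zero>"
    and smult: "\<And>a b x. x \<in> carrier A \<Longrightarrow> (a + b) \<odot> x = a \<odot> x \<oplus> b \<odot> x"
      "\<And>a x y. \<lbrakk>x \<in> carrier A; y \<in> carrier A\<rbrakk> \<Longrightarrow> a \<odot> (x \<oplus> y) = a \<odot> x \<oplus> a \<odot> y"
      "\<And>a b x. x \<in> carrier A \<Longrightarrow> (a * b) \<odot> x = a \<odot> (b \<odot> x)"
      "\<And>x. x \<in> carrier A \<Longrightarrow> 1 \<odot> x = x"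
    and mult: "\<And>x y z. \<lbrakk>x \<in> carrier A; y \<in> carrier A; z \<in> carrier A\<rbrakk> \<Longrightarrow> (x \<otimes> y) \<otimes> z = x \<otimes> (y \<otimes> z)"
      "\<And>x y z. \<lbrakk>x \<in> carrier A; y \<in> carrier A; z \<in> carrier A\<rbrakk> \<Longrightarrow> (x \<oplus> y) \<otimes> z = (x \<otimes> z) \<oplus> (y \<otimes> z)"
      "\<And>x y z. \<lbrakk>x \<in> carrier A; y \<in> carrier A; z \<in> carrier A\<rbrakk> \<Longrightarrow> z \<otimes> (x \<oplus> y) = (z \<otimes> x) \<oplus> (z \<otimes> y)"
      "\<And>c x y. \<lbrakk>x \<in> carrier A; y \<in> carrier A\<rbrakk> \<Longrightarrow> (c \<odot> x) \<otimes> y = c \<odot> (x \<otimes> y)"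
      "\<And>c x y. \<lbrakk>x \<in> carrier A; y \<in> carrier A\<rbrakk> \<Longrightarrow> x \<otimes> (c \<odot> y) = c \<odot> (x \<otimes> y)"
    and adj: "\<And>x y. \<lbrakk>x \<in> carrier A; y \<in> carrier A\<rbrakk> \<Longrightarrow> adj A (x \<oplus> y) = adj A x \<oplus> adj A y"
      "\<And>c x. x \<in> carrier A \<Longrightarrow> adj A (c \<odot> x) = cnj c \<odot> adj A x"
      "\<And>x y. \<lbrakk>x \<in> carrier A; y \<in> carrier A\<rbrakk> \<Longrightarrow> adj A (x \<otimes> y) = adj A y \<otimes> adj A x"
      "\<And>x. x \<in> carrier A \<Longrightarrow> adj A (adj A x) = x"
    and norm: "\<And>x. x \<in> carrier A \<Longrightarrow> 0 \<le> cnorm A x"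
      "\<And>x. x \<in> carrier A \<Longrightarrow> cnorm A x = 0 \<longleftrightarrow> x = \<zero>"
      "\<And>x y. \<lbrakk>x \<in> carrier A; y \<in> carrier A\<rbrakk> \<Longrightarrow> cnorm A (x \<oplus> y) \<le> cnorm A x + cnorm A y"
      "\<And>c x. x \<in> carrier A \<Longrightarrow> cnorm A (c \<odot> x) \<le> cmod c * cnorm A x"
      "\<And>x y. \<lbrakk>x \<in> carrier A; y \<in> carrier A\<rbrakk> \<Longrightarrow> cnorm A (x \<otimes> y) \<le> cnorm A x * cnorm A y"
      "\<And>x. x \<in> carrier A \<Longrightarrow> (cnorm A x)\<^sup>2 \<le> cnorm A (adj A x \<otimes> x)"
    and compl: "\<And>\<sigma> :: nat \<Rightarrow> 'a. \<lbrakk>\<And>n. \<sigma> n \<in> carrier A;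
        \<And>e. e > 0 \<Longrightarrow> \<exists>N. \<forall>m\<ge>N. \<forall>n\<ge>N. cnorm A (\<sigma> m \<oplus> (-1) \<odot> \<sigma> n) < e\<rbrakk> \<Longrightarrow>
        \<exists>x\<in>carrier A. \<forall>e>0. \<exists>N. \<forall>n\<ge>N. cnorm A (\<sigma> n \<oplus> (-1) \<odot> x) < e"
  shows "cstar_algebra A"
proof -
  have grp: "abelian_group A"
  proof (rule abelian_groupI)
    fix x assume "x \<in> carrier A"
    thus "\<exists>y\<in>carrier A. y \<oplus> x = \<zero>" using add(4) cl(3) by blast
  qed (use cl add(1-3) in auto)
  have mod: "module complex_ring A"
    by (rule moduleI) (use cl grp cring_complex_ring smult in auto)
  interpret M: module complex_ring A by (rule mod)
  have minus: "x \<ominus> y = x \<oplus> (-1) \<odot> y" if "x \<in> carrier A" "y \<in> carrier A" for x y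
  proof -
    have "\<ominus> y = (-1) \<odot> y" using that cl add(4) by (intro M.minus_equality) auto
    thus ?thesis by (simp add: a_minus_def)
  qed
  have dist: "cdist A x y = (if x \<in> carrier A \<and> y \<in> carrier A then cnorm A (x \<oplus> (-1) \<odot> y) else 0)" for x y
    by (simp add: cdist_def minus)
  have nsmult: "cnorm A (c \<odot> x) = cmod c * cnorm A x" if x: "x \<in> carrier A" for c x
  proof (cases "c = 0")
    case True
    then show ?thesis using norm(4)[OF x, of c] norm(1)[OF cl(3)[OF x, of c]] by simp
  next
    case False
    have "inverse c \<odot> (c \<odot> x) = x" using smult(3)[OF x, of "inverse c" c] smult(4)[OF x] False by simp
    hence "cnorm A x \<le> cmod (inverse c) * cnorm A (c \<odot> x)"
      using norm(4)[OF cl(3)[OF x, of c], of "inverse c"] by simp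
    hence "cmod c * cnorm A x \<le> cmod c * (cmod (inverse c) * cnorm A (c \<odot> x))"
      by (rule mult_left_mono) simp
    also have "\<dots> = cnorm A (c \<odot> x)" using False by (simp add: norm_inverse)
    finally show ?thesis using norm(4)[OF x, of c] by simp
  qed
  have adj_le: "cnorm A x \<le> cnorm A (adj A x)" if x: "x \<in> carrier A" for x
  proof (cases "cnorm A x = 0")
    case False
    have "cnorm A x * cnorm A x \<le> cnorm A (adj A x) * cnorm A x"
      using norm(5)[OF cl(5)[OF x] x] norm(6)[OF x] by (simp add: power2_eq_square)
    thus ?thesis by (rule mult_right_le_imp_le) (use False norm(1)[OF x] in simp)
  qed (use norm(1)[OF cl(5)[OF x]] in simp)
  have nstar: "cnorm A (adj A x \<otimes> x) = (cnorm A x)\<^sup>2" if x: "x \<in> carrier A" for x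
    using norm(6)[OF x] norm(5)[OF cl(5)[OF x] x] adj_le[OF x] adj_le[OF cl(5)[OF x]] adj(4)[OF x]
    by (simp add: power2_eq_square)
  have ncomm: "cnorm A (x \<oplus> (-1) \<odot> y) = cnorm A (y \<oplus> (-1) \<odot> x)"
    if "x \<in> carrier A" "y \<in> carrier A" for x y
  proof -
    have "(-1) \<odot> (x \<oplus> (-1) \<odot> y) = y \<oplus> (-1) \<odot> x"
      using that cl by (simp add: smult(2,4) add(2) smult(3)[symmetric])
    thus ?thesis using nsmult[of "x \<oplus> (-1) \<odot> y" "-1"] that cl by simp
  qed
  have split: "x \<oplus> (-1) \<odot> z = (x \<oplus> (-1) \<odot> y) \<oplus> (y \<oplus> (-1) \<odot> z)"
    if "x \<in> carrier A" "y \<in> carrier A" "z \<in> carrier A" for x y z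
  proof -
    have "(x \<oplus> (-1) \<odot> y) \<oplus> (y \<oplus> (-1) \<odot> z) = x \<oplus> (((-1) \<odot> y \<oplus> y) \<oplus> (-1) \<odot> z)"
      using that cl by (simp add: add(1))
    thus ?thesis using that cl add by simp
  qed
  have ms: "Metric_space (carrier A) (cdist A)"
  proof
    fix x y z
    show "0 \<le> cdist A x y" using norm(1) cl by (simp add: dist)
    show "cdist A x y = cdist A y x" by (simp add: dist ncomm)
    show "cdist A x y = 0 \<longleftrightarrow> x = y" if xy: "x \<in> carrier A" "y \<in> carrier A"
    proof
      assume "cdist A x y = 0"
      hence "x \<oplus> (-1) \<odot> y = \<zero>" using norm(2)[of "x \<oplus> (-1) \<odot> y"] xy cl by (simp add: dist)
      hence "x \<oplus> ((-1) \<odot> y \<oplus> y) = \<zero> \<oplus> y" using xy cl by (simp add: add(1)[symmetric])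
      thus "x = y" using xy add by (metis cl(1))
    next
      assume "x = y"
      hence "x \<oplus> (-1) \<odot> y = \<zero>" using add(2)[of x "(-1) \<odot> y"] add(4)[of x] xy cl by simp
      thus "cdist A x y = 0" using norm(2)[OF cl(1)] xy by (simp add: dist)
    qed
    show "cdist A x z \<le> cdist A x y + cdist A y z"
      if xy: "x \<in> carrier A" "y \<in> carrier A" "z \<in> carrier A"
      using norm(3)[of "x \<oplus> (-1) \<odot> y" "y \<oplus> (-1) \<odot> z"] split[OF xy] xy cl by (simp add: dist)
  qed
  interpret ms: Metric_space "carrier A" "cdist A" by (rule ms)
  have "ms.mcomplete"
    unfolding ms.mcomplete_def
  proof (intro allI impI)
    fix \<sigma> assume \<sigma>: "ms.MCauchy \<sigma>"
    hence r: "\<sigma> n \<in> carrier A" for n by (auto simp: ms.MCauchy_def)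
    have "\<exists>x\<in>carrier A. \<forall>e>0. \<exists>N. \<forall>n\<ge>N. cnorm A (\<sigma> n \<oplus> (-1) \<odot> x) < e"
      using \<sigma> r by (intro compl) (auto simp: ms.MCauchy_def dist)
    then obtain x where "x \<in> carrier A"
      "\<And>e. e > 0 \<Longrightarrow> \<exists>N. \<forall>n\<ge>N. cnorm A (\<sigma> n \<oplus> (-1) \<odot> x) < e" by blast
    thus "\<exists>x. limitin ms.mtopology \<sigma> x sequentially"
      using r unfolding ms.limit_metric_sequentially by (auto simp: dist)
  qed
  thus ?thesis
    by (intro cstar_algebra.intro[OF mod], unfold_locales)
      (use cl mult adj norm(1,2,3,5) nsmult nstar in auto)
qed

text \<open>Cauchy-Schwarz is an axiom rather than a consequence of positivity: the instance
  \<open>A\<close> over itself is what provides a unital algebra around \<open>A\<close>, before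
  positive elements of a non-unital \<open>A\<close> can be treated. There the inequality is
  submultiplicativity of the norm.\<close>

locale hilbert_module = cstar_algebra A + X: module complex_ring X
  for A :: "('a, 'z) cstar_scheme" (structure) and X :: "(complex, 'x, 'y) module_scheme" +
  fixes ip :: "'x \<Rightarrow> 'x \<Rightarrow> 'a"
  assumes ip_closed [simp, intro]: "\<lbrakk>x \<in> carrier X; y \<in> carrier X\<rbrakk> \<Longrightarrow> ip x y \<in> carrier A"
    and ip_add_right: "\<lbrakk>x \<in> carrier X; y \<in> carrier X; z \<in> carrier X\<rbrakk> \<Longrightarrow>
          ip x (y \<oplus>\<^bsub>X\<^esub> z) = ip x y \<oplus> ip x z"
    and ip_smult_right: "\<lbrakk>x \<in> carrier X; y \<in> carrier X\<rbrakk> \<Longrightarrow> ip x (c \<odot>\<^bsub>X\<^esub> y) = c \<odot> ip x y"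
    and adj_ip: "\<lbrakk>x \<in> carrier X; y \<in> carrier X\<rbrakk> \<Longrightarrow> adj A (ip x y) = ip y x"
    and ip_self_eq_0: "\<lbrakk>x \<in> carrier X; ip x x = \<zero>\<rbrakk> \<Longrightarrow> x = \<zero>\<^bsub>X\<^esub>"
    and cauchy_schwarz: "\<lbrakk>x \<in> carrier X; y \<in> carrier X\<rbrakk> \<Longrightarrow>
          cnorm A (ip x y) \<le> sqrt (cnorm A (ip x x)) * sqrt (cnorm A (ip y y))"
    and ip_complete: "\<And>\<sigma> :: nat \<Rightarrow> 'x. \<lbrakk>\<And>n. \<sigma> n \<in> carrier X; \<And>e. e > 0 \<Longrightarrow> \<exists>N. \<forall>m\<ge>N. \<forall>n\<ge>N.
          sqrt (cnorm A (ip (\<sigma> m \<oplus>\<^bsub>X\<^esub> (-1) \<odot>\<^bsub>X\<^esub> \<sigma> n) (\<sigma> m \<oplus>\<^bsub>X\<^esub> (-1) \<odot>\<^bsub>X\<^esub> \<sigma> n))) < e\<rbrakk> \<Longrightarrow>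
          \<exists>x\<in>carrier X. \<forall>e>0. \<exists>N. \<forall>n\<ge>N.
            sqrt (cnorm A (ip (\<sigma> n \<oplus>\<^bsub>X\<^esub> (-1) \<odot>\<^bsub>X\<^esub> x) (\<sigma> n \<oplus>\<^bsub>X\<^esub> (-1) \<odot>\<^bsub>X\<^esub> x))) < (e::real)"
begin

definition hnorm :: "'x \<Rightarrow> real" where "hnorm x = sqrt (cnorm A (ip x x))"

lemmas ip_cauchy_schwarz = cauchy_schwarz[folded hnorm_def]
lemmas hnorm_complete = ip_complete[folded hnorm_def]

lemma X_smult [simp, intro]: "x \<in> carrier X \<Longrightarrow> c \<odot>\<^bsub>X\<^esub> x \<in> carrier X"
  by (rule X.smult_closed) simp_all

lemma X_one_smult [simp]: "x \<in> carrier X \<Longrightarrow> 1 \<odot>\<^bsub>X\<^esub> x = x"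
  using X.smult_one[of x] by simp

lemma X_null_smult: "x \<in> carrier X \<Longrightarrow> 0 \<odot>\<^bsub>X\<^esub> x = \<zero>\<^bsub>X\<^esub>"
  using X.smult_l_null[of x] by simp

lemma X_neg: "x \<in> carrier X \<Longrightarrow> (-1) \<odot>\<^bsub>X\<^esub> x \<oplus>\<^bsub>X\<^esub> x = \<zero>\<^bsub>X\<^esub>"
  using X.smult_l_distr[of "-1" 1 x] X_null_smult[of x] by simp

lemma hnorm_sq: "x \<in> carrier X \<Longrightarrow> (hnorm x)\<^sup>2 = cnorm A (ip x x)"
  by (simp add: hnorm_def cnorm_nonneg)

lemma hnorm_nonneg [simp]: "x \<in> carrier X \<Longrightarrow> 0 \<le> hnorm x"
  by (simp add: hnorm_def cnorm_nonneg)

lemma ip_add_left: "\<lbrakk>x \<in> carrier X; y \<in> carrier X; z \<in> carrier X\<rbrakk> \<Longrightarrow>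
    ip (x \<oplus>\<^bsub>X\<^esub> y) z = ip x z \<oplus> ip y z"
  using adj_ip[of z "x \<oplus>\<^bsub>X\<^esub> y"] by (simp add: ip_add_right adj_add adj_ip)

lemma ip_smult_left: "\<lbrakk>x \<in> carrier X; y \<in> carrier X\<rbrakk> \<Longrightarrow> ip (c \<odot>\<^bsub>X\<^esub> x) y = cnj c \<odot> ip x y"
  using adj_ip[of y "c \<odot>\<^bsub>X\<^esub> x"] by (simp add: ip_smult_right adj_smult adj_ip)

lemma ip_zero [simp]: "x \<in> carrier X \<Longrightarrow> ip x \<zero>\<^bsub>X\<^esub> = \<zero>" "x \<in> carrier X \<Longrightarrow> ip \<zero>\<^bsub>X\<^esub> x = \<zero>"
  using ip_smult_right[of x x 0] ip_smult_left[of x x 0] X_null_smult[of x] smult_l_null[of "ip x x"]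
  by simp_all

lemma ip_ext:
  assumes "x \<in> carrier X" "y \<in> carrier X" "\<And>z. z \<in> carrier X \<Longrightarrow> ip z x = ip z y"
  shows "x = y"
proof -
  let ?d = "x \<oplus>\<^bsub>X\<^esub> (-1) \<odot>\<^bsub>X\<^esub> y"
  have "ip ?d ?d = ip ?d x \<oplus> (-1) \<odot> ip ?d y"
    using assms(1,2) by (simp add: ip_add_right[of ?d] ip_smult_right[of ?d])
  also have "\<dots> = \<zero>" using assms minus_eq[of "ip ?d y" "ip ?d y"] diff_self by simp
  finally have "?d = \<zero>\<^bsub>X\<^esub>" using assms by (intro ip_self_eq_0) auto
  hence "x \<oplus>\<^bsub>X\<^esub> ((-1) \<odot>\<^bsub>X\<^esub> y \<oplus>\<^bsub>X\<^esub> y) = y" using assms(1,2) by (simp add: X.a_assoc[symmetric])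
  thus ?thesis using assms(1,2) by (simp add: X_neg)
qed

lemma hnorm_add: "\<lbrakk>x \<in> carrier X; y \<in> carrier X\<rbrakk> \<Longrightarrow> hnorm (x \<oplus>\<^bsub>X\<^esub> y) \<le> hnorm x + hnorm y"
proof -
  assume xy: "x \<in> carrier X" "y \<in> carrier X"
  have "(hnorm (x \<oplus>\<^bsub>X\<^esub> y))\<^sup>2 = cnorm A ((ip x x \<oplus> ip x y) \<oplus> (ip y x \<oplus> ip y y))"
    using xy by (simp add: hnorm_sq ip_add_left ip_add_right a_ac)
  also have "\<dots> \<le> cnorm A (ip x x \<oplus> ip x y) + cnorm A (ip y x \<oplus> ip y y)"
    using xy by (intro cnorm_add) auto
  also have "\<dots> \<le> (cnorm A (ip x x) + cnorm A (ip x y)) + (cnorm A (ip y x) + cnorm A (ip y y))"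
    using xy by (intro add_mono cnorm_add) auto
  also have "\<dots> \<le> ((hnorm x)\<^sup>2 + hnorm x * hnorm y) + (hnorm y * hnorm x + (hnorm y)\<^sup>2)"
    using xy by (intro add_mono ip_cauchy_schwarz) (simp_all add: hnorm_sq)
  also have "\<dots> = (hnorm x + hnorm y)\<^sup>2" by (simp add: power2_eq_square algebra_simps)
  finally show ?thesis by (rule power2_le_imp_le) (use xy in simp)
qed

lemma hnorm_smult: "x \<in> carrier X \<Longrightarrow> hnorm (c \<odot>\<^bsub>X\<^esub> x) = cmod c * hnorm x"
proof -
  assume x: "x \<in> carrier X"
  have "cnorm A (ip (c \<odot>\<^bsub>X\<^esub> x) (c \<odot>\<^bsub>X\<^esub> x)) = (cmod c)\<^sup>2 * cnorm A (ip x x)"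
    using x by (simp add: ip_smult_left ip_smult_right cnorm_smult power2_eq_square)
  thus ?thesis by (simp add: hnorm_def real_sqrt_mult)
qed

lemma hnorm_eq_0: "x \<in> carrier X \<Longrightarrow> hnorm x = 0 \<longleftrightarrow> x = \<zero>\<^bsub>X\<^esub>"
  using ip_self_eq_0[of x] cnorm_eq_0[of "ip x x"] by (auto simp: hnorm_def cnorm_zero)

lemma hnorm_zero [simp]: "hnorm \<zero>\<^bsub>X\<^esub> = 0"
  by (simp add: hnorm_eq_0)

section \<open>Operators with an adjoint and their C*-algebra\<close>

definition adjoint_pair :: "('x \<Rightarrow> 'x) \<Rightarrow> ('x \<Rightarrow> 'x) \<Rightarrow> bool" where
  "adjoint_pair f g \<longleftrightarrow> f \<in> carrier X \<rightarrow> carrier X \<and> g \<in> carrier X \<rightarrow> carrier X \<and>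
     (\<forall>x\<in>carrier X. \<forall>y\<in>carrier X. ip (f x) y = ip x (g y))"

definition bounded_by :: "real \<Rightarrow> ('x \<Rightarrow> 'x) \<Rightarrow> bool" where
  "bounded_by K f \<longleftrightarrow> 0 \<le> K \<and> (\<forall>x\<in>carrier X. hnorm (f x) \<le> K * hnorm x)"

definition hadj :: "('x \<Rightarrow> 'x) \<Rightarrow> 'x \<Rightarrow> 'x" where
  "hadj f = restrict (SOME g. adjoint_pair f g) (carrier X)"

text \<open>Operators are extensional, so that agreement on the carrier is equality and the axioms
  of a C*-algebra can be checked pointwise. The norm is the least bound.\<close>

definition Lop :: "('x \<Rightarrow> 'x) cstar" where
  "Lop = \<lparr>carrier = {f \<in> extensional (carrier X). (\<exists>g. adjoint_pair f g) \<and> (\<exists>K. bounded_by K f)},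
     monoid.mult = (\<lambda>f g. \<lambda>x\<in>carrier X. f (g x)), one = (\<lambda>x\<in>carrier X. x),
     ring.zero = (\<lambda>x\<in>carrier X. \<zero>\<^bsub>X\<^esub>), add = (\<lambda>f g. \<lambda>x\<in>carrier X. f x \<oplus>\<^bsub>X\<^esub> g x),
     smult = (\<lambda>c f. \<lambda>x\<in>carrier X. c \<odot>\<^bsub>X\<^esub> f x), adj = hadj,
     cnorm = (\<lambda>f. Inf {K. bounded_by K f})\<rparr>"

lemma Lop_simps:
  "f \<otimes>\<^bsub>Lop\<^esub> g = (\<lambda>x\<in>carrier X. f (g x))" "\<one>\<^bsub>Lop\<^esub> = (\<lambda>x\<in>carrier X. x)"
  "\<zero>\<^bsub>Lop\<^esub> = (\<lambda>x\<in>carrier X. \<zero>\<^bsub>X\<^esub>)" "f \<oplus>\<^bsub>Lop\<^esub> g = (\<lambda>x\<in>carrier X. f x \<oplus>\<^bsub>X\<^esub> g x)"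
  "c \<odot>\<^bsub>Lop\<^esub> f = (\<lambda>x\<in>carrier X. c \<odot>\<^bsub>X\<^esub> f x)" "adj Lop f = hadj f"
  by (simp_all add: Lop_def)

lemma adjoint_pairD:
  assumes "adjoint_pair f g"
  shows "x \<in> carrier X \<Longrightarrow> f x \<in> carrier X" "x \<in> carrier X \<Longrightarrow> g x \<in> carrier X"
    "\<lbrakk>x \<in> carrier X; y \<in> carrier X\<rbrakk> \<Longrightarrow> ip (f x) y = ip x (g y)"
  using assms by (auto simp: adjoint_pair_def)

lemma adjoint_pair_unique:
  "\<lbrakk>adjoint_pair f g; adjoint_pair f h; x \<in> carrier X\<rbrakk> \<Longrightarrow> g x = h x"
  by (rule ip_ext) (auto simp: adjoint_pair_def)

lemma adjoint_pair_sym: "adjoint_pair f g \<Longrightarrow> adjoint_pair g f"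
  unfolding adjoint_pair_def using adj_ip by (auto simp: Pi_iff) metis

text \<open>An adjoint forces linearity: paired with any vector, \<open>f\<close> moves to the other
  side of the inner product, which is additive and homogeneous there.\<close>

lemma adjoint_pair_linear:
  assumes p: "adjoint_pair f g" and xy: "x \<in> carrier X" "y \<in> carrier X"
  shows "f (x \<oplus>\<^bsub>X\<^esub> y) = f x \<oplus>\<^bsub>X\<^esub> f y" "f (c \<odot>\<^bsub>X\<^esub> x) = c \<odot>\<^bsub>X\<^esub> f x"
proof -
  note D = adjoint_pairD[OF p] and E = adjoint_pairD[OF adjoint_pair_sym[OF p]]
  show "f (x \<oplus>\<^bsub>X\<^esub> y) = f x \<oplus>\<^bsub>X\<^esub> f y"
    by (rule ip_ext) (use xy D(1,2) in \<open>auto simp: ip_add_right E(3)[symmetric]\<close>)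
  show "f (c \<odot>\<^bsub>X\<^esub> x) = c \<odot>\<^bsub>X\<^esub> f x"
    by (rule ip_ext) (use xy D(1,2) in \<open>auto simp: ip_smult_right E(3)[symmetric]\<close>)
qed

text \<open>Cauchy-Schwarz bounds \<open>\<parallel>g y\<parallel>\<^sup>2 = \<parallel>ip (f (g y))
  y\<parallel>\<close> by \<open>K \<parallel>g y\<parallel> \<parallel>y\<parallel>\<close>; one
  factor \<open>\<parallel>g y\<parallel>\<close> cancels unless it is zero.\<close>

lemma adjoint_pair_bounded:
  assumes p: "adjoint_pair f g" and b: "bounded_by K f" shows "bounded_by K g"
  unfolding bounded_by_def
proof (intro conjI ballI)
  show K: "0 \<le> K" using b by (simp add: bounded_by_def)
  note D = adjoint_pairD[OF p]
  fix y assume y: "y \<in> carrier X"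
  have "hnorm (g y) * hnorm (g y) = cnorm A (ip (f (g y)) y)"
    using D y by (simp add: hnorm_sq[symmetric] power2_eq_square)
  also have "\<dots> \<le> hnorm (f (g y)) * hnorm y" using D y by (intro ip_cauchy_schwarz) auto
  also have "\<dots> \<le> (K * hnorm (g y)) * hnorm y"
    using b D y by (intro mult_right_mono) (auto simp: bounded_by_def)
  finally have *: "hnorm (g y) * hnorm (g y) \<le> (K * hnorm y) * hnorm (g y)" by (simp add: mult_ac)
  show "hnorm (g y) \<le> K * hnorm y"
  proof (cases "hnorm (g y) = 0")
    case False
    hence "0 < hnorm (g y)" using hnorm_nonneg[OF D(2)[OF y]] by linarith
    thus ?thesis using * by (rule mult_right_le_imp_le[rotated])
  qed (use K y in simp)
qed

lemma LopI:
  assumes "adjoint_pair f g" "bounded_by K f"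
  shows "restrict f (carrier X) \<in> carrier Lop" "adj Lop (restrict f (carrier X)) = restrict g (carrier X)"
proof -
  let ?f = "restrict f (carrier X)"
  have p: "adjoint_pair ?f g" using assms(1) by (auto simp: adjoint_pair_def)
  have b: "bounded_by K ?f" using assms(2) by (auto simp: bounded_by_def)
  show "?f \<in> carrier Lop" using p b by (auto simp: Lop_def)
  have "adjoint_pair ?f (SOME g. adjoint_pair ?f g)" using p someI_ex[of "adjoint_pair ?f"] by blast
  thus "adj Lop ?f = restrict g (carrier X)"
    unfolding Lop_simps hadj_def using adjoint_pair_unique[OF _ p] by fastforce
qed

lemma LopD:
  assumes "f \<in> carrier Lop"
  shows "f \<in> extensional (carrier X)" "adjoint_pair f (adj Lop f)" "\<exists>K. bounded_by K f"
proof -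
  obtain g K where g: "adjoint_pair f g" and K: "bounded_by K f" and e: "f \<in> extensional (carrier X)"
    using assms by (auto simp: Lop_def)
  show "f \<in> extensional (carrier X)" "\<exists>K. bounded_by K f" using e K by auto
  have "restrict f (carrier X) = f" using e by (rule extensional_restrict)
  hence "adj Lop f = restrict g (carrier X)" using LopI(2)[OF g K] by simp
  thus "adjoint_pair f (adj Lop f)" using g by (auto simp: adjoint_pair_def)
qed

lemma Lop_in: "f \<in> carrier Lop \<Longrightarrow> x \<in> carrier X \<Longrightarrow> f x \<in> carrier X"
  using adjoint_pairD(1)[OF LopD(2)] .

lemma Lop_ext: "\<lbrakk>f \<in> carrier Lop; g \<in> carrier Lop; \<And>x. x \<in> carrier X \<Longrightarrow> f x = g x\<rbrakk> \<Longrightarrow> f = g"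
  using LopD(1) by (auto intro: extensionalityI)

lemma Lop_bounded: "f \<in> carrier Lop \<Longrightarrow> bounded_by (cnorm Lop f) f"
proof -
  assume f: "f \<in> carrier Lop"
  then obtain K where K: "bounded_by K f" using LopD(3) by blast
  let ?S = "{K. bounded_by K f}"
  have ne: "?S \<noteq> {}" using K by auto
  have 0: "0 \<le> Inf ?S" by (rule cInf_greatest[OF ne]) (simp add: bounded_by_def)
  have "hnorm (f x) \<le> Inf ?S * hnorm x" if x: "x \<in> carrier X" for x
  proof (cases "hnorm x = 0")
    case True
    then show ?thesis using K x by (auto simp: bounded_by_def)
  next
    case False
    hence pos: "hnorm x > 0" using hnorm_nonneg[OF x] by linarith
    have "hnorm (f x) / hnorm x \<le> Inf ?S"
      by (rule cInf_greatest[OF ne]) (use x pos in \<open>auto simp: bounded_by_def field_simps\<close>)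
    thus ?thesis using pos by (simp add: field_simps)
  qed
  thus ?thesis using 0 by (simp add: Lop_def bounded_by_def)
qed

lemma Lop_norm_le: "bounded_by K f \<Longrightarrow> cnorm Lop f \<le> K"
  unfolding Lop_def by (auto intro!: cInf_lower bdd_belowI[of _ 0] simp: bounded_by_def)

lemma Lop_hnorm: "f \<in> carrier Lop \<Longrightarrow> x \<in> carrier X \<Longrightarrow> hnorm (f x) \<le> cnorm Lop f * hnorm x"
  using Lop_bounded[of f] by (auto simp: bounded_by_def)

lemma Lop_norm_nonneg: "f \<in> carrier Lop \<Longrightarrow> 0 \<le> cnorm Lop f"
  using Lop_bounded[of f] by (auto simp: bounded_by_def)

lemma Lop_adj: "f \<in> carrier Lop \<Longrightarrow> adj Lop f \<in> carrier Lop" "f \<in> carrier Lop \<Longrightarrow> adj Lop (adj Lop f) = f"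
proof -
  assume f: "f \<in> carrier Lop"
  have e: "adj Lop f \<in> extensional (carrier X)" by (simp add: Lop_simps hadj_def)
  note p = adjoint_pair_sym[OF LopD(2)[OF f]]
  note b = adjoint_pair_bounded[OF LopD(2)[OF f] Lop_bounded[OF f]]
  show "adj Lop f \<in> carrier Lop" "adj Lop (adj Lop f) = f"
    using LopI[OF p b] e LopD(1)[OF f] by (simp_all add: extensional_restrict)
qed

lemma Lop_closed:
  assumes f: "f \<in> carrier Lop" and g: "g \<in> carrier Lop"
  shows "f \<oplus>\<^bsub>Lop\<^esub> g \<in> carrier Lop" "adj Lop (f \<oplus>\<^bsub>Lop\<^esub> g) = adj Lop f \<oplus>\<^bsub>Lop\<^esub> adj Lop g"
    "cnorm Lop (f \<oplus>\<^bsub>Lop\<^esub> g) \<le> cnorm Lop f + cnorm Lop g"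
    "f \<otimes>\<^bsub>Lop\<^esub> g \<in> carrier Lop" "adj Lop (f \<otimes>\<^bsub>Lop\<^esub> g) = adj Lop g \<otimes>\<^bsub>Lop\<^esub> adj Lop f"
    "cnorm Lop (f \<otimes>\<^bsub>Lop\<^esub> g) \<le> cnorm Lop f * cnorm Lop g"
    "c \<odot>\<^bsub>Lop\<^esub> f \<in> carrier Lop" "adj Lop (c \<odot>\<^bsub>Lop\<^esub> f) = cnj c \<odot>\<^bsub>Lop\<^esub> adj Lop f"
    "cnorm Lop (c \<odot>\<^bsub>Lop\<^esub> f) \<le> cmod c * cnorm Lop f"
proof -
  note F = adjoint_pairD[OF LopD(2)[OF f]] and G = adjoint_pairD[OF LopD(2)[OF g]]
  note nf = Lop_hnorm[OF f] and ng = Lop_hnorm[OF g]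
  have p1: "adjoint_pair (\<lambda>x. f x \<oplus>\<^bsub>X\<^esub> g x) (\<lambda>x. adj Lop f x \<oplus>\<^bsub>X\<^esub> adj Lop g x)"
    using F G by (auto simp: adjoint_pair_def ip_add_left ip_add_right)
  have b1: "bounded_by (cnorm Lop f + cnorm Lop g) (\<lambda>x. f x \<oplus>\<^bsub>X\<^esub> g x)"
    unfolding bounded_by_def
    using Lop_norm_nonneg[OF f] Lop_norm_nonneg[OF g] nf ng F(1) G(1)
    by (auto simp: distrib_right intro!: order_trans[OF hnorm_add] add_mono)
  show "f \<oplus>\<^bsub>Lop\<^esub> g \<in> carrier Lop" "adj Lop (f \<oplus>\<^bsub>Lop\<^esub> g) = adj Lop f \<oplus>\<^bsub>Lop\<^esub> adj Lop g"
    using LopI[OF p1 b1] by (simp_all add: Lop_simps(4))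
  show "cnorm Lop (f \<oplus>\<^bsub>Lop\<^esub> g) \<le> cnorm Lop f + cnorm Lop g"
    using b1 by (intro Lop_norm_le) (simp add: bounded_by_def Lop_simps(4))
  have p2: "adjoint_pair (\<lambda>x. f (g x)) (\<lambda>x. adj Lop g (adj Lop f x))"
    using F G by (auto simp: adjoint_pair_def)
  have b2: "bounded_by (cnorm Lop f * cnorm Lop g) (\<lambda>x. f (g x))"
    unfolding bounded_by_def
  proof (intro conjI ballI)
    fix x assume x: "x \<in> carrier X"
    have "hnorm (f (g x)) \<le> cnorm Lop f * hnorm (g x)" using nf G(1) x by simp
    also have "\<dots> \<le> cnorm Lop f * (cnorm Lop g * hnorm x)"
      using ng x Lop_norm_nonneg[OF f] by (intro mult_left_mono) auto
    finally show "hnorm (f (g x)) \<le> cnorm Lop f * cnorm Lop g * hnorm x" by (simp add: mult.assoc)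
  qed (use Lop_norm_nonneg[OF f] Lop_norm_nonneg[OF g] in simp)
  show "f \<otimes>\<^bsub>Lop\<^esub> g \<in> carrier Lop" "adj Lop (f \<otimes>\<^bsub>Lop\<^esub> g) = adj Lop g \<otimes>\<^bsub>Lop\<^esub> adj Lop f"
    using LopI[OF p2 b2] by (simp_all add: Lop_simps(1))
  show "cnorm Lop (f \<otimes>\<^bsub>Lop\<^esub> g) \<le> cnorm Lop f * cnorm Lop g"
    using b2 by (intro Lop_norm_le) (simp add: bounded_by_def Lop_simps(1))
  have p3: "adjoint_pair (\<lambda>x. c \<odot>\<^bsub>X\<^esub> f x) (\<lambda>x. cnj c \<odot>\<^bsub>X\<^esub> adj Lop f x)"
    using F by (auto simp: adjoint_pair_def ip_smult_left ip_smult_right)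
  have b3: "bounded_by (cmod c * cnorm Lop f) (\<lambda>x. c \<odot>\<^bsub>X\<^esub> f x)"
    unfolding bounded_by_def using nf F(1) Lop_norm_nonneg[OF f]
    by (auto simp: hnorm_smult mult.assoc intro!: mult_left_mono)
  show "c \<odot>\<^bsub>Lop\<^esub> f \<in> carrier Lop" "adj Lop (c \<odot>\<^bsub>Lop\<^esub> f) = cnj c \<odot>\<^bsub>Lop\<^esub> adj Lop f"
    using LopI[OF p3 b3] by (simp_all add: Lop_simps(5))
  show "cnorm Lop (c \<odot>\<^bsub>Lop\<^esub> f) \<le> cmod c * cnorm Lop f"
    using b3 by (intro Lop_norm_le) (simp add: bounded_by_def Lop_simps(5))
qed

lemma Lop_zero: "\<zero>\<^bsub>Lop\<^esub> \<in> carrier Lop" and Lop_one: "\<one>\<^bsub>Lop\<^esub> \<in> carrier Lop"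
proof -
  have "adjoint_pair (\<lambda>x. \<zero>\<^bsub>X\<^esub>) (\<lambda>x. \<zero>\<^bsub>X\<^esub>)" "bounded_by 0 (\<lambda>x. \<zero>\<^bsub>X\<^esub>)"
    using hnorm_eq_0[OF X.zero_closed] by (auto simp: adjoint_pair_def bounded_by_def)
  from LopI(1)[OF this] show "\<zero>\<^bsub>Lop\<^esub> \<in> carrier Lop" by (simp add: Lop_simps)
  have "adjoint_pair (\<lambda>x. x) (\<lambda>x. x)" "bounded_by 1 (\<lambda>x. x)"
    by (auto simp: adjoint_pair_def bounded_by_def)
  from LopI(1)[OF this] show "\<one>\<^bsub>Lop\<^esub> \<in> carrier Lop" by (simp add: Lop_simps)
qed

text \<open>Pointwise limits are taken of the operators and of their adjoints separately. Continuity
  of the inner product makes the two limits adjoint to each other, so the limit is again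
  adjointable.\<close>

lemma Lop_complete:
  fixes \<sigma> :: "nat \<Rightarrow> 'x \<Rightarrow> 'x"
  assumes \<sigma>: "\<And>n. \<sigma> n \<in> carrier Lop"
    and Cau: "\<And>e. e > 0 \<Longrightarrow> \<exists>N. \<forall>m\<ge>N. \<forall>n\<ge>N. cnorm Lop (\<sigma> m \<oplus>\<^bsub>Lop\<^esub> (-1) \<odot>\<^bsub>Lop\<^esub> \<sigma> n) < e"
  shows "\<exists>f\<in>carrier Lop. \<forall>e>0. \<exists>N. \<forall>n\<ge>N. cnorm Lop (\<sigma> n \<oplus>\<^bsub>Lop\<^esub> (-1) \<odot>\<^bsub>Lop\<^esub> f) < e"
proof -
  have lim: "\<exists>y. y \<in> carrier X \<and> (\<forall>e>0. \<exists>N. \<forall>n\<ge>N. hnorm (\<tau> n x \<oplus>\<^bsub>X\<^esub> (-1) \<odot>\<^bsub>X\<^esub> y) < e)"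
    if \<tau>: "\<And>n. \<tau> n \<in> carrier Lop" and C: "\<And>e. e > 0 \<Longrightarrow> \<exists>N. \<forall>m\<ge>N. \<forall>n\<ge>N. cnorm Lop (\<tau> m \<oplus>\<^bsub>Lop\<^esub> (-1) \<odot>\<^bsub>Lop\<^esub> \<tau> n) < e"
      and x: "x \<in> carrier X" for \<tau> :: "nat \<Rightarrow> 'x \<Rightarrow> 'x" and x
  proof -
    have "\<exists>N. \<forall>m\<ge>N. \<forall>n\<ge>N. hnorm (\<tau> m x \<oplus>\<^bsub>X\<^esub> (-1) \<odot>\<^bsub>X\<^esub> \<tau> n x) < e" if "e > 0" for e
    proof -
      have "e / (hnorm x + 1) > 0" using that hnorm_nonneg[OF x] by (intro divide_pos_pos) auto
      then obtain N where N: "\<And>m n. m \<ge> N \<Longrightarrow> n \<ge> N \<Longrightarrow>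
          cnorm Lop (\<tau> m \<oplus>\<^bsub>Lop\<^esub> (-1) \<odot>\<^bsub>Lop\<^esub> \<tau> n) < e / (hnorm x + 1)" using C by meson
      have "hnorm (\<tau> m x \<oplus>\<^bsub>X\<^esub> (-1) \<odot>\<^bsub>X\<^esub> \<tau> n x) < e" if "m \<ge> N" "n \<ge> N" for m n
      proof -
        let ?d = "\<tau> m \<oplus>\<^bsub>Lop\<^esub> (-1) \<odot>\<^bsub>Lop\<^esub> \<tau> n"
        have d: "?d \<in> carrier Lop" using Lop_closed(1,7) \<tau> by blast
        have "hnorm (?d x) \<le> cnorm Lop ?d * hnorm x" using Lop_hnorm[OF d x] .
        also have "\<dots> \<le> cnorm Lop ?d * (hnorm x + 1)"
          using Lop_norm_nonneg[OF d] by (intro mult_left_mono) auto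
        also have "\<dots> < e" using N[OF that] hnorm_nonneg[OF x] by (simp add: field_simps)
        finally show ?thesis using x by (simp add: Lop_simps)
      qed
      thus ?thesis by blast
    qed
    thus ?thesis using hnorm_complete[of "\<lambda>n. \<tau> n x"] Lop_in[OF \<tau> x] by blast
  qed
  \<comment> \<open>Every bound for an operator is one for its adjoint, so the adjoints form a
    Cauchy sequence too.\<close>
  have Cau': "\<exists>N. \<forall>m\<ge>N. \<forall>n\<ge>N. cnorm Lop (adj Lop (\<sigma> m) \<oplus>\<^bsub>Lop\<^esub> (-1) \<odot>\<^bsub>Lop\<^esub> adj Lop (\<sigma> n)) < e"
    if "e > 0" for e
  proof -
    have "cnorm Lop (adj Lop (\<sigma> m) \<oplus>\<^bsub>Lop\<^esub> (-1) \<odot>\<^bsub>Lop\<^esub> adj Lop (\<sigma> n)) \<le>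
        cnorm Lop (\<sigma> m \<oplus>\<^bsub>Lop\<^esub> (-1) \<odot>\<^bsub>Lop\<^esub> \<sigma> n)" for m n
    proof -
      let ?d = "\<sigma> m \<oplus>\<^bsub>Lop\<^esub> (-1) \<odot>\<^bsub>Lop\<^esub> \<sigma> n"
      have d: "?d \<in> carrier Lop" using Lop_closed(1,7) \<sigma> by blast
      have "adj Lop ?d = adj Lop (\<sigma> m) \<oplus>\<^bsub>Lop\<^esub> (-1) \<odot>\<^bsub>Lop\<^esub> adj Lop (\<sigma> n)"
        by (simp add: Lop_closed(2)[OF \<sigma> Lop_closed(7)[OF \<sigma> \<sigma>]] Lop_closed(8)[OF \<sigma> \<sigma>])
      thus ?thesis
        using Lop_norm_le[OF adjoint_pair_bounded[OF LopD(2)[OF d] Lop_bounded[OF d]]] by simp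
    qed
    thus ?thesis using Cau[OF that] by (meson le_less_trans)
  qed
  obtain f where f: "\<And>x. x \<in> carrier X \<Longrightarrow> f x \<in> carrier X"
    "\<And>x e. x \<in> carrier X \<Longrightarrow> e > 0 \<Longrightarrow> \<exists>N. \<forall>n\<ge>N. hnorm (\<sigma> n x \<oplus>\<^bsub>X\<^esub> (-1) \<odot>\<^bsub>X\<^esub> f x) < e"
    using lim[OF \<sigma> Cau] by metis
  obtain g where g: "\<And>x. x \<in> carrier X \<Longrightarrow> g x \<in> carrier X"
    "\<And>x e. x \<in> carrier X \<Longrightarrow> e > 0 \<Longrightarrow> \<exists>N. \<forall>n\<ge>N. hnorm (adj Lop (\<sigma> n) x \<oplus>\<^bsub>X\<^esub> (-1) \<odot>\<^bsub>X\<^esub> g x) < e"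
    using lim[OF Lop_adj(1)[OF \<sigma>] Cau'] by metis
  have ipconv: "cconv (\<lambda>n. ip x (u n)) (ip x y)"
    if x: "x \<in> carrier X" "y \<in> carrier X" and u: "\<And>n. u n \<in> carrier X"
      and c: "\<And>e. e > 0 \<Longrightarrow> \<exists>N. \<forall>n\<ge>N. hnorm (u n \<oplus>\<^bsub>X\<^esub> (-1) \<odot>\<^bsub>X\<^esub> y) < e" for x y u
  proof (rule cconv_dominated)
    have "(\<lambda>n. hnorm (u n \<oplus>\<^bsub>X\<^esub> (-1) \<odot>\<^bsub>X\<^esub> y)) \<longlonglongrightarrow> 0"
      using c u x unfolding LIMSEQ_iff by (auto simp: abs_of_nonneg)
    thus "(\<lambda>n. hnorm x * hnorm (u n \<oplus>\<^bsub>X\<^esub> (-1) \<odot>\<^bsub>X\<^esub> y)) \<longlonglongrightarrow> 0"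
      by (rule tendsto_mult_right_zero)
    fix n
    have "ip x (u n) \<ominus> ip x y = ip x (u n \<oplus>\<^bsub>X\<^esub> (-1) \<odot>\<^bsub>X\<^esub> y)"
      using x u by (simp add: ip_add_right ip_smult_right minus_eq)
    thus "cnorm A (ip x (u n) \<ominus> ip x y) \<le> hnorm x * hnorm (u n \<oplus>\<^bsub>X\<^esub> (-1) \<odot>\<^bsub>X\<^esub> y)"
      using ip_cauchy_schwarz x u by simp
  qed (use x u in auto)
  have fg: "adjoint_pair f g"
    unfolding adjoint_pair_def
  proof (intro conjI ballI)
    fix x y assume x: "x \<in> carrier X" and y: "y \<in> carrier X"
    have "cconv (\<lambda>n. ip y (\<sigma> n x)) (ip y (f x))"
      using f x y Lop_in[OF \<sigma>] by (intro ipconv) auto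
    from cconv_adj[OF this] have "cconv (\<lambda>n. ip (\<sigma> n x) y) (ip (f x) y)"
      using x y f Lop_in[OF \<sigma>] by (simp add: adj_ip)
    hence "cconv (\<lambda>n. ip x (adj Lop (\<sigma> n) y)) (ip (f x) y)"
      using adjoint_pairD(3)[OF LopD(2)[OF \<sigma>] x y] by simp
    moreover have "cconv (\<lambda>n. ip x (adj Lop (\<sigma> n) y)) (ip x (g y))"
      using g x y Lop_in[OF Lop_adj(1)[OF \<sigma>]] by (intro ipconv) auto
    ultimately show "ip (f x) y = ip x (g y)" by (rule cconv_unique)
  qed (use f g in auto)
  \<comment> \<open>The Cauchy estimate does not depend on \<open>x\<close>; comparison with a late
    member of the sequence turns it into an estimate for the limit that is uniform on the unit
    ball.\<close>
  have unif: "hnorm (\<sigma> n x \<oplus>\<^bsub>X\<^esub> (-1) \<odot>\<^bsub>X\<^esub> f x) \<le> e * hnorm x"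
    if N: "\<And>m n. m \<ge> N \<Longrightarrow> n \<ge> N \<Longrightarrow> cnorm Lop (\<sigma> m \<oplus>\<^bsub>Lop\<^esub> (-1) \<odot>\<^bsub>Lop\<^esub> \<sigma> n) < e"
      and n: "n \<ge> N" and x: "x \<in> carrier X" for N n e x
  proof (rule field_le_epsilon)
    fix \<epsilon> :: real assume "\<epsilon> > 0"
    then obtain M where M: "\<And>m. m \<ge> M \<Longrightarrow> hnorm (\<sigma> m x \<oplus>\<^bsub>X\<^esub> (-1) \<odot>\<^bsub>X\<^esub> f x) < \<epsilon>" using f(2)[OF x] by blast
    let ?m = "max M N"
    note s = Lop_in[OF \<sigma> x]
    have "\<sigma> n x \<oplus>\<^bsub>X\<^esub> (-1) \<odot>\<^bsub>X\<^esub> f x =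
        (\<sigma> n x \<oplus>\<^bsub>X\<^esub> ((-1) \<odot>\<^bsub>X\<^esub> \<sigma> ?m x \<oplus>\<^bsub>X\<^esub> \<sigma> ?m x)) \<oplus>\<^bsub>X\<^esub> (-1) \<odot>\<^bsub>X\<^esub> f x"
      using s f(1)[OF x] by (simp add: X_neg)
    also have "\<dots> = (\<sigma> n x \<oplus>\<^bsub>X\<^esub> (-1) \<odot>\<^bsub>X\<^esub> \<sigma> ?m x) \<oplus>\<^bsub>X\<^esub> (\<sigma> ?m x \<oplus>\<^bsub>X\<^esub> (-1) \<odot>\<^bsub>X\<^esub> f x)"
      using s f(1)[OF x] by (simp add: X.a_assoc)
    finally have "hnorm (\<sigma> n x \<oplus>\<^bsub>X\<^esub> (-1) \<odot>\<^bsub>X\<^esub> f x) \<le>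
        hnorm (\<sigma> n x \<oplus>\<^bsub>X\<^esub> (-1) \<odot>\<^bsub>X\<^esub> \<sigma> ?m x) + hnorm (\<sigma> ?m x \<oplus>\<^bsub>X\<^esub> (-1) \<odot>\<^bsub>X\<^esub> f x)"
      using s f(1)[OF x] hnorm_add by simp
    also have "hnorm (\<sigma> n x \<oplus>\<^bsub>X\<^esub> (-1) \<odot>\<^bsub>X\<^esub> \<sigma> ?m x) \<le> e * hnorm x"
    proof -
      let ?d = "\<sigma> n \<oplus>\<^bsub>Lop\<^esub> (-1) \<odot>\<^bsub>Lop\<^esub> \<sigma> ?m"
      have d: "?d \<in> carrier Lop" using Lop_closed(1,7) \<sigma> by blast
      have "hnorm (?d x) \<le> cnorm Lop ?d * hnorm x" by (rule Lop_hnorm[OF d x])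
      also have "\<dots> \<le> e * hnorm x" using N[OF n, of ?m] x by (intro mult_right_mono) auto
      finally show ?thesis using x by (simp add: Lop_simps)
    qed
    also have "hnorm (\<sigma> ?m x \<oplus>\<^bsub>X\<^esub> (-1) \<odot>\<^bsub>X\<^esub> f x) \<le> \<epsilon>" using M[of ?m] by simp
    finally show "hnorm (\<sigma> n x \<oplus>\<^bsub>X\<^esub> (-1) \<odot>\<^bsub>X\<^esub> f x) \<le> e * hnorm x + \<epsilon>" by simp
  qed
  obtain N where N: "\<And>m n. m \<ge> N \<Longrightarrow> n \<ge> N \<Longrightarrow> cnorm Lop (\<sigma> m \<oplus>\<^bsub>Lop\<^esub> (-1) \<odot>\<^bsub>Lop\<^esub> \<sigma> n) < 1"
    using Cau[of 1] by auto
  have "hnorm (f x) \<le> (1 + cnorm Lop (\<sigma> N)) * hnorm x" if x: "x \<in> carrier X" for x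
  proof -
    note s = Lop_in[OF \<sigma> x, of N] f(1)[OF x]
    have "f x = (-1) \<odot>\<^bsub>X\<^esub> (\<sigma> N x \<oplus>\<^bsub>X\<^esub> (-1) \<odot>\<^bsub>X\<^esub> f x) \<oplus>\<^bsub>X\<^esub> \<sigma> N x"
    proof -
      have "(-1) \<odot>\<^bsub>X\<^esub> (\<sigma> N x \<oplus>\<^bsub>X\<^esub> (-1) \<odot>\<^bsub>X\<^esub> f x) = (-1) \<odot>\<^bsub>X\<^esub> \<sigma> N x \<oplus>\<^bsub>X\<^esub> f x"
        using s X.smult_assoc1[of "-1" "-1" "f x"] X.smult_r_distr[of "-1" "\<sigma> N x" "(-1) \<odot>\<^bsub>X\<^esub> f x"] by simp
      moreover have "((-1) \<odot>\<^bsub>X\<^esub> \<sigma> N x \<oplus>\<^bsub>X\<^esub> f x) \<oplus>\<^bsub>X\<^esub> \<sigma> N x = f x"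
        using s X.a_comm[of "(-1) \<odot>\<^bsub>X\<^esub> \<sigma> N x" "f x"] by (simp add: X.a_assoc X_neg)
      ultimately show ?thesis by simp
    qed
    hence "hnorm (f x) \<le> hnorm ((-1) \<odot>\<^bsub>X\<^esub> (\<sigma> N x \<oplus>\<^bsub>X\<^esub> (-1) \<odot>\<^bsub>X\<^esub> f x)) + hnorm (\<sigma> N x)"
      using hnorm_add[of "(-1) \<odot>\<^bsub>X\<^esub> (\<sigma> N x \<oplus>\<^bsub>X\<^esub> (-1) \<odot>\<^bsub>X\<^esub> f x)" "\<sigma> N x"] s by simp
    also have "\<dots> = hnorm (\<sigma> N x \<oplus>\<^bsub>X\<^esub> (-1) \<odot>\<^bsub>X\<^esub> f x) + hnorm (\<sigma> N x)"
      using s by (simp add: hnorm_smult)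
    also have "\<dots> \<le> 1 * hnorm x + cnorm Lop (\<sigma> N) * hnorm x"
      using unif[OF N order_refl x] Lop_hnorm[OF \<sigma> x] by (intro add_mono) auto
    finally show ?thesis by (simp add: algebra_simps)
  qed
  hence fb: "bounded_by (1 + cnorm Lop (\<sigma> N)) f"
    using Lop_norm_nonneg[OF \<sigma>] by (auto simp: bounded_by_def)
  let ?f = "restrict f (carrier X)"
  show ?thesis
  proof (intro bexI[of _ ?f] allI impI)
    show "?f \<in> carrier Lop" by (rule LopI(1)[OF fg fb])
    fix e :: real assume e: "e > 0"
    then obtain N where N: "\<And>m n. m \<ge> N \<Longrightarrow> n \<ge> N \<Longrightarrow> cnorm Lop (\<sigma> m \<oplus>\<^bsub>Lop\<^esub> (-1) \<odot>\<^bsub>Lop\<^esub> \<sigma> n) < e/2"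
      using Cau[of "e/2"] by auto
    have "cnorm Lop (\<sigma> n \<oplus>\<^bsub>Lop\<^esub> (-1) \<odot>\<^bsub>Lop\<^esub> ?f) < e" if "n \<ge> N" for n
    proof -
      have "bounded_by (e/2) (\<sigma> n \<oplus>\<^bsub>Lop\<^esub> (-1) \<odot>\<^bsub>Lop\<^esub> ?f)"
        using unif[OF N that] e by (simp add: bounded_by_def Lop_simps)
      from Lop_norm_le[OF this] show ?thesis using e by simp
    qed
    thus "\<exists>N. \<forall>n\<ge>N. cnorm Lop (\<sigma> n \<oplus>\<^bsub>Lop\<^esub> (-1) \<odot>\<^bsub>Lop\<^esub> ?f) < e" by blast
  qed
qed

theorem Lop_cstar: "cstar_algebra Lop"
proof (rule cstar_algebraI)
  note E = Lop_ext and C = Lop_closed Lop_zero Lop_adj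
  note S = Lop_simps(1-5) restrict_def
  have add_in: "f \<oplus>\<^bsub>Lop\<^esub> g \<in> carrier Lop" and mult_in: "f \<otimes>\<^bsub>Lop\<^esub> g \<in> carrier Lop"
    if "f \<in> carrier Lop" "g \<in> carrier Lop" for f g
    using Lop_closed(1,4)[OF that] .
  have smul_in: "c \<odot>\<^bsub>Lop\<^esub> f \<in> carrier Lop" if "f \<in> carrier Lop" for f c
    by (rule Lop_closed(7)[OF that that])
  note cl = add_in mult_in smul_in Lop_zero
  fix f assume f: "f \<in> carrier Lop"
  note I = Lop_in[OF f] and L = adjoint_pair_linear[OF LopD(2)[OF f]]
  show "0 \<le> cnorm Lop f" by (rule Lop_norm_nonneg[OF f])
  show "\<zero>\<^bsub>Lop\<^esub> \<oplus>\<^bsub>Lop\<^esub> f = f" by (rule E, simp only: cl f, simp only: cl f, simp add: S I)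
  show "(-1) \<odot>\<^bsub>Lop\<^esub> f \<oplus>\<^bsub>Lop\<^esub> f = \<zero>\<^bsub>Lop\<^esub>"
    by (rule E, simp only: cl f, simp only: cl f, simp add: S I X_neg)
  show "(a + b) \<odot>\<^bsub>Lop\<^esub> f = a \<odot>\<^bsub>Lop\<^esub> f \<oplus>\<^bsub>Lop\<^esub> b \<odot>\<^bsub>Lop\<^esub> f" for a b
    by (rule E, simp only: cl f, simp only: cl f, insert X.smult_l_distr[of a b], simp add: S I X_neg)
  show "(a * b) \<odot>\<^bsub>Lop\<^esub> f = a \<odot>\<^bsub>Lop\<^esub> (b \<odot>\<^bsub>Lop\<^esub> f)" for a b
    by (rule E, simp only: cl f, simp only: cl f, insert X.smult_assoc1[of a b], simp add: S I X_neg)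
  show "1 \<odot>\<^bsub>Lop\<^esub> f = f" by (rule E, simp only: cl f, simp only: cl f, simp add: S I)
  show n0: "cnorm Lop f = 0 \<longleftrightarrow> f = \<zero>\<^bsub>Lop\<^esub>"
  proof
    assume 0: "cnorm Lop f = 0"
    show "f = \<zero>\<^bsub>Lop\<^esub>"
    proof (rule E[OF f Lop_zero])
      fix x assume x: "x \<in> carrier X"
      have "hnorm (f x) = 0" using Lop_hnorm[OF f x] hnorm_nonneg[OF I[OF x]] 0 by simp
      thus "f x = \<zero>\<^bsub>Lop\<^esub> x" using x I by (simp add: hnorm_eq_0 S)
    qed
  next
    assume "f = \<zero>\<^bsub>Lop\<^esub>"
    hence "bounded_by 0 f" by (auto simp: bounded_by_def S hnorm_eq_0)
    thus "cnorm Lop f = 0" using Lop_norm_le Lop_norm_nonneg[OF f] by force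
  qed
  \<comment> \<open>The square of \<open>\<parallel>f x\<parallel>\<close> is the norm of the inner
    product of \<open>x\<close> with \<open>f\<^sup>* f x\<close>, hence at most
    \<open>\<parallel>f\<^sup>* f\<parallel> \<parallel>x\<parallel>\<^sup>2\<close>.\<close>
  show "(cnorm Lop f)\<^sup>2 \<le> cnorm Lop (adj Lop f \<otimes>\<^bsub>Lop\<^esub> f)"
  proof -
    let ?g = "adj Lop f"
    let ?K = "cnorm Lop (?g \<otimes>\<^bsub>Lop\<^esub> f)"
    have gf: "?g \<otimes>\<^bsub>Lop\<^esub> f \<in> carrier Lop" by (rule C(4)[OF Lop_adj(1)[OF f] f])
    have "bounded_by (sqrt ?K) f"
      unfolding bounded_by_def
    proof (intro conjI ballI)
      fix x assume x: "x \<in> carrier X"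
      have "(hnorm (f x))\<^sup>2 = cnorm A (ip x (?g (f x)))"
        using adjoint_pairD(3)[OF LopD(2)[OF f], of x "f x"] x I by (simp add: hnorm_sq)
      also have "\<dots> \<le> hnorm x * hnorm ((?g \<otimes>\<^bsub>Lop\<^esub> f) x)"
        using ip_cauchy_schwarz[OF x Lop_in[OF gf x]] x by (simp add: S)
      also have "\<dots> \<le> hnorm x * (?K * hnorm x)"
        by (rule mult_left_mono[OF Lop_hnorm[OF gf x] hnorm_nonneg[OF x]])
      also have "\<dots> = (sqrt ?K * hnorm x)\<^sup>2"
        using Lop_norm_nonneg[OF gf] by (simp add: power_mult_distrib) (simp add: power2_eq_square)
      finally show "hnorm (f x) \<le> sqrt ?K * hnorm x"
        by (rule power2_le_imp_le) (use Lop_norm_nonneg[OF gf] x in simp)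
    qed (use Lop_norm_nonneg[OF gf] in simp)
    from Lop_norm_le[OF this] have "cnorm Lop f \<le> sqrt ?K" .
    hence "(cnorm Lop f)\<^sup>2 \<le> (sqrt ?K)\<^sup>2" using Lop_norm_nonneg[OF f] by (intro power_mono)
    thus "(cnorm Lop f)\<^sup>2 \<le> ?K" using Lop_norm_nonneg[OF gf] by simp
  qed
  fix g assume g: "g \<in> carrier Lop"
  note Ig = Lop_in[OF g]
  show "f \<oplus>\<^bsub>Lop\<^esub> g = g \<oplus>\<^bsub>Lop\<^esub> f"
    by (rule E, simp only: cl f g, simp only: cl f g, simp add: S I Ig X.a_comm)
  show "a \<odot>\<^bsub>Lop\<^esub> (f \<oplus>\<^bsub>Lop\<^esub> g) = a \<odot>\<^bsub>Lop\<^esub> f \<oplus>\<^bsub>Lop\<^esub> a \<odot>\<^bsub>Lop\<^esub> g" for a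
    by (rule E, simp only: cl f g, simp only: cl f g, insert X.smult_r_distr[of a], simp add: S I Ig)
  show "(a \<odot>\<^bsub>Lop\<^esub> f) \<otimes>\<^bsub>Lop\<^esub> g = a \<odot>\<^bsub>Lop\<^esub> (f \<otimes>\<^bsub>Lop\<^esub> g)" for a
    by (rule E, simp only: cl f g, simp only: cl f g, simp add: S I Ig)
  show "f \<otimes>\<^bsub>Lop\<^esub> (a \<odot>\<^bsub>Lop\<^esub> g) = a \<odot>\<^bsub>Lop\<^esub> (f \<otimes>\<^bsub>Lop\<^esub> g)" for a
    by (rule E, simp only: cl f g, simp only: cl f g, simp add: S I Ig L)
  fix h assume h: "h \<in> carrier Lop"
  note Ih = Lop_in[OF h]
  show "f \<oplus>\<^bsub>Lop\<^esub> g \<oplus>\<^bsub>Lop\<^esub> h = f \<oplus>\<^bsub>Lop\<^esub> (g \<oplus>\<^bsub>Lop\<^esub> h)"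
    by (rule E, simp only: cl f g h, simp only: cl f g h, simp add: S I Ig Ih X.a_assoc )
  show "f \<otimes>\<^bsub>Lop\<^esub> g \<otimes>\<^bsub>Lop\<^esub> h = f \<otimes>\<^bsub>Lop\<^esub> (g \<otimes>\<^bsub>Lop\<^esub> h)"
    by (rule E, simp only: cl f g h, simp only: cl f g h, simp add: S I Ig Ih )
  show "(f \<oplus>\<^bsub>Lop\<^esub> g) \<otimes>\<^bsub>Lop\<^esub> h = f \<otimes>\<^bsub>Lop\<^esub> h \<oplus>\<^bsub>Lop\<^esub> g \<otimes>\<^bsub>Lop\<^esub> h"
    by (rule E, simp only: cl f g h, simp only: cl f g h, simp add: S I Ig Ih )
  show "h \<otimes>\<^bsub>Lop\<^esub> (f \<oplus>\<^bsub>Lop\<^esub> g) = h \<otimes>\<^bsub>Lop\<^esub> f \<oplus>\<^bsub>Lop\<^esub> h \<otimes>\<^bsub>Lop\<^esub> g"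
    by (rule E, simp only: cl f g h, simp only: cl f g h, simp add: S I Ig Ih adjoint_pair_linear(1)[OF LopD(2)[OF h]] )
qed (rule Lop_closed Lop_zero Lop_adj Lop_complete; assumption)+

sublocale Lop: unital_cstar_algebra Lop
proof -
  interpret L: cstar_algebra Lop by (rule Lop_cstar)
  show "unital_cstar_algebra Lop"
  proof
    fix f assume f: "f \<in> carrier Lop"
    note C = Lop_closed(4)[OF f Lop_one] Lop_closed(4)[OF Lop_one f] Lop_one
    show "\<one>\<^bsub>Lop\<^esub> \<otimes>\<^bsub>Lop\<^esub> f = f" "f \<otimes>\<^bsub>Lop\<^esub> \<one>\<^bsub>Lop\<^esub> = f"
      by (rule Lop_ext; use f C Lop_in[OF f] in \<open>auto simp: Lop_simps\<close>)+
  qed (rule Lop_one)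
qed

end

section \<open>Consequences for general C*-algebras\<close>

context cstar_algebra
begin

lemma hilbert_module_self: "hilbert_module A A (\<lambda>x y. adj A x \<otimes> y)"
proof (rule hilbert_module.intro)
  show "hilbert_module_axioms A A (\<lambda>x y. adj A x \<otimes> y)"
  proof
    fix x y assume xy: "x \<in> carrier A" "y \<in> carrier A"
    have "cnorm A (adj A x \<otimes> y) \<le> cnorm A x * cnorm A y"
      using cnorm_mult[of "adj A x" y] xy by (simp add: cnorm_adj)
    thus "cnorm A (adj A x \<otimes> y) \<le> sqrt (cnorm A (adj A x \<otimes> x)) * sqrt (cnorm A (adj A y \<otimes> y))"
      using xy by (simp add: cnorm_adj_mult cnorm_nonneg)
  next
    fix \<sigma> :: "nat \<Rightarrow> 'a"
    assume c: "\<And>n. \<sigma> n \<in> carrier A"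
      and Cau: "\<And>e. e > 0 \<Longrightarrow> \<exists>N. \<forall>m\<ge>N. \<forall>n\<ge>N.
        sqrt (cnorm A (adj A (\<sigma> m \<oplus> (-1) \<odot> \<sigma> n) \<otimes> (\<sigma> m \<oplus> (-1) \<odot> \<sigma> n))) < e"
    have eq: "sqrt (cnorm A (adj A (x \<oplus> (-1) \<odot> y) \<otimes> (x \<oplus> (-1) \<odot> y))) = cnorm A (x \<ominus> y)"
      if "x \<in> carrier A" "y \<in> carrier A" for x y
      using that cnorm_adj_mult[of "x \<ominus> y"] by (simp add: minus_eq cnorm_nonneg)
    obtain x where x: "cconv \<sigma> x"
      using complete_cconv[of \<sigma>] c Cau unfolding eq[OF c c] by blast
    have "\<exists>N. \<forall>n\<ge>N. cnorm A (\<sigma> n \<ominus> x) < e" if e: "e > 0" for e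
    proof -
      obtain N where "\<forall>n\<ge>N. cnorm A (\<sigma> n \<ominus> x) \<le> e/2" using cconvD[OF x half_gt_zero[OF e]] by blast
      thus ?thesis using e by (intro exI[of _ N]) fastforce
    qed
    thus "\<exists>x\<in>carrier A. \<forall>e>0. \<exists>N. \<forall>n\<ge>N.
        sqrt (cnorm A (adj A (\<sigma> n \<oplus> (-1) \<odot> x) \<otimes> (\<sigma> n \<oplus> (-1) \<odot> x))) < e"
      using cconv_in(2)[OF x] by (intro bexI[of _ x]) (simp_all add: eq[OF c])
  qed (auto simp: mult_distr_right smult_mult_right adj_mult adj_adj intro: adj_mult_zero)
qed unfold_locales

text \<open>\<open>A\<close> acts on itself by left multiplication, and the adjointable operators
  have a unit. The action is isometric: applied to \<open>adj A a\<close> it yields an element whose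
  norm is the square of that of \<open>a\<close>.\<close>

lemma unital_embedding:
  obtains U :: "('a \<Rightarrow> 'a) cstar" and j where "unital_cstar_algebra U" "j \<in> star_hom A U"
    "\<And>x. x \<in> carrier A \<Longrightarrow> cnorm U (j x) = cnorm A x"
proof -
  interpret R: hilbert_module A A "\<lambda>x y. adj A x \<otimes> y" by (rule hilbert_module_self)
  have hn: "R.hnorm x = cnorm A x" if "x \<in> carrier A" for x
    using that by (simp add: R.hnorm_def cnorm_adj_mult cnorm_nonneg)
  define j where "j a = restrict (\<lambda>x. a \<otimes> x) (carrier A)" for a
  have p: "R.adjoint_pair (\<lambda>x. a \<otimes> x) (\<lambda>x. adj A a \<otimes> x)" if "a \<in> carrier A" for a
    using that by (auto simp: R.adjoint_pair_def adj_mult mult_assoc)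
  have b: "R.bounded_by (cnorm A a) (\<lambda>x. a \<otimes> x)" if "a \<in> carrier A" for a
    using that by (auto simp: R.bounded_by_def hn cnorm_nonneg cnorm_mult)
  have jc: "j a \<in> carrier R.Lop" and jadj: "adj R.Lop (j a) = j (adj A a)" if "a \<in> carrier A" for a
    using R.LopI[OF p[OF that] b[OF that]] by (simp_all add: j_def)
  have jhom: "j \<in> star_hom A R.Lop"
  proof (rule star_homI)
    fix x y c assume xy: "x \<in> carrier A" "y \<in> carrier A"
    show "j (x \<oplus> y) = j x \<oplus>\<^bsub>R.Lop\<^esub> j y" "j (x \<otimes> y) = j x \<otimes>\<^bsub>R.Lop\<^esub> j y" 
      using xy by (auto simp: j_def R.Lop_simps mult_distr_left mult_assoc restrict_def)
  next
    fix x c assume x: "x \<in> carrier A"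
    show "j (c \<odot> x) = c \<odot>\<^bsub>R.Lop\<^esub> j x"
      using x by (auto simp: j_def R.Lop_simps smult_mult_left restrict_def)
  qed (simp_all add: jc jadj)
  have "cnorm R.Lop (j a) = cnorm A a" if a: "a \<in> carrier A" for a
  proof (rule antisym)
    show "cnorm R.Lop (j a) \<le> cnorm A a"
      using b[OF a] by (intro R.Lop_norm_le) (simp add: R.bounded_by_def j_def)
    show "cnorm A a \<le> cnorm R.Lop (j a)"
    proof (cases "cnorm A a = 0")
      case True
      then show ?thesis using R.Lop_norm_nonneg[OF jc[OF a]] by simp
    next
      case False
      have "cnorm A a * cnorm A a = cnorm A (j a (adj A a))"
        using a cnorm_adj_mult[of "adj A a"] by (simp add: j_def adj_adj cnorm_adj power2_eq_square)
      also have "\<dots> \<le> cnorm R.Lop (j a) * cnorm A a"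
        using R.Lop_hnorm[OF jc[OF a], of "adj A a"] R.Lop_in[OF jc[OF a], of "adj A a"] a
        by (simp add: hn cnorm_adj)
      finally show ?thesis using False cnorm_nonneg[OF a] by (simp add: mult_le_cancel_right)
    qed
  qed
  thus ?thesis using that[OF R.Lop.unital_cstar_algebra_axioms jhom] by blast
qed

lemma cnorm_adj_mult_mono:
  assumes y: "y \<in> carrier A" and z: "z \<in> carrier A"
  shows "(cnorm A y)\<^sup>2 \<le> cnorm A (adj A y \<otimes> y \<oplus> adj A z \<otimes> z)"
proof -
  obtain U :: "('a \<Rightarrow> 'a) cstar" and j where U: "unital_cstar_algebra U" and j: "j \<in> star_hom A U"
    and iso: "\<And>x. x \<in> carrier A \<Longrightarrow> cnorm U (j x) = cnorm A x" by (rule unital_embedding, rule that)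
  interpret U: unital_cstar_algebra U by (rule U)
  note D = star_homD[OF j]
  have "(cnorm A y)\<^sup>2 = cnorm U (adj U (j y) \<otimes>\<^bsub>U\<^esub> j y)"
    using y by (simp add: U.cnorm_adj_mult D iso)
  also have "\<dots> \<le> cnorm U (adj U (j y) \<otimes>\<^bsub>U\<^esub> j y \<oplus>\<^bsub>U\<^esub> adj U (j z) \<otimes>\<^bsub>U\<^esub> j z)"
    using y z D(1) by (intro U.pos_cnorm_mono U.pos_adj_mult) auto
  also have "\<dots> = cnorm A (adj A y \<otimes> y \<oplus> adj A z \<otimes> z)"
    using y z by (simp add: iso flip: D(2,4,5))
  finally show ?thesis .
qed

text \<open>In a unital algebra around \<open>A\<close> the element \<open>1 - a\<close> has norm at
  most one, \<open>a\<close> being positive. The equation for \<open>e\<close> amounts to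
  \<open>(1 + \<epsilon>) (1 - e) = \<epsilon> + (1 - a) (1 - e)\<close>, which bounds
  \<open>1 - e\<close> by one independently of \<open>\<epsilon>\<close>.\<close>

lemma cnorm_diff_mult_le:
  assumes y: "y \<in> carrier A" and z: "z \<in> carrier A" and x: "x \<in> carrier A"
    and a: "a = adj A y \<otimes> y \<oplus> adj A z \<otimes> z" "cnorm A a \<le> 1"
  shows "cnorm A (x \<ominus> a \<otimes> x) \<le> cnorm A x"
    and "\<lbrakk>e \<in> carrier A; \<epsilon> > 0; a \<ominus> a \<otimes> e = complex_of_real \<epsilon> \<odot> e\<rbrakk> \<Longrightarrow> cnorm A e \<le> 2"
proof -
  obtain U :: "('a \<Rightarrow> 'a) cstar" and j where U: "unital_cstar_algebra U" and j: "j \<in> star_hom A U"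
    and iso: "\<And>x. x \<in> carrier A \<Longrightarrow> cnorm U (j x) = cnorm A x" by (rule unital_embedding, rule that)
  interpret U: unital_cstar_algebra U by (rule U)
  note D = star_homD[OF j]
  have A: "cstar_algebra A" and UC: "cstar_algebra U" by unfold_locales
  have ac: "a \<in> carrier A" using a(1) y z by simp
  have ja: "j a = adj U (j y) \<otimes>\<^bsub>U\<^esub> j y \<oplus>\<^bsub>U\<^esub> adj U (j z) \<otimes>\<^bsub>U\<^esub> j z"
    unfolding a(1) using y z by (simp add: D)
  have "U.pos (j a)" unfolding ja using y z D(1) by (intro U.pos_add U.pos_adj_mult) auto
  hence n1: "cnorm U (\<one>\<^bsub>U\<^esub> \<ominus>\<^bsub>U\<^esub> j a) \<le> 1" using iso[OF ac] a(2) by (intro U.pos_norm_one_minus) auto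
  have jac: "j a \<in> carrier U" using D(1)[OF ac] .
  have n: "cnorm U ((\<one>\<^bsub>U\<^esub> \<ominus>\<^bsub>U\<^esub> j a) \<otimes>\<^bsub>U\<^esub> w) \<le> cnorm U w" if w: "w \<in> carrier U" for w
    using U.cnorm_mult[of "\<one>\<^bsub>U\<^esub> \<ominus>\<^bsub>U\<^esub> j a" w] mult_right_mono[OF n1 U.cnorm_nonneg[OF w]] w jac by simp
  have jx: "j (x \<ominus> a \<otimes> x) = (\<one>\<^bsub>U\<^esub> \<ominus>\<^bsub>U\<^esub> j a) \<otimes>\<^bsub>U\<^esub> j x"
    using x ac D(1)[OF x] jac by (simp add: star_hom_diff[OF A UC j] D U.mult_diff_left)
  have "cnorm A (x \<ominus> a \<otimes> x) = cnorm U (j (x \<ominus> a \<otimes> x))" using x ac by (simp add: iso)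
  also have "\<dots> \<le> cnorm U (j x)" unfolding jx by (rule n[OF D(1)[OF x]])
  finally show "cnorm A (x \<ominus> a \<otimes> x) \<le> cnorm A x" using iso[OF x] by simp
  assume e: "e \<in> carrier A" and \<epsilon>: "\<epsilon> > 0" and eq: "a \<ominus> a \<otimes> e = complex_of_real \<epsilon> \<odot> e"
  note jec = D(1)[OF e]
  have jeq: "j a \<ominus>\<^bsub>U\<^esub> j a \<otimes>\<^bsub>U\<^esub> j e = complex_of_real \<epsilon> \<odot>\<^bsub>U\<^esub> j e"
    using arg_cong[OF eq, of j] e ac by (simp add: star_hom_diff[OF A UC j] D)
  let ?f = "\<one>\<^bsub>U\<^esub> \<ominus>\<^bsub>U\<^esub> j e"
  have f: "?f \<in> carrier U" using jec by simp
  have "complex_of_real (1 + \<epsilon>) \<odot>\<^bsub>U\<^esub> ?f = complex_of_real \<epsilon> \<odot>\<^bsub>U\<^esub> \<one>\<^bsub>U\<^esub> \<oplus>\<^bsub>U\<^esub>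
      ((\<one>\<^bsub>U\<^esub> \<ominus>\<^bsub>U\<^esub> j a) \<otimes>\<^bsub>U\<^esub> ?f \<oplus>\<^bsub>U\<^esub> ((j a \<ominus>\<^bsub>U\<^esub> j a \<otimes>\<^bsub>U\<^esub> j e) \<ominus>\<^bsub>U\<^esub> complex_of_real \<epsilon> \<odot>\<^bsub>U\<^esub> j e))"
    by (rule U.nc_eqI[where xs = "[j a, j e]"], (rule U.nc_reify)+) (use jac jec in simp_all)
  also have "(j a \<ominus>\<^bsub>U\<^esub> j a \<otimes>\<^bsub>U\<^esub> j e) \<ominus>\<^bsub>U\<^esub> complex_of_real \<epsilon> \<odot>\<^bsub>U\<^esub> j e = \<zero>\<^bsub>U\<^esub>"
    unfolding jeq using jec by (simp add: U.diff_self)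
  finally have fe: "complex_of_real (1 + \<epsilon>) \<odot>\<^bsub>U\<^esub> ?f =
      complex_of_real \<epsilon> \<odot>\<^bsub>U\<^esub> \<one>\<^bsub>U\<^esub> \<oplus>\<^bsub>U\<^esub> (\<one>\<^bsub>U\<^esub> \<ominus>\<^bsub>U\<^esub> j a) \<otimes>\<^bsub>U\<^esub> ?f" using jac f by simp
  have "(1 + \<epsilon>) * cnorm U ?f = cnorm U (complex_of_real (1 + \<epsilon>) \<odot>\<^bsub>U\<^esub> ?f)"
    using f \<epsilon> by (subst U.cnorm_smult) (simp_all del: of_real_add)
  also have "\<dots> \<le> \<epsilon> + cnorm U ?f"
    unfolding fe
    using U.cnorm_add[of "complex_of_real \<epsilon> \<odot>\<^bsub>U\<^esub> \<one>\<^bsub>U\<^esub>" "(\<one>\<^bsub>U\<^esub> \<ominus>\<^bsub>U\<^esub> j a) \<otimes>\<^bsub>U\<^esub> ?f"]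
      U.cnorm_smult_one[of "complex_of_real \<epsilon>"] n[OF f] f jac \<epsilon> by simp
  finally have "\<epsilon> * cnorm U ?f \<le> \<epsilon> * 1" by (simp add: algebra_simps)
  hence f1: "cnorm U ?f \<le> 1" using \<epsilon> by (simp add: mult_le_cancel_left)
  have "j e = \<one>\<^bsub>U\<^esub> \<ominus>\<^bsub>U\<^esub> ?f"
    by (rule U.nc_eqI[where xs = "[j e]"], (rule U.nc_reify)+) (use jec in simp_all)
  hence "cnorm U (j e) \<le> cnorm U \<one>\<^bsub>U\<^esub> + cnorm U (\<ominus>\<^bsub>U\<^esub> ?f)"
    using U.cnorm_add[of "\<one>\<^bsub>U\<^esub>" "\<ominus>\<^bsub>U\<^esub> ?f"] f by (simp add: a_minus_def)
  thus "cnorm A e \<le> 2" using f1 U.cnorm_one f iso[OF e] by (simp add: U.cnorm_uminus)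
qed

text \<open>The element \<open>e\<close> plays the role of \<open>a (\<epsilon> + a)\<^bsup>-1\<^esup>\<close>; it is found in \<open>H\<close> as the fixed point of the
  contraction \<open>e \<mapsto> (a + (1 - a) e) / (1 + \<epsilon>)\<close>.\<close>

lemma approximate_unit_fixed_point:
  assumes H: "cstar_subalgebra H A" and y: "y \<in> carrier A" and z: "z \<in> carrier A"
    and a: "a = adj A y \<otimes> y \<oplus> adj A z \<otimes> z" "cnorm A a \<le> 1" "a \<in> H" and \<epsilon>: "\<epsilon> > 0"
  shows "\<exists>e\<in>H. cnorm A e \<le> 2 \<and> a \<ominus> a \<otimes> e = complex_of_real \<epsilon> \<odot> e"
proof -
  note HD = cstar_subalgebraD[OF H]
  interpret B: cstar_algebra "A\<lparr>carrier := H\<rparr>" by (rule subalgebra_cstar[OF H])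
  have ac: "a \<in> carrier A" using a HD(1) by blast
  have min: "a_minus (A\<lparr>carrier := H\<rparr>) x y = x \<ominus> y" if "x \<in> H" "y \<in> H" for x y
    using that HD(1) B.minus_eq[of x y] minus_eq[of x y] by (simp add: subset_iff)
  have dist: "cdist (A\<lparr>carrier := H\<rparr>) x y = cnorm A (x \<ominus> y)" if "x \<in> H" "y \<in> H" for x y
    using that by (simp add: cdist_def min)
  define r where "r = 1 / (1 + \<epsilon>)"
  have r: "0 < r" "r < 1" using \<epsilon> by (auto simp: r_def)
  define F where "F e = complex_of_real r \<odot> (a \<oplus> (e \<ominus> a \<otimes> e))" for e
  have FH: "F e \<in> H" if "e \<in> H" for e
    unfolding F_def by (intro HD(4) HD(3) subalgebra_diff[OF H] HD(5) that a(3))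
  have contr: "cnorm A (F x \<ominus> F y) \<le> r * cnorm A (x \<ominus> y)" if "x \<in> H" "y \<in> H" for x y
  proof -
    have xy: "x \<in> carrier A" "y \<in> carrier A" using that HD(1) by auto
    have "(a \<oplus> (x \<ominus> a \<otimes> x)) \<ominus> (a \<oplus> (y \<ominus> a \<otimes> y)) = (a \<ominus> a) \<oplus> ((x \<ominus> y) \<ominus> (a \<otimes> x \<ominus> a \<otimes> y))"
      using xy ac by (simp add: minus_eq smult_r_distr smult_smult a_ac)
    also have "\<dots> = (x \<ominus> y) \<ominus> a \<otimes> (x \<ominus> y)"
      using xy ac by (simp add: diff_self mult_diff_right)
    finally have "F x \<ominus> F y = complex_of_real r \<odot> ((x \<ominus> y) \<ominus> a \<otimes> (x \<ominus> y))"
      using xy ac by (simp add: F_def smult_diff[symmetric])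
    moreover have "cnorm A ((x \<ominus> y) \<ominus> a \<otimes> (x \<ominus> y)) \<le> cnorm A (x \<ominus> y)"
      using xy by (intro cnorm_diff_mult_le(1)[OF y z _ a(1,2)]) simp
    ultimately show ?thesis using xy ac r by (simp add: cnorm_smult mult_left_mono)
  qed
  have "\<exists>e. e \<in> H \<and> F e = e"
  proof (rule B.metr.Banach_fixedpoint_thm[of F r])
    show "Metric_space.mcomplete (carrier (A\<lparr>carrier := H\<rparr>)) (cdist (A\<lparr>carrier := H\<rparr>))"
      by (rule B.complete)
    show "carrier (A\<lparr>carrier := H\<rparr>) \<noteq> {}" using a(3) by auto
    show "cdist (A\<lparr>carrier := H\<rparr>) (F u) (F v) \<le> r * cdist (A\<lparr>carrier := H\<rparr>) u v"
      if "u \<in> carrier (A\<lparr>carrier := H\<rparr>)" "v \<in> carrier (A\<lparr>carrier := H\<rparr>)" for u v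
      using that contr[of u v] by (simp add: dist FH)
  qed (use r FH in auto)
  then obtain e where e: "e \<in> H" "F e = e" by blast
  have ec: "e \<in> carrier A" using e HD(1) by auto
  have "complex_of_real (1 + \<epsilon>) \<odot> e = complex_of_real (1 + \<epsilon>) \<odot> F e" using e by simp
  also have "\<dots> = a \<oplus> (e \<ominus> a \<otimes> e)"
    using ac ec \<epsilon> by (simp add: F_def smult_smult r_def del: of_real_add flip: of_real_mult)
  finally have eq: "e \<oplus> complex_of_real \<epsilon> \<odot> e = e \<oplus> (a \<ominus> a \<otimes> e)"
    using ac ec smult_l_distr[of 1 "complex_of_real \<epsilon>" e] by (simp add: minus_eq a_ac)
  have "complex_of_real \<epsilon> \<odot> e = a \<ominus> a \<otimes> e"
    using eq ac ec by simp
  hence eq: "a \<ominus> a \<otimes> e = complex_of_real \<epsilon> \<odot> e" ..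
  show ?thesis using e(1) eq cnorm_diff_mult_le(2)[OF y z ec a(1,2) ec \<epsilon> eq] by blast
qed

text \<open>Let \<open>0 \<le> b \<le> a\<close> with \<open>a\<close> in \<open>H\<close> and
  \<open>b = y\<^sup>* y\<close>. For bounded \<open>e n\<close> in \<open>H\<close> with
  \<open>a (1 - e n)\<close> tending to zero, domination by \<open>a\<close> makes
  \<open>y (1 - e n)\<close> tend to zero as well. Hence \<open>b\<close> is the limit of the
  elements \<open>(e n)\<^sup>* b (e n)\<close>, which lie in \<open>H\<close> by
  \<open>HAH\<close>.\<close>

lemma hereditaryI:
  assumes H: "cstar_subalgebra H A"
    and HAH: "\<And>g d h. \<lbrakk>g \<in> H; d \<in> carrier A; h \<in> H\<rbrakk> \<Longrightarrow> g \<otimes> (d \<otimes> h) \<in> H"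
  shows "hereditary_cstar_subalgebra H A"
  unfolding hereditary_cstar_subalgebra_def
proof (intro conjI ballI impI H)
  note HD = cstar_subalgebraD[OF H]
  fix a b assume a: "a \<in> H" and b: "b \<in> carrier A" and p: "cstar_positive A b \<and> cstar_positive A (a \<ominus> b)"
  have ac: "a \<in> carrier A" using a HD(1) by auto
  obtain y where y: "y \<in> carrier A" "b = adj A y \<otimes> y" using p by (auto simp: cstar_positive_def)
  obtain z where z: "z \<in> carrier A" "a \<ominus> b = adj A z \<otimes> z" using p by (auto simp: cstar_positive_def)
  have ayz: "a = adj A y \<otimes> y \<oplus> adj A z \<otimes> z"
    using diff_add_cancel[OF ac b] y z a_comm[of "adj A z \<otimes> z" "adj A y \<otimes> y"] by simp
  \<comment> \<open>Scaling by \<open>1 / s\<close> brings \<open>a\<close> into the unit ball; the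
    summand \<open>1\<close> covers \<open>a = 0\<close>.\<close>
  define s where "s = cnorm A a + 1"
  have s: "s > 0" "cnorm A a \<le> s" using cnorm_nonneg[OF ac] by (auto simp: s_def)
  define c where "c = complex_of_real (1 / sqrt s)"
  have cc: "c * cnj c = complex_of_real (1/s)" using s by (simp add: c_def flip: of_real_mult)
  let ?a = "complex_of_real (1/s) \<odot> a"
  have ac': "?a = adj A (c \<odot> y) \<otimes> (c \<odot> y) \<oplus> adj A (c \<odot> z) \<otimes> (c \<odot> z)"
    using y z cc unfolding ayz
    by (simp add: adj_smult smult_mult_left smult_mult_right smult_smult smult_r_distr)
  have an: "cnorm A ?a \<le> 1" using s ac by (simp add: cnorm_smult norm_divide)
  have "\<exists>e\<in>H. cnorm A e \<le> 2 \<and> cnorm A (a \<ominus> a \<otimes> e) \<le> \<delta>" if \<delta>: "\<delta> > 0" for \<delta>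
  proof -
    \<comment> \<open>The parameter \<open>\<delta> / (2 s)\<close> is chosen so that, after undoing
      the scaling by \<open>s\<close> and using the bound \<open>2\<close> on \<open>e\<close>,
      exactly \<open>\<delta>\<close> remains.\<close>
    have "\<delta> / (2 * s) > 0" using \<delta> s by simp
    then obtain e where e: "e \<in> H" "cnorm A e \<le> 2"
      and eq: "?a \<ominus> ?a \<otimes> e = complex_of_real (\<delta> / (2 * s)) \<odot> e"
      using approximate_unit_fixed_point[OF H smult_in[OF y(1)] smult_in[OF z(1)] ac' an HD(4)[OF a]] by blast
    have ec: "e \<in> carrier A" using e HD(1) by auto
    have "complex_of_real (1/s) \<odot> (a \<ominus> a \<otimes> e) = complex_of_real (\<delta> / (2 * s)) \<odot> e"
      using eq ac ec by (simp add: smult_diff smult_mult_left)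
    hence "cnorm A (complex_of_real (1/s) \<odot> (a \<ominus> a \<otimes> e)) = cnorm A (complex_of_real (\<delta> / (2 * s)) \<odot> e)"
      by simp
    hence "1 / s * cnorm A (a \<ominus> a \<otimes> e) = \<delta> / (2 * s) * cnorm A e"
      using ac ec s \<delta> by (simp add: cnorm_smult norm_divide)
    hence "cnorm A (a \<ominus> a \<otimes> e) = \<delta> / 2 * cnorm A e" using s by (simp add: field_simps)
    also have "\<dots> \<le> \<delta> / 2 * 2" using e(2) \<delta> by (intro mult_left_mono) auto
    finally show ?thesis using e by auto
  qed
  hence "\<exists>e\<in>H. cnorm A e \<le> 2 \<and> cnorm A (a \<ominus> a \<otimes> e) \<le> inverse (real (Suc n))" for n by simp
  then obtain e where e: "\<And>n. e n \<in> H" "\<And>n. cnorm A (e n) \<le> 2"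
    "\<And>n. cnorm A (a \<ominus> a \<otimes> e n) \<le> inverse (real (Suc n))" by metis
  have ec: "e n \<in> carrier A" for n using e(1) HD(1) by auto
  \<comment> \<open>The element \<open>(1 - e)\<^sup>* y\<^sup>* y (1 - e)\<close> is dominated by
    \<open>(1 - e)\<^sup>* a (1 - e)\<close>. Splitting off the left factor
    \<open>1 - (e n)\<^sup>*\<close> costs \<open>1 + 2\<close>, whence the constant
    \<open>3\<close>.\<close>
  have bound: "cnorm A (y \<otimes> e n \<ominus> y) \<le> sqrt (3 * inverse (real (Suc n)))" for n
  proof -
    let ?d = "\<lambda>x. x \<ominus> x \<otimes> e n"
    have d: "adj A (?d x) \<otimes> ?d x = ?d (adj A x \<otimes> x) \<ominus> adj A (e n) \<otimes> ?d (adj A x \<otimes> x)"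
      if x: "x \<in> carrier A" for x
    proof -
      have "adj A (?d x) \<otimes> ?d x = adj A x \<otimes> ?d x \<ominus> (adj A (e n) \<otimes> adj A x) \<otimes> ?d x"
        using x ec by (simp add: adj_diff adj_mult mult_diff_left)
      also have "(adj A (e n) \<otimes> adj A x) \<otimes> ?d x = adj A (e n) \<otimes> (adj A x \<otimes> ?d x)"
        using x ec by (simp add: mult_assoc)
      also have "adj A x \<otimes> ?d x = ?d (adj A x \<otimes> x)"
        using x ec by (simp add: mult_diff_right mult_assoc)
      finally show ?thesis .
    qed
    have "?d a = ?d (adj A y \<otimes> y) \<oplus> ?d (adj A z \<otimes> z)"
      unfolding ayz using y(1) z(1) ec by (simp add: minus_eq mult_distr_left smult_r_distr a_ac)
    hence sum: "adj A (?d y) \<otimes> ?d y \<oplus> adj A (?d z) \<otimes> ?d z = ?d a \<ominus> adj A (e n) \<otimes> ?d a"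
      unfolding d[OF y(1)] d[OF z(1)] using y(1) z(1) ec
      by (simp add: minus_eq mult_distr_right smult_r_distr a_ac)
    have "(cnorm A (?d y))\<^sup>2 \<le> cnorm A (?d a \<ominus> adj A (e n) \<otimes> ?d a)"
      unfolding sum[symmetric] using y(1) z(1) ec by (intro cnorm_adj_mult_mono) auto
    also have "\<dots> \<le> cnorm A (?d a) + cnorm A (adj A (e n)) * cnorm A (?d a)"
      using cnorm_add[of "?d a" "\<ominus> (adj A (e n) \<otimes> ?d a)"] cnorm_mult[of "adj A (e n)" "?d a"] ac ec
      by (simp add: cnorm_uminus a_minus_def)
    also have "\<dots> \<le> cnorm A (?d a) + 2 * cnorm A (?d a)"
      using e(2)[of n] ac ec by (intro add_left_mono mult_right_mono) (auto simp: cnorm_adj cnorm_nonneg)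
    also have "\<dots> \<le> 3 * inverse (real (Suc n))" using e(3)[of n] by simp
    finally have "cnorm A (?d y) \<le> sqrt (3 * inverse (real (Suc n)))" by (rule real_le_rsqrt)
    thus ?thesis using cnorm_commute[of "y \<otimes> e n" y] y(1) ec by simp
  qed
  have "cconv (\<lambda>n. y \<otimes> e n) y"
  proof (rule cconv_dominated[OF _ y(1) bound])
    have "(\<lambda>n. sqrt (3 * inverse (real (Suc n)))) \<longlonglongrightarrow> sqrt (3 * 0)"
      by (intro tendsto_intros LIMSEQ_inverse_real_of_nat)
    thus "(\<lambda>n. sqrt (3 * inverse (real (Suc n)))) \<longlonglongrightarrow> 0" by simp
  qed (use y ec in auto)
  hence lim: "cconv (\<lambda>n. adj A (y \<otimes> e n) \<otimes> (y \<otimes> e n)) b"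
    unfolding y(2) by (intro cconv_mult cconv_adj)
  have "adj A (y \<otimes> e n) \<otimes> (y \<otimes> e n) = adj A (e n) \<otimes> (b \<otimes> e n)" for n
    using y ec by (simp add: adj_mult mult_assoc)
  hence "adj A (y \<otimes> e n) \<otimes> (y \<otimes> e n) \<in> H" for n
    using HAH[OF HD(6)[OF e(1)] b e(1), of n n] by simp
  thus "b \<in> H" using HD(7)[OF _ lim] by auto
qed

end

text \<open>For self-adjoint \<open>a\<close> in the unit ball the relation
  \<open>2 d = a\<^sup>2 + d\<^sup>2\<close> makes sense without a unit and is preserved by
  \<open>\<phi>\<close>. In a unital algebra around \<open>C\<close> it reads
  \<open>h\<^sup>2 + (1 - k)\<^sup>2 = 1\<close>, so \<open>unitary_bound\<close> gives
  \<open>\<parallel>h\<parallel> \<le> 1\<close>. The general case follows by scaling and the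
  C*-identity.\<close>

lemma star_hom_contractive:
  fixes A :: "('a, 'z) cstar_scheme" and C :: "('b, 'w) cstar_scheme"
  assumes A: "cstar_algebra A" and C: "cstar_algebra C" and \<phi>: "\<phi> \<in> star_hom A C" and x: "x \<in> carrier A"
  shows "cnorm C (\<phi> x) \<le> cnorm A x"
proof -
  interpret A: cstar_algebra A by (rule A)
  interpret C: cstar_algebra C by (rule C)
  obtain U :: "('b \<Rightarrow> 'b) cstar" and j where U: "unital_cstar_algebra U" and j: "j \<in> star_hom C U"
    and iso: "\<And>x. x \<in> carrier C \<Longrightarrow> cnorm U (j x) = cnorm C x" by (rule C.unital_embedding, rule that)
  interpret U: unital_cstar_algebra U by (rule U)
  note D = star_homD[OF \<phi>] and E = star_homD[OF j]
  have sa: "cnorm C (\<phi> a) \<le> 1" if a: "a \<in> carrier A" "adj A a = a" "cnorm A a \<le> 1" for a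
  proof -
    let ?e = "a \<otimes>\<^bsub>A\<^esub> a"
    have e: "?e \<in> carrier A" "adj A ?e = ?e" "cnorm A ?e \<le> 1"
      using a by (auto simp: A.adj_mult A.cnorm_self_adjoint_square power_le_one A.cnorm_nonneg)
    obtain d where d: "d \<in> carrier A" "adj A d = d" "complex_of_real 2 \<odot>\<^bsub>A\<^esub> d = ?e \<oplus>\<^bsub>A\<^esub> d \<otimes>\<^bsub>A\<^esub> d"
      "\<And>z. z \<in> carrier A \<Longrightarrow> z \<otimes>\<^bsub>A\<^esub> ?e = ?e \<otimes>\<^bsub>A\<^esub> z \<Longrightarrow> z \<otimes>\<^bsub>A\<^esub> d = d \<otimes>\<^bsub>A\<^esub> z"
      by (rule A.sqrt_iteration[OF e], rule that)
    have ad: "a \<otimes>\<^bsub>A\<^esub> d = d \<otimes>\<^bsub>A\<^esub> a" by (rule d(4)[OF a(1)]) (simp add: A.mult_assoc a)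
    define h k where "h = j (\<phi> a)" and "k = j (\<phi> d)"
    have hk: "h \<in> carrier U" "k \<in> carrier U" using D(1) E(1) a(1) d(1) by (auto simp: h_def k_def)
    have hk': "adj U h = h" "adj U k = k"
      using D(1,5) E(5) a(1,2) d(1,2) by (simp_all add: h_def k_def flip: E(5) D(5))
    have comm: "h \<otimes>\<^bsub>U\<^esub> k = k \<otimes>\<^bsub>U\<^esub> h"
      using arg_cong[OF ad, of "\<lambda>x. j (\<phi> x)"] a(1) d(1) by (simp add: h_def k_def D(1,4) E(4))
    have eq: "complex_of_real 2 \<odot>\<^bsub>U\<^esub> k = h \<otimes>\<^bsub>U\<^esub> h \<oplus>\<^bsub>U\<^esub> k \<otimes>\<^bsub>U\<^esub> k"
      using arg_cong[OF d(3), of "\<lambda>x. j (\<phi> x)"] a(1) d(1) by (simp add: h_def k_def D E)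
    have "(cnorm U h)\<^sup>2 \<le> 1"
    proof (rule U.unitary_bound[where c = "\<one>\<^bsub>U\<^esub> \<ominus>\<^bsub>U\<^esub> k"])
      show "(\<one>\<^bsub>U\<^esub> \<ominus>\<^bsub>U\<^esub> k) \<otimes>\<^bsub>U\<^esub> h = h \<otimes>\<^bsub>U\<^esub> (\<one>\<^bsub>U\<^esub> \<ominus>\<^bsub>U\<^esub> k)"
        using hk comm by (simp add: U.mult_diff_left U.mult_diff_right)
      have "h \<otimes>\<^bsub>U\<^esub> h \<oplus>\<^bsub>U\<^esub> (\<one>\<^bsub>U\<^esub> \<ominus>\<^bsub>U\<^esub> k) \<otimes>\<^bsub>U\<^esub> (\<one>\<^bsub>U\<^esub> \<ominus>\<^bsub>U\<^esub> k) =
          complex_of_real 1 \<odot>\<^bsub>U\<^esub> \<one>\<^bsub>U\<^esub> \<oplus>\<^bsub>U\<^esub> ((h \<otimes>\<^bsub>U\<^esub> h \<oplus>\<^bsub>U\<^esub> k \<otimes>\<^bsub>U\<^esub> k) \<ominus>\<^bsub>U\<^esub> complex_of_real 2 \<odot>\<^bsub>U\<^esub> k)"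
        by (rule U.nc_eqI[where xs = "[h, k]"], (rule U.nc_reify)+) (use hk in simp_all)
      also have "(h \<otimes>\<^bsub>U\<^esub> h \<oplus>\<^bsub>U\<^esub> k \<otimes>\<^bsub>U\<^esub> k) \<ominus>\<^bsub>U\<^esub> complex_of_real 2 \<odot>\<^bsub>U\<^esub> k = \<zero>\<^bsub>U\<^esub>"
        unfolding eq using hk by (intro U.diff_self) simp
      finally show "h \<otimes>\<^bsub>U\<^esub> h \<oplus>\<^bsub>U\<^esub> (\<one>\<^bsub>U\<^esub> \<ominus>\<^bsub>U\<^esub> k) \<otimes>\<^bsub>U\<^esub> (\<one>\<^bsub>U\<^esub> \<ominus>\<^bsub>U\<^esub> k) = complex_of_real 1 \<odot>\<^bsub>U\<^esub> \<one>\<^bsub>U\<^esub>"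
        by simp
    qed (use hk hk' in \<open>auto simp: U.adj_simps\<close>)
    hence "cnorm U h \<le> 1" using power2_le_imp_le[of "cnorm U h" 1] by simp
    thus ?thesis using iso[OF D(1)[OF a(1)]] by (simp add: h_def)
  qed
  show ?thesis
  proof (cases "cnorm A x = 0")
    case True
    hence "x = \<zero>\<^bsub>A\<^esub>" using A.cnorm_eq_0[OF x] by simp
    thus ?thesis using star_hom_zero[OF A C \<phi>] by (simp add: C.cnorm_zero A.cnorm_zero)
  next
    case False
    hence n: "cnorm A x > 0" using A.cnorm_nonneg[OF x] by simp
    define t where "t = 1 / (cnorm A x)\<^sup>2"
    have t: "t > 0" "t * (cnorm A x)\<^sup>2 = 1" using n by (simp_all add: t_def)
    let ?b = "adj A x \<otimes>\<^bsub>A\<^esub> x"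
    let ?a = "complex_of_real t \<odot>\<^bsub>A\<^esub> ?b"
    have b: "?b \<in> carrier A" using x by simp
    have "cnorm A ?a \<le> 1"
      using t by (subst A.cnorm_smult[OF b]) (simp add: A.cnorm_adj_mult[OF x])
    moreover have "adj A ?a = ?a" using x by (simp add: A.adj_simps)
    ultimately have "cnorm C (\<phi> ?a) \<le> 1" using sa[of ?a] b by blast
    moreover have "cnorm C (\<phi> ?a) = t * (cnorm C (\<phi> x))\<^sup>2"
      unfolding D(3)[OF b] D(4)[OF A.adj_closed[OF x] x] D(5)[OF x]
      using D(1)[OF x] C.cnorm_adj_mult[OF D(1)[OF x]] t
      by (subst C.cnorm_smult) simp_all
    ultimately have "t * (cnorm C (\<phi> x))\<^sup>2 \<le> t * (cnorm A x)\<^sup>2" using t(2) by simp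
    hence "(cnorm C (\<phi> x))\<^sup>2 \<le> (cnorm A x)\<^sup>2" using t(1) by (simp add: mult_le_cancel_left)
    thus ?thesis by (rule power2_le_imp_le) (use n in simp)
  qed
qed

section \<open>Matrix algebras\<close>

lemma (in cstar_algebra) finsum_additive:
  assumes h: "\<And>x. x \<in> carrier A \<Longrightarrow> h x \<in> carrier A"
    "\<And>x y. x \<in> carrier A \<Longrightarrow> y \<in> carrier A \<Longrightarrow> h (x \<oplus> y) = h x \<oplus> h y" "h \<zero> = \<zero>"
    and f: "finite F" "\<And>i. i \<in> F \<Longrightarrow> f i \<in> carrier A"
  shows "h (finsum A f F) = finsum A (\<lambda>i. h (f i)) F"
  using f
proof (induction F)
  case (insert i F)
  have c: "f \<in> F \<rightarrow> carrier A" "(\<lambda>i. h (f i)) \<in> F \<rightarrow> carrier A" "f i \<in> carrier A"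
    using insert.prems h(1) by auto
  have "h (finsum A f (insert i F)) = h (f i) \<oplus> h (finsum A f F)"
    using insert.hyps c h(2) by simp
  also have "\<dots> = finsum A (\<lambda>i. h (f i)) (insert i F)"
    using insert c h(1) by simp
  finally show ?case .
qed (simp add: h(3))

locale columns = unital_cstar_algebra A for A :: "('a, 'z) cstar_scheme" (structure) +
  fixes F :: "'i set"
  assumes finite_F: "finite F"
begin

text \<open>The Hilbert module of columns indexed by \<open>F\<close>. Entries outside
  \<open>F\<close> are zero, which is stable under the pointwise operations, so no case distinction
  enters them.\<close>

definition col :: "(complex, 'i \<Rightarrow> 'a) module" where
  "col = \<lparr>carrier = {x. (\<forall>i\<in>F. x i \<in> carrier A) \<and> (\<forall>i. i \<notin> F \<longrightarrow> x i = \<zero>)},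
     monoid.mult = (\<lambda>x y. x), one = (\<lambda>i. \<zero>), ring.zero = (\<lambda>i. \<zero>), add = (\<lambda>x y i. x i \<oplus> y i),
     smult = (\<lambda>c x i. c \<odot> x i)\<rparr>"

definition cip :: "('i \<Rightarrow> 'a) \<Rightarrow> ('i \<Rightarrow> 'a) \<Rightarrow> 'a" where
  "cip x y = (\<Oplus>i\<in>F. adj A (x i) \<otimes> y i)"

lemma col_simps:
  "x \<oplus>\<^bsub>col\<^esub> y = (\<lambda>i. x i \<oplus> y i)" "\<zero>\<^bsub>col\<^esub> = (\<lambda>i. \<zero>)" "c \<odot>\<^bsub>col\<^esub> x = (\<lambda>i. c \<odot> x i)"
  by (simp_all add: col_def)

lemma col_entry: "x \<in> carrier col \<Longrightarrow> x i \<in> carrier A"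
  by (cases "i \<in> F") (auto simp: col_def)

lemma colI: "(\<And>i. x i \<in> carrier A) \<Longrightarrow> (\<And>i. i \<notin> F \<Longrightarrow> x i = \<zero>) \<Longrightarrow> x \<in> carrier col"
  by (auto simp: col_def)

lemma col_outside: "x \<in> carrier col \<Longrightarrow> i \<notin> F \<Longrightarrow> x i = \<zero>"
  by (auto simp: col_def)

declare col_entry [simp]

lemma col_closed:
  "\<zero>\<^bsub>col\<^esub> \<in> carrier col" "\<lbrakk>x \<in> carrier col; y \<in> carrier col\<rbrakk> \<Longrightarrow> x \<oplus>\<^bsub>col\<^esub> y \<in> carrier col"
  "x \<in> carrier col \<Longrightarrow> c \<odot>\<^bsub>col\<^esub> x \<in> carrier col"
  "\<lbrakk>x \<in> carrier col; a \<in> carrier A\<rbrakk> \<Longrightarrow> (\<lambda>i. x i \<otimes> a) \<in> carrier col"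
  by (rule colI; simp add: col_simps col_outside smult_r_null)+

lemma col_module: "module complex_ring col"
proof (rule moduleI)
  show "abelian_group col"
  proof (rule abelian_groupI)
    fix x assume x: "x \<in> carrier col"
    have "(-1) \<odot>\<^bsub>col\<^esub> x \<oplus>\<^bsub>col\<^esub> x = \<zero>\<^bsub>col\<^esub>"
      using x by (simp add: col_simps minus_eq_smult[symmetric] l_neg)
    thus "\<exists>y\<in>carrier col. y \<oplus>\<^bsub>col\<^esub> x = \<zero>\<^bsub>col\<^esub>" using col_closed(3)[OF x] by blast
  next
    fix x y assume "x \<in> carrier col" "y \<in> carrier col"
    thus "x \<oplus>\<^bsub>col\<^esub> y = y \<oplus>\<^bsub>col\<^esub> x" by (simp add: col_simps a_comm)
  qed (simp_all add: col_closed, simp_all add: col_simps a_assoc)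
  fix a b x assume x: "x \<in> carrier col"
  show "(a \<oplus>\<^bsub>complex_ring\<^esub> b) \<odot>\<^bsub>col\<^esub> x = a \<odot>\<^bsub>col\<^esub> x \<oplus>\<^bsub>col\<^esub> b \<odot>\<^bsub>col\<^esub> x"
    using x smult_l_distr[of a b] by (simp add: col_simps)
  show "(a \<otimes>\<^bsub>complex_ring\<^esub> b) \<odot>\<^bsub>col\<^esub> x = a \<odot>\<^bsub>col\<^esub> (b \<odot>\<^bsub>col\<^esub> x)"
    using x by (simp add: col_simps smult_smult)
  show "\<one>\<^bsub>complex_ring\<^esub> \<odot>\<^bsub>col\<^esub> x = x" using x by (simp add: col_simps)
next
  fix a x y assume "x \<in> carrier col" "y \<in> carrier col"
  thus "a \<odot>\<^bsub>col\<^esub> (x \<oplus>\<^bsub>col\<^esub> y) = a \<odot>\<^bsub>col\<^esub> x \<oplus>\<^bsub>col\<^esub> a \<odot>\<^bsub>col\<^esub> y"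
    by (simp add: col_simps smult_r_distr)
qed (simp_all add: cring_complex_ring col_closed)

lemma cip_in [simp, intro]: "\<lbrakk>x \<in> carrier col; y \<in> carrier col\<rbrakk> \<Longrightarrow> cip x y \<in> carrier A"
  unfolding cip_def by (intro finsum_closed) auto

lemma cip_add: "\<lbrakk>x \<in> carrier col; y \<in> carrier col; z \<in> carrier col\<rbrakk> \<Longrightarrow>
    cip x (y \<oplus>\<^bsub>col\<^esub> z) = cip x y \<oplus> cip x z"
proof -
  assume c: "x \<in> carrier col" "y \<in> carrier col" "z \<in> carrier col"
  have "cip x (y \<oplus>\<^bsub>col\<^esub> z) = (\<Oplus>i\<in>F. adj A (x i) \<otimes> y i \<oplus> adj A (x i) \<otimes> z i)"
    unfolding cip_def using c by (intro finsum_cong') (auto simp: col_simps mult_distr_right)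
  also have "\<dots> = cip x y \<oplus> cip x z"
    unfolding cip_def using c by (intro finsum_addf) auto
  finally show ?thesis .
qed

lemma cip_mult_right: "\<lbrakk>x \<in> carrier col; y \<in> carrier col; a \<in> carrier A\<rbrakk> \<Longrightarrow>
    cip x (\<lambda>i. y i \<otimes> a) = cip x y \<otimes> a"
proof -
  assume c: "x \<in> carrier col" "y \<in> carrier col" "a \<in> carrier A"
  have "cip x y \<otimes> a = (\<Oplus>i\<in>F. (adj A (x i) \<otimes> y i) \<otimes> a)"
    unfolding cip_def using c
    by (intro finsum_additive[where h = "\<lambda>x. x \<otimes> a"] finite_F) (auto simp: mult_distr_left)
  also have "\<dots> = cip x (\<lambda>i. y i \<otimes> a)"
    unfolding cip_def using c by (intro finsum_cong') (auto simp: mult_assoc)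
  finally show ?thesis ..
qed

lemma cip_smult: "\<lbrakk>x \<in> carrier col; y \<in> carrier col\<rbrakk> \<Longrightarrow> cip x (c \<odot>\<^bsub>col\<^esub> y) = c \<odot> cip x y"
proof -
  assume c: "x \<in> carrier col" "y \<in> carrier col"
  have "c \<odot>\<^bsub>col\<^esub> y = (\<lambda>i. y i \<otimes> (c \<odot> \<one>))" using c by (simp add: col_simps smult_mult_right)
  hence "cip x (c \<odot>\<^bsub>col\<^esub> y) = cip x y \<otimes> (c \<odot> \<one>)"
    using cip_mult_right[OF c, of "c \<odot> \<one>"] by (simp only: one_in smult_in)
  thus ?thesis using c by (simp add: smult_mult_right)
qed

lemma adj_cip: "\<lbrakk>x \<in> carrier col; y \<in> carrier col\<rbrakk> \<Longrightarrow> adj A (cip x y) = cip y x"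
proof -
  assume c: "x \<in> carrier col" "y \<in> carrier col"
  have "adj A (cip x y) = (\<Oplus>i\<in>F. adj A (adj A (x i) \<otimes> y i))"
    unfolding cip_def using c by (intro finsum_additive finite_F) (auto simp: adj_add adj_zero)
  also have "\<dots> = cip y x"
    unfolding cip_def using c by (intro finsum_cong') (auto simp: adj_mult adj_adj)
  finally show ?thesis .
qed

lemma pos_finsum:
  assumes "finite G" "\<And>i. i \<in> G \<Longrightarrow> pos (f i)" shows "pos (finsum A f G)"
  using assms
proof (induction G)
  case (insert i G)
  have "f \<in> G \<rightarrow> carrier A" "f i \<in> carrier A" using insert.prems posD(1) by auto
  thus ?case using insert by (simp add: pos_add)
qed (simp add: pos_zero)

lemma pos_cip: "x \<in> carrier col \<Longrightarrow> pos (cip x x)"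
  unfolding cip_def by (intro pos_finsum finite_F pos_adj_mult) auto

text \<open>\<open>cip x x\<close> is \<open>(x i)\<^sup>* x i\<close> plus a positive remainder,
  and the norm is monotone on positive elements.\<close>

lemma cip_entry:
  assumes x: "x \<in> carrier col" shows "(cnorm A (x i))\<^sup>2 \<le> cnorm A (cip x x)"
proof (cases "i \<in> F")
  case True
  let ?f = "\<lambda>i. adj A (x i) \<otimes> x i"
  have "insert i (F - {i}) = F" using True by auto
  hence "cip x x = finsum A ?f (insert i (F - {i}))" by (simp add: cip_def)
  also have "\<dots> = ?f i \<oplus> finsum A ?f (F - {i})"
    using x finite_F by (intro finsum_insert) auto
  finally have eq: "cip x x = ?f i \<oplus> finsum A ?f (F - {i})" .
  have "cnorm A (?f i) \<le> cnorm A (cip x x)"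
    unfolding eq using x finite_F by (intro pos_cnorm_mono pos_adj_mult pos_finsum) auto
  thus ?thesis using x by (simp add: cnorm_adj_mult)
qed (use x in \<open>simp add: col_outside cnorm_zero cnorm_nonneg\<close>)

text \<open>Pythagoras for \<open>z = x - y b\<close> with \<open>b = cip y x\<close>: the element
  \<open>cip x x\<close> is the sum of \<open>b\<^sup>* b\<close>, \<open>cip z z\<close> and
  \<open>b\<^sup>* (1 - cip y y) b\<close>. The last summand is positive because
  \<open>1 - cip y y\<close> has a self-adjoint square root.\<close>

lemma cip_cauchy_schwarz_unit:
  assumes x: "x \<in> carrier col" and y: "y \<in> carrier col" and n: "cnorm A (cip y y) \<le> 1"
  shows "(cnorm A (cip y x))\<^sup>2 \<le> cnorm A (cip x x)"
proof -
  define b where "b = cip y x"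
  have b: "b \<in> carrier A" and b': "adj A b = cip x y" using x y by (auto simp: b_def adj_cip)
  have yb: "(\<lambda>i. y i \<otimes> b) \<in> carrier col" by (rule col_closed(4)[OF y b])
  define z where "z = x \<oplus>\<^bsub>col\<^esub> (-1) \<odot>\<^bsub>col\<^esub> (\<lambda>i. y i \<otimes> b)"
  have z: "z \<in> carrier col" using x yb by (simp add: z_def col_closed)
  have wz: "cip w z = cip w x \<ominus> cip w y \<otimes> b" if "w \<in> carrier col" for w
    using that x y yb b by (simp add: z_def cip_add cip_smult cip_mult_right col_closed minus_eq)
  have zw: "cip z w = cip x w \<ominus> adj A b \<otimes> cip y w" if "w \<in> carrier col" for w
  proof -
    have "cip z w = adj A (cip w z)" using that z by (simp add: adj_cip)
    also have "\<dots> = cip x w \<ominus> adj A b \<otimes> cip y w" using that x y b by (simp add: wz adj_simps adj_cip)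
    finally show ?thesis .
  qed
  have pos1: "pos (\<one> \<ominus> cip y y)"
    using pos_norm_minus[OF posD(1,2)[OF pos_cip[OF y]] n] by simp
  obtain s where s: "s \<in> carrier A" "adj A s = s" "s \<otimes> s = \<one> \<ominus> cip y y"
    by (rule pos_sqrt[OF pos1], rule that)
  have zz: "cip z z = (cip x x \<ominus> cip x y \<otimes> b) \<ominus> adj A b \<otimes> (b \<ominus> cip y y \<otimes> b)"
    unfolding zw[OF z] wz[OF x] wz[OF y] b_def[symmetric] ..
  have p3: "adj A (s \<otimes> b) \<otimes> (s \<otimes> b) = adj A b \<otimes> ((\<one> \<ominus> cip y y) \<otimes> b)"
    using s(1,2) b unfolding s(3)[symmetric] by (simp add: adj_mult mult_assoc)
  have eq: "cip x x = adj A b \<otimes> b \<oplus> (cip z z \<oplus> adj A (s \<otimes> b) \<otimes> (s \<otimes> b))"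
    unfolding p3 zz b'[symmetric]
    by (rule nc_eqI[where xs = "[b, adj A b, cip x x, cip y y]"], (rule nc_reify)+)
      (use x y b in simp_all)
  have "cnorm A (adj A b \<otimes> b) \<le> cnorm A (cip x x)"
    unfolding eq using b s(1) z by (intro pos_cnorm_mono pos_add pos_adj_mult pos_cip) auto
  thus ?thesis using b by (simp add: cnorm_adj_mult b_def[symmetric])
qed

lemma cip_zero: "x \<in> carrier col \<Longrightarrow> cip x x = \<zero> \<Longrightarrow> x = \<zero>\<^bsub>col\<^esub>"
proof
  fix i assume x: "x \<in> carrier col" "cip x x = \<zero>"
  have "cnorm A (x i) = 0" using cip_entry[OF x(1), of i] x(2) by (simp add: cnorm_zero)
  thus "x i = \<zero>\<^bsub>col\<^esub> i" using cnorm_eq_0[OF col_entry[OF x(1)]] by (simp add: col_simps)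
qed

lemma cip_cauchy_schwarz:
  assumes x: "x \<in> carrier col" and y: "y \<in> carrier col"
  shows "cnorm A (cip y x) \<le> sqrt (cnorm A (cip y y)) * sqrt (cnorm A (cip x x))"
proof (cases "cnorm A (cip y y) = 0")
  case True
  hence "cip y y = \<zero>" using cnorm_eq_0[OF cip_in[OF y y]] by simp
  hence "y = \<zero>\<^bsub>col\<^esub>" by (rule cip_zero[OF y])
  hence "cip y x = (\<Oplus>i\<in>F. \<zero>)" unfolding cip_def using x
    by (intro finsum_cong') (auto simp: col_simps adj_zero)
  thus ?thesis using x y by (simp add: cnorm_zero cnorm_nonneg)
next
  case False
  define K where "K = cnorm A (cip y y)"
  have K: "K > 0" using False cnorm_nonneg[OF cip_in[OF y y]] by (simp add: K_def)
  define c where "c = complex_of_real (1 / sqrt K)"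
  have c: "cmod c = 1 / sqrt K" using K by (simp add: c_def norm_divide)
  let ?y = "c \<odot>\<^bsub>col\<^esub> y"
  have y': "?y \<in> carrier col" by (rule col_closed(3)[OF y])
  have left: "cip ?y w = cnj c \<odot> cip y w" if "w \<in> carrier col" for w
    using adj_cip[OF that y'] that y by (simp add: cip_smult adj_smult adj_cip)
  have "cnorm A (cip ?y ?y) = cmod c * (cmod c * K)"
    using y y' by (simp add: left cip_smult cnorm_smult K_def)
  also have "\<dots> = 1" using K c by (simp add: real_sqrt_mult_self flip: power2_eq_square)
  finally have "(cnorm A (cip ?y x))\<^sup>2 \<le> cnorm A (cip x x)"
    using cip_cauchy_schwarz_unit[OF x y'] by simp
  hence "cnorm A (cip ?y x) \<le> sqrt (cnorm A (cip x x))" by (rule real_le_rsqrt)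
  hence "1 / sqrt K * cnorm A (cip y x) \<le> sqrt (cnorm A (cip x x))"
    using x y c by (simp add: left cnorm_smult)
  thus ?thesis unfolding K_def[symmetric] using K by (simp add: field_simps)
qed

lemma cnorm_finsum_le:
  assumes "finite G" "\<And>i. i \<in> G \<Longrightarrow> f i \<in> carrier A"
  shows "cnorm A (finsum A f G) \<le> (\<Sum>i\<in>G. cnorm A (f i))"
  using assms
proof (induction G)
  case (insert i G)
  have c: "f \<in> G \<rightarrow> carrier A" "f i \<in> carrier A" using insert.prems by auto
  have "cnorm A (finsum A f (insert i G)) \<le> cnorm A (f i) + cnorm A (finsum A f G)"
    using insert.hyps c cnorm_add[of "f i" "finsum A f G"] by simp
  thus ?case using insert by auto
qed (simp add: cnorm_zero)

lemma cip_le: "x \<in> carrier col \<Longrightarrow> cnorm A (cip x x) \<le> (\<Sum>i\<in>F. (cnorm A (x i))\<^sup>2)"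
  unfolding cip_def
  using cnorm_finsum_le[OF finite_F, of "\<lambda>i. adj A (x i) \<otimes> x i"] by (simp add: cnorm_adj_mult)

text \<open>Entries are dominated by the module norm, so they converge separately; conversely the
  module norm is at most the root of the finite sum of the squared entry norms.\<close>

lemma col_complete:
  fixes \<sigma> :: "nat \<Rightarrow> 'i \<Rightarrow> 'a"
  assumes \<sigma>: "\<And>n. \<sigma> n \<in> carrier col"
    and Cau: "\<And>e. e > 0 \<Longrightarrow> \<exists>N. \<forall>m\<ge>N. \<forall>n\<ge>N.
      sqrt (cnorm A (cip (\<sigma> m \<oplus>\<^bsub>col\<^esub> (-1) \<odot>\<^bsub>col\<^esub> \<sigma> n) (\<sigma> m \<oplus>\<^bsub>col\<^esub> (-1) \<odot>\<^bsub>col\<^esub> \<sigma> n))) < e"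
  shows "\<exists>x\<in>carrier col. \<forall>e>0. \<exists>N. \<forall>n\<ge>N.
      sqrt (cnorm A (cip (\<sigma> n \<oplus>\<^bsub>col\<^esub> (-1) \<odot>\<^bsub>col\<^esub> x) (\<sigma> n \<oplus>\<^bsub>col\<^esub> (-1) \<odot>\<^bsub>col\<^esub> x))) < e"
proof -
  let ?d = "\<lambda>x y. x \<oplus>\<^bsub>col\<^esub> (-1) \<odot>\<^bsub>col\<^esub> y"
  have dc: "?d x y \<in> carrier col" if "x \<in> carrier col" "y \<in> carrier col" for x y
    using that col_closed by blast
  have di: "?d x y i = x i \<ominus> y i" if "x \<in> carrier col" "y \<in> carrier col" for x y i
    using that by (simp add: col_simps minus_eq)
  have "\<exists>y. cconv (\<lambda>n. \<sigma> n i) y" for i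
  proof (rule complete_cconv)
    fix e :: real assume "e > 0"
    then obtain N where N: "\<And>m n. m \<ge> N \<Longrightarrow> n \<ge> N \<Longrightarrow> sqrt (cnorm A (cip (?d (\<sigma> m) (\<sigma> n)) (?d (\<sigma> m) (\<sigma> n)))) < e"
      using Cau by blast
    have "cnorm A (\<sigma> m i \<ominus> \<sigma> n i) < e" if "m \<ge> N" "n \<ge> N" for m n
    proof -
      have "cnorm A (?d (\<sigma> m) (\<sigma> n) i) \<le> sqrt (cnorm A (cip (?d (\<sigma> m) (\<sigma> n)) (?d (\<sigma> m) (\<sigma> n))))"
        by (rule real_le_rsqrt) (rule cip_entry[OF dc[OF \<sigma> \<sigma>]])
      also have "\<dots> < e" by (rule N[OF that])
      finally show ?thesis by (simp only: di[OF \<sigma> \<sigma>])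
    qed
    thus "\<exists>N. \<forall>m\<ge>N. \<forall>n\<ge>N. cnorm A (\<sigma> m i \<ominus> \<sigma> n i) < e" by blast
  qed (use \<sigma> in auto)
  then obtain x where x: "\<And>i. cconv (\<lambda>n. \<sigma> n i) (x i)" by metis
  have xc: "x \<in> carrier col"
  proof (rule colI)
    fix i show "x i \<in> carrier A" using cconv_in(2)[OF x] .
    assume "i \<notin> F"
    hence "(\<lambda>n. \<sigma> n i) = (\<lambda>n. \<zero>)" using col_outside[OF \<sigma>] by auto
    thus "x i = \<zero>" using x[of i] cconv_unique cconv_const[OF zero_closed] by metis
  qed
  have "(\<lambda>n. \<Sum>i\<in>F. (cnorm A (\<sigma> n i \<ominus> x i))\<^sup>2) \<longlonglongrightarrow> (\<Sum>i\<in>F. 0\<^sup>2)"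
    using x by (intro tendsto_intros) (simp add: cconv_def)
  hence lim: "(\<lambda>n. \<Sum>i\<in>F. (cnorm A (\<sigma> n i \<ominus> x i))\<^sup>2) \<longlonglongrightarrow> 0" by simp
  have "\<exists>N. \<forall>n\<ge>N. sqrt (cnorm A (cip (?d (\<sigma> n) x) (?d (\<sigma> n) x))) < e" if e: "e > 0" for e
  proof -
    obtain N where N: "\<And>n. n \<ge> N \<Longrightarrow> (\<Sum>i\<in>F. (cnorm A (\<sigma> n i \<ominus> x i))\<^sup>2) < e\<^sup>2"
      using order_tendstoD(2)[OF lim, of "e\<^sup>2"] e unfolding eventually_sequentially by auto
    have "sqrt (cnorm A (cip (?d (\<sigma> n) x) (?d (\<sigma> n) x))) < e" if "n \<ge> N" for n
    proof -
      have "cnorm A (cip (?d (\<sigma> n) x) (?d (\<sigma> n) x)) < e\<^sup>2"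
        using cip_le[OF dc[OF \<sigma> xc], of n] N[OF that] by (simp add: di[OF \<sigma> xc])
      hence "sqrt (cnorm A (cip (?d (\<sigma> n) x) (?d (\<sigma> n) x))) < sqrt (e\<^sup>2)" by (rule real_sqrt_less_mono)
      thus ?thesis using e by simp
    qed
    thus ?thesis by blast
  qed
  thus ?thesis using xc by blast
qed

sublocale H: hilbert_module A col cip
proof (rule hilbert_module.intro[OF cstar_algebra_axioms col_module], unfold_locales)
qed (simp_all add: cip_add cip_smult adj_cip cip_zero cip_cauchy_schwarz col_complete)

section \<open>Matrix units\<close>

abbreviation "Mat \<equiv> H.Lop"

text \<open>The matrix whose entry in row \<open>i\<close> and column \<open>j\<close> is
  \<open>a\<close>, all others being zero, in its action on columns.\<close>

definition munit :: "'i \<Rightarrow> 'i \<Rightarrow> 'a \<Rightarrow> ('i \<Rightarrow> 'a) \<Rightarrow> 'i \<Rightarrow> 'a" where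
  "munit i j a = (\<lambda>x\<in>carrier col. \<lambda>k. if k = i then a \<otimes> x j else \<zero>)"

lemma single_in: "\<lbrakk>i \<in> F; a \<in> carrier A\<rbrakk> \<Longrightarrow> (\<lambda>k. if k = i then a else \<zero>) \<in> carrier col"
  by (rule colI) auto

lemma cip_single:
  assumes "i \<in> F" "a \<in> carrier A" "y \<in> carrier col"
  shows "cip (\<lambda>k. if k = i then a else \<zero>) y = adj A a \<otimes> y i"
proof -
  have "cip (\<lambda>k. if k = i then a else \<zero>) y = (\<Oplus>k\<in>F. if i = k then adj A a \<otimes> y k else \<zero>)"
    unfolding cip_def using assms by (intro finsum_cong') (auto simp: adj_zero)
  also have "\<dots> = adj A a \<otimes> y i"
    using finsum_singleton[OF assms(1) finite_F, of "\<lambda>k. adj A a \<otimes> y k"] assms by simp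
  finally show ?thesis .
qed

lemma hnorm_single:
  "\<lbrakk>i \<in> F; a \<in> carrier A\<rbrakk> \<Longrightarrow> H.hnorm (\<lambda>k. if k = i then a else \<zero>) = cnorm A a"
  by (simp add: H.hnorm_def cip_single single_in cnorm_adj_mult cnorm_nonneg)

lemma munit_pair:
  assumes ij: "i \<in> F" "j \<in> F" and a: "a \<in> carrier A"
  shows "H.adjoint_pair (\<lambda>x k. if k = i then a \<otimes> x j else \<zero>) (\<lambda>x k. if k = j then adj A a \<otimes> x i else \<zero>)"
    and "H.bounded_by (cnorm A a) (\<lambda>x k. if k = i then a \<otimes> x j else \<zero>)"
proof -
  show "H.adjoint_pair (\<lambda>x k. if k = i then a \<otimes> x j else \<zero>) (\<lambda>x k. if k = j then adj A a \<otimes> x i else \<zero>)"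
    unfolding H.adjoint_pair_def
  proof (intro conjI ballI)
    fix x y assume xy: "x \<in> carrier col" "y \<in> carrier col"
    have "cip x (\<lambda>k. if k = j then adj A a \<otimes> y i else \<zero>) =
        adj A (cip (\<lambda>k. if k = j then adj A a \<otimes> y i else \<zero>) x)"
      using xy ij a by (simp add: adj_cip single_in)
    thus "cip (\<lambda>k. if k = i then a \<otimes> x j else \<zero>) y = cip x (\<lambda>k. if k = j then adj A a \<otimes> y i else \<zero>)"
      using xy ij a by (simp add: cip_single adj_mult adj_adj mult_assoc)
  qed (use ij a in \<open>auto intro!: single_in\<close>)
  show "H.bounded_by (cnorm A a) (\<lambda>x k. if k = i then a \<otimes> x j else \<zero>)"
    unfolding H.bounded_by_def
  proof (intro conjI ballI)
    fix x assume x: "x \<in> carrier col"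
    have "cnorm A (x j) \<le> H.hnorm x" unfolding H.hnorm_def by (rule real_le_rsqrt) (rule cip_entry[OF x])
    hence "cnorm A a * cnorm A (x j) \<le> cnorm A a * H.hnorm x"
      using a by (intro mult_left_mono) (auto simp: cnorm_nonneg)
    thus "H.hnorm (\<lambda>k. if k = i then a \<otimes> x j else \<zero>) \<le> cnorm A a * H.hnorm x"
      using cnorm_mult[of a "x j"] x a ij by (simp add: hnorm_single)
  qed (use a in \<open>simp add: cnorm_nonneg\<close>)
qed

lemma munit_in: "\<lbrakk>i \<in> F; j \<in> F; a \<in> carrier A\<rbrakk> \<Longrightarrow> munit i j a \<in> carrier Mat"
  unfolding munit_def by (rule H.LopI(1)[OF munit_pair])

lemma adj_munit: "\<lbrakk>i \<in> F; j \<in> F; a \<in> carrier A\<rbrakk> \<Longrightarrow> adj Mat (munit i j a) = munit j i (adj A a)"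
  unfolding munit_def by (rule H.LopI(2)[OF munit_pair])

lemma cnorm_munit: "\<lbrakk>i \<in> F; j \<in> F; a \<in> carrier A\<rbrakk> \<Longrightarrow> cnorm Mat (munit i j a) = cnorm A a"
proof (rule antisym)
  assume ij: "i \<in> F" "j \<in> F" and a: "a \<in> carrier A"
  have "H.bounded_by (cnorm A a) (munit i j a)"
    using munit_pair(2)[OF ij a] by (simp add: H.bounded_by_def munit_def)
  thus "cnorm Mat (munit i j a) \<le> cnorm A a" by (rule H.Lop_norm_le)
  \<comment> \<open>Testing on the \<open>j\<close>-th unit column recovers \<open>a\<close>; the
    norm of this column is only bounded by one, which is the direction needed and covers the zero
    algebra.\<close>
  let ?x = "\<lambda>k. if k = j then \<one> else \<zero>"
  have x: "?x \<in> carrier col" using ij by (simp add: single_in)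
  have "cnorm A a = H.hnorm (munit i j a ?x)"
    using x a ij by (simp add: munit_def hnorm_single)
  also have "\<dots> \<le> cnorm Mat (munit i j a) * H.hnorm ?x"
    by (rule H.Lop_hnorm[OF munit_in[OF ij a] x])
  also have "\<dots> \<le> cnorm Mat (munit i j a) * 1"
    using H.Lop_norm_nonneg[OF munit_in[OF ij a]] cnorm_one ij
    by (intro mult_left_mono) (simp_all add: hnorm_single)
  finally show "cnorm A a \<le> cnorm Mat (munit i j a)" by simp
qed

lemma munit_mult:
  assumes "i \<in> F" "j \<in> F" "k \<in> F" "l \<in> F" "a \<in> carrier A" "b \<in> carrier A"
  shows "munit i j a \<otimes>\<^bsub>Mat\<^esub> munit k l b = (if j = k then munit i l (a \<otimes> b) else \<zero>\<^bsub>Mat\<^esub>)"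
proof -
  have "(\<lambda>m. if m = k then b \<otimes> x l else \<zero>) \<in> carrier col" if "x \<in> carrier col" for x
    using that assms by (intro single_in) auto
  thus ?thesis using assms
    by (auto simp: H.Lop_simps munit_def fun_eq_iff mult_assoc restrict_def col_simps)
qed

lemma munit_add: "\<lbrakk>a \<in> carrier A; b \<in> carrier A\<rbrakk> \<Longrightarrow>
    munit i j (a \<oplus> b) = munit i j a \<oplus>\<^bsub>Mat\<^esub> munit i j b"
  by (auto simp: H.Lop_simps munit_def fun_eq_iff mult_distr_left restrict_def col_simps)

lemma munit_smult: "a \<in> carrier A \<Longrightarrow> munit i j (c \<odot> a) = c \<odot>\<^bsub>Mat\<^esub> munit i j a"
  by (auto simp: H.Lop_simps munit_def fun_eq_iff smult_mult_left restrict_def col_simps smult_r_null)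

lemma munit_zero: "munit i j \<zero> = \<zero>\<^bsub>Mat\<^esub>"
  by (auto simp: H.Lop_simps munit_def fun_eq_iff restrict_def col_simps)

end

section \<open>Reduced products\<close>

lemma le_mult_epsilon:
  fixes x a b :: real
  assumes "\<And>e. e > 0 \<Longrightarrow> x \<le> (a + e) * (b + e)" shows "x \<le> a * b"
proof (rule LIMSEQ_le_const)
  have "(\<lambda>n. (a + inverse (real (Suc n))) * (b + inverse (real (Suc n)))) \<longlonglongrightarrow> (a + 0) * (b + 0)"
    by (intro tendsto_intros LIMSEQ_inverse_real_of_nat)
  thus "(\<lambda>n. (a + inverse (real (Suc n))) * (b + inverse (real (Suc n)))) \<longlonglongrightarrow> a * b" by simp
  show "\<exists>N. \<forall>n\<ge>N. x \<le> (a + inverse (real (Suc n))) * (b + inverse (real (Suc n)))"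
    using assms by simp
qed

locale reduced_product =
  fixes M :: "'p \<Rightarrow> 'm cstar" and Fl :: "'p filter"
  assumes cstar_M: "\<And>p. cstar_algebra (M p)" and Fl_proper: "Fl \<noteq> bot"
begin

sublocale C: cstar_algebra "M p" for p by (rule cstar_M)

definition Bd :: "('p \<Rightarrow> 'm) set" where
  "Bd = {f. (\<forall>p. f p \<in> carrier (M p)) \<and> (\<exists>K. \<forall>p. cnorm (M p) (f p) \<le> K)}"

text \<open>The limit superior of the norms along the filter, written as the infimum of the eventual
  upper bounds.\<close>

definition N :: "('p \<Rightarrow> 'm) \<Rightarrow> real" where
  "N f = Inf {c. 0 \<le> c \<and> eventually (\<lambda>p. cnorm (M p) (f p) \<le> c) Fl}"

definition padd where "padd f g = (\<lambda>p. f p \<oplus>\<^bsub>M p\<^esub> g p)"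
definition pmult where "pmult f g = (\<lambda>p. f p \<otimes>\<^bsub>M p\<^esub> g p)"
definition psmult where "psmult c f = (\<lambda>p. c \<odot>\<^bsub>M p\<^esub> f p)"
definition padj where "padj f = (\<lambda>p. adj (M p) (f p))"
definition pzero where "pzero = (\<lambda>p. \<zero>\<^bsub>M p\<^esub>)"

lemmas pdefs = padd_def pmult_def psmult_def padj_def pzero_def

definition psub where "psub f g = padd f (psmult (-1) g)"

definition peq :: "('p \<Rightarrow> 'm) \<Rightarrow> ('p \<Rightarrow> 'm) \<Rightarrow> bool" where
  "peq f g \<longleftrightarrow> N (psub f g) = 0"

text \<open>Equivalent families satisfy the same predicate, so the choice operator returns the same
  representative for both.\<close>

definition rep :: "('p \<Rightarrow> 'm) \<Rightarrow> 'p \<Rightarrow> 'm" where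
  "rep f = (SOME g. g \<in> Bd \<and> peq f g)"

text \<open>The elements of the quotient are chosen representatives rather than cosets, so that the
  quotient lives on the same type as the product.\<close>

definition RP :: "('p \<Rightarrow> 'm) cstar" where
  "RP = \<lparr>carrier = rep ` Bd, monoid.mult = (\<lambda>f g. rep (pmult f g)), one = pzero,
     ring.zero = rep pzero, add = (\<lambda>f g. rep (padd f g)), smult = (\<lambda>c f. rep (psmult c f)),
     adj = (\<lambda>f. rep (padj f)), cnorm = N\<rparr>"

lemma BdD: "f \<in> Bd \<Longrightarrow> f p \<in> carrier (M p)"
  by (simp add: Bd_def)

lemma BdE: assumes "f \<in> Bd" obtains K where "K \<ge> 0" "\<And>p. cnorm (M p) (f p) \<le> K"
proof -
  obtain K where "\<And>p. cnorm (M p) (f p) \<le> K" using assms by (auto simp: Bd_def)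
  thus ?thesis using that[of "max 0 K"] by (simp add: le_max_iff_disj)
qed

lemma BdI: "(\<And>p. f p \<in> carrier (M p)) \<Longrightarrow> (\<And>p. cnorm (M p) (f p) \<le> K) \<Longrightarrow> f \<in> Bd"
  by (auto simp: Bd_def)

lemma Bd_closed:
  "pzero \<in> Bd" "\<lbrakk>f \<in> Bd; g \<in> Bd\<rbrakk> \<Longrightarrow> padd f g \<in> Bd" "\<lbrakk>f \<in> Bd; g \<in> Bd\<rbrakk> \<Longrightarrow> pmult f g \<in> Bd"
  "f \<in> Bd \<Longrightarrow> psmult c f \<in> Bd" "f \<in> Bd \<Longrightarrow> padj f \<in> Bd"
proof -
  show "pzero \<in> Bd" by (rule BdI[of _ 0]) (simp_all add: pdefs C.cnorm_zero)
  assume f: "f \<in> Bd"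
  obtain K where K: "K \<ge> 0" "\<And>p. cnorm (M p) (f p) \<le> K" by (rule BdE[OF f], rule that)
  show "psmult c f \<in> Bd"
    by (rule BdI[of _ "cmod c * K"]) (simp_all add: pdefs BdD[OF f] C.cnorm_smult K mult_left_mono)
  show "padj f \<in> Bd" by (rule BdI[of _ K]) (simp_all add: pdefs BdD[OF f] C.cnorm_adj K)
  assume g: "g \<in> Bd"
  obtain L where L: "L \<ge> 0" "\<And>p. cnorm (M p) (g p) \<le> L" by (rule BdE[OF g], rule that)
  show "padd f g \<in> Bd"
  proof (rule BdI)
    fix p show "cnorm (M p) (padd f g p) \<le> K + L"
      unfolding pdefs by (rule order_trans[OF C.cnorm_add add_mono]) (simp_all add: BdD f g K L)
  qed (simp add: pdefs BdD f g)
  show "pmult f g \<in> Bd"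
  proof (rule BdI)
    fix p show "cnorm (M p) (pmult f g p) \<le> K * L"
      unfolding pdefs
      by (rule order_trans[OF C.cnorm_mult mult_mono]) (simp_all add: BdD f g K L C.cnorm_nonneg)
  qed (simp add: pdefs BdD f g)
qed

lemma N_le: "0 \<le> c \<Longrightarrow> eventually (\<lambda>p. cnorm (M p) (f p) \<le> c) Fl \<Longrightarrow> N f \<le> c"
  unfolding N_def by (intro cInf_lower) (auto intro: bdd_belowI[of _ 0])

lemma N_set: "f \<in> Bd \<Longrightarrow> {c. 0 \<le> c \<and> eventually (\<lambda>p. cnorm (M p) (f p) \<le> c) Fl} \<noteq> {}"
proof -
  assume f: "f \<in> Bd"
  obtain K where "K \<ge> 0" "\<And>p. cnorm (M p) (f p) \<le> K" by (rule BdE[OF f], rule that)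
  thus ?thesis by auto
qed

lemma N_nonneg: "f \<in> Bd \<Longrightarrow> 0 \<le> N f"
  unfolding N_def by (rule cInf_greatest[OF N_set]) auto

lemma N_less: "f \<in> Bd \<Longrightarrow> N f < c \<Longrightarrow> eventually (\<lambda>p. cnorm (M p) (f p) \<le> c) Fl"
proof -
  assume f: "f \<in> Bd" "N f < c"
  then obtain d where "d < c" "eventually (\<lambda>p. cnorm (M p) (f p) \<le> d) Fl"
    unfolding N_def using cInf_lessD[OF N_set[OF f(1)]] by blast
  thus ?thesis by (auto elim: eventually_mono)
qed

text \<open>An eventual bound below \<open>c\<close> could hold nowhere, which a proper filter
  excludes.\<close>

lemma N_const: "f \<in> Bd \<Longrightarrow> (\<And>p. c \<le> cnorm (M p) (f p)) \<Longrightarrow> c \<le> N f"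
proof (rule ccontr)
  assume f: "f \<in> Bd" and c: "\<And>p. c \<le> cnorm (M p) (f p)" and "\<not> c \<le> N f"
  then obtain d where d: "N f < d" "d < c" using dense[of "N f" c] by auto
  have "eventually (\<lambda>p. False) Fl"
    using N_less[OF f d(1)] by eventually_elim (use c d(2) in \<open>meson leD order_less_le_trans le_less_trans\<close>)
  thus False using Fl_proper by (simp add: trivial_limit_def)
qed

lemma N_add: "f \<in> Bd \<Longrightarrow> g \<in> Bd \<Longrightarrow> N (padd f g) \<le> N f + N g"
proof (rule field_le_epsilon)
  fix e :: real assume f: "f \<in> Bd" and g: "g \<in> Bd" and e: "e > 0"
  have "eventually (\<lambda>p. cnorm (M p) (f p) \<le> N f + e/2) Fl" "eventually (\<lambda>p. cnorm (M p) (g p) \<le> N g + e/2) Fl"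
    using e by (auto intro!: N_less f g)
  hence "eventually (\<lambda>p. cnorm (M p) (padd f g p) \<le> N f + N g + e) Fl"
  proof eventually_elim
    case (elim p)
    show ?case using C.cnorm_add[OF BdD[OF f] BdD[OF g], of p] elim by (simp add: pdefs)
  qed
  thus "N (padd f g) \<le> N f + N g + e" using N_nonneg[OF f] N_nonneg[OF g] e by (intro N_le) auto
qed

lemma N_mult: "f \<in> Bd \<Longrightarrow> g \<in> Bd \<Longrightarrow> N (pmult f g) \<le> N f * N g"
proof (rule le_mult_epsilon)
  fix e :: real assume f: "f \<in> Bd" and g: "g \<in> Bd" and e: "e > 0"
  have "eventually (\<lambda>p. cnorm (M p) (f p) \<le> N f + e) Fl" "eventually (\<lambda>p. cnorm (M p) (g p) \<le> N g + e) Fl"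
    using e by (auto intro!: N_less f g)
  hence "eventually (\<lambda>p. cnorm (M p) (pmult f g p) \<le> (N f + e) * (N g + e)) Fl"
  proof eventually_elim
    case (elim p)
    have "cnorm (M p) (f p) * cnorm (M p) (g p) \<le> (N f + e) * (N g + e)"
      using elim N_nonneg[OF f] e by (intro mult_mono) (simp_all add: C.cnorm_nonneg BdD g)
    thus ?case using C.cnorm_mult[OF BdD[OF f] BdD[OF g], of p] by (simp add: pdefs)
  qed
  thus "N (pmult f g) \<le> (N f + e) * (N g + e)" using N_nonneg[OF f] N_nonneg[OF g] e by (intro N_le) auto
qed

lemma N_adj_le: "f \<in> Bd \<Longrightarrow> N (padj f) \<le> N f"
proof (rule field_le_epsilon)
  fix e :: real assume f: "f \<in> Bd" and e: "e > 0"
  have "eventually (\<lambda>p. cnorm (M p) (f p) \<le> N f + e) Fl" using e by (auto intro!: N_less f)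
  thus "N (padj f) \<le> N f + e"
    using N_nonneg[OF f] e by (intro N_le) (simp_all add: pdefs C.cnorm_adj BdD f)
qed

lemma N_smult: "f \<in> Bd \<Longrightarrow> N (psmult c f) \<le> cmod c * N f"
proof -
  assume f: "f \<in> Bd"
  have "N (psmult c f) \<le> (cmod c + e) * (N f + e)" if e: "e > 0" for e
  proof -
    have "eventually (\<lambda>p. cnorm (M p) (f p) \<le> N f + e) Fl" using e by (auto intro!: N_less f)
    hence "eventually (\<lambda>p. cnorm (M p) (psmult c f p) \<le> (cmod c + e) * (N f + e)) Fl"
    proof eventually_elim
      case (elim p)
      thus ?case using e N_nonneg[OF f] C.cnorm_nonneg[OF BdD[OF f], of p]
        by (simp add: pdefs C.cnorm_smult BdD[OF f] mult_mono)
    qed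
    thus ?thesis using N_nonneg[OF f] e by (intro N_le) auto
  qed
  thus ?thesis by (rule le_mult_epsilon)
qed

lemma N_cstar: "f \<in> Bd \<Longrightarrow> (N f)\<^sup>2 \<le> N (pmult (padj f) f)"
proof (rule field_le_epsilon)
  fix e :: real assume f: "f \<in> Bd" and e: "e > 0"
  let ?h = "pmult (padj f) f"
  have h: "?h \<in> Bd" using f Bd_closed by blast
  have "eventually (\<lambda>p. cnorm (M p) (?h p) \<le> N ?h + e) Fl" using e by (intro N_less[OF h]) simp
  hence "eventually (\<lambda>p. cnorm (M p) (f p) \<le> sqrt (N ?h + e)) Fl"
  proof eventually_elim
    case (elim p)
    thus ?case by (intro real_le_rsqrt) (simp add: pdefs C.cnorm_adj_mult BdD f)
  qed
  hence "N f \<le> sqrt (N ?h + e)" using N_nonneg[OF h] e by (intro N_le) auto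
  hence "(N f)\<^sup>2 \<le> (sqrt (N ?h + e))\<^sup>2" using N_nonneg[OF f] by (rule power_mono)
  thus "(N f)\<^sup>2 \<le> N ?h + e" using N_nonneg[OF h] e by simp
qed

section \<open>Equality up to null families and the quotient\<close>

lemma psub: "f \<in> Bd \<Longrightarrow> g \<in> Bd \<Longrightarrow> psub f g = (\<lambda>p. f p \<ominus>\<^bsub>M p\<^esub> g p)"
  by (auto simp: psub_def pdefs C.minus_eq BdD)

lemma psub_Bd: "f \<in> Bd \<Longrightarrow> g \<in> Bd \<Longrightarrow> psub f g \<in> Bd"
  unfolding psub_def by (intro Bd_closed)

lemma peqI: "\<lbrakk>f \<in> Bd; g \<in> Bd; N (psub f g) \<le> 0\<rbrakk> \<Longrightarrow> peq f g"
  using N_nonneg[OF psub_Bd, of f g] by (simp add: peq_def)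

lemma peq_eventually: "\<lbrakk>f \<in> Bd; g \<in> Bd; eventually (\<lambda>p. f p = g p) Fl\<rbrakk> \<Longrightarrow> peq f g"
proof (rule peqI)
  assume f: "f \<in> Bd" and g: "g \<in> Bd" and ev: "eventually (\<lambda>p. f p = g p) Fl"
  show "N (psub f g) \<le> 0"
    unfolding psub[OF f g]
  proof (rule N_le)
    show "eventually (\<lambda>p. cnorm (M p) (f p \<ominus>\<^bsub>M p\<^esub> g p) \<le> 0) Fl"
      using ev by eventually_elim (simp add: C.diff_self BdD g C.cnorm_zero)
  qed simp
qed

lemma peq_refl: "f \<in> Bd \<Longrightarrow> peq f f"
  by (rule peq_eventually) simp_all

lemma peq_sym: "f \<in> Bd \<Longrightarrow> g \<in> Bd \<Longrightarrow> peq f g \<Longrightarrow> peq g f"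
proof (rule peqI)
  assume f: "f \<in> Bd" and g: "g \<in> Bd" and eq: "peq f g"
  have "psub g f = psmult (-1) (psub f g)"
    using C.diff_commute[OF BdD[OF f] BdD[OF g]] C.minus_eq_smult[OF BdD[OF psub_Bd[OF f g]]]
    by (simp add: psub f g psmult_def)
  thus "N (psub g f) \<le> 0" using N_smult[OF psub_Bd[OF f g], of "-1"] eq by (simp add: peq_def)
qed

lemma peq_trans:
  assumes fgh: "f \<in> Bd" "g \<in> Bd" "h \<in> Bd" and eq: "peq f g" "peq g h"
  shows "peq f h"
proof (rule peqI[OF fgh(1,3)])
  have "psub f h = padd (psub f g) (psub g h)"
    using C.diff_split[OF BdD[OF fgh(1)] BdD[OF fgh(2)] BdD[OF fgh(3)]] by (simp add: psub fgh padd_def)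
  thus "N (psub f h) \<le> 0"
    using N_add[OF psub_Bd[OF fgh(1,2)] psub_Bd[OF fgh(2,3)]] eq by (simp add: peq_def)
qed

lemma rep_Bd: "f \<in> Bd \<Longrightarrow> rep f \<in> Bd" and peq_rep: "f \<in> Bd \<Longrightarrow> peq f (rep f)"
proof -
  assume f: "f \<in> Bd"
  have "rep f \<in> Bd \<and> peq f (rep f)"
    unfolding rep_def by (rule someI[of _ f]) (simp add: f peq_refl)
  thus "rep f \<in> Bd" "peq f (rep f)" by auto
qed

lemma rep_eqI: "\<lbrakk>f \<in> Bd; g \<in> Bd; peq f g\<rbrakk> \<Longrightarrow> rep f = rep g"
proof -
  assume f: "f \<in> Bd" and g: "g \<in> Bd" and eq: "peq f g"
  have "(h \<in> Bd \<and> peq f h) \<longleftrightarrow> (h \<in> Bd \<and> peq g h)" for h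
    using peq_trans[OF g f, of h] peq_trans[OF f g, of h] eq peq_sym[OF f g eq] by blast
  thus ?thesis unfolding rep_def by simp
qed

lemma rep_eq_iff: "\<lbrakk>f \<in> Bd; g \<in> Bd\<rbrakk> \<Longrightarrow> rep f = rep g \<longleftrightarrow> peq f g"
  using rep_eqI[of f g] peq_trans[OF _ rep_Bd, of f g g] peq_rep[of f] peq_rep[of g]
    peq_sym[of g "rep g"] rep_Bd[of g] by auto

lemma rep_eventually: "\<lbrakk>f \<in> Bd; g \<in> Bd; eventually (\<lambda>p. f p = g p) Fl\<rbrakk> \<Longrightarrow> rep f = rep g"
  by (intro rep_eqI peq_eventually)

lemma peq_cong:
  assumes fg: "f \<in> Bd" "f' \<in> Bd" "g \<in> Bd" "g' \<in> Bd" and eq: "peq f f'" "peq g g'"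
  shows "peq (padd f g) (padd f' g')" "peq (pmult f g) (pmult f' g')"
    "peq (psmult c f) (psmult c f')" "peq (padj f) (padj f')"
proof -
  note B = psub_Bd[OF fg(1,2)] psub_Bd[OF fg(3,4)] and c = BdD[OF fg(1)] BdD[OF fg(2)] BdD[OF fg(3)] BdD[OF fg(4)]
  note N0 = eq[unfolded peq_def]
  have "psub (padd f g) (padd f' g') = padd (psub f f') (psub g g')"
    by (simp add: psub_def pdefs c C.smult_r_distr C.a_ac)
  thus "peq (padd f g) (padd f' g')"
    using N_add[OF B] N0 by (intro peqI Bd_closed fg) simp
  have "psub (pmult f g) (pmult f' g') = padd (pmult f (psub g g')) (pmult (psub f f') g')"
  proof
    fix p
    show "psub (pmult f g) (pmult f' g') p = padd (pmult f (psub g g')) (pmult (psub f f') g') p"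
      using C.diff_split[of "f p \<otimes>\<^bsub>M p\<^esub> g p" p "f p \<otimes>\<^bsub>M p\<^esub> g' p" "f' p \<otimes>\<^bsub>M p\<^esub> g' p"]
      by (simp add: psub fg Bd_closed) (simp add: pdefs c C.mult_diff_left C.mult_diff_right)
  qed
  moreover have "N (pmult f (psub g g')) \<le> 0" "N (pmult (psub f f') g') \<le> 0"
    using N_mult[OF fg(1) B(2)] N_mult[OF B(1) fg(4)] N0 by simp_all
  ultimately show "peq (pmult f g) (pmult f' g')"
    using N_add[OF Bd_closed(3)[OF fg(1) B(2)] Bd_closed(3)[OF B(1) fg(4)]]
    by (intro peqI Bd_closed fg) simp
  have "psub (psmult c f) (psmult c f') = psmult c (psub f f')"
    by (simp add: psub_def pdefs c C.smult_r_distr C.smult_smult mult.commute)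
  thus "peq (psmult c f) (psmult c f')"
    using N_smult[OF B(1), of c] N0 by (intro peqI Bd_closed fg) simp
  have "psub (padj f) (padj f') = padj (psub f f')"
    by (simp add: psub_def pdefs c C.adj_add C.adj_smult)
  thus "peq (padj f) (padj f')"
    using N_adj_le[OF B(1)] N0 by (intro peqI Bd_closed fg) simp
qed

lemma RP_simps:
  "carrier RP = rep ` Bd" "\<zero>\<^bsub>RP\<^esub> = rep pzero"
  "\<lbrakk>f \<in> Bd; g \<in> Bd\<rbrakk> \<Longrightarrow> rep f \<oplus>\<^bsub>RP\<^esub> rep g = rep (padd f g)"
  "\<lbrakk>f \<in> Bd; g \<in> Bd\<rbrakk> \<Longrightarrow> rep f \<otimes>\<^bsub>RP\<^esub> rep g = rep (pmult f g)"
  "f \<in> Bd \<Longrightarrow> c \<odot>\<^bsub>RP\<^esub> rep f = rep (psmult c f)"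
  "f \<in> Bd \<Longrightarrow> adj RP (rep f) = rep (padj f)"
proof -
  show "carrier RP = rep ` Bd" "\<zero>\<^bsub>RP\<^esub> = rep pzero" by (simp_all add: RP_def)
  assume f: "f \<in> Bd"
  note sf = peq_sym[OF f rep_Bd[OF f] peq_rep[OF f]]
  have "rep (psmult c (rep f)) = rep (psmult c f)"
    by (intro rep_eqI peq_cong[OF _ f _ f _ peq_refl[OF f]] Bd_closed rep_Bd f sf)
  thus "c \<odot>\<^bsub>RP\<^esub> rep f = rep (psmult c f)" by (simp add: RP_def)
  have "rep (padj (rep f)) = rep (padj f)"
    by (intro rep_eqI peq_cong[OF _ f _ f _ peq_refl[OF f]] Bd_closed rep_Bd f sf)
  thus "adj RP (rep f) = rep (padj f)" by (simp add: RP_def)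
  assume g: "g \<in> Bd"
  note sg = peq_sym[OF g rep_Bd[OF g] peq_rep[OF g]]
  have "rep (padd (rep f) (rep g)) = rep (padd f g)"
    by (intro rep_eqI peq_cong Bd_closed rep_Bd f g sf sg)
  thus "rep f \<oplus>\<^bsub>RP\<^esub> rep g = rep (padd f g)" by (simp add: RP_def)
  have "rep (pmult (rep f) (rep g)) = rep (pmult f g)"
    by (intro rep_eqI peq_cong Bd_closed rep_Bd f g sf sg)
  thus "rep f \<otimes>\<^bsub>RP\<^esub> rep g = rep (pmult f g)" by (simp add: RP_def)
qed

lemma N_cong: "\<lbrakk>f \<in> Bd; g \<in> Bd; peq f g\<rbrakk> \<Longrightarrow> N f = N g"
proof -
  have le: "N f \<le> N g" if f: "f \<in> Bd" and g: "g \<in> Bd" and eq: "peq f g" for f g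
  proof -
    have "padd (psub f g) g = f" by (simp add: psub f g padd_def C.diff_add_cancel BdD)
    thus ?thesis using N_add[OF psub_Bd[OF f g] g] eq by (simp add: peq_def)
  qed
  assume "f \<in> Bd" "g \<in> Bd" "peq f g"
  thus ?thesis using le[of f g] le[of g f] peq_sym[of f g] by simp
qed

lemma cnorm_RP: "f \<in> Bd \<Longrightarrow> cnorm RP (rep f) = N f"
  using N_cong[OF _ rep_Bd peq_rep, of f] by (simp add: RP_def)

text \<open>A Cauchy sequence for \<open>N\<close> need not be Cauchy at any single index. A
  subsequence with geometrically small steps is therefore altered, off sets that belong to the
  filter, until its steps are small at every index; the altered sequence converges uniformly, and
  the alterations do not affect \<open>N\<close>.\<close>

lemma N_complete:
  fixes \<sigma> :: "nat \<Rightarrow> 'p \<Rightarrow> 'm"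
  assumes \<sigma>: "\<And>n. \<sigma> n \<in> Bd"
    and Cau: "\<And>e. e > 0 \<Longrightarrow> \<exists>K. \<forall>m\<ge>K. \<forall>n\<ge>K. N (psub (\<sigma> m) (\<sigma> n)) < e"
  shows "\<exists>x\<in>Bd. \<forall>e>0. \<exists>K. \<forall>n\<ge>K. N (psub (\<sigma> n) x) < e"
proof -
  have "\<exists>K. \<forall>m\<ge>K. \<forall>n\<ge>K. N (psub (\<sigma> m) (\<sigma> n)) < (1/2) ^ k" for k :: nat
    by (rule Cau) simp
  then obtain \<kappa> where \<kappa>: "\<And>k m n. m \<ge> \<kappa> k \<Longrightarrow> n \<ge> \<kappa> k \<Longrightarrow> N (psub (\<sigma> m) (\<sigma> n)) < (1/2) ^ k"
    by metis
  \<comment> \<open>Summation makes the thresholds monotone while keeping them above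
    \<open>\<kappa> k\<close>.\<close>
  define \<nu> where "\<nu> k = (\<Sum>i\<le>k. \<kappa> i)" for k
  have \<nu>: "\<kappa> k \<le> \<nu> k" "\<nu> k \<le> \<nu> (Suc k)" for k
    by (simp_all add: \<nu>_def member_le_sum)
  define h where "h k = \<sigma> (\<nu> k)" for k
  have h: "h k \<in> Bd" for k by (simp add: h_def \<sigma>)
  have hc: "h k p \<in> carrier (M p)" for k p by (rule BdD[OF h])
  have hN: "N (psub (h (Suc k)) (h k)) < (1/2) ^ k" for k
    unfolding h_def using \<nu>[of k] by (intro \<kappa>) auto
  \<comment> \<open>A step is taken only at the indices where it is at most
    \<open>(1/2) ^ k\<close>, and the old value is kept elsewhere. As the step is that small
    eventually along the filter, \<open>g k\<close> and \<open>h k\<close> eventually agree.\<close>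
  define g where "g = rec_nat (h 0) (\<lambda>k f p. if cnorm (M p) (h (Suc k) p \<ominus>\<^bsub>M p\<^esub> f p) \<le> (1/2) ^ k then h (Suc k) p else f p)"
  have g0: "g 0 = h 0" and gS: "g (Suc k) p =
      (if cnorm (M p) (h (Suc k) p \<ominus>\<^bsub>M p\<^esub> g k p) \<le> (1/2) ^ k then h (Suc k) p else g k p)" for k p
    by (simp_all add: g_def)
  have gc: "g k p \<in> carrier (M p)" for k p
    by (induction k) (simp_all add: g0 gS hc)
  have gh: "eventually (\<lambda>p. g k p = h k p) Fl" for k
  proof (induction k)
    case (Suc k)
    have "eventually (\<lambda>p. cnorm (M p) (psub (h (Suc k)) (h k) p) \<le> (1/2) ^ k) Fl"
      by (rule N_less[OF psub_Bd[OF h h] hN])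
    with Suc show ?case
      unfolding psub[OF h h] by eventually_elim (simp add: gS)
  qed (simp add: g0)
  have step: "cnorm (M p) (g (Suc k) p \<ominus>\<^bsub>M p\<^esub> g k p) \<le> (1/2) ^ k" for k p
    using C.diff_self[OF gc[of k p]] by (simp add: gS C.cnorm_zero)
  have dist: "cnorm (M p) (g (k + j) p \<ominus>\<^bsub>M p\<^esub> g k p) \<le> 2 * (1/2) ^ k - 2 * (1/2) ^ (k + j)" for p k j
  proof (induction j)
    case 0
    show ?case using C.diff_self[OF gc[of k p]] by (simp add: C.cnorm_zero)
  next
    case (Suc j)
    have "cnorm (M p) (g (k + Suc j) p \<ominus>\<^bsub>M p\<^esub> g k p) \<le>
        cnorm (M p) (g (Suc (k + j)) p \<ominus>\<^bsub>M p\<^esub> g (k + j) p) + cnorm (M p) (g (k + j) p \<ominus>\<^bsub>M p\<^esub> g k p)"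
      using C.cnorm_triangle[OF gc[of "Suc (k + j)" p] gc[of "k + j" p] gc[of k p]] by simp
    also have "\<dots> \<le> (1/2) ^ (k + j) + (2 * (1/2) ^ k - 2 * (1/2) ^ (k + j))"
      by (rule add_mono[OF step Suc])
    also have "\<dots> = 2 * (1/2) ^ k - 2 * (1/2) ^ (k + Suc j)" by simp
    finally show ?case .
  qed
  have dist': "cnorm (M p) (g m p \<ominus>\<^bsub>M p\<^esub> g k p) \<le> 2 * (1/2) ^ k" if "m \<ge> k" for p k m
  proof -
    have "cnorm (M p) (g m p \<ominus>\<^bsub>M p\<^esub> g k p) \<le> 2 * (1/2) ^ k - 2 * (1/2) ^ m"
      using dist[of p k "m - k"] that by simp
    moreover have "0 \<le> 2 * (1/2 :: real) ^ m" by simp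
    ultimately show ?thesis by linarith
  qed
  have lim0: "(\<lambda>k. 2 * (1/2 :: real) ^ k) \<longlonglongrightarrow> 0"
    by (intro tendsto_mult_right_zero LIMSEQ_power_zero) simp
  have "\<exists>x. C.cconv p (\<lambda>k. g k p) x" for p
  proof (rule C.complete_cconv)
    fix e :: real assume "e > 0"
    hence "e/2 > 0" by simp
    then obtain K where K: "2 * (1/2 :: real) ^ K < e / 2"
      using order_tendstoD(2)[OF lim0] unfolding eventually_sequentially by blast
    have "cnorm (M p) (g m p \<ominus>\<^bsub>M p\<^esub> g n p) < e" if "m \<ge> K" "n \<ge> K" for m n
    proof -
      have "cnorm (M p) (g m p \<ominus>\<^bsub>M p\<^esub> g n p) \<le>
          cnorm (M p) (g m p \<ominus>\<^bsub>M p\<^esub> g K p) + cnorm (M p) (g K p \<ominus>\<^bsub>M p\<^esub> g n p)"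
        by (rule C.cnorm_triangle[OF gc gc gc])
      also have "cnorm (M p) (g K p \<ominus>\<^bsub>M p\<^esub> g n p) = cnorm (M p) (g n p \<ominus>\<^bsub>M p\<^esub> g K p)"
        by (rule C.cnorm_commute[OF gc gc])
      finally show ?thesis using dist'[OF that(1), of p] dist'[OF that(2), of p] K by linarith
    qed
    thus "\<exists>K. \<forall>m\<ge>K. \<forall>n\<ge>K. cnorm (M p) (g m p \<ominus>\<^bsub>M p\<^esub> g n p) < e" by blast
  qed (use gc in auto)
  then obtain x where x: "\<And>p. C.cconv p (\<lambda>k. g k p) (x p)" by metis
  have xc: "x p \<in> carrier (M p)" for p by (rule C.cconv_in(2)[OF x])
  have xd: "cnorm (M p) (g k p \<ominus>\<^bsub>M p\<^esub> x p) \<le> 2 * (1/2) ^ k" for p k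
  proof (rule C.cconv_le[OF x gc])
    fix m assume "m \<ge> k"
    thus "cnorm (M p) (g k p \<ominus>\<^bsub>M p\<^esub> g m p) \<le> 2 * (1/2) ^ k"
      using dist'[of k m p] C.cnorm_commute[OF gc[of k p] gc[of m p]] by simp
  qed
  obtain K where K: "\<And>p. cnorm (M p) (h 0 p) \<le> K" by (rule BdE[OF h[of 0]], rule that)
  have xB: "x \<in> Bd"
  proof (rule BdI[OF xc])
    fix p
    have "x p = (x p \<ominus>\<^bsub>M p\<^esub> g 0 p) \<oplus>\<^bsub>M p\<^esub> g 0 p" by (rule C.diff_add_cancel[OF xc gc, symmetric])
    hence "cnorm (M p) (x p) \<le> cnorm (M p) (x p \<ominus>\<^bsub>M p\<^esub> g 0 p) + cnorm (M p) (g 0 p)"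
      using C.cnorm_add[OF C.minus_closed[OF xc[of p] gc[of 0 p]] gc[of 0 p]] by simp
    thus "cnorm (M p) (x p) \<le> 2 + K"
      using xd[of p 0] C.cnorm_commute[OF xc[of p] gc[of 0 p]] K[of p] by (simp add: g0)
  qed
  have hx: "N (psub (h k) x) \<le> 2 * (1/2) ^ k" for k
    unfolding psub[OF h xB]
  proof (rule N_le)
    show "eventually (\<lambda>p. cnorm (M p) (h k p \<ominus>\<^bsub>M p\<^esub> x p) \<le> 2 * (1/2) ^ k) Fl"
      using gh[of k] by eventually_elim (use xd in metis)
  qed simp
  have "\<exists>K. \<forall>n\<ge>K. N (psub (\<sigma> n) x) < e" if e: "e > 0" for e
  proof -
    have "e/2 > 0" using e by simp
    then obtain k where k: "2 * (1/2 :: real) ^ k < e / 2"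
      using order_tendstoD(2)[OF lim0] unfolding eventually_sequentially by blast
    have "N (psub (\<sigma> n) x) < e" if n: "n \<ge> \<nu> k" for n
    proof -
      have "psub (\<sigma> n) x = padd (psub (\<sigma> n) (h k)) (psub (h k) x)"
        unfolding psub[OF \<sigma> h] psub[OF h xB] psub[OF \<sigma> xB]
        using C.diff_split[OF BdD[OF \<sigma>] hc xc] by (simp add: padd_def)
      hence "N (psub (\<sigma> n) x) \<le>
          N (psub (\<sigma> n) (h k)) + N (psub (h k) x)"
        using N_add[of "psub (\<sigma> n) (h k)" "psub (h k) x"]
        by (simp add: psub_Bd \<sigma> h xB)
      also have "\<dots> < (1/2) ^ k + 2 * (1/2) ^ k"
        using hx[of k] \<kappa>[of k n "\<nu> k"] n \<nu>(1)[of k] by (simp add: h_def)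
      also have "\<dots> < e" using k zero_less_power[of "1/2 :: real" k] by linarith
      finally show ?thesis .
    qed
    thus ?thesis by blast
  qed
  thus ?thesis using xB by blast
qed

theorem RP_cstar: "cstar_algebra RP"
proof (rule cstar_algebraI)
  note B = Bd_closed
  note S = RP_simps(3-6) B
  note E = arg_cong[where f = rep]
  show "\<zero>\<^bsub>RP\<^esub> \<in> carrier RP" by (simp add: RP_simps(1,2) B)
  fix x assume "x \<in> carrier RP"
  then obtain f where f: "f \<in> Bd" "x = rep f" by (auto simp: RP_simps(1))
  note c = BdD[OF f(1)]
  show "c \<odot>\<^bsub>RP\<^esub> x \<in> carrier RP" for c by (simp add: f S RP_simps(1))
  show "adj RP x \<in> carrier RP" by (simp add: f S RP_simps(1))
  show "\<zero>\<^bsub>RP\<^esub> \<oplus>\<^bsub>RP\<^esub> x = x"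
    by (simp add: f S RP_simps(2), rule E) (simp add: pdefs c)
  show "(-1) \<odot>\<^bsub>RP\<^esub> x \<oplus>\<^bsub>RP\<^esub> x = \<zero>\<^bsub>RP\<^esub>"
    by (simp add: f S RP_simps(2), rule E) (simp add: pdefs c C.minus_eq_smult[symmetric] C.l_neg)
  show "(a + b) \<odot>\<^bsub>RP\<^esub> x = a \<odot>\<^bsub>RP\<^esub> x \<oplus>\<^bsub>RP\<^esub> b \<odot>\<^bsub>RP\<^esub> x" for a b
    by (simp add: f S, rule E) (use C.smult_l_distr[of a b] in \<open>simp add: pdefs c\<close>)
  show "(a * b) \<odot>\<^bsub>RP\<^esub> x = a \<odot>\<^bsub>RP\<^esub> (b \<odot>\<^bsub>RP\<^esub> x)" for a b
    by (simp add: f S, rule E) (simp add: pdefs c C.smult_smult)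
  show "1 \<odot>\<^bsub>RP\<^esub> x = x" by (simp add: f S, rule E) (simp add: pdefs c)
  show "adj RP (c \<odot>\<^bsub>RP\<^esub> x) = cnj c \<odot>\<^bsub>RP\<^esub> adj RP x" for c
    by (simp add: f S, rule E) (simp add: pdefs BdD[OF f(1)] C.adj_smult)
  show "adj RP (adj RP x) = x" by (simp add: f S, rule E) (simp add: pdefs c C.adj_adj)
  show "0 \<le> cnorm RP x" by (simp add: f cnorm_RP N_nonneg)
  have z: "psub f pzero = f" by (simp add: psub_def pdefs c C.smult_r_null)
  show "cnorm RP x = 0 \<longleftrightarrow> x = \<zero>\<^bsub>RP\<^esub>"
    unfolding RP_simps(2) f(2) rep_eq_iff[OF f(1) B(1)] peq_def z cnorm_RP[OF f(1)] ..
  show "cnorm RP (c \<odot>\<^bsub>RP\<^esub> x) \<le> cmod c * cnorm RP x" for c by (simp add: f S cnorm_RP N_smult)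
  show "(cnorm RP x)\<^sup>2 \<le> cnorm RP (adj RP x \<otimes>\<^bsub>RP\<^esub> x)" by (simp add: f S cnorm_RP N_cstar)
  fix y assume "y \<in> carrier RP"
  then obtain g where g: "g \<in> Bd" "y = rep g" by (auto simp: RP_simps(1))
  note d = BdD[OF g(1)]
  show "x \<oplus>\<^bsub>RP\<^esub> y \<in> carrier RP" "x \<otimes>\<^bsub>RP\<^esub> y \<in> carrier RP" by (simp_all add: f g S RP_simps(1))
  show "x \<oplus>\<^bsub>RP\<^esub> y = y \<oplus>\<^bsub>RP\<^esub> x" by (simp add: f g S, rule E) (simp add: pdefs c d C.a_comm)
  show "a \<odot>\<^bsub>RP\<^esub> (x \<oplus>\<^bsub>RP\<^esub> y) = a \<odot>\<^bsub>RP\<^esub> x \<oplus>\<^bsub>RP\<^esub> a \<odot>\<^bsub>RP\<^esub> y" for a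
    by (simp add: f g S, rule E) (simp add: pdefs c d C.smult_r_distr)
  show "(a \<odot>\<^bsub>RP\<^esub> x) \<otimes>\<^bsub>RP\<^esub> y = a \<odot>\<^bsub>RP\<^esub> (x \<otimes>\<^bsub>RP\<^esub> y)" for a
    by (simp add: f g S, rule E) (simp add: pdefs c d C.smult_mult_left)
  show "x \<otimes>\<^bsub>RP\<^esub> (a \<odot>\<^bsub>RP\<^esub> y) = a \<odot>\<^bsub>RP\<^esub> (x \<otimes>\<^bsub>RP\<^esub> y)" for a
    by (simp add: f g S, rule E) (simp add: pdefs c d C.smult_mult_right)
  show "adj RP (x \<oplus>\<^bsub>RP\<^esub> y) = adj RP x \<oplus>\<^bsub>RP\<^esub> adj RP y"
    by (simp add: f g S, rule E) (simp add: pdefs c d C.adj_add)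
  show "adj RP (x \<otimes>\<^bsub>RP\<^esub> y) = adj RP y \<otimes>\<^bsub>RP\<^esub> adj RP x"
    by (simp add: f g S, rule E) (simp add: pdefs c d C.adj_mult)
  show "cnorm RP (x \<oplus>\<^bsub>RP\<^esub> y) \<le> cnorm RP x + cnorm RP y" by (simp add: f g S cnorm_RP N_add)
  show "cnorm RP (x \<otimes>\<^bsub>RP\<^esub> y) \<le> cnorm RP x * cnorm RP y" by (simp add: f g S cnorm_RP N_mult)
  fix z assume "z \<in> carrier RP"
  then obtain h where h: "h \<in> Bd" "z = rep h" by (auto simp: RP_simps(1))
  note e = BdD[OF h(1)]
  show "x \<oplus>\<^bsub>RP\<^esub> y \<oplus>\<^bsub>RP\<^esub> z = x \<oplus>\<^bsub>RP\<^esub> (y \<oplus>\<^bsub>RP\<^esub> z)"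
    by (simp add: f g h S, rule E) (simp add: pdefs c d e C.a_assoc)
  show "x \<otimes>\<^bsub>RP\<^esub> y \<otimes>\<^bsub>RP\<^esub> z = x \<otimes>\<^bsub>RP\<^esub> (y \<otimes>\<^bsub>RP\<^esub> z)"
    by (simp add: f g h S, rule E) (simp add: pdefs c d e C.mult_assoc)
  show "(x \<oplus>\<^bsub>RP\<^esub> y) \<otimes>\<^bsub>RP\<^esub> z = x \<otimes>\<^bsub>RP\<^esub> z \<oplus>\<^bsub>RP\<^esub> y \<otimes>\<^bsub>RP\<^esub> z"
    by (simp add: f g h S, rule E) (simp add: pdefs c d e C.mult_distr_left)
  show "z \<otimes>\<^bsub>RP\<^esub> (x \<oplus>\<^bsub>RP\<^esub> y) = z \<otimes>\<^bsub>RP\<^esub> x \<oplus>\<^bsub>RP\<^esub> z \<otimes>\<^bsub>RP\<^esub> y"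
    by (simp add: f g h S, rule E) (simp add: pdefs c d e C.mult_distr_right)
next
  fix \<sigma> :: "nat \<Rightarrow> 'p \<Rightarrow> 'm"
  assume \<sigma>: "\<And>n. \<sigma> n \<in> carrier RP"
    and Cau: "\<And>e. e > 0 \<Longrightarrow> \<exists>K. \<forall>m\<ge>K. \<forall>n\<ge>K. cnorm RP (\<sigma> m \<oplus>\<^bsub>RP\<^esub> (-1) \<odot>\<^bsub>RP\<^esub> \<sigma> n) < e"
  have "\<exists>f. f \<in> Bd \<and> \<sigma> n = rep f" for n using \<sigma>[of n] by (auto simp: RP_simps(1))
  then obtain f where f: "\<And>n. f n \<in> Bd" "\<And>n. \<sigma> n = rep (f n)" by metis
  have eq: "cnorm RP (\<sigma> n \<oplus>\<^bsub>RP\<^esub> (-1) \<odot>\<^bsub>RP\<^esub> rep g) = N (psub (f n) g)" if "g \<in> Bd" for n g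
    using that f by (simp add: RP_simps(3,5) Bd_closed cnorm_RP psub_def)
  have eq': "cnorm RP (\<sigma> m \<oplus>\<^bsub>RP\<^esub> (-1) \<odot>\<^bsub>RP\<^esub> \<sigma> n) = N (psub (f m) (f n))" for m n
    using eq[OF f(1)[of n], of m] by (simp only: f(2))
  have "\<exists>x\<in>Bd. \<forall>e>0. \<exists>K. \<forall>n\<ge>K. N (psub (f n) x) < e"
  proof (rule N_complete[OF f(1)])
    fix e :: real assume "e > 0"
    thus "\<exists>K. \<forall>m\<ge>K. \<forall>n\<ge>K. N (psub (f m) (f n)) < e"
      using Cau[of e] by (simp only: eq')
  qed
  then obtain x where x: "x \<in> Bd" "\<forall>e>0. \<exists>K. \<forall>n\<ge>K. N (psub (f n) x) < e" by blast
  show "\<exists>x\<in>carrier RP. \<forall>e>0. \<exists>K. \<forall>n\<ge>K. cnorm RP (\<sigma> n \<oplus>\<^bsub>RP\<^esub> (-1) \<odot>\<^bsub>RP\<^esub> x) < e"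
    by (rule bexI[of _ "rep x"]) (use x in \<open>simp_all add: eq RP_simps(1)\<close>)
qed

end

section \<open>Dilating a representation\<close>

text \<open>The square \<open>x\<^sup>* x\<close> of \<open>x = t p - t\<close> involves
  \<open>t\<close> only through \<open>t\<^sup>* t = p\<close> and cancels.\<close>

lemma (in cstar_algebra) isometry_partial:
  assumes t: "t \<in> carrier A" and p: "cstar_projection A p" and eq: "adj A t \<otimes> t = p"
  shows "t \<otimes> p = t" "cstar_partial_isometry A t"
proof -
  have pc: "p \<in> carrier A" "adj A p = p" "p \<otimes> p = p" using p by (auto simp: cstar_projection_def)
  have "adj A (t \<otimes> p \<ominus> t) \<otimes> (t \<otimes> p \<ominus> t) =
      (p \<otimes> (adj A t \<otimes> t) \<otimes> p \<ominus> (adj A t \<otimes> t) \<otimes> p) \<ominus> (p \<otimes> (adj A t \<otimes> t) \<ominus> adj A t \<otimes> t)"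
    using t pc(1,2) by (simp add: adj_diff adj_mult mult_diff_left mult_diff_right mult_assoc)
  also have "\<dots> = \<zero>" unfolding eq using pc by (simp add: diff_self)
  finally have "t \<otimes> p \<ominus> t = \<zero>" by (rule adj_mult_zero[rotated]) (use t pc(1) in simp)
  thus tp: "t \<otimes> p = t" using diff_eq_0 t pc(1) by simp
  show "cstar_partial_isometry A t"
    using t tp eq by (simp add: cstar_partial_isometry_def mult_assoc)
qed

context bds_representation
begin

lemma P_in [simp]: "P X \<in> carrier A"
  using projection_P[of X] by (simp add: cstar_projection_def)

lemma adj_P [simp]: "adj A (P X) = P X"
  using projection_P[of X] by (simp add: cstar_projection_def)

lemma S_in [simp]: "\<lbrakk>\<alpha> \<in> L; B \<in> \<I> \<alpha>\<rbrakk> \<Longrightarrow> S \<alpha> B \<in> carrier A"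
  using partial_isometry_S[of \<alpha> B] by (simp add: cstar_partial_isometry_def)

text \<open>All four products formed from an adjoint of one side and the other equal
  \<open>P (inf B C)\<close>, so the difference \<open>x\<close> of the two sides satisfies
  \<open>x\<^sup>* x = 0\<close>.\<close>

lemma S_mult_P:
  assumes \<alpha>: "\<alpha> \<in> L" and B: "B \<in> \<I> \<alpha>" "inf B C \<in> \<I> \<alpha>"
  shows "S \<alpha> B \<otimes> P C = S \<alpha> (inf B C)"
proof -
  let ?x = "S \<alpha> B \<otimes> P C" and ?y = "S \<alpha> (inf B C)"
  have c: "?x \<in> carrier A" "?y \<in> carrier A" using \<alpha> B by auto
  have "adj A ?x \<otimes> ?x = P C \<otimes> ((adj A (S \<alpha> B) \<otimes> S \<alpha> B) \<otimes> P C)"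
    "adj A ?x \<otimes> ?y = P C \<otimes> (adj A (S \<alpha> B) \<otimes> ?y)" "adj A ?y \<otimes> ?x = (adj A ?y \<otimes> S \<alpha> B) \<otimes> P C"
    using \<alpha> B by (simp_all add: adj_mult mult_assoc)
  hence e: "adj A ?x \<otimes> ?x = P (inf B C)" "adj A ?x \<otimes> ?y = P (inf B C)" "adj A ?y \<otimes> ?x = P (inf B C)"
    "adj A ?y \<otimes> ?y = P (inf B C)"
    using \<alpha> B by (simp_all add: adj_S_S P_inf[symmetric] inf_aci)
  have "adj A (?x \<ominus> ?y) \<otimes> (?x \<ominus> ?y) = (adj A ?x \<otimes> ?x \<ominus> adj A ?y \<otimes> ?x) \<ominus> (adj A ?x \<otimes> ?y \<ominus> adj A ?y \<otimes> ?y)"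
    using c by (simp add: adj_diff mult_diff_left mult_diff_right del: adj_mult)
  also have "\<dots> = \<zero>" unfolding e by (simp add: diff_self)
  finally have "?x \<ominus> ?y = \<zero>" by (rule adj_mult_zero[rotated]) (use c in simp)
  thus ?thesis using diff_eq_0[OF c] by simp
qed

end

lemma (in relative_generalized_bds) representation_image:
  assumes rep: "bds_representation L \<theta> \<I> J A P S" and C: "cstar_algebra C" and j: "j \<in> star_hom A C"
  shows "bds_representation L \<theta> \<I> J C (\<lambda>X. j (P X)) (\<lambda>\<alpha> B. j (S \<alpha> B))"
proof -
  interpret R: bds_representation L \<theta> \<I> J A P S by (rule rep)
  have A: "cstar_algebra A" by unfold_locales
  interpret C: cstar_algebra C by (rule C)
  note D = star_homD[OF j]
  show ?thesis
  proof (rule bds_representation.intro[OF C], unfold_locales)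
    show "cstar_projection C (j (P X))" for X
      using R.projection_P[of X] by (simp add: cstar_projection_def D flip: D(4,5))
    show "cstar_partial_isometry C (j (S \<alpha> B))" if "\<alpha> \<in> L" "B \<in> \<I> \<alpha>" for \<alpha> B
      using R.partial_isometry_S[OF that] by (simp add: cstar_partial_isometry_def D(1) flip: D(4,5))
    show "j (P bot) = \<zero>\<^bsub>C\<^esub>" by (simp add: R.P_bot star_hom_zero[OF A C j])
    show "j (P (inf X Y)) = j (P X) \<otimes>\<^bsub>C\<^esub> j (P Y)" for X Y by (simp add: R.P_inf D)
    show "j (P (sup X Y)) = j (P X) \<oplus>\<^bsub>C\<^esub> j (P Y) \<ominus>\<^bsub>C\<^esub> j (P (inf X Y))" for X Y
      unfolding R.P_sup by (simp add: star_hom_diff[OF A C j] D)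
    show "j (P X) \<otimes>\<^bsub>C\<^esub> j (S \<alpha> B) = j (S \<alpha> B) \<otimes>\<^bsub>C\<^esub> j (P (\<theta> \<alpha> X))" if "\<alpha> \<in> L" "B \<in> \<I> \<alpha>" for X \<alpha> B
      using R.P_S[OF that, of X] that by (simp flip: D(4))
    show "adj C (j (S \<alpha> B)) \<otimes>\<^bsub>C\<^esub> j (S \<beta> B') = (if \<alpha> = \<beta> then j (P (inf B B')) else \<zero>\<^bsub>C\<^esub>)"
      if "\<alpha> \<in> L" "B \<in> \<I> \<alpha>" "\<beta> \<in> L" "B' \<in> \<I> \<beta>" for \<alpha> B \<beta> B'
      using R.adj_S_S[OF that] that by (auto simp: star_hom_zero[OF A C j] simp flip: D(4,5))
    show "j (P X) = (\<Oplus>\<^bsub>C\<^esub>\<alpha>\<in>bds_Delta L \<theta> X. j (S \<alpha> (\<theta> \<alpha> X)) \<otimes>\<^bsub>C\<^esub> adj C (j (S \<alpha> (\<theta> \<alpha> X))))"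
      if X: "X \<in> J" for X
    proof -
      let ?f = "\<lambda>\<alpha>. S \<alpha> (\<theta> \<alpha> X) \<otimes>\<^bsub>A\<^esub> adj A (S \<alpha> (\<theta> \<alpha> X))"
      have f: "?f \<in> bds_Delta L \<theta> X \<rightarrow> carrier A" using Delta_\<I> by auto
      have "j (P X) = (\<Oplus>\<^bsub>C\<^esub>\<alpha>\<in>bds_Delta L \<theta> X. j (?f \<alpha>))"
        using R.P_sum[OF X] star_hom_finsum[OF A C j f] by simp
      also have "\<dots> = (\<Oplus>\<^bsub>C\<^esub>\<alpha>\<in>bds_Delta L \<theta> X. j (S \<alpha> (\<theta> \<alpha> X)) \<otimes>\<^bsub>C\<^esub> adj C (j (S \<alpha> (\<theta> \<alpha> X))))"
        using Delta_\<I> D(1) by (intro C.finsum_cong') (auto simp: D)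
      finally show ?thesis .
    qed
  qed
qed

lemma finite_subsets_eventually_mem:
  assumes "z \<in> Z" shows "eventually (\<lambda>p. finite p \<and> p \<subseteq> Z \<and> z \<in> p) (finite_subsets_at_top Z)"
  unfolding eventually_finite_subsets_at_top using assms by (intro exI[of _ "{z}"]) auto

text \<open>Along the finite sets of pairs \<open>(\<alpha>, C)\<close> with \<open>C \<in> \<I> \<alpha>\<close>, the elements \<open>s p \<alpha>\<close> exhaust the
  ideal \<open>\<I> \<alpha>\<close>. In the reduced product of the matrix algebras the limit of \<open>P (s p \<alpha>)\<close> is a
  projection, and \<open>T\<close> is the sum of the extended isometry on its range and of a copy of its complement
  in a fresh matrix coordinate.\<close>

locale bds_dilation = relative_generalized_bds L \<theta> \<I> J + unital_cstar_algebra A +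
    bds_representation L \<theta> \<I> J A P S
  for L :: "'l set" and \<theta> :: "'l \<Rightarrow> 'b::generalized_boolean_algebra \<Rightarrow> 'b"
    and \<I> :: "'l \<Rightarrow> 'b set" and J :: "'b set" and A :: "('a, 'z) cstar_scheme" (structure)
    and P :: "'b \<Rightarrow> 'a" and S :: "'l \<Rightarrow> 'b \<Rightarrow> 'a"
begin

text \<open>\<open>None\<close> is the original coordinate and \<open>Some \<alpha>\<close> the
  fresh one for the label \<open>\<alpha>\<close>. The value for infinite \<open>p\<close>, which is
  immaterial along the filter, keeps the index set finite for every \<open>p\<close>.\<close>

definition coords :: "('l \<times> 'b) set \<Rightarrow> 'l option set" where
  "coords p = (if finite p then insert None (Some ` fst ` p) else {None})"

sublocale K: columns A "coords p" for p
  by unfold_locales (simp add: coords_def)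

definition M :: "('l \<times> 'b) set \<Rightarrow> (('l option \<Rightarrow> 'a) \<Rightarrow> 'l option \<Rightarrow> 'a) cstar" where
  "M p = hilbert_module.Lop A (columns.col A (coords p)) (columns.cip A (coords p))"

definition Z :: "('l \<times> 'b) set" where "Z = {(\<alpha>, C). \<alpha> \<in> L \<and> C \<in> \<I> \<alpha>}"

sublocale reduced_product M "finite_subsets_at_top Z"
proof (rule reduced_product.intro)
  show "cstar_algebra (M p)" for p unfolding M_def by (rule K.H.Lop_cstar)
qed simp

abbreviation mu where "mu p \<equiv> columns.munit A (coords p)"

lemma None_coords [simp]: "None \<in> coords p"
  by (simp add: coords_def)

lemma mu_in: "\<lbrakk>i \<in> coords p; j \<in> coords p; a \<in> carrier A\<rbrakk> \<Longrightarrow> mu p i j a \<in> carrier (M p)"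
  unfolding M_def by (rule K.munit_in)

lemma adj_mu: "\<lbrakk>i \<in> coords p; j \<in> coords p; a \<in> carrier A\<rbrakk> \<Longrightarrow> adj (M p) (mu p i j a) = mu p j i (adj A a)"
  unfolding M_def by (rule K.adj_munit)

lemma cnorm_mu: "\<lbrakk>i \<in> coords p; j \<in> coords p; a \<in> carrier A\<rbrakk> \<Longrightarrow> cnorm (M p) (mu p i j a) = cnorm A a"
  unfolding M_def by (rule K.cnorm_munit)

lemma mu_mult: "\<lbrakk>i \<in> coords p; j \<in> coords p; k \<in> coords p; l \<in> coords p; a \<in> carrier A; b \<in> carrier A\<rbrakk> \<Longrightarrow>
    mu p i j a \<otimes>\<^bsub>M p\<^esub> mu p k l b = (if j = k then mu p i l (a \<otimes> b) else \<zero>\<^bsub>M p\<^esub>)"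
  unfolding M_def by (rule K.munit_mult)

lemma mu_add: "\<lbrakk>a \<in> carrier A; b \<in> carrier A\<rbrakk> \<Longrightarrow> mu p i j (a \<oplus> b) = mu p i j a \<oplus>\<^bsub>M p\<^esub> mu p i j b"
  unfolding M_def by (rule K.munit_add)

lemma mu_smult: "a \<in> carrier A \<Longrightarrow> mu p i j (c \<odot> a) = c \<odot>\<^bsub>M p\<^esub> mu p i j a"
  unfolding M_def by (rule K.munit_smult)

lemma mu_zero: "mu p i j \<zero> = \<zero>\<^bsub>M p\<^esub>"
  unfolding M_def by (rule K.munit_zero)

section \<open>Finite stages of the dilation\<close>

lemma ideal_I_inf: "\<alpha> \<in> L \<Longrightarrow> B \<in> \<I> \<alpha> \<Longrightarrow> inf B C \<in> \<I> \<alpha>"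
  using ideal_\<I>[of \<alpha>] by (auto simp: boolean_ideal_def)

lemma ideal_upper_bound:
  assumes \<alpha>: "\<alpha> \<in> L" and X: "finite X" "X \<subseteq> \<I> \<alpha>"
  shows "\<exists>B\<in>\<I> \<alpha>. \<forall>C\<in>X. C \<le> B"
  using X
proof (induction X)
  case empty
  show ?case using ideal_\<I>[OF \<alpha>] by (auto simp: boolean_ideal_def)
next
  case (insert C X)
  then obtain B where B: "B \<in> \<I> \<alpha>" "\<forall>C\<in>X. C \<le> B" by auto
  have "sup C B \<in> \<I> \<alpha>" using ideal_\<I>[OF \<alpha>] B insert.prems by (auto simp: boolean_ideal_def)
  thus ?case using B by (intro bexI[of _ "sup C B"]) (auto intro: le_supI2)
qed

text \<open>Ideals are closed under finite unions, so the elements of \<open>\<I> \<alpha>\<close>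
  listed in \<open>p\<close> have an upper bound in \<open>\<I> \<alpha>\<close>. Pairs outside
  \<open>Z\<close> are ignored and an infinite \<open>p\<close> imposes nothing, so the choice
  succeeds for every \<open>p\<close> as soon as \<open>\<alpha> \<in> L\<close>.\<close>

definition s :: "('l \<times> 'b) set \<Rightarrow> 'l \<Rightarrow> 'b" where
  "s p \<alpha> = (SOME B. B \<in> \<I> \<alpha> \<and> (finite p \<longrightarrow> (\<forall>C. (\<alpha>, C) \<in> p \<inter> Z \<longrightarrow> C \<le> B)))"

lemma s_upper_bound: "\<alpha> \<in> L \<Longrightarrow> s p \<alpha> \<in> \<I> \<alpha>" "\<lbrakk>\<alpha> \<in> L; finite p; (\<alpha>, C) \<in> p; (\<alpha>, C) \<in> Z\<rbrakk> \<Longrightarrow> C \<le> s p \<alpha>"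
proof -
  assume \<alpha>: "\<alpha> \<in> L"
  have "\<exists>B. B \<in> \<I> \<alpha> \<and> (finite p \<longrightarrow> (\<forall>C. (\<alpha>, C) \<in> p \<inter> Z \<longrightarrow> C \<le> B))"
  proof (cases "finite p")
    case True
    have "finite (snd ` {z \<in> p \<inter> Z. fst z = \<alpha>})" using True by simp
    moreover have "snd ` {z \<in> p \<inter> Z. fst z = \<alpha>} \<subseteq> \<I> \<alpha>" by (auto simp: Z_def)
    ultimately obtain B where "B \<in> \<I> \<alpha>" "\<forall>C\<in>snd ` {z \<in> p \<inter> Z. fst z = \<alpha>}. C \<le> B"
      using ideal_upper_bound[OF \<alpha>] by blast
    thus ?thesis by (intro exI[of _ B]) force
  next
    case False
    then show ?thesis using ideal_\<I>[OF \<alpha>] by (auto simp: boolean_ideal_def)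
  qed
  from someI_ex[OF this]
  show "s p \<alpha> \<in> \<I> \<alpha>" "\<lbrakk>finite p; (\<alpha>, C) \<in> p; (\<alpha>, C) \<in> Z\<rbrakk> \<Longrightarrow> C \<le> s p \<alpha>"
    unfolding s_def[symmetric] by auto
qed

lemma eventually_s:
  assumes "\<alpha> \<in> L" "C \<in> \<I> \<alpha>"
  shows "eventually (\<lambda>p. Some \<alpha> \<in> coords p \<and> C \<le> s p \<alpha>) (finite_subsets_at_top Z)"
proof -
  have z: "(\<alpha>, C) \<in> Z" using assms by (simp add: Z_def)
  show ?thesis
    using finite_subsets_eventually_mem[OF z]
  proof eventually_elim
    case (elim p)
    hence "Some \<alpha> \<in> coords p" by (force simp: coords_def)
    thus ?case using s_upper_bound(2)[of \<alpha> p C] assms z elim by blast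
  qed
qed

lemma eventually_coords: "\<alpha> \<in> L \<Longrightarrow> eventually (\<lambda>p. Some \<alpha> \<in> coords p) (finite_subsets_at_top Z)"
proof -
  assume \<alpha>: "\<alpha> \<in> L"
  then obtain C where "C \<in> \<I> \<alpha>" using ideal_\<I>[OF \<alpha>] by (auto simp: boolean_ideal_def)
  from eventually_s[OF \<alpha> this] show ?thesis by (rule eventually_mono) simp
qed

definition a where "a p \<alpha> B = S \<alpha> (inf (s p \<alpha>) B)"
definition q where "q p \<alpha> B = P B \<ominus> P (inf (s p \<alpha>) B)"

text \<open>One column with the entries \<open>a\<close> and \<open>q\<close>:
  \<open>a\<^sup>* a\<close> is \<open>P (inf (s p \<alpha>) B)\<close> and
  \<open>q\<^sup>* q\<close> is the rest of \<open>P B\<close>, so together they give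
  \<open>P B\<close>. Placing \<open>q\<close> in the row \<open>Some \<alpha>\<close> makes it
  orthogonal to the entries of other labels and invisible to projections in the corner at
  \<open>None\<close>.\<close>

definition T0 where
  "T0 \<alpha> B p = (if Some \<alpha> \<in> coords p then mu p None None (a p \<alpha> B) \<oplus>\<^bsub>M p\<^esub> mu p (Some \<alpha>) None (q p \<alpha> B)
    else \<zero>\<^bsub>M p\<^esub>)"

lemma a_in [simp]: "\<alpha> \<in> L \<Longrightarrow> a p \<alpha> B \<in> carrier A"
  by (simp add: a_def ideal_I_inf s_upper_bound(1))

lemma q_in [simp]: "q p \<alpha> B \<in> carrier A" and adj_q [simp]: "adj A (q p \<alpha> B) = q p \<alpha> B"
  by (simp_all add: q_def adj_diff)

lemma a_a: "\<lbrakk>\<alpha> \<in> L; \<beta> \<in> L\<rbrakk> \<Longrightarrow> adj A (a p \<alpha> B) \<otimes> a p \<beta> C = (if \<alpha> = \<beta> then P (inf (s p \<alpha>) (inf B C)) else \<zero>)"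
proof -
  assume \<alpha>: "\<alpha> \<in> L" and \<beta>: "\<beta> \<in> L"
  show ?thesis
    using adj_S_S[OF \<alpha> ideal_I_inf[OF \<alpha> s_upper_bound(1)[OF \<alpha>]] \<beta> ideal_I_inf[OF \<beta> s_upper_bound(1)[OF \<beta>]]]
    by (auto simp: a_def inf_aci)
qed

lemma q_P: "q p \<alpha> B \<otimes> P C = q p \<alpha> (inf B C)"
  by (simp add: q_def mult_diff_left P_inf[symmetric] inf_aci)

lemma q_q: "q p \<alpha> B \<otimes> q p \<alpha> C = q p \<alpha> (inf B C)"
proof -
  have "q p \<alpha> B \<otimes> q p \<alpha> C = q p \<alpha> (inf B C) \<ominus> q p \<alpha> (inf B (inf (s p \<alpha>) C))"
    unfolding q_P[symmetric] unfolding q_def[of p \<alpha> C] by (rule mult_diff_right) simp_all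
  also have "q p \<alpha> (inf B (inf (s p \<alpha>) C)) = \<zero>"
    by (simp add: q_def inf_aci diff_self)
  finally show ?thesis by simp
qed

lemma q_zero: "inf (s p \<alpha>) B = B \<Longrightarrow> q p \<alpha> B = \<zero>"
  by (simp add: q_def diff_self)

lemma T0_in: "\<alpha> \<in> L \<Longrightarrow> T0 \<alpha> B p \<in> carrier (M p)"
  by (simp add: T0_def mu_in)

lemma adj_T0: "\<lbrakk>\<alpha> \<in> L; Some \<alpha> \<in> coords p\<rbrakk> \<Longrightarrow> adj (M p) (T0 \<alpha> B p) =
    mu p None None (adj A (a p \<alpha> B)) \<oplus>\<^bsub>M p\<^esub> mu p None (Some \<alpha>) (q p \<alpha> B)"
  by (simp add: T0_def C.adj_add mu_in adj_mu)

lemma T0_Bd: assumes \<alpha>: "\<alpha> \<in> L" shows "T0 \<alpha> B \<in> Bd"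
proof (rule BdI[OF T0_in[OF \<alpha>]])
  fix p
  have "cnorm A (a p \<alpha> B) \<le> 1"
    unfolding a_def using representation_carrier(4)[OF bds_representation_axioms \<alpha>] \<alpha>
    by (simp add: ideal_I_inf s_upper_bound(1))
  moreover have "cnorm A (q p \<alpha> B) \<le> 2"
    using cnorm_add[of "P B" "\<ominus> P (inf (s p \<alpha>) B)"] representation_carrier(2)[OF bds_representation_axioms, of B]
      representation_carrier(2)[OF bds_representation_axioms, of "inf (s p \<alpha>) B"]
    by (simp add: q_def a_minus_def cnorm_uminus)
  ultimately show "cnorm (M p) (T0 \<alpha> B p) \<le> 3"
    using C.cnorm_add[OF mu_in mu_in, of None p None "a p \<alpha> B" "Some \<alpha>" None "q p \<alpha> B"] \<alpha>
    by (cases "Some \<alpha> \<in> coords p") (simp_all add: T0_def cnorm_mu C.cnorm_zero)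
qed

lemma adj_T0_T0:
  assumes \<alpha>: "\<alpha> \<in> L" "Some \<alpha> \<in> coords p" and \<beta>: "\<beta> \<in> L" "Some \<beta> \<in> coords p"
  shows "adj (M p) (T0 \<alpha> B p) \<otimes>\<^bsub>M p\<^esub> T0 \<beta> C p = (if \<alpha> = \<beta> then mu p None None (P (inf B C)) else \<zero>\<^bsub>M p\<^esub>)"
proof -
  have "adj (M p) (T0 \<alpha> B p) \<otimes>\<^bsub>M p\<^esub> T0 \<beta> C p =
      mu p None None (adj A (a p \<alpha> B) \<otimes> a p \<beta> C) \<oplus>\<^bsub>M p\<^esub>
      (if \<alpha> = \<beta> then mu p None None (q p \<alpha> B \<otimes> q p \<beta> C) else \<zero>\<^bsub>M p\<^esub>)"
    unfolding adj_T0[OF \<alpha>] using \<alpha> \<beta>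
    by (simp add: T0_def C.mult_distr_left C.mult_distr_right mu_in mu_mult)
  also have "\<dots> = (if \<alpha> = \<beta> then mu p None None (P (inf B C)) else \<zero>\<^bsub>M p\<^esub>)"
  proof (cases "\<alpha> = \<beta>")
    case True
    have "P (inf (s p \<alpha>) (inf B C)) \<oplus> q p \<alpha> (inf B C) = P (inf B C)"
      using diff_add_cancel[of "P (inf B C)" "P (inf (s p \<alpha>) (inf B C))"]
        a_comm[of "P (inf (s p \<alpha>) (inf B C))" "P (inf B C) \<ominus> P (inf (s p \<alpha>) (inf B C))"]
      by (simp add: q_def)
    thus ?thesis using True \<alpha> by (simp add: a_a q_q mu_add[symmetric])
  next
    case False
    then show ?thesis using \<alpha> \<beta> by (simp add: a_a mu_zero)
  qed
  finally show ?thesis .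
qed

text \<open>On the left the corner projection annihilates the fresh row; on the right
  \<open>q\<close> vanishes on everything below \<open>s p \<alpha>\<close>. What remains is the
  commutation rule for \<open>S\<close> on the ideal.\<close>

lemma P_T0:
  assumes \<alpha>: "\<alpha> \<in> L" "Some \<alpha> \<in> coords p" and le: "\<theta> \<alpha> X \<le> s p \<alpha>"
  shows "mu p None None (P X) \<otimes>\<^bsub>M p\<^esub> T0 \<alpha> B p = T0 \<alpha> B p \<otimes>\<^bsub>M p\<^esub> mu p None None (P (\<theta> \<alpha> X))"
proof -
  have "inf (s p \<alpha>) (inf B (\<theta> \<alpha> X)) = inf B (\<theta> \<alpha> X)"
    using le by (simp add: inf_absorb2 le_infI2)
  hence 0: "q p \<alpha> B \<otimes> P (\<theta> \<alpha> X) = \<zero>" by (simp add: q_P q_zero)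
  have 1: "P X \<otimes> a p \<alpha> B = a p \<alpha> B \<otimes> P (\<theta> \<alpha> X)"
    using \<alpha> by (simp add: a_def P_S ideal_I_inf s_upper_bound(1))
  show ?thesis using \<alpha> 0 1
    by (simp add: T0_def C.mult_distr_left C.mult_distr_right mu_in mu_mult mu_zero)
qed

lemma T0_ideal: "\<lbrakk>\<alpha> \<in> L; Some \<alpha> \<in> coords p; B \<le> s p \<alpha>; B \<in> \<I> \<alpha>\<rbrakk> \<Longrightarrow> T0 \<alpha> B p = mu p None None (S \<alpha> B)"
  by (simp add: T0_def a_def q_zero inf_absorb2 mu_zero mu_in)

section \<open>The corner embedding and the extended isometries in the limit\<close>

definition \<iota>0 :: "'a \<Rightarrow> ('l \<times> 'b) set \<Rightarrow> ('l option \<Rightarrow> 'a) \<Rightarrow> 'l option \<Rightarrow> 'a" where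
  "\<iota>0 x p = mu p None None x"

definition \<iota> where "\<iota> x = rep (\<iota>0 x)"
definition T where "T \<alpha> B = rep (T0 \<alpha> B)"

lemma \<iota>0_Bd: "x \<in> carrier A \<Longrightarrow> \<iota>0 x \<in> Bd"
  by (rule BdI[of _ "cnorm A x"]) (simp_all add: \<iota>0_def mu_in cnorm_mu)

lemma \<iota>_hom: "\<iota> \<in> star_hom A RP"
proof (rule star_homI)
  fix x y assume xy: "x \<in> carrier A" "y \<in> carrier A"
  show "\<iota> (x \<oplus> y) = \<iota> x \<oplus>\<^bsub>RP\<^esub> \<iota> y" "\<iota> (x \<otimes> y) = \<iota> x \<otimes>\<^bsub>RP\<^esub> \<iota> y"
    unfolding \<iota>_def RP_simps(3,4)[OF \<iota>0_Bd[OF xy(1)] \<iota>0_Bd[OF xy(2)]]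
    using xy by (auto intro!: arg_cong[where f = rep] simp: \<iota>0_def pdefs mu_add mu_mult)
next
  fix c x assume x: "x \<in> carrier A"
  show "\<iota> (c \<odot> x) = c \<odot>\<^bsub>RP\<^esub> \<iota> x" "\<iota> (adj A x) = adj RP (\<iota> x)"
    unfolding \<iota>_def RP_simps(5,6)[OF \<iota>0_Bd[OF x]]
    using x by (auto intro!: arg_cong[where f = rep] simp: \<iota>0_def pdefs mu_smult adj_mu)
  show "\<iota> x \<in> carrier RP" using \<iota>0_Bd[OF x] by (simp add: \<iota>_def RP_simps(1))
qed

lemma \<iota>_norm: "x \<in> carrier A \<Longrightarrow> cnorm A x \<le> cnorm RP (\<iota> x)"
  unfolding \<iota>_def cnorm_RP[OF \<iota>0_Bd]
  by (rule N_const[OF \<iota>0_Bd]) (simp_all add: \<iota>0_def cnorm_mu)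

lemma T_in: "\<alpha> \<in> L \<Longrightarrow> T \<alpha> B \<in> carrier RP"
  using T0_Bd by (simp add: T_def RP_simps(1))

text \<open>From some finite set on, \<open>s p \<alpha>\<close> dominates \<open>B\<close>; then
  \<open>q\<close> vanishes and \<open>a\<close> is \<open>S \<alpha> B\<close> itself.\<close>

lemma T_ideal: "\<lbrakk>\<alpha> \<in> L; B \<in> \<I> \<alpha>\<rbrakk> \<Longrightarrow> T \<alpha> B = \<iota> (S \<alpha> B)"
  unfolding T_def \<iota>_def
proof (rule rep_eventually)
  assume \<alpha>: "\<alpha> \<in> L" "B \<in> \<I> \<alpha>"
  show "eventually (\<lambda>p. T0 \<alpha> B p = \<iota>0 (S \<alpha> B) p) (finite_subsets_at_top Z)"
    using eventually_s[OF \<alpha>] by eventually_elim (simp add: \<iota>0_def T0_ideal \<alpha>)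
qed (simp_all add: T0_Bd \<iota>0_Bd)

lemma adj_T_T:
  assumes \<alpha>: "\<alpha> \<in> L" and \<beta>: "\<beta> \<in> L"
  shows "adj RP (T \<alpha> B) \<otimes>\<^bsub>RP\<^esub> T \<beta> C = (if \<alpha> = \<beta> then \<iota> (P (inf B C)) else \<zero>\<^bsub>RP\<^esub>)"
proof -
  have "adj RP (T \<alpha> B) \<otimes>\<^bsub>RP\<^esub> T \<beta> C = rep (pmult (padj (T0 \<alpha> B)) (T0 \<beta> C))"
    using \<alpha> \<beta> by (simp add: T_def RP_simps T0_Bd Bd_closed)
  also have "\<dots> = rep (if \<alpha> = \<beta> then \<iota>0 (P (inf B C)) else pzero)"
  proof (rule rep_eventually)
    show "eventually (\<lambda>p. pmult (padj (T0 \<alpha> B)) (T0 \<beta> C) p =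
        (if \<alpha> = \<beta> then \<iota>0 (P (inf B C)) else pzero) p) (finite_subsets_at_top Z)"
      using eventually_coords[OF \<alpha>] eventually_coords[OF \<beta>]
      by eventually_elim (use \<alpha> \<beta> adj_T0_T0[of \<alpha> _ \<beta> B C] in \<open>simp add: \<iota>0_def pdefs\<close>)
  qed (simp_all add: \<alpha> \<beta> T0_Bd Bd_closed \<iota>0_Bd)
  also have "\<dots> = (if \<alpha> = \<beta> then \<iota> (P (inf B C)) else \<zero>\<^bsub>RP\<^esub>)"
    by (simp add: \<iota>_def RP_simps)
  finally show ?thesis .
qed

theorem dilation_representation: "bds_representation L \<theta> (\<lambda>_. UNIV) J RP (\<lambda>X. \<iota> (P X)) T"
proof -
  interpret RP: cstar_algebra RP by (rule RP_cstar)
  note rep = representation_image[OF bds_representation_axioms RP_cstar \<iota>_hom]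
  interpret R: bds_representation L \<theta> \<I> J RP "\<lambda>X. \<iota> (P X)" "\<lambda>\<alpha> B. \<iota> (S \<alpha> B)" by (rule rep)
  show ?thesis
  proof (rule bds_representation.intro[OF RP_cstar], unfold_locales)
    show "cstar_projection RP (\<iota> (P X))" for X by (rule R.projection_P)
    show "cstar_partial_isometry RP (T \<alpha> B)" if "\<alpha> \<in> L" for \<alpha> B
      by (rule RP.isometry_partial(2)[OF T_in[OF that] R.projection_P[of B]]) (simp add: adj_T_T that)
    show "\<iota> (P bot) = \<zero>\<^bsub>RP\<^esub>" by (rule R.P_bot)
    show "\<iota> (P (inf X Y)) = \<iota> (P X) \<otimes>\<^bsub>RP\<^esub> \<iota> (P Y)" for X Y by (rule R.P_inf)
    show "\<iota> (P (sup X Y)) = \<iota> (P X) \<oplus>\<^bsub>RP\<^esub> \<iota> (P Y) \<ominus>\<^bsub>RP\<^esub> \<iota> (P (inf X Y))" for X Y by (rule R.P_sup)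
    show "\<iota> (P X) \<otimes>\<^bsub>RP\<^esub> T \<alpha> B = T \<alpha> B \<otimes>\<^bsub>RP\<^esub> \<iota> (P (\<theta> \<alpha> X))" if \<alpha>: "\<alpha> \<in> L" for X \<alpha> B
    proof -
      have "rep (pmult (\<iota>0 (P X)) (T0 \<alpha> B)) = rep (pmult (T0 \<alpha> B) (\<iota>0 (P (\<theta> \<alpha> X))))"
      proof (rule rep_eventually)
        \<comment> \<open>The ideal contains the range of \<open>\<theta> \<alpha>\<close>, so
          \<open>s p \<alpha>\<close> eventually lies above \<open>\<theta> \<alpha> X\<close>, as
          \<open>P_T0\<close> demands.\<close>
        have "\<theta> \<alpha> X \<in> \<I> \<alpha>" using range_subset_\<I>[OF \<alpha>] by (auto simp: bds_range_def)
        from eventually_s[OF \<alpha> this]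
        show "eventually (\<lambda>p. pmult (\<iota>0 (P X)) (T0 \<alpha> B) p = pmult (T0 \<alpha> B) (\<iota>0 (P (\<theta> \<alpha> X))) p)
            (finite_subsets_at_top Z)"
          by eventually_elim (simp add: pdefs \<iota>0_def P_T0 \<alpha>)
      qed (simp_all add: \<alpha> T0_Bd Bd_closed \<iota>0_Bd)
      thus ?thesis using \<alpha> by (simp add: \<iota>_def T_def RP_simps T0_Bd \<iota>0_Bd)
    qed
    show "adj RP (T \<alpha> B) \<otimes>\<^bsub>RP\<^esub> T \<beta> C = (if \<alpha> = \<beta> then \<iota> (P (inf B C)) else \<zero>\<^bsub>RP\<^esub>)"
      if "\<alpha> \<in> L" "\<beta> \<in> L" for \<alpha> B \<beta> C using adj_T_T[OF that] .
    \<comment> \<open>Every index \<open>\<theta> \<alpha> X\<close> in this sum lies in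
      \<open>\<I> \<alpha>\<close>, where \<open>T\<close> is the image of \<open>S\<close>; the
      relation is thus the image of the one in \<open>A\<close>.\<close>
    show "\<iota> (P X) = (\<Oplus>\<^bsub>RP\<^esub>\<alpha>\<in>bds_Delta L \<theta> X. T \<alpha> (\<theta> \<alpha> X) \<otimes>\<^bsub>RP\<^esub> adj RP (T \<alpha> (\<theta> \<alpha> X)))"
      if X: "X \<in> J" for X
      unfolding R.P_sum[OF X] using Delta_\<I> T_in by (intro RP.finsum_cong') (auto simp: T_ideal)
  qed
qed

end

text \<open>Matrices over \<open>A\<close> are formed only after passing to a unital algebra around
  it. Bounding the norm of \<open>k x\<close> from below suffices, as the opposite inequality holds
  for every homomorphism.\<close>

lemma (in relative_generalized_bds) isometric_dilation:
  fixes A :: "('a, 'z) cstar_scheme"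
  assumes rep: "bds_representation L \<theta> \<I> J A P S"
  obtains E :: "(('l \<times> 'b) set \<Rightarrow> ('l option \<Rightarrow> 'a \<Rightarrow> 'a) \<Rightarrow> 'l option \<Rightarrow> 'a \<Rightarrow> 'a) cstar" and k T
  where "k \<in> star_hom A E" "\<And>x. x \<in> carrier A \<Longrightarrow> cnorm A x \<le> cnorm E (k x)"
    "bds_representation L \<theta> (\<lambda>_. UNIV) J E (\<lambda>X. k (P X)) T"
    "\<And>\<alpha> B. \<lbrakk>\<alpha> \<in> L; B \<in> \<I> \<alpha>\<rbrakk> \<Longrightarrow> T \<alpha> B = k (S \<alpha> B)"
proof -
  interpret A: bds_representation L \<theta> \<I> J A P S by (rule rep)
  obtain U :: "('a \<Rightarrow> 'a) cstar" and j where U: "unital_cstar_algebra U" and j: "j \<in> star_hom A U"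
    and iso: "\<And>x. x \<in> carrier A \<Longrightarrow> cnorm U (j x) = cnorm A x" by (rule A.unital_embedding, rule that)
  interpret U: unital_cstar_algebra U by (rule U)
  have UC: "cstar_algebra U" by unfold_locales
  interpret R: bds_representation L \<theta> \<I> J U "\<lambda>X. j (P X)" "\<lambda>\<alpha> B. j (S \<alpha> B)"
    by (rule representation_image[OF rep UC j])
  interpret D: bds_dilation L \<theta> \<I> J U "\<lambda>X. j (P X)" "\<lambda>\<alpha> B. j (S \<alpha> B)" by unfold_locales
  show ?thesis
  proof (rule that[of "\<lambda>x. D.\<iota> (j x)" D.RP D.T])
    show "(\<lambda>x. D.\<iota> (j x)) \<in> star_hom A D.RP"
      by (rule star_homI) (simp_all add: star_homD[OF j] star_homD[OF D.\<iota>_hom])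
    show "cnorm A x \<le> cnorm D.RP (D.\<iota> (j x))" if "x \<in> carrier A" for x
      using D.\<iota>_norm[OF star_homD(1)[OF j that]] iso[OF that] by simp
    show "bds_representation L \<theta> (\<lambda>_. UNIV) J D.RP (\<lambda>X. D.\<iota> (j (P X))) D.T"
      by (rule D.dilation_representation)
  qed (rule D.T_ideal)
qed

section \<open>The full hereditary subalgebra\<close>

context
  fixes A :: "('a, 'z) cstar_scheme" and C :: "('c, 'w) cstar_scheme" and \<phi>
  assumes A: "cstar_algebra A" and C: "cstar_algebra C" and \<phi>: "\<phi> \<in> star_hom A C"
begin

interpretation A: cstar_algebra A by (rule A)
interpretation C: cstar_algebra C by (rule C)

lemma star_hom_cconv: "A.cconv \<sigma> x \<Longrightarrow> C.cconv (\<lambda>n. \<phi> (\<sigma> n)) (\<phi> x)"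
proof -
  assume c: "A.cconv \<sigma> x"
  note i = A.cconv_in[OF c]
  show ?thesis
  proof (rule C.cconv_dominated)
    show "(\<lambda>n. cnorm A (\<sigma> n \<ominus>\<^bsub>A\<^esub> x)) \<longlonglongrightarrow> 0" using c by (simp add: A.cconv_def)
    show "cnorm C (\<phi> (\<sigma> n) \<ominus>\<^bsub>C\<^esub> \<phi> x) \<le> cnorm A (\<sigma> n \<ominus>\<^bsub>A\<^esub> x)" for n
      unfolding star_hom_diff[OF A C \<phi> i, symmetric]
      by (rule star_hom_contractive[OF A C \<phi>]) (simp add: i)
  qed (use star_homD(1)[OF \<phi>] i in auto)
qed

lemma star_hom_preimage_subalgebra:
  assumes K: "cstar_subalgebra K C" shows "cstar_subalgebra {x \<in> carrier A. \<phi> x \<in> K} A"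
proof (rule A.cstar_subalgebraI)
  note D = C.cstar_subalgebraD[OF K] and E = star_homD[OF \<phi>]
  show "\<zero>\<^bsub>A\<^esub> \<in> {x \<in> carrier A. \<phi> x \<in> K}" using star_hom_zero[OF A C \<phi>] D(2) by simp
  fix \<sigma> x assume \<sigma>: "range \<sigma> \<subseteq> {x \<in> carrier A. \<phi> x \<in> K}" "A.cconv \<sigma> x"
  have "range (\<lambda>n. \<phi> (\<sigma> n)) \<subseteq> K" using \<sigma>(1) by auto
  thus "x \<in> {x \<in> carrier A. \<phi> x \<in> K}" using D(7) star_hom_cconv[OF \<sigma>(2)] A.cconv_in(2)[OF \<sigma>(2)] by auto
qed (use C.cstar_subalgebraD[OF K] star_homD[OF \<phi>] in auto)

end

text \<open>The equaliser of two homomorphisms is a C*-subalgebra; it is closed because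
  homomorphisms are contractive.\<close>

lemma star_hom_eq_on_generators:
  assumes A: "cstar_algebra A" and C: "cstar_algebra C" and \<phi>: "\<phi> \<in> star_hom A C" and \<psi>: "\<psi> \<in> star_hom A C"
    and X: "X \<subseteq> carrier A" "cstar_generates A X" "\<And>x. x \<in> X \<Longrightarrow> \<phi> x = \<psi> x" and x: "x \<in> carrier A"
  shows "\<phi> x = \<psi> x"
proof -
  interpret A: cstar_algebra A by (rule A)
  interpret C: cstar_algebra C by (rule C)
  note E = star_homD[OF \<phi>] and F = star_homD[OF \<psi>]
  have "cstar_subalgebra {x \<in> carrier A. \<phi> x = \<psi> x} A"
  proof (rule A.cstar_subalgebraI)
    show "\<zero>\<^bsub>A\<^esub> \<in> {x \<in> carrier A. \<phi> x = \<psi> x}"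
      using star_hom_zero[OF A C \<phi>] star_hom_zero[OF A C \<psi>] by simp
    fix \<sigma> x assume \<sigma>: "range \<sigma> \<subseteq> {x \<in> carrier A. \<phi> x = \<psi> x}" "A.cconv \<sigma> x"
    have "(\<lambda>n. \<phi> (\<sigma> n)) = (\<lambda>n. \<psi> (\<sigma> n))" using \<sigma>(1) by auto
    hence "\<phi> x = \<psi> x"
      using star_hom_cconv[OF A C \<phi> \<sigma>(2)] star_hom_cconv[OF A C \<psi> \<sigma>(2)] C.cconv_unique by metis
    thus "x \<in> {x \<in> carrier A. \<phi> x = \<psi> x}" using A.cconv_in(2)[OF \<sigma>(2)] by simp
  qed (use E F in auto)
  thus ?thesis using X x unfolding cstar_generates_def by blast
qed

text \<open>The image is closed because a convergent sequence in it pulls back to a Cauchy sequence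
  in the complete algebra \<open>A\<close>.\<close>

lemma isometric_image_subalgebra:
  assumes A: "cstar_algebra A" and C: "cstar_algebra C" and \<phi>: "\<phi> \<in> star_hom A C"
    and iso: "\<And>x. x \<in> carrier A \<Longrightarrow> cnorm C (\<phi> x) = cnorm A x"
  shows "cstar_subalgebra (\<phi> ` carrier A) C" "star_isomorphic A (C\<lparr>carrier := \<phi> ` carrier A\<rparr>)"
proof -
  interpret A: cstar_algebra A by (rule A)
  interpret C: cstar_algebra C by (rule C)
  note E = star_homD[OF \<phi>]
  show "cstar_subalgebra (\<phi> ` carrier A) C"
  proof (rule C.cstar_subalgebraI)
    show "\<zero>\<^bsub>C\<^esub> \<in> \<phi> ` carrier A"
      by (rule image_eqI[of _ _ "\<zero>\<^bsub>A\<^esub>"]) (simp_all add: star_hom_zero[OF A C \<phi>])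
    fix x assume "x \<in> \<phi> ` carrier A"
    then obtain a where a: "a \<in> carrier A" "x = \<phi> a" by blast
    show "c \<odot>\<^bsub>C\<^esub> x \<in> \<phi> ` carrier A" for c
      by (rule image_eqI[of _ _ "c \<odot>\<^bsub>A\<^esub> a"]) (simp_all add: a E)
    show "adj C x \<in> \<phi> ` carrier A" by (rule image_eqI[of _ _ "adj A a"]) (simp_all add: a E)
    fix y assume "y \<in> \<phi> ` carrier A"
    then obtain b where b: "b \<in> carrier A" "y = \<phi> b" by blast
    show "x \<oplus>\<^bsub>C\<^esub> y \<in> \<phi> ` carrier A" by (rule image_eqI[of _ _ "a \<oplus>\<^bsub>A\<^esub> b"]) (simp_all add: a b E)
    show "x \<otimes>\<^bsub>C\<^esub> y \<in> \<phi> ` carrier A" by (rule image_eqI[of _ _ "a \<otimes>\<^bsub>A\<^esub> b"]) (simp_all add: a b E)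
  next
    fix \<sigma> y assume \<sigma>: "range \<sigma> \<subseteq> \<phi> ` carrier A" and y: "C.cconv \<sigma> y"
    have "\<exists>a. a \<in> carrier A \<and> \<sigma> n = \<phi> a" for n using \<sigma> by auto
    then obtain a where a: "\<And>n. a n \<in> carrier A" "\<And>n. \<sigma> n = \<phi> (a n)" by metis
    have \<sigma>c: "\<sigma> n \<in> carrier C" for n by (rule C.cconv_in(1)[OF y])
    note yc = C.cconv_in(2)[OF y]
    have "\<exists>x. A.cconv a x"
    proof (rule A.complete_cconv)
      fix e :: real assume e: "e > 0"
      obtain N where N: "\<And>n. n \<ge> N \<Longrightarrow> cnorm C (\<sigma> n \<ominus>\<^bsub>C\<^esub> y) \<le> e / 3"
        using C.cconvD[OF y, of "e / 3"] e by (metis zero_less_divide_iff zero_less_numeral)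
      have "cnorm A (a m \<ominus>\<^bsub>A\<^esub> a n) < e" if "m \<ge> N" "n \<ge> N" for m n
      proof -
        have "cnorm A (a m \<ominus>\<^bsub>A\<^esub> a n) = cnorm C (\<sigma> m \<ominus>\<^bsub>C\<^esub> \<sigma> n)"
          using a iso[of "a m \<ominus>\<^bsub>A\<^esub> a n"] by (simp add: star_hom_diff[OF A C \<phi>])
        also have "\<dots> \<le> cnorm C (\<sigma> m \<ominus>\<^bsub>C\<^esub> y) + cnorm C (y \<ominus>\<^bsub>C\<^esub> \<sigma> n)"
          by (rule C.cnorm_triangle[OF \<sigma>c yc \<sigma>c])
        also have "cnorm C (y \<ominus>\<^bsub>C\<^esub> \<sigma> n) = cnorm C (\<sigma> n \<ominus>\<^bsub>C\<^esub> y)" by (rule C.cnorm_commute[OF yc \<sigma>c])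
        finally show ?thesis using N[OF that(1)] N[OF that(2)] e by linarith
      qed
      thus "\<exists>N. \<forall>m\<ge>N. \<forall>n\<ge>N. cnorm A (a m \<ominus>\<^bsub>A\<^esub> a n) < e" by blast
    qed (use a in auto)
    then obtain x where x: "A.cconv a x" ..
    have "C.cconv \<sigma> (\<phi> x)" using star_hom_cconv[OF A C \<phi> x] a(2)[symmetric] by simp
    hence "y = \<phi> x" using C.cconv_unique[OF y] by blast
    thus "y \<in> \<phi> ` carrier A" using A.cconv_in(2)[OF x] by blast
  qed (use E in auto)
  have "inj_on \<phi> (carrier A)"
  proof (rule inj_onI)
    fix x y assume xy: "x \<in> carrier A" "y \<in> carrier A" "\<phi> x = \<phi> y"
    have "cnorm A (x \<ominus>\<^bsub>A\<^esub> y) = 0"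
      using iso[of "x \<ominus>\<^bsub>A\<^esub> y"] xy E(1) by (simp add: star_hom_diff[OF A C \<phi>] C.diff_self C.cnorm_zero)
    thus "x = y" using A.cnorm_eq_0[of "x \<ominus>\<^bsub>A\<^esub> y"] A.diff_eq_0 xy by simp
  qed
  moreover have "\<phi> \<in> star_hom A (C\<lparr>carrier := \<phi> ` carrier A\<rparr>)"
    using E by (intro star_homI) auto
  ultimately show "star_isomorphic A (C\<lparr>carrier := \<phi> ` carrier A\<rparr>)"
    unfolding star_isomorphic_def bij_betw_def by auto
qed

text \<open>The common pattern of the generator arguments below: to show that \<open>V\<close> is
  carried into \<open>W\<close>, it is enough to look at generators. The adjoint clause makes the
  set self-adjoint, and products are left to \<open>mult\<close>, since \<open>W\<close> need not be
  contained in \<open>V\<close>.\<close>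

lemma (in cstar_algebra) multiplier_subalgebra:
  assumes G: "cstar_subalgebra G A" and V: "V \<subseteq> carrier A"
    and W: "\<zero> \<in> W" "\<And>x y. \<lbrakk>x \<in> W; y \<in> W\<rbrakk> \<Longrightarrow> x \<oplus> y \<in> W" "\<And>c x. x \<in> W \<Longrightarrow> c \<odot> x \<in> W"
      "\<And>\<sigma> x. \<lbrakk>\<And>n. \<sigma> n \<in> W; cconv \<sigma> x\<rbrakk> \<Longrightarrow> x \<in> W"
    and mult: "\<And>u v x. \<lbrakk>u \<in> G; \<forall>x\<in>V. u \<otimes> x \<in> W; v \<in> G; \<forall>x\<in>V. v \<otimes> x \<in> W; x \<in> V\<rbrakk> \<Longrightarrow>
      u \<otimes> (v \<otimes> x) \<in> W"
  shows "cstar_subalgebra {u \<in> G. (\<forall>x\<in>V. u \<otimes> x \<in> W) \<and> (\<forall>x\<in>V. adj A u \<otimes> x \<in> W)} A" (is "cstar_subalgebra ?K A")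
proof -
  note GD = cstar_subalgebraD[OF G]
  have c: "u \<in> carrier A" if "u \<in> G" for u using that GD(1) by auto
  have Vc: "x \<in> carrier A" if "x \<in> V" for x using that V by auto
  show ?thesis
  proof (rule cstar_subalgebraI)
    show "?K \<subseteq> carrier A" using c by auto
    show "\<zero> \<in> ?K" using GD(2) W(1) Vc by (simp add: adj_zero)
    fix u assume u: "u \<in> ?K"
    show "a \<odot> u \<in> ?K" for a using u c Vc GD(4) W(3) by (simp add: adj_smult smult_mult_left)
    show "adj A u \<in> ?K" using u c GD(6) by (simp add: adj_adj)
    fix v assume v: "v \<in> ?K"
    show "u \<oplus> v \<in> ?K" using u v c Vc GD(3) W(2) by (simp add: adj_add mult_distr_left)
    show "u \<otimes> v \<in> ?K"
      using u v c Vc GD(5,6) mult[of u v] mult[of "adj A v" "adj A u"] by (simp add: adj_mult mult_assoc)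
  next
    fix \<sigma> u assume \<sigma>: "range \<sigma> \<subseteq> ?K" and lim: "cconv \<sigma> u"
    have \<sigma>': "\<sigma> n \<in> G" "x \<in> V \<Longrightarrow> \<sigma> n \<otimes> x \<in> W" "x \<in> V \<Longrightarrow> adj A (\<sigma> n) \<otimes> x \<in> W" for n x using \<sigma> by auto
    have "u \<in> G" by (rule GD(7)[OF _ lim]) (use \<sigma>' in auto)
    moreover have "u \<otimes> x \<in> W" "adj A u \<otimes> x \<in> W" if x: "x \<in> V" for x
      using W(4)[OF \<sigma>'(2)[OF x] cconv_mult[OF lim cconv_const[OF Vc[OF x]]]]
        W(4)[OF \<sigma>'(3)[OF x] cconv_mult[OF cconv_adj[OF lim] cconv_const[OF Vc[OF x]]]] by auto
    ultimately show "u \<in> ?K" by blast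
  qed
qed

text \<open>\<open>gen_H\<close> expresses that \<open>H\<close> is generated by the
  \<open>Q X\<close> and the \<open>T \<alpha> B\<close> with \<open>B\<close> in the ideal as
  minimality among the C*-subalgebras of \<open>D\<close>, so that all arguments stay inside
  \<open>D\<close>.\<close>

locale full_corner = sys: relative_generalized_bds L \<theta> \<I> J + bds_representation L \<theta> "\<lambda>_. UNIV" J D Q T
  for L :: "'l set" and \<theta> :: "'l \<Rightarrow> 'b::generalized_boolean_algebra \<Rightarrow> 'b"
    and \<I> :: "'l \<Rightarrow> 'b set" and J :: "'b set"
    and D :: "('d, 'z) cstar_scheme" (structure) and Q :: "'b \<Rightarrow> 'd" and T :: "'l \<Rightarrow> 'b \<Rightarrow> 'd" +
  fixes H
  assumes gen_D: "cstar_generates D (range Q \<union> {T \<alpha> B |\<alpha> B. \<alpha> \<in> L \<and> B \<in> UNIV})"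
    and H: "cstar_subalgebra H D" and Q_H: "Q X \<in> H" and T_H: "\<lbrakk>\<alpha> \<in> L; B \<in> \<I> \<alpha>\<rbrakk> \<Longrightarrow> T \<alpha> B \<in> H"
    and gen_H: "\<lbrakk>cstar_subalgebra K D; range Q \<subseteq> K; \<And>\<alpha> B. \<lbrakk>\<alpha> \<in> L; B \<in> \<I> \<alpha>\<rbrakk> \<Longrightarrow> T \<alpha> B \<in> K\<rbrakk> \<Longrightarrow> H \<subseteq> K"
begin

lemmas HD = cstar_subalgebraD[OF H]

lemma H_in: "x \<in> H \<Longrightarrow> x \<in> carrier D"
  using HD(1) by auto

lemma T_in [simp]: "\<alpha> \<in> L \<Longrightarrow> T \<alpha> B \<in> carrier D"
  using S_in[of \<alpha> B] by simp

lemma T_Q: "\<alpha> \<in> L \<Longrightarrow> T \<alpha> B \<otimes> Q C = T \<alpha> (inf B C)"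
  using S_mult_P[of \<alpha> B C] by simp

lemma Q_T: "\<alpha> \<in> L \<Longrightarrow> Q X \<otimes> T \<alpha> B = T \<alpha> (inf B (\<theta> \<alpha> X))"
  using P_S[of \<alpha> B X] by (simp add: T_Q)

lemma T_Q_self: "\<alpha> \<in> L \<Longrightarrow> T \<alpha> B \<otimes> Q B = T \<alpha> B"
  by (simp add: T_Q)

text \<open>The inclusion of \<open>bds_range\<close> in the ideals enters here: multiplying any
  \<open>T \<alpha> B\<close> by some \<open>Q X\<close> from the left cuts it down to a generator
  of \<open>H\<close>.\<close>

lemma inf_\<theta>_in: "\<alpha> \<in> L \<Longrightarrow> inf B (\<theta> \<alpha> X) \<in> \<I> \<alpha>"
proof -
  assume \<alpha>: "\<alpha> \<in> L"
  have "inf B (\<theta> \<alpha> X) \<in> bds_range \<theta> \<alpha>"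
    unfolding bds_range_def mem_Collect_eq by (rule exI[of _ X]) simp
  thus ?thesis using sys.range_subset_\<I>[OF \<alpha>] by blast
qed

lemma adj_T_T: "\<lbrakk>\<alpha> \<in> L; \<beta> \<in> L\<rbrakk> \<Longrightarrow> adj D (T \<alpha> B) \<otimes> T \<beta> C = (if \<alpha> = \<beta> then Q (inf B C) else \<zero>)"
  using adj_S_S[of \<alpha> B \<beta> C] by simp

lemma H_lim: "\<lbrakk>\<And>n. \<sigma> n \<in> H; cconv \<sigma> x\<rbrakk> \<Longrightarrow> x \<in> H"
  by (rule HD(7)) auto

text \<open>By adjoints it suffices that \<open>H\<close> multiplies \<open>T \<alpha> B\<close>
  into \<open>H\<close> from the left. For a factor \<open>Q X\<close> the product is
  \<open>T\<close> at an element of the ideal; a factor \<open>T \<beta> C\<close> absorbs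
  \<open>Q C\<close> on its right and reduces to that case; a factor
  \<open>(T \<beta> C)\<^sup>*\<close> leaves some \<open>Q Y\<close> or zero.\<close>

lemma adj_T_H:
  assumes h: "h \<in> H" and \<alpha>: "\<alpha> \<in> L" shows "adj D (T \<alpha> B) \<otimes> h \<in> H"
proof -
  let ?K = "{u \<in> H. (\<forall>x\<in>{T \<alpha> B}. u \<otimes> x \<in> H) \<and> (\<forall>x\<in>{T \<alpha> B}. adj D u \<otimes> x \<in> H)}"
  have "cstar_subalgebra ?K D"
    by (rule multiplier_subalgebra[OF H _ HD(2) HD(3) HD(4) H_lim]) (use \<alpha> HD(5) in auto)
  hence "H \<subseteq> ?K"
  proof (rule gen_H)
    show "range Q \<subseteq> ?K" using Q_H T_H[OF \<alpha> inf_\<theta>_in[OF \<alpha>]] Q_T[OF \<alpha>] by auto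
    fix \<beta> C assume \<beta>: "\<beta> \<in> L" "C \<in> \<I> \<beta>"
    have "T \<beta> C \<otimes> T \<alpha> B = T \<beta> C \<otimes> T \<alpha> (inf B (\<theta> \<alpha> C))"
      using T_Q_self[OF \<beta>(1), of C] mult_assoc[of "T \<beta> C" "Q C" "T \<alpha> B"] Q_T[OF \<alpha>, of C B] \<alpha> \<beta>(1) by simp
    thus "T \<beta> C \<in> ?K"
      using HD(2) HD(5)[OF T_H[OF \<beta>] T_H[OF \<alpha> inf_\<theta>_in[OF \<alpha>]]] T_H[OF \<beta>] Q_H adj_T_T[OF \<beta>(1) \<alpha>, of C B]
      by simp
  qed
  hence "adj D h \<otimes> T \<alpha> B \<in> H" using h by auto
  from HD(6)[OF this] show ?thesis using h \<alpha> H_in by (simp add: adj_mult adj_adj)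
qed

text \<open>\<open>col_H\<close> is the right \<open>H\<close>-module on which \<open>D\<close> acts from the left; it contains \<open>D H\<close>.\<close>

definition col_H :: "'d set" where
  "col_H = {x \<in> carrier D. (\<forall>X. Q X \<otimes> x \<in> H) \<and> (\<forall>\<alpha>\<in>L. \<forall>B. adj D (T \<alpha> B) \<otimes> x \<in> H)}"

lemma col_HD: "x \<in> col_H \<Longrightarrow> x \<in> carrier D" "x \<in> col_H \<Longrightarrow> Q X \<otimes> x \<in> H"
  "\<lbrakk>x \<in> col_H; \<alpha> \<in> L\<rbrakk> \<Longrightarrow> adj D (T \<alpha> B) \<otimes> x \<in> H"
  by (auto simp: col_H_def)

lemma H_col: "H \<subseteq> col_H"
  using H_in HD(5)[OF Q_H] adj_T_H by (auto simp: col_H_def)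

lemma col_H_closed:
  "\<zero> \<in> col_H" "\<lbrakk>x \<in> col_H; y \<in> col_H\<rbrakk> \<Longrightarrow> x \<oplus> y \<in> col_H" "x \<in> col_H \<Longrightarrow> c \<odot> x \<in> col_H"
  by (auto simp: col_H_def HD mult_distr_right smult_mult_right)

lemma col_H_lim:
  assumes r: "\<And>n. \<sigma> n \<in> col_H" and c: "cconv \<sigma> x" shows "x \<in> col_H"
proof -
  have lim: "t \<otimes> x \<in> H" if t: "t \<in> carrier D" and tH: "\<And>n. t \<otimes> \<sigma> n \<in> H" for t
    using cconv_mult[OF cconv_const[OF t] c] tH by (intro HD(7)) auto
  show ?thesis unfolding col_H_def using cconv_in(2)[OF c] lim col_HD(2,3)[OF r] by simp
qed

text \<open>\<open>T \<alpha> B\<close> absorbs \<open>Q B\<close>, and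
  \<open>Q B \<otimes> x\<close> already lies in \<open>H\<close>.\<close>

lemma T_col:
  assumes x: "x \<in> col_H" and \<alpha>: "\<alpha> \<in> L" "B \<in> \<I> \<alpha>" shows "T \<alpha> B \<otimes> x \<in> H"
proof -
  have "T \<alpha> B \<otimes> x = T \<alpha> B \<otimes> (Q B \<otimes> x)"
    using T_Q_self[OF \<alpha>(1), of B] mult_assoc[of "T \<alpha> B" "Q B" x] \<alpha>(1) col_HD(1)[OF x] by simp
  thus ?thesis using HD(5)[OF T_H[OF \<alpha>] col_HD(2)[OF x]] by simp
qed

text \<open>The critical generator is \<open>T \<alpha> B\<close> with \<open>B\<close> outside the
  ideal. To stay in \<open>col_H\<close>, its product with \<open>x\<close> is tested by
  \<open>Q X\<close>, which replaces \<open>B\<close> by an element of the ideal so that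
  \<open>T_col\<close> applies, and by the \<open>(T \<beta> C)\<^sup>*\<close>, which leave
  \<open>Q (inf C B) \<otimes> x\<close> or zero.\<close>

lemma D_col:
  assumes d: "d \<in> carrier D" and x: "x \<in> col_H" shows "d \<otimes> x \<in> col_H"
proof -
  let ?K = "{u \<in> carrier D. (\<forall>x\<in>col_H. u \<otimes> x \<in> col_H) \<and> (\<forall>x\<in>col_H. adj D u \<otimes> x \<in> col_H)}"
  have K: "cstar_subalgebra ?K D"
    by (rule multiplier_subalgebra[OF subalgebra_carrier _ col_H_closed col_H_lim])
      (use col_HD(1) in auto)
  have "range Q \<union> {T \<alpha> B |\<alpha> B. \<alpha> \<in> L \<and> B \<in> UNIV} \<subseteq> ?K"
  proof -
    have "T \<alpha> B \<otimes> x \<in> col_H" if \<alpha>: "\<alpha> \<in> L" and x: "x \<in> col_H" for \<alpha> B x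
    proof -
      note xc = col_HD(1)[OF x]
      have "Q X \<otimes> (T \<alpha> B \<otimes> x) = T \<alpha> (inf B (\<theta> \<alpha> X)) \<otimes> x" for X
        using mult_assoc[of "Q X" "T \<alpha> B" x] \<alpha> xc by (simp add: Q_T)
      hence 1: "Q X \<otimes> (T \<alpha> B \<otimes> x) \<in> H" for X using T_col[OF x \<alpha> inf_\<theta>_in[OF \<alpha>]] by simp
      have "adj D (T \<beta> C) \<otimes> (T \<alpha> B \<otimes> x) = (if \<beta> = \<alpha> then Q (inf C B) \<otimes> x else \<zero>)" if "\<beta> \<in> L" for \<beta> C
        using mult_assoc[of "adj D (T \<beta> C)" "T \<alpha> B" x] \<alpha> that xc adj_T_T[OF that \<alpha>, of C B]
        by (simp split: if_splits)
      hence 2: "adj D (T \<beta> C) \<otimes> (T \<alpha> B \<otimes> x) \<in> H" if "\<beta> \<in> L" for \<beta> C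
        using that col_HD(2)[OF x] HD(2) by simp
      show ?thesis using 1 2 \<alpha> xc by (simp add: col_H_def)
    qed
    thus ?thesis using col_HD(2,3) H_col by auto
  qed
  hence "?K = carrier D" using gen_D K unfolding cstar_generates_def by blast
  thus ?thesis using d x by blast
qed

text \<open>Each generator of \<open>H\<close>, and its adjoint, carries \<open>col_H\<close> into
  \<open>H\<close>; since \<open>H\<close> lies in \<open>col_H\<close>, products do so too.\<close>

lemma H_mult_col:
  assumes h: "h \<in> H" and x: "x \<in> col_H" shows "h \<otimes> x \<in> H"
proof -
  let ?K = "{u \<in> H. (\<forall>x\<in>col_H. u \<otimes> x \<in> H) \<and> (\<forall>x\<in>col_H. adj D u \<otimes> x \<in> H)}"
  have "cstar_subalgebra ?K D"
    by (rule multiplier_subalgebra[OF H _ HD(2) HD(3) HD(4) H_lim]) (use col_HD(1) H_col in auto)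
  hence "H \<subseteq> ?K"
    by (rule gen_H) (use Q_H T_H col_HD(2,3) T_col in auto)
  thus ?thesis using h x by auto
qed

theorem hereditary: "hereditary_cstar_subalgebra H D"
proof (rule hereditaryI[OF H])
  fix g d h assume "g \<in> H" "d \<in> carrier D" "h \<in> H"
  thus "g \<otimes> (d \<otimes> h) \<in> H" using H_col by (intro H_mult_col D_col) auto
qed

theorem full: "full_cstar_subalgebra H D"
  unfolding full_cstar_subalgebra_def
proof (intro conjI H allI impI)
  fix K assume K: "closed_two_sided_ideal K D \<and> H \<subseteq> K"
  have sm: "submodule K complex_ring D" and cl: "cstar_closed D K"
    and left: "\<And>a x. x \<in> K \<Longrightarrow> a \<in> carrier D \<Longrightarrow> a \<otimes> x \<in> K"
    and right: "\<And>a x. x \<in> K \<Longrightarrow> a \<in> carrier D \<Longrightarrow> x \<otimes> a \<in> K"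
    using K by (auto simp: closed_two_sided_ideal_def)
  note E = submoduleE[OF sm]
  have Kc: "x \<in> carrier D" if "x \<in> K" for x using E(1) that by auto
  have Ks: "c \<odot> x \<in> K" if "x \<in> K" for c x using E(4)[OF _ that] by simp
  have K0: "\<zero> \<in> K" using K HD(2) by auto
  have Klim: "x \<in> K" if "\<And>n. \<sigma> n \<in> K" "cconv \<sigma> x" for \<sigma> x
    using cl that unfolding cstar_closed_iff by blast
  \<comment> \<open>Self-adjointness of \<open>K\<close> is not presupposed, so the subalgebra
    compared with \<open>D\<close> is the intersection of \<open>K\<close> with its adjoint.\<close>
  let ?K = "{x \<in> K. adj D x \<in> K}"
  have KS: "cstar_subalgebra ?K D"
  proof (rule cstar_subalgebraI)
    fix \<sigma> x assume \<sigma>: "range \<sigma> \<subseteq> ?K" and c: "cconv \<sigma> x"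
    have "\<sigma> n \<in> K" "adj D (\<sigma> n) \<in> K" for n using \<sigma> by auto
    thus "x \<in> ?K" using Klim[OF _ c] Klim[OF _ cconv_adj[OF c]] by simp
  qed (use Kc K0 Ks E(5) left right in \<open>auto simp: adj_simps\<close>)
  have QK: "Q X \<in> K" for X using K Q_H by auto
  have TK: "T \<alpha> B \<in> ?K" if \<alpha>: "\<alpha> \<in> L" for \<alpha> B
  proof -
    have "adj D (T \<alpha> B) = Q B \<otimes> adj D (T \<alpha> B)"
      using arg_cong[OF T_Q_self[OF \<alpha>, of B], of "adj D"] \<alpha> by (simp add: adj_mult)
    hence "adj D (T \<alpha> B) \<in> K" using right[OF QK, of "adj D (T \<alpha> B)" B] \<alpha> by simp
    moreover have "T \<alpha> B \<in> K" using left[OF QK, of "T \<alpha> B" B] T_Q_self[OF \<alpha>] \<alpha> by simp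
    ultimately show ?thesis by simp
  qed
  have "range Q \<union> {T \<alpha> B |\<alpha> B. \<alpha> \<in> L \<and> B \<in> UNIV} \<subseteq> ?K" using QK TK by auto
  hence "?K = carrier D" using gen_D KS unfolding cstar_generates_def by blast
  thus "K = carrier D" using Kc by blast
qed

end

theorem proposition6p3:
  fixes L :: "'l set" and \<theta> :: "'l \<Rightarrow> 'b::generalized_boolean_algebra \<Rightarrow> 'b"
    and \<I> :: "'l \<Rightarrow> 'b set" and J :: "'b set"
    and A :: "'a cstar" and P :: "'b \<Rightarrow> 'a" and S :: "'l \<Rightarrow> 'b \<Rightarrow> 'a"
    and D :: "'d cstar" and Q :: "'b \<Rightarrow> 'd" and T :: "'l \<Rightarrow> 'b \<Rightarrow> 'd"
  assumes "relative_generalized_bds L \<theta> \<I> J"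
    and "universal_bds_representation L \<theta> \<I> J A P S"
    and "universal_bds_representation L \<theta> (\<lambda>_. UNIV) J D Q T"
  shows "\<exists>H. hereditary_cstar_subalgebra H D \<and> full_cstar_subalgebra H D \<and>
           star_isomorphic A (D\<lparr>carrier := H\<rparr>)"
proof -
  interpret sys: relative_generalized_bds L \<theta> \<I> J by (rule assms(1))
  have sysU: "relative_generalized_bds L \<theta> (\<lambda>_. UNIV) J"
    by unfold_locales (auto simp: boolean_ideal_def sys.ideal_J[unfolded boolean_ideal_def])
  have repA: "bds_representation L \<theta> \<I> J A P S"
    and genA: "cstar_generates A (range P \<union> {S \<alpha> B |\<alpha> B. \<alpha> \<in> L \<and> B \<in> \<I> \<alpha>})"
    using assms(2) by (auto simp: universal_bds_representation_def)
  have repD: "bds_representation L \<theta> (\<lambda>_. UNIV) J D Q T"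
    and genD: "cstar_generates D (range Q \<union> {T \<alpha> B |\<alpha> B. \<alpha> \<in> L \<and> B \<in> UNIV})"
    using assms(3) by (auto simp: universal_bds_representation_def)
  interpret A: bds_representation L \<theta> \<I> J A P S by (rule repA)
  interpret D: bds_representation L \<theta> "\<lambda>_. UNIV" J D Q T by (rule repD)
  have AC: "cstar_algebra A" and DC: "cstar_algebra D" by unfold_locales
  \<comment> \<open>The relations of the smaller system are those of the larger one with
    \<open>B\<close> restricted to \<open>\<I> \<alpha>\<close>.\<close>
  have repD': "bds_representation L \<theta> \<I> J D Q T"
    by unfold_locales
      (simp_all add: D.projection_P D.partial_isometry_S D.P_bot D.P_inf D.P_sup D.P_S D.adj_S_S D.P_sum)
  obtain \<phi> where \<phi>: "\<phi> \<in> star_hom A D" "\<And>X. \<phi> (P X) = Q X"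
    "\<And>\<alpha> B. \<alpha> \<in> L \<Longrightarrow> B \<in> \<I> \<alpha> \<Longrightarrow> \<phi> (S \<alpha> B) = T \<alpha> B"
    using universal_bds_representation_property[OF assms(1,2) repD'] by blast
  obtain E :: "(('l \<times> 'b) set \<Rightarrow> ('l option \<Rightarrow> 'a \<Rightarrow> 'a) \<Rightarrow> 'l option \<Rightarrow> 'a \<Rightarrow> 'a) cstar" and k V
    where k: "k \<in> star_hom A E" and kn: "\<And>x. x \<in> carrier A \<Longrightarrow> cnorm A x \<le> cnorm E (k x)"
    and repE: "bds_representation L \<theta> (\<lambda>_. UNIV) J E (\<lambda>X. k (P X)) V"
    and V: "\<And>\<alpha> B. \<lbrakk>\<alpha> \<in> L; B \<in> \<I> \<alpha>\<rbrakk> \<Longrightarrow> V \<alpha> B = k (S \<alpha> B)"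
    by (rule sys.isometric_dilation[OF repA], rule that)
  have EC: "cstar_algebra E" by (rule bds_representation.axioms(1)[OF repE])
  \<comment> \<open>The dilation lives on a type built from that of \<open>A\<close>, so the
    universal property of \<open>D\<close> is used in its form for arbitrary types.\<close>
  obtain \<psi> where \<psi>: "\<psi> \<in> star_hom D E" "\<And>X. \<psi> (Q X) = k (P X)"
    "\<And>\<alpha> B. \<alpha> \<in> L \<Longrightarrow> \<psi> (T \<alpha> B) = V \<alpha> B"
    using universal_bds_representation_property[OF sysU assms(3) repE] by blast
  have comp: "(\<lambda>x. \<psi> (\<phi> x)) \<in> star_hom A E"
    by (rule star_homI) (simp_all add: star_homD[OF \<phi>(1)] star_homD[OF \<psi>(1)])
  have \<psi>\<phi>: "\<psi> (\<phi> x) = k x" if "x \<in> carrier A" for x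
  proof (rule star_hom_eq_on_generators[OF AC EC comp k _ genA _ that])
    show "range P \<union> {S \<alpha> B |\<alpha> B. \<alpha> \<in> L \<and> B \<in> \<I> \<alpha>} \<subseteq> carrier A" by auto
  qed (auto simp: \<phi> \<psi> V)
  \<comment> \<open>Neither \<open>\<phi>\<close> nor \<open>\<psi>\<close> increases norms, while
    their composite \<open>k\<close> does not decrease them.\<close>
  have iso: "cnorm D (\<phi> x) = cnorm A x" if x: "x \<in> carrier A" for x
  proof (rule antisym)
    show "cnorm D (\<phi> x) \<le> cnorm A x" by (rule star_hom_contractive[OF AC DC \<phi>(1) x])
    have "cnorm A x \<le> cnorm E (\<psi> (\<phi> x))" using kn[OF x] \<psi>\<phi>[OF x] by simp
    also have "\<dots> \<le> cnorm D (\<phi> x)" by (rule star_hom_contractive[OF DC EC \<psi>(1) star_homD(1)[OF \<phi>(1) x]])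
    finally show "cnorm A x \<le> cnorm D (\<phi> x)" .
  qed
  let ?H = "\<phi> ` carrier A"
  note image = isometric_image_subalgebra[OF AC DC \<phi>(1) iso]
  interpret H: full_corner L \<theta> \<I> J D Q T ?H
  proof unfold_locales
    show "cstar_generates D (range Q \<union> {T \<alpha> B |\<alpha> B. \<alpha> \<in> L \<and> B \<in> UNIV})" by (rule genD)
    show "cstar_subalgebra ?H D" by (rule image(1))
    show "Q X \<in> ?H" for X by (rule image_eqI[of _ _ "P X"]) (simp_all add: \<phi>)
    show "T \<alpha> B \<in> ?H" if "\<alpha> \<in> L" "B \<in> \<I> \<alpha>" for \<alpha> B
      by (rule image_eqI[of _ _ "S \<alpha> B"]) (simp_all add: \<phi> that)
    fix K assume K: "cstar_subalgebra K D" "range Q \<subseteq> K"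
      and TK: "\<And>\<alpha> B. \<lbrakk>\<alpha> \<in> L; B \<in> \<I> \<alpha>\<rbrakk> \<Longrightarrow> T \<alpha> B \<in> K"
    \<comment> \<open>Minimality of the image is pulled back to \<open>A\<close>: the preimage of
      \<open>K\<close> is a C*-subalgebra containing the generators of \<open>A\<close>.\<close>
    have "range P \<union> {S \<alpha> B |\<alpha> B. \<alpha> \<in> L \<and> B \<in> \<I> \<alpha>} \<subseteq> {x \<in> carrier A. \<phi> x \<in> K}"
      using K(2) TK by (auto simp: \<phi>)
    hence "{x \<in> carrier A. \<phi> x \<in> K} = carrier A"
      using genA star_hom_preimage_subalgebra[OF AC DC \<phi>(1) K(1)] unfolding cstar_generates_def by blast
    thus "?H \<subseteq> K" by blast
  qed
  show ?thesis using H.hereditary H.full image(2) by blast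
qed

end
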